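(* For Lebesgue-almost every $\gamma\in(1/2,1)$ the following holds. For all $a,b>0$, the function $$\phi(u)=E\big[\exp\big(iu(aI_1(f)+bI_2(g))\big)\big],\qquad u\in\mathbb{R},$$ belongs to $L^2(\mathbb{R})$. Consequently, for every $\xi\in[0,1]$, the function $[0,1]\ni y\mapsto H(\xi,y)-\kappa\, y\,S(\xi,0)$ possesses a square integrable occupation density.
   Context: $\gamma\in(1/2,1)$, $\kappa=\frac1{2\gamma}$. $(X_n)_{n\ge1}$ is an i.i.d. sequence with $P(X_n=1)=P(X_n=-1)=\frac12$, and $I_1(f)=\sum_{n\ge1}f(n)X_n$, $I_2(g)=\sum_{n,m\ge1}g(n,m)X_nX_m$ with $f(i)=\gamma^i$ and $g(i,j)=\frac12\gamma^{\frac{i+j}{2}}\left(\frac{\kappa}{2}\right)^{\frac{|i-j|}{2}}1_{\{i\ne j\}}$. $\Phi(y)=d(y,\mathbb{Z})$ is the distance of $y\in\mathbb{R}$ to the nearest integer. Binary digits: for $(\xi,x)\in[0,1]^2$ write $\xi=\sum_{n\ge0}\bar\xi_{-n}2^{-(n+1)}$, $x=\sum_{n\ge1}\bar x_n2^{-n}$ with digits in $\{0,1\}$; when there are two expansions, the one not ending in zeros is chosen. The iterates of the baker transformation $B=(B_1,B_2)$ are, for $k\ge0$, $$B^k(\xi,x)=\Big(\sum_{n\ge0}\bar\xi_{-n-k}2^{-(n+1)},\ \sum_{j=0}^{k-1}\bar\xi_{-j}2^{-(k-j)}+\frac{x}{2^k}\Big),$$ and for $k\ge1$ $$B^{-k}(\xi,x)=\Big(\frac{\xi}{2^k}+\sum_{j=1}^k\bar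 x_j2^{-(k-j+1)},\ \sum_{n\ge1}\bar x_{n+k}2^{-n}\Big);$$ $B^k=(B_1^k,B_2^k)$ denotes the components. $S(\xi,x)=\sum_{n=1}^\infty\kappa^n\Phi'(B_2^n(\xi,x))$, where $\Phi'=1$ on the first half and $-1$ on the second half of $[0,1]$; at the breakpoints $\Phi'(B_2^n(\xi,x))$ is read off from the leading digit, i.e. it is $1$ if $\bar\xi_{-n+1}=0$ and $-1$ if $\bar\xi_{-n+1}=1$. $H(\xi,x)=\sum_{n\in\mathbb{Z}}\gamma^n\big[\Phi(B_2^{-n}(\xi,x))-\Phi(B_2^{-n}(\xi,0))\big]$. The occupation measure of a measurable $F:[0,1]\to\mathbb{R}$ is $\mu_F(A)=\lambda(\{x\in[0,1]:F(x)\in A\})$, $\lambda$ Lebesgue measure; $F$ has a square integrable occupation density if $\mu_F$ is absolutely continuous with respect to Lebesgue measure with density in $L^2(\mathbb{R})$. *)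

theory Defs
  imports "HOL-Probability.Probability"
begin

text \<open>
  A binary expansion is indexed from 0, with \<open>d n\<close> the coefficient of \<open>2 ^ -(n + 1)\<close>. Thus
  \<open>binary_digits \<xi> n\<close> is the digit of \<open>\<xi>\<close> with index \<open>-n\<close>, while the digit of \<open>x\<close> with index
  \<open>n \<ge> 1\<close> is \<open>binary_digits x (n - 1)\<close>.
\<close>

definition is_binary_expansion :: "real \<Rightarrow> (nat \<Rightarrow> nat) \<Rightarrow> bool" where
  "is_binary_expansion x d \<longleftrightarrow>
     (\<forall>n. d n \<in> {0, 1}) \<and> (\<lambda>n. real (d n) / 2 ^ (n + 1)) sums x"

definition ends_in_zeros :: "(nat \<Rightarrow> nat) \<Rightarrow> bool" where
  "ends_in_zeros d \<longleftrightarrow> (\<exists>N. \<forall>n\<ge>N. d n = 0)"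

definition is_chosen_expansion :: "real \<Rightarrow> (nat \<Rightarrow> nat) \<Rightarrow> bool" where
  "is_chosen_expansion x d \<longleftrightarrow>
     is_binary_expansion x d \<and>
     ((\<exists>d'. is_binary_expansion x d' \<and> d' \<noteq> d) \<longrightarrow> \<not> ends_in_zeros d)"

definition binary_digits :: "real \<Rightarrow> nat \<Rightarrow> nat" where
  "binary_digits x = (THE d. is_chosen_expansion x d)"

lemma is_binary_expansion_exists:
  assumes "x \<in> {0..1}"
  shows "\<exists>d. is_binary_expansion x d"
proof (cases "x = 0")
  case True
  then have "is_binary_expansion x (\<lambda>_. 0)"
    by (simp add: is_binary_expansion_def)
  then show ?thesis by blast
next
  case False
  define c :: "nat \<Rightarrow> int" where "c n = \<lceil>2 ^ n * x\<rceil> - 1" for n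
  define d :: "nat \<Rightarrow> nat" where "d n = nat (c (Suc n) - 2 * c n)" for n
  have c: "real_of_int (c n) < 2 ^ n * x" "2 ^ n * x \<le> real_of_int (c n) + 1" for n
    unfolding c_def by linarith+
  have diff: "c (Suc n) - 2 * c n \<in> {0, 1}" for n
  proof -
    have "real_of_int (c (Suc n)) < 2 * (real_of_int (c n) + 1)"
      using c(1)[of "Suc n"] c(2)[of n] by simp
    moreover have "2 * real_of_int (c n) < real_of_int (c (Suc n)) + 1"
      using c(2)[of "Suc n"] c(1)[of n] by simp
    ultimately have "real_of_int (c (Suc n)) < real_of_int (2 * (c n + 1))"
        "real_of_int (2 * c n) < real_of_int (c (Suc n) + 1)"
      by simp_all
    then have "c (Suc n) < 2 * (c n + 1)" "2 * c n < c (Suc n) + 1"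
      unfolding of_int_less_iff .
    then show ?thesis by auto
  qed
  have c0: "c 0 = 0"
    using assms False c[of 0] by simp
  have partial: "(\<Sum>i<n. real (d i) / 2 ^ (i + 1)) = real_of_int (c n) / 2 ^ n" for n
  proof (induction n)
    case 0
    then show ?case using c0 by simp
  next
    case (Suc n)
    have "real (d n) = real_of_int (c (Suc n)) - 2 * real_of_int (c n)"
      using diff[of n] unfolding d_def by auto
    with Suc show ?case by (simp add: field_simps)
  qed
  have lim: "(\<lambda>n. real_of_int (c n) / 2 ^ n) \<longlonglongrightarrow> x"
  proof (rule tendsto_sandwich)
    show "\<forall>\<^sub>F n in sequentially. x - (1 / 2) ^ n \<le> real_of_int (c n) / 2 ^ n"
    proof (intro always_eventually allI)
      fix n
      have "x \<le> (real_of_int (c n) + 1) / 2 ^ n"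
        using c(2)[of n] by (simp add: pos_le_divide_eq mult.commute)
      then show "x - (1 / 2) ^ n \<le> real_of_int (c n) / 2 ^ n"
        by (simp add: add_divide_distrib power_one_over)
    qed
    show "\<forall>\<^sub>F n in sequentially. real_of_int (c n) / 2 ^ n \<le> x"
      using c(1) by (intro always_eventually allI) (simp add: field_simps less_imp_le)
    have "(\<lambda>n. x - (1 / 2 :: real) ^ n) \<longlonglongrightarrow> x - 0"
      by (intro tendsto_intros LIMSEQ_power_zero) simp
    then show "(\<lambda>n. x - (1 / 2 :: real) ^ n) \<longlonglongrightarrow> x" by simp
  qed simp
  have "d n \<in> {0, 1}" for n
    using diff[of n] unfolding d_def by auto
  with lim have "is_binary_expansion x d"
    unfolding is_binary_expansion_def sums_def partial by blast
  then show ?thesis by blast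
qed

lemma two_expansions:
  assumes "is_binary_expansion x d" "is_binary_expansion x e" "d N = 0" "e N = 1"
    and eq: "\<And>n. n < N \<Longrightarrow> d n = e n"
  shows "\<forall>n>N. d n = 1 \<and> e n = 0"
proof -
  define t where "t n = (real (d n) - real (e n)) / 2 ^ (n + 1)" for n
  have dig: "d n \<in> {0, 1}" "e n \<in> {0, 1}" for n
    using assms(1,2) unfolding is_binary_expansion_def by auto
  have "(\<lambda>n. real (d n) / 2 ^ (n + 1) - real (e n) / 2 ^ (n + 1)) sums (x - x)"
    using assms(1,2) unfolding is_binary_expansion_def by (intro sums_diff) auto
  then have t: "t sums 0"
    unfolding t_def by (simp add: diff_divide_distrib)
  have part: "(\<Sum>i<Suc N. t i) = - 1 / 2 ^ (N + 1)"
    using eq assms(3,4) by (simp add: t_def)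
  have "(\<lambda>n. t (n + Suc N)) sums (0 - (\<Sum>i<Suc N. t i))"
    using t by (subst sums_iff_shift) simp
  then have s1: "(\<lambda>n. t (n + Suc N)) sums (1 / 2 ^ (N + 1))"
    unfolding part by simp
  have "(\<lambda>n. (1 / 2 :: real) ^ Suc n * (1 / 2 ^ (N + 1))) sums (1 * (1 / 2 ^ (N + 1)))"
    by (rule sums_mult2[OF power_half_series])
  then have s2: "(\<lambda>n. (1 / 2 :: real) ^ Suc n * (1 / 2 ^ (N + 1))) sums (1 / 2 ^ (N + 1))"
    by simp
  define r where "r n = (1 / 2 :: real) ^ Suc n * (1 / 2 ^ (N + 1)) - t (n + Suc N)" for n
  have r: "r sums 0"
    using sums_diff[OF s2 s1] unfolding r_def by simp
  have r_eq: "r n = (1 - (real (d (n + Suc N)) - real (e (n + Suc N)))) / 2 ^ (n + Suc N + 1)" for n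
    unfolding r_def t_def by (simp add: field_simps power_add power_divide)
  have nonneg: "0 \<le> r n" for n
    unfolding r_eq using dig[of "n + Suc N"] by auto
  have "r n = 0" for n
    using r nonneg suminf_eq_zero_iff[of r] by (auto simp: sums_iff)
  then have *: "real (d (n + Suc N)) - real (e (n + Suc N)) = 1" for n
    using r_eq[of n] by simp
  show ?thesis
  proof (intro allI impI)
    fix n assume "N < n"
    then have "n = (n - Suc N) + Suc N" by simp
    then have "real (d n) - real (e n) = 1"
      using *[of "n - Suc N"] by simp
    then show "d n = 1 \<and> e n = 0"
      using dig[of n] by auto
  qed
qed

lemma distinct_expansions:
  assumes "is_binary_expansion x d" "is_binary_expansion x e" "d \<noteq> e"
  shows "ends_in_zeros d \<noteq> ends_in_zeros e"
proof -
  have *: "ends_in_zeros e' \<and> \<not> ends_in_zeros d'"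
    if "\<forall>n>N. d' n = 1 \<and> e' n = 0" for N d' e'
  proof -
    have "ends_in_zeros e'"
      unfolding ends_in_zeros_def using that by (intro exI[of _ "Suc N"]) auto
    moreover have "\<not> ends_in_zeros d'"
    proof
      assume "ends_in_zeros d'"
      then obtain K where "\<forall>n\<ge>K. d' n = 0" unfolding ends_in_zeros_def by blast
      then have "d' (max K (Suc N)) = 0" by simp
      moreover have "d' (max K (Suc N)) = 1" using that by auto
      ultimately show False by simp
    qed
    ultimately show ?thesis by blast
  qed
  define N where "N = (LEAST n. d n \<noteq> e n)"
  have "\<exists>n. d n \<noteq> e n" using assms(3) by auto
  then have N: "d N \<noteq> e N" unfolding N_def by (rule LeastI_ex)
  have eq: "d n = e n" if "n < N" for n
    using not_less_Least that unfolding N_def by blast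
  have "d N \<in> {0, 1}" "e N \<in> {0, 1}"
    using assms(1,2) unfolding is_binary_expansion_def by auto
  with N consider "d N = 0" "e N = 1" | "d N = 1" "e N = 0" by auto
  then show ?thesis
  proof cases
    case 1
    then show ?thesis using *[OF two_expansions[OF assms(1,2) 1]] eq by blast
  next
    case 2
    then show ?thesis
      using *[OF two_expansions[OF assms(2,1) 2(2) 2(1)]] eq by metis
  qed
qed

lemma ex1_chosen_expansion:
  assumes "x \<in> {0..1}"
  shows "\<exists>!d. is_chosen_expansion x d"
proof -
  obtain d where d: "is_binary_expansion x d"
    using is_binary_expansion_exists[OF assms] by blast
  have "\<exists>d. is_chosen_expansion x d"
    using d distinct_expansions[of x] unfolding is_chosen_expansion_def by metis
  then show ?thesis
    using distinct_expansions[of x] unfolding is_chosen_expansion_def by metis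
qed

lemma is_chosen_expansion_binary_digits:
  "x \<in> {0..1} \<Longrightarrow> is_chosen_expansion x (binary_digits x)"
  unfolding binary_digits_def by (rule theI'[OF ex1_chosen_expansion])

definition baker_iter :: "int \<Rightarrow> real \<times> real \<Rightarrow> real \<times> real" where
  "baker_iter k = (\<lambda>(\<xi>, x).
     if k \<ge> 0 then
       (let m = nat k in
         ((\<Sum>n. real (binary_digits \<xi> (n + m)) / 2 ^ (n + 1)),
          (\<Sum>j<m. real (binary_digits \<xi> j) / 2 ^ (m - j)) + x / 2 ^ m))
     else
       (let m = nat (- k) in
         (\<xi> / 2 ^ m + (\<Sum>j = 1..m. real (binary_digits x (j - 1)) / 2 ^ (m - j + 1)),
          (\<Sum>n. real (binary_digits x (n + m)) / 2 ^ (n + 1)))))"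

definition baker_iter2 :: "int \<Rightarrow> real \<Rightarrow> real \<Rightarrow> real" where
  "baker_iter2 k \<xi> x = snd (baker_iter k (\<xi>, x))"

definition kappa :: "real \<Rightarrow> real" where
  "kappa \<gamma> = 1 / (2 * \<gamma>)"

definition Phi :: "real \<Rightarrow> real" where
  "Phi y = infdist y \<int>"

text \<open>
  The derivative of \<open>Phi\<close> at a point \<open>y\<close> of the unit interval; \<open>c\<close> is the leading binary digit
  of \<open>y\<close> and decides only at \<open>y = 1/2\<close>. At the other two breakpoints, 0 and 1, the
  leading digit is forced.
\<close>

definition Phi_deriv :: "nat \<Rightarrow> real \<Rightarrow> real" where
  "Phi_deriv c y =
     (if y < 1 / 2 then 1 else if y > 1 / 2 then - 1 else if c = 0 then 1 else - 1)"

text \<open>The summand below at index \<open>n\<close> is the one with exponent \<open>n + 1\<close> of \<open>kappa \<gamma>\<close>.\<close>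

definition S_fun :: "real \<Rightarrow> real \<Rightarrow> real \<Rightarrow> real" where
  "S_fun \<gamma> \<xi> x =
     (\<Sum>n. kappa \<gamma> ^ (n + 1) *
        Phi_deriv (binary_digits \<xi> n) (baker_iter2 (int (n + 1)) \<xi> x))"

definition H_fun :: "real \<Rightarrow> real \<Rightarrow> real \<Rightarrow> real" where
  "H_fun \<gamma> \<xi> x =
     (\<Sum>\<^sub>\<infinity>n\<in>(UNIV :: int set). \<gamma> powi n *
        (Phi (baker_iter2 (- n) \<xi> x) - Phi (baker_iter2 (- n) \<xi> 0)))"

definition f_coeff :: "real \<Rightarrow> nat \<Rightarrow> real" where
  "f_coeff \<gamma> i = \<gamma> ^ i"

definition g_coeff :: "real \<Rightarrow> nat \<Rightarrow> nat \<Rightarrow> real" where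
  "g_coeff \<gamma> i j =
     1 / 2 * \<gamma> powr (real (i + j) / 2) *
     (kappa \<gamma> / 2) powr (\<bar>real i - real j\<bar> / 2) * (if i \<noteq> j then 1 else 0)"

definition I1 :: "(nat \<Rightarrow> 'w \<Rightarrow> real) \<Rightarrow> (nat \<Rightarrow> real) \<Rightarrow> 'w \<Rightarrow> real" where
  "I1 X f \<omega> = (\<Sum>n. f (n + 1) * X (n + 1) \<omega>)"

definition I2 :: "(nat \<Rightarrow> 'w \<Rightarrow> real) \<Rightarrow> (nat \<Rightarrow> nat \<Rightarrow> real) \<Rightarrow> 'w \<Rightarrow> real" where
  "I2 X g \<omega> = (\<Sum>\<^sub>\<infinity>(n, m)\<in>{1..} \<times> {1..}. g n m * X n \<omega> * X m \<omega>)"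

definition rademacher_seq :: "'w measure \<Rightarrow> (nat \<Rightarrow> 'w \<Rightarrow> real) \<Rightarrow> bool" where
  "rademacher_seq M X \<longleftrightarrow>
     prob_space.indep_vars M (\<lambda>_. borel) X {1..} \<and>
     (\<forall>n\<ge>1. measure M {\<omega> \<in> space M. X n \<omega> = 1} = 1 / 2 \<and>
             measure M {\<omega> \<in> space M. X n \<omega> = - 1} = 1 / 2)"

definition square_integrable :: "(real \<Rightarrow> 'a :: {banach, second_countable_topology}) \<Rightarrow> bool" where
  "square_integrable h \<longleftrightarrow>
     h \<in> borel_measurable lborel \<and> integrable lborel (\<lambda>u. (norm (h u))\<^sup>2)"

definition occupation_measure :: "(real \<Rightarrow> real) \<Rightarrow> real measure" where
  "occupation_measure F = distr (lebesgue_on {0..1}) borel F"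

text \<open>
  Measurability of \<open>F\<close> is part of the following definition, since the image measure is
  meaningless without it.
\<close>

definition has_square_integrable_occupation_density :: "(real \<Rightarrow> real) \<Rightarrow> bool" where
  "has_square_integrable_occupation_density F \<longleftrightarrow>
     F \<in> borel_measurable (lebesgue_on {0..1}) \<and>
     absolutely_continuous lborel (occupation_measure F) \<and>
     (\<exists>h :: real \<Rightarrow> real. (\<forall>x. h x \<ge> 0) \<and> square_integrable h \<and>
        occupation_measure F = density lborel (\<lambda>x. ennreal (h x)))"

end

theory Submission
  imports Defs "HOL-Complex_Analysis.Complex_Analysis"
begin

text \<open>
  Both claims concern the law of \<open>Y\<^sub>c = \<Sum>n. \<gamma>^n * s\<^sub>n * (\<gamma> * a + c\<^sub>n / 2)\<close>, where the \<open>s\<^sub>n\<close> are fair signs,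
  \<open>c\<^sub>0 = c\<close> and \<open>c\<^sub>n\<^sub>+\<^sub>1 = \<kappa> * c\<^sub>n + s\<^sub>n\<close>. The chaos \<open>a * I1 + b * I2\<close> is \<open>b * Y\<^sub>0\<close> with \<open>a / b\<close> in place of \<open>a\<close>.
  On \<open>[0,1]\<close> with its binary digits as signs, the second function is a constant minus \<open>Y\<^sub>c / (4 * \<gamma>)\<close>
  with \<open>a = 0\<close> and \<open>c = - 2 * \<gamma> * (1 - \<kappa>) * S(\<xi>,0)\<close>.

  Let \<open>B\<^sub>r(c)\<close> be the squared \<open>L\<^sup>2\<close> distance between the laws of \<open>Y\<^sub>c\<close> smoothed at the scales \<open>r\<close> and \<open>2 * r\<close>,
  up to a constant. If \<open>B\<^sub>r = O(r^\<beta>)\<close> for some \<open>\<beta> > 0\<close>, the smoothed laws converge in \<open>L\<^sup>2\<close>.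
  Splitting off \<open>n\<close> steps of the walk bounds \<open>B\<^sub>r(c)\<close> by \<open>\<kappa>^n\<close> times a weighted sum of \<open>B\<close> at scale
  \<open>r / \<gamma>^n\<close> over the slopes \<open>c\<^sub>n\<close>. Averaged over \<open>c\<close>, \<open>B\<close> is small by transversality, because \<open>c\<close> enters
  \<open>Y\<^sub>c\<close> through \<open>c\<close> times a uniform variable. The average controls the weighted sum as soon as few
  pairs of slopes nearly coincide, and each such step improves the exponent of \<open>r\<close> by a fixed amount.

  The slopes are polynomials in \<open>\<kappa>\<close> with coefficients \<open>\<plusminus>1\<close>. For almost every \<open>\<kappa>\<close> there are few near
  coincidences: jets of high order separate such polynomials by Blaschke's argument, and one descends
  from \<open>j + 1\<close> to \<open>j\<close> derivatives because a function is small with a large derivative only on a set of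
  small measure.
\<close>

section \<open>Jets of sign polynomials\<close>

text \<open>The weights that the splitting puts on slopes count near pairs of prefixes, so they
  depend on \<gamma>, whereas the collision bounds hold for almost every \<kappa> only once the
  weights are given. Therefore nearness is counted at slopes from a grid and divided by a power of
  2: for each block length only finitely many weight functions can occur, and one null set serves
  them all. The price is a sum over all sequences of weights. Blocks are grouped into superblocks
  that need a single grid point each, and long superblocks make this price negligible against the
  gain. Since superblocks and slack are chosen late, the constants of the collision bounds must not
  depend on them. In the descent two words are compared block by block at a frozen parameter, so
  nearness of blocks does not move with the variable of integration. Positive definiteness replaces
  near blocks by a common one, so only the first far block matters. The same inequality (a cross
  term is at most the mean of two self terms) reduces pairs of prefixes to single slopes in the
  energy.\<close>

definition words :: "nat \<Rightarrow> bool list set" where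
  "words n = {w. length w = n}"

definition sg :: "bool \<Rightarrow> real" where
  "sg b = (if b then 1 else - 1)"

lemma finite_words [simp]: "finite (words n)"
  using finite_lists_length_eq[of "UNIV :: bool set" n] by (simp add: words_def)

lemma card_words: "card (words n) = 2 ^ n"
  using card_lists_length_eq[of "UNIV :: bool set" n] by (simp add: words_def card_UNIV_bool)

lemma words_0 [simp]: "words 0 = {[]}"
  by (auto simp: words_def)

lemma sum_words_add:
  "(\<Sum>h\<in>words (m + n). f h) = (\<Sum>w\<in>words m. \<Sum>u\<in>words n. f (w @ u))"
proof -
  have "bij_betw (\<lambda>(w, u). w @ u) (words m \<times> words n) (words (m + n))"
    by (rule bij_betw_byWitness[where f' = "\<lambda>h. (take m h, drop m h)"]) (auto simp: words_def)
  then have "(\<Sum>h\<in>words (m + n). f h) = (\<Sum>(w, u)\<in>words m \<times> words n. f (w @ u))"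
    using sum.reindex_bij_betw[of "\<lambda>(w, u). w @ u" "words m \<times> words n" "words (m + n)" f]
    by (simp add: case_prod_beta)
  then show ?thesis
    by (simp add: sum.cartesian_product)
qed

text \<open>With \<open>E\<close> the Euler operator \<open>x * d/dx\<close>, the product
  \<open>x ^ n * sjet n l w x\<close> is \<open>E\<close> applied \<open>l\<close> times to
  \<open>x ^ n\<close> times the polynomial with coefficients \<open>sg (w ! i)\<close>. Euler
  derivatives keep this form when a prefix is split off, at the price of the shift
  \<open>n\<close>.\<close>

definition sjet :: "nat \<Rightarrow> nat \<Rightarrow> bool list \<Rightarrow> real \<Rightarrow> real" where
  "sjet n l w x = (\<Sum>i<length w. real (n + i) ^ l * sg (w ! i) * x ^ i)"

abbreviation "jet \<equiv> sjet 0"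

lemma sum_lessThan_add: "sum f {..<m + n :: nat} = sum f {..<m} + (\<Sum>i<n. f (m + i))"
  by (induction n) (simp_all add: add.assoc)

lemma sjet_append: "sjet n l (p @ u) x = sjet n l p x + x ^ length p * sjet (n + length p) l u x"
  unfolding sjet_def length_append sum_lessThan_add sum_distrib_left
  by (intro arg_cong2[where f = "(+)"] sum.cong refl) (simp_all add: nth_append power_add add.assoc mult_ac)

text \<open>Binomial theorem for \<open>i = (n + i) - n\<close>; it removes the shift left behind by
  a prefix of length \<open>n\<close>.\<close>

lemma jet_eq_sum_sjet:
  "jet l w x = (\<Sum>r\<le>l. real (l choose r) * (- real n) ^ (l - r) * sjet n r w x)"
proof -
  have "real i ^ l = (\<Sum>r\<le>l. real (l choose r) * real (n + i) ^ r * (- real n) ^ (l - r))" for i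
    using binomial_ring[of "real (n + i)" "- real n" l] by simp
  then have "jet l w x = (\<Sum>i<length w. \<Sum>r\<le>l. real (l choose r) * real (n + i) ^ r * (- real n) ^ (l - r) * sg (w ! i) * x ^ i)"
    by (simp add: sjet_def sum_distrib_right)
  also have "\<dots> = (\<Sum>r\<le>l. \<Sum>i<length w. real (l choose r) * real (n + i) ^ r * (- real n) ^ (l - r) * sg (w ! i) * x ^ i)"
    by (rule sum.swap)
  also have "\<dots> = (\<Sum>r\<le>l. real (l choose r) * (- real n) ^ (l - r) * sjet n r w x)"
    by (intro sum.cong refl) (simp add: sjet_def sum_distrib_left algebra_simps)
  finally show ?thesis .
qed

text \<open>Removing the shift costs only a polynomial factor in \<open>n\<close>, which the
  exponential slack of the later estimates absorbs.\<close>

lemma abs_jet_diff_le: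
  assumes "\<And>r. r \<le> l \<Longrightarrow> \<bar>sjet n r u x - sjet n r v x\<bar> \<le> e"
  shows "\<bar>jet l u x - jet l v x\<bar> \<le> (1 + real n) ^ l * e"
proof -
  have "jet l u x - jet l v x = (\<Sum>r\<le>l. real (l choose r) * (- real n) ^ (l - r) * (sjet n r u x - sjet n r v x))"
    unfolding jet_eq_sum_sjet[of l u x n] jet_eq_sum_sjet[of l v x n]
    by (simp add: sum_subtractf algebra_simps)
  also have "\<bar>\<dots>\<bar> \<le> (\<Sum>r\<le>l. real (l choose r) * real n ^ (l - r) * e)"
    by (rule order_trans[OF sum_abs], rule sum_mono)
       (use assms in \<open>auto simp: abs_mult power_abs intro!: mult_left_mono\<close>)
  also have "\<dots> = (1 + real n) ^ l * e"
    by (simp add: binomial_ring[of 1 "real n" l] sum_distrib_right)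
  finally show ?thesis .
qed

lemma abs_sg [simp]: "\<bar>sg b\<bar> = 1"
  by (simp add: sg_def)

text \<open>Each induction step spends one factor \<open>1 + i\<close> on enlarging \<open>x\<close>
  to the midpoint of \<open>x\<close> and 1.\<close>

lemma summable_jet_bound:
  assumes "0 \<le> x" "x < 1"
  shows "summable (\<lambda>i. (1 + real i) ^ k * x ^ i)"
  using assms
proof (induction k arbitrary: x)
  case 0
  then show ?case by simp
next
  case (Suc k)
  define c where "c = (1 + x) / 2"
  have c: "x < c" "c < 1" "0 < c" using Suc.prems by (auto simp: c_def)
  have xc: "0 \<le> x / c" "x / c < 1" using c Suc.prems by auto
  have "(\<lambda>i. (x / c) ^ i + real i * (x / c) ^ i) \<longlonglongrightarrow> 0 + 0"
    using powser_times_n_limit_0[of "x / c"] xc by (intro tendsto_add LIMSEQ_power_zero) auto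
  then have "eventually (\<lambda>i. (x / c) ^ i + real i * (x / c) ^ i < 1) sequentially"
    by (rule order_tendstoD) simp
  then have "eventually (\<lambda>i. norm ((1 + real i) ^ Suc k * x ^ i) \<le> (1 + real i) ^ k * c ^ i) sequentially"
  proof eventually_elim
    case (elim i)
    then have "(1 + real i) * x ^ i \<le> c ^ i"
      using c by (simp add: power_divide field_simps)
    then have "(1 + real i) ^ k * ((1 + real i) * x ^ i) \<le> (1 + real i) ^ k * c ^ i"
      by (intro mult_left_mono) auto
    then show ?case using Suc.prems by (simp add: abs_mult mult_ac)
  qed
  moreover have "summable (\<lambda>i. (1 + real i) ^ k * c ^ i)" using c by (intro Suc.IH) auto
  ultimately show ?case by (rule summable_comparison_test_ev)
qed

definition jet_bound :: "nat \<Rightarrow> real \<Rightarrow> real" where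
  "jet_bound k x = (\<Sum>i. (1 + real i) ^ k * x ^ i)"

text \<open>The estimate \<open>n + i \<le> (1 + n) * (1 + i)\<close> separates the shift from the
  index, so one convergent series controls words of every length.\<close>

lemma abs_sjet_le:
  assumes "l \<le> k" "0 \<le> x" "x \<le> y" "y < 1"
  shows "\<bar>sjet n l w x\<bar> \<le> (1 + real n) ^ k * jet_bound k y"
proof -
  have "\<bar>sjet n l w x\<bar> \<le> (\<Sum>i<length w. real (n + i) ^ l * x ^ i)"
    unfolding sjet_def by (rule order_trans[OF sum_abs]) (use assms in \<open>auto simp: abs_mult power_abs\<close>)
  also have "\<dots> \<le> (\<Sum>i<length w. (1 + real n) ^ k * ((1 + real i) ^ k * y ^ i))"
  proof (rule sum_mono)
    fix i
    have "real (n + i) ^ l \<le> ((1 + real n) * (1 + real i)) ^ l"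
      by (rule power_mono) (auto simp: algebra_simps)
    also have "\<dots> \<le> ((1 + real n) * (1 + real i)) ^ k"
      by (rule power_increasing) (use assms in \<open>auto simp: algebra_simps\<close>)
    finally have "real (n + i) ^ l \<le> (1 + real n) ^ k * (1 + real i) ^ k"
      by (simp add: power_mult_distrib)
    moreover have "x ^ i \<le> y ^ i" using assms by (intro power_mono)
    ultimately have "real (n + i) ^ l * x ^ i \<le> ((1 + real n) ^ k * (1 + real i) ^ k) * y ^ i"
      using assms by (intro mult_mono) auto
    then show "real (n + i) ^ l * x ^ i \<le> (1 + real n) ^ k * ((1 + real i) ^ k * y ^ i)"
      by (simp add: mult.assoc)
  qed
  also have "\<dots> = (1 + real n) ^ k * (\<Sum>i<length w. (1 + real i) ^ k * y ^ i)"
    by (simp add: sum_distrib_left)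
  also have "\<dots> \<le> (1 + real n) ^ k * jet_bound k y"
    unfolding jet_bound_def
    by (intro mult_left_mono sum_le_suminf summable_jet_bound) (use assms in auto)
  finally show ?thesis .
qed

lemma continuous_on_sjet [continuous_intros]: "continuous_on A (\<lambda>x. sjet n l w x)"
  unfolding sjet_def by (intro continuous_intros)

lemma jet_has_real_derivative:
  assumes "x \<noteq> 0"
  shows "((\<lambda>x. jet l w x) has_real_derivative jet (Suc l) w x / x) (at x)"
proof -
  have "((\<lambda>x. (real i ^ l * sg (w ! i)) * x ^ i) has_real_derivative
      (real i ^ l * sg (w ! i)) * (real i * x ^ (i - Suc 0))) (at x)" for i
    using DERIV_pow[of i x] by (intro DERIV_cmult)
  moreover have "(real i ^ l * sg (w ! i)) * (real i * x ^ (i - Suc 0)) = real i ^ Suc l * sg (w ! i) * x ^ i / x" for i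
    using assms by (cases i) auto
  ultimately show ?thesis
    unfolding sjet_def sum_divide_distrib by (simp del: power_Suc add: DERIV_sum)
qed

text \<open>Taylor coefficients carry binomial coefficients, jets carry powers. As a function of
  \<open>i\<close>, \<open>i choose l\<close> is a polynomial of degree \<open>l\<close>, so the
  change of basis does not involve \<open>i\<close>.\<close>

lemma binomial_eq_sum_powers:
  obtains c where "\<And>l i. l < k \<Longrightarrow> real (i choose l) = (\<Sum>r<k. c l r * real i ^ r)"
proof -
  define p :: "nat \<Rightarrow> real poly" where "p l = smult (1 / fact l) (\<Prod>r<l. [:- real r, 1:])" for l
  have deg: "degree (p l) \<le> l" for l
  proof -
    have "degree (\<Prod>r<l. [:- real r, 1:]) \<le> (\<Sum>r<l. degree [:- real r, 1:])"
      using degree_prod_sum_le[of "{..<l}" "\<lambda>r. [:- real r, 1:]"] by simp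
    then show ?thesis by (simp add: p_def)
  qed
  have "real (i choose l) = (\<Sum>r<k. coeff (p l) r * real i ^ r)" if "l < k" for i l
  proof -
    have "real (i choose l) = poly (p l) (real i)"
      by (simp add: p_def poly_prod binomial_gbinomial gbinomial_prod_rev atLeast0LessThan)
    also have "\<dots> = (\<Sum>r<k. coeff (p l) r * real i ^ r)"
      unfolding poly_altdef
      by (rule sum.mono_neutral_left) (use deg[of l] that in \<open>auto simp: coeff_eq_0\<close>)
    finally show ?thesis .
  qed
  then show ?thesis by (rule that)
qed

text \<open>
  Blaschke's argument: a polynomial with coefficients bounded by 1 that nearly vanishes to a high
  order at \<open>x\<close> is small at 0.
\<close>

lemma poly_value_at_0_le:
  fixes d :: "nat \<Rightarrow> real" and x R B :: real and n k :: nat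
  defines "e \<equiv> \<lambda>l. \<Sum>i<n. real (i choose l) * d i * x ^ (i - l)"
  assumes d: "\<And>i. \<bar>d i\<bar> \<le> 1" and x: "0 < x" "x < R" "R < 1"
    and e: "\<And>l. l < k \<Longrightarrow> \<bar>e l\<bar> * 2 ^ l \<le> B" and n: "0 < n"
  shows "\<bar>d 0\<bar> \<le> (x / R) ^ k * (1 / (1 - R) + real k * B) + real k * B"
proof -
  \<comment> \<open>The \<open>e l\<close> are the Taylor coefficients of \<open>g\<close> at
    \<open>x\<close>; \<open>T\<close> is the Taylor polynomial of degree below \<open>k\<close>,
    and \<open>H\<close> is the cofactor of \<open>(z - x) ^ k\<close> in the remainder.\<close>
  define g :: "complex \<Rightarrow> complex" where "g z = (\<Sum>i<n. of_real (d i) * z ^ i)" for z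
  define T :: "complex \<Rightarrow> complex" where "T z = (\<Sum>l<k. of_real (e l) * (z - of_real x) ^ l)" for z
  define H :: "complex \<Rightarrow> complex" where "H z = (\<Sum>l<n. of_real (e (k + l)) * (z - of_real x) ^ l)" for z
  have gT: "g z = T z + (z - of_real x) ^ k * H z" for z
  proof -
    have pw: "z ^ i = (\<Sum>l<k + n. of_nat (i choose l) * (z - of_real x) ^ l * of_real x ^ (i - l))" if "i < n" for i
    proof -
      have "z ^ i = (\<Sum>l\<le>i. of_nat (i choose l) * (z - of_real x) ^ l * of_real x ^ (i - l))"
        using binomial_ring[of "z - of_real x" "of_real x" i] by simp
      also have "\<dots> = (\<Sum>l<k + n. of_nat (i choose l) * (z - of_real x) ^ l * of_real x ^ (i - l))"
        by (rule sum.mono_neutral_left) (use that in auto)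
      finally show ?thesis .
    qed
    have "g z = (\<Sum>i<n. \<Sum>l<k + n. of_real (d i) * (of_nat (i choose l) * (z - of_real x) ^ l * of_real x ^ (i - l)))"
      unfolding g_def by (intro sum.cong refl) (simp add: pw sum_distrib_left)
    also have "\<dots> = (\<Sum>l<k + n. \<Sum>i<n. of_real (d i) * (of_nat (i choose l) * (z - of_real x) ^ l * of_real x ^ (i - l)))"
      by (rule sum.swap)
    also have "\<dots> = (\<Sum>l<k + n. of_real (e l) * (z - of_real x) ^ l)"
      by (intro sum.cong refl) (simp add: e_def sum_distrib_right sum_distrib_left mult_ac)
    also have "\<dots> = T z + (z - of_real x) ^ k * H z"
      by (simp add: sum_lessThan_add T_def H_def sum_distrib_left power_add mult_ac)
    finally show ?thesis .
  qed
  have B: "0 \<le> B" if "k > 0" using e[of 0] that abs_ge_zero[of "e 0"] by simp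
  have norm_T: "norm (T z) \<le> real k * B" if "norm (z - of_real x) \<le> 2" for z
  proof -
    have "norm (T z) \<le> (\<Sum>l<k. B)"
      unfolding T_def
    proof (rule order_trans[OF norm_sum], rule sum_mono)
      fix l assume "l \<in> {..<k}"
      then have "\<bar>e l\<bar> * norm (z - of_real x) ^ l \<le> \<bar>e l\<bar> * 2 ^ l"
        using that by (intro mult_left_mono power_mono) auto
      then show "norm (of_real (e l) * (z - of_real x) ^ l) \<le> B"
        using e[of l] \<open>l \<in> {..<k}\<close> by (simp add: norm_mult norm_power)
    qed
    then show ?thesis by simp
  qed
  have norm_g: "norm (g z) \<le> 1 / (1 - R)" if "norm z \<le> R" for z
  proof -
    have "norm (g z) \<le> (\<Sum>i<n. R ^ i)"
      unfolding g_def
    proof (rule order_trans[OF norm_sum], rule sum_mono)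
      fix i
      have "\<bar>d i\<bar> * norm z ^ i \<le> 1 * R ^ i"
        using that d by (intro mult_mono power_mono) auto
      then show "norm (of_real (d i) * z ^ i) \<le> R ^ i" by (simp add: norm_mult norm_power)
    qed
    also have "\<dots> \<le> (\<Sum>i. R ^ i)"
      using x by (intro sum_le_suminf summable_geometric) auto
    finally show ?thesis using x by (simp add: suminf_geometric)
  qed
  \<comment> \<open>On the circle of radius \<open>R\<close> the modulus of
    \<open>R^2 - x * z\<close> is \<open>R\<close> times that of \<open>z - x\<close>, so there
    \<open>F\<close> is \<open>R ^ k\<close> times \<open>g - T\<close> in modulus, without any
    division by \<open>z - x\<close>. At 0 the factor is \<open>R ^ (2 * k)\<close>; the surplus
    \<open>R ^ k\<close> becomes the gain \<open>(x / R) ^ k\<close>.\<close>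
  define F where "F z = H z * (of_real (R\<^sup>2) - of_real x * z) ^ k" for z
  define A where "A = R ^ k * (1 / (1 - R) + real k * B)"
  have "norm (F 0) \<le> A"
  proof (rule maximum_modulus_frontier[of F "cball 0 R"])
    have "F holomorphic_on UNIV"
      unfolding F_def H_def by (intro holomorphic_intros)
    then show "F holomorphic_on interior (cball 0 R)"
      by (rule holomorphic_on_subset) auto
    show "continuous_on (closure (cball 0 R)) F"
      unfolding F_def H_def by (intro continuous_intros)
    fix z :: complex assume "z \<in> frontier (cball 0 R)"
    then have z: "norm z = R" by simp
    have "of_real (R\<^sup>2) = z * cnj z"
      using complex_norm_square[of z] z by simp
    then have "of_real (R\<^sup>2) - of_real x * z = z * cnj (z - of_real x)"
      by (simp add: algebra_simps)
    then have "norm (of_real (R\<^sup>2) - of_real x * z) = R * norm (z - of_real x)"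
      using z by (metis complex_mod_cnj norm_mult)
    then have "norm (F z) = R ^ k * norm ((z - of_real x) ^ k * H z)"
      by (simp add: F_def norm_mult norm_power power_mult_distrib)
    also have "(z - of_real x) ^ k * H z = g z - T z" by (simp add: gT)
    also have "norm (g z - T z) \<le> 1 / (1 - R) + real k * B"
    proof -
      have "norm (z - of_real x) \<le> norm z + norm (of_real x :: complex)"
        by (rule norm_triangle_ineq4)
      then have "norm (z - of_real x) \<le> 2" using z x by simp
      then show ?thesis
        using norm_triangle_ineq4[of "g z" "T z"] norm_g[of z] norm_T[of z] z by linarith
    qed
    finally show "norm (F z) \<le> A"
      using x by (simp add: A_def mult_left_mono)
  qed (use x in auto)
  then have "norm (H 0) * R ^ (2 * k) \<le> R ^ k * (1 / (1 - R) + real k * B)"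
    by (simp add: F_def A_def norm_mult norm_power power_mult abs_of_nonneg)
  then have "norm (H 0) * R ^ k \<le> 1 / (1 - R) + real k * B"
    using x by (simp add: mult_2 power_add)
  then have "norm (H 0) \<le> (1 / (1 - R) + real k * B) / R ^ k"
    using x by (simp add: field_simps)
  then have "x ^ k * norm (H 0) \<le> x ^ k * ((1 / (1 - R) + real k * B) / R ^ k)"
    using x by (intro mult_left_mono) auto
  moreover have "norm (g 0) \<le> norm (T 0) + x ^ k * norm (H 0)"
    using norm_triangle_ineq[of "T 0" "(0 - of_real x) ^ k * H 0"] x
    by (simp add: gT[of 0] norm_mult norm_power)
  moreover have "norm (T 0) \<le> real k * B" using x by (intro norm_T) auto
  moreover have "g 0 = of_real (d 0)"
    using n by (cases n) (auto simp: g_def lessThan_Suc_eq_insert_0 sum.reindex)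
  ultimately show ?thesis by (simp add: power_divide)
qed

text \<open>\<open>poly_value_at_0_le\<close> is applied to half the difference of the two
  polynomials. Its value at 0 is \<plusminus>1, while jets below \<open>c\<close> in all orders less
  than \<open>k\<close> would force it below 1/2. Neither \<open>k\<close> nor \<open>c\<close>
  depends on the length of the words.\<close>

lemma jets_separate:
  assumes "0 < y" "y \<le> z" "z < 1"
  shows "\<exists>k c. 0 < c \<and> 1 \<le> k \<and> (\<forall>x\<in>{y..z}. \<forall>u v. length u = length v \<longrightarrow> u \<noteq> [] \<longrightarrow> u ! 0 \<noteq> v ! 0 \<longrightarrow>
    (\<exists>l<k. c \<le> \<bar>jet l u x - jet l v x\<bar>))"
proof -
  define R where "R = (1 + z) / 2"
  have R: "z < R" "R < 1" "0 < R" using assms by (auto simp: R_def)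
  have "(\<lambda>k. (z / R) ^ k * (1 / (1 - R) + 1)) \<longlonglongrightarrow> 0 * (1 / (1 - R) + 1)"
    using R assms by (intro tendsto_mult tendsto_const LIMSEQ_power_zero) auto
  then have "eventually (\<lambda>k. (z / R) ^ k * (1 / (1 - R) + 1) < 1 / 4) sequentially"
    by (rule order_tendstoD) simp
  then have "eventually (\<lambda>k. (z / R) ^ k * (1 / (1 - R) + 1) < 1 / 4 \<and> 1 \<le> k) sequentially"
    using eventually_ge_at_top[of 1] by (rule eventually_conj)
  then obtain k where k: "(z / R) ^ k * (1 / (1 - R) + 1) < 1 / 4" "1 \<le> k"
    using eventually_happens'[OF sequentially_bot] by blast
  obtain p where p: "\<And>l i. l < k \<Longrightarrow> real (i choose l) = (\<Sum>r<k. p l r * real i ^ r)"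
    using binomial_eq_sum_powers[of k] by blast
  define P where "P = (\<Sum>l<k. \<Sum>r<k. \<bar>p l r\<bar>)"
  have P: "0 \<le> P" by (auto simp: P_def intro!: sum_nonneg)
  \<comment> \<open>Chosen so that \<open>real k * B = 1 / 4\<close> for the bound \<open>B\<close>
    on the scaled Taylor coefficients below.\<close>
  define c where "c = 1 / (4 * real k * (P + 1) * (2 / y) ^ k)"
  have c: "0 < c" using P k assms by (simp add: c_def)
  have "\<exists>l<k. c \<le> \<bar>jet l u x - jet l v x\<bar>"
    if x: "x \<in> {y..z}" and uv: "length u = length v" "u \<noteq> []" "u ! 0 \<noteq> v ! 0" for x u v
  proof (rule ccontr)
    assume "\<not> ?thesis"
    then have small: "\<bar>jet l u x - jet l v x\<bar> \<le> c" if "l < k" for l using that by force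
    define d where "d i = (sg (u ! i) - sg (v ! i)) / 2" for i
    define B where "B = c * (P + 1) * (2 / y) ^ k"
    have "\<bar>\<Sum>i<length u. real (i choose l) * d i * x ^ (i - l)\<bar> * 2 ^ l \<le> B" if l: "l < k" for l
    proof -
      have "x ^ l * (\<Sum>i<length u. real (i choose l) * d i * x ^ (i - l))
          = (\<Sum>i<length u. real (i choose l) * d i * x ^ i)"
        unfolding sum_distrib_left
      proof (intro sum.cong refl)
        fix i show "x ^ l * (real (i choose l) * d i * x ^ (i - l)) = real (i choose l) * d i * x ^ i"
          by (cases "l \<le> i") (auto simp: power_add[symmetric] mult_ac)
      qed
      also have "\<dots> = (\<Sum>i<length u. \<Sum>r<k. p l r * real i ^ r * d i * x ^ i)"
        using l by (simp add: p sum_distrib_right)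
      also have "\<dots> = (\<Sum>r<k. \<Sum>i<length u. p l r * real i ^ r * d i * x ^ i)"
        by (rule sum.swap)
      also have "\<dots> = (\<Sum>r<k. p l r * ((jet r u x - jet r v x) / 2))"
        by (intro sum.cong refl)
          (simp add: sjet_def uv d_def sum_subtractf[symmetric] sum_distrib_left sum_divide_distrib algebra_simps diff_divide_distrib)
      also have "\<bar>\<dots>\<bar> \<le> (\<Sum>r<k. \<bar>p l r\<bar> * c)"
      proof (rule order_trans[OF sum_abs], rule sum_mono)
        fix r assume "r \<in> {..<k}"
        then have "\<bar>(jet r u x - jet r v x) / 2\<bar> \<le> c" using small[of r] c by simp
        then show "\<bar>p l r * ((jet r u x - jet r v x) / 2)\<bar> \<le> \<bar>p l r\<bar> * c"
          unfolding abs_mult by (rule mult_left_mono) simp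
      qed
      also have "\<dots> \<le> P * c"
        unfolding P_def sum_distrib_right[symmetric] using c l
        by (intro mult_right_mono member_le_sum[of l "{..<k}" "\<lambda>l. \<Sum>r<k. \<bar>p l r\<bar>"] sum_nonneg) auto
      finally have *: "x ^ l * \<bar>\<Sum>i<length u. real (i choose l) * d i * x ^ (i - l)\<bar> \<le> P * c"
        using x assms by (simp add: abs_mult)
      have "y ^ l \<le> x ^ l" using x assms by (intro power_mono) auto
      then have "y ^ l * \<bar>\<Sum>i<length u. real (i choose l) * d i * x ^ (i - l)\<bar> \<le> P * c"
        using * by (meson abs_ge_zero mult_right_mono order_trans)
      then have "\<bar>\<Sum>i<length u. real (i choose l) * d i * x ^ (i - l)\<bar> * 2 ^ l \<le> P * c * (2 / y) ^ l"
        using assms by (simp add: power_divide field_simps)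
      also have "\<dots> \<le> (P + 1) * c * (2 / y) ^ k"
        using assms l c P by (intro mult_mono power_increasing) auto
      finally show ?thesis by (simp add: B_def mult_ac)
    qed
    moreover have "\<bar>d i\<bar> \<le> 1" for i by (auto simp: d_def sg_def)
    ultimately have "\<bar>d 0\<bar> \<le> (x / R) ^ k * (1 / (1 - R) + real k * B) + real k * B"
      using x assms R uv by (intro poly_value_at_0_le[where n = "length u"]) auto
    moreover have "real k * B = 1 / 4"
      using P k assms by (simp add: B_def c_def)
    moreover have "(x / R) ^ k * (1 / (1 - R) + 1 / 4) \<le> (z / R) ^ k * (1 / (1 - R) + 1)"
      using x assms R by (intro mult_mono power_mono divide_right_mono) auto
    moreover have "\<bar>d 0\<bar> = 1" using uv by (auto simp: d_def sg_def)
    ultimately show False using k by simp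
  qed
  then show ?thesis using c k by blast
qed

section \<open>Collision sums of product weights\<close>

text \<open>With \<open>A r v\<close> the mass that \<open>r\<close> sends to \<open>v\<close>, each
  of the three sums is a scalar product of such vectors over the values \<open>v\<close>; then
  \<open>x * y \<le> (x^2 + y^2) / 2\<close> applies for every \<open>v\<close>.\<close>

lemma eq_kernel_le:
  fixes a :: "'i \<Rightarrow> real" and p q :: "'i \<Rightarrow> 'v"
  assumes "finite I"
  shows "(\<Sum>i\<in>I. \<Sum>j\<in>I. a i * a j * of_bool (p i = q j))
    \<le> ((\<Sum>i\<in>I. \<Sum>j\<in>I. a i * a j * of_bool (p i = p j))
        + (\<Sum>i\<in>I. \<Sum>j\<in>I. a i * a j * of_bool (q i = q j))) / 2"
proof -
  define V where "V = p ` I \<union> q ` I"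
  have V: "finite V" using assms by (simp add: V_def)
  define A where "A r v = (\<Sum>i\<in>I. a i * of_bool (r i = v))" for r :: "'i \<Rightarrow> 'v" and v
  have *: "(\<Sum>i\<in>I. \<Sum>j\<in>I. a i * a j * of_bool (r i = s j)) = (\<Sum>v\<in>V. A r v * A s v)"
    if "r ` I \<subseteq> V" for r s
  proof -
    have "(\<Sum>v\<in>V. A r v * A s v)
        = (\<Sum>v\<in>V. \<Sum>i\<in>I. \<Sum>j\<in>I. a i * of_bool (r i = v) * (a j * of_bool (s j = v)))"
      by (simp add: A_def sum_product)
    also have "\<dots> = (\<Sum>i\<in>I. \<Sum>j\<in>I. \<Sum>v\<in>V. a i * of_bool (r i = v) * (a j * of_bool (s j = v)))"
      by (subst sum.swap, intro sum.cong refl, rule sum.swap)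
    also have "\<dots> = (\<Sum>i\<in>I. \<Sum>j\<in>I. a i * a j * of_bool (r i = s j))"
    proof (intro sum.cong refl)
      fix i j assume "i \<in> I"
      then have "r i \<in> V" using that by auto
      have "(\<Sum>v\<in>V. a i * of_bool (r i = v) * (a j * of_bool (s j = v)))
          = (\<Sum>v\<in>V. if v = r i then a i * a j * of_bool (r i = s j) else 0)"
        by (intro sum.cong refl) auto
      also have "\<dots> = a i * a j * of_bool (r i = s j)"
        using V \<open>r i \<in> V\<close> by simp
      finally show "(\<Sum>v\<in>V. a i * of_bool (r i = v) * (a j * of_bool (s j = v))) = a i * a j * of_bool (r i = s j)" .
    qed
    finally show ?thesis by simp
  qed
  have "(\<Sum>v\<in>V. A p v * A q v) \<le> (\<Sum>v\<in>V. (A p v * A p v + A q v * A q v) / 2)"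
  proof (rule sum_mono)
    fix v show "A p v * A q v \<le> (A p v * A p v + A q v * A q v) / 2"
      using sum_squares_bound[of "A p v" "A q v"] by (simp add: power2_eq_square)
  qed
  also have "\<dots> = ((\<Sum>v\<in>V. A p v * A p v) + (\<Sum>v\<in>V. A q v * A q v)) / 2"
    by (simp add: sum_divide_distrib[symmetric] sum.distrib)
  finally show ?thesis
    by (subst (1 2 3) *) (auto simp: V_def)
qed

text \<open>Integer vectors that differ by at most 1 in each entry become equal after one of
  \<open>3 ^ k\<close> translations. Each translation is handled by \<open>eq_kernel_le\<close>, and
  a translated map has the same collisions as the original one.\<close>

lemma adjacent_kernel_le:
  fixes a :: "'i \<Rightarrow> real" and v :: "'i \<Rightarrow> int list"
  assumes "finite I" and a: "\<And>i. i \<in> I \<Longrightarrow> 0 \<le> a i" and v: "\<And>i. i \<in> I \<Longrightarrow> length (v i) = k"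
  shows "(\<Sum>i\<in>I. \<Sum>j\<in>I. a i * a j * of_bool (\<forall>l<k. \<bar>v i ! l - v j ! l\<bar> \<le> 1))
    \<le> 3 ^ k * (\<Sum>i\<in>I. \<Sum>j\<in>I. a i * a j * of_bool (v i = v j))"
proof -
  define E where "E = {e :: int list. set e \<subseteq> {- 1, 0, 1} \<and> length e = k}"
  have E: "finite E" "card E = 3 ^ k"
    by (simp_all add: E_def finite_lists_length_eq card_lists_length_eq numeral_3_eq_3)
  define s where "s e i = map2 (+) (v i) e" for e i
  have "(\<Sum>i\<in>I. \<Sum>j\<in>I. a i * a j * of_bool (\<forall>l<k. \<bar>v i ! l - v j ! l\<bar> \<le> 1))
      \<le> (\<Sum>i\<in>I. \<Sum>j\<in>I. \<Sum>e\<in>E. a i * a j * of_bool (s e i = v j))"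
  proof (intro sum_mono)
    fix i j assume ij: "i \<in> I" "j \<in> I"
    show "a i * a j * of_bool (\<forall>l<k. \<bar>v i ! l - v j ! l\<bar> \<le> 1) \<le> (\<Sum>e\<in>E. a i * a j * of_bool (s e i = v j))"
    proof (cases "\<forall>l<k. \<bar>v i ! l - v j ! l\<bar> \<le> 1")
      case True
      define e where "e = map2 (-) (v j) (v i)"
      have "e \<in> E"
        using True ij v by (force simp: E_def e_def in_set_conv_nth)
      moreover have "s e i = v j"
        using ij v by (auto simp: s_def e_def intro!: nth_equalityI)
      ultimately have "a i * a j * of_bool (s e i = v j) \<le> (\<Sum>e\<in>E. a i * a j * of_bool (s e i = v j))"
        using a ij E by (intro member_le_sum) auto
      then show ?thesis using \<open>s e i = v j\<close> True by simp
    next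
      case False
      then show ?thesis using a ij by (auto intro!: sum_nonneg)
    qed
  qed
  also have "\<dots> = (\<Sum>e\<in>E. \<Sum>i\<in>I. \<Sum>j\<in>I. a i * a j * of_bool (s e i = v j))"
  proof -
    have "(\<Sum>i\<in>I. \<Sum>j\<in>I. \<Sum>e\<in>E. a i * a j * of_bool (s e i = v j))
        = (\<Sum>i\<in>I. \<Sum>e\<in>E. \<Sum>j\<in>I. a i * a j * of_bool (s e i = v j))"
      by (rule sum.cong[OF refl], rule sum.swap)
    also have "\<dots> = (\<Sum>e\<in>E. \<Sum>i\<in>I. \<Sum>j\<in>I. a i * a j * of_bool (s e i = v j))"
      by (rule sum.swap)
    finally show ?thesis .
  qed
  also have "\<dots> \<le> (\<Sum>e\<in>E. \<Sum>i\<in>I. \<Sum>j\<in>I. a i * a j * of_bool (v i = v j))"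
  proof (rule sum_mono)
    fix e assume e: "e \<in> E"
    have "s e i = s e j \<longleftrightarrow> v i = v j" if "i \<in> I" "j \<in> I" for i j
    proof
      assume "s e i = s e j"
      then have "\<forall>l<k. s e i ! l = s e j ! l" by simp
      then show "v i = v j" using that v e by (intro nth_equalityI) (auto simp: s_def E_def)
    qed (simp add: s_def)
    then have "(\<Sum>i\<in>I. \<Sum>j\<in>I. a i * a j * of_bool (s e i = s e j)) = (\<Sum>i\<in>I. \<Sum>j\<in>I. a i * a j * of_bool (v i = v j))"
      by (intro sum.cong refl) auto
    then show "(\<Sum>i\<in>I. \<Sum>j\<in>I. a i * a j * of_bool (s e i = v j)) \<le> (\<Sum>i\<in>I. \<Sum>j\<in>I. a i * a j * of_bool (v i = v j))"
      using eq_kernel_le[OF assms(1), of a "s e" v] by simp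
  qed
  finally show ?thesis using E by simp
qed

text \<open>The density of a product measure: the word is cut into blocks of length
  \<open>L\<close>, each with its own weight. Letters beyond the last block are ignored.\<close>

fun wt :: "nat \<Rightarrow> (bool list \<Rightarrow> real) list \<Rightarrow> bool list \<Rightarrow> real" where
  "wt L [] h = 1"
| "wt L (\<omega> # ts) h = \<omega> (take L h) * wt L ts (drop L h)"

definition wsum :: "nat \<Rightarrow> (bool list \<Rightarrow> real) list \<Rightarrow> (bool list \<Rightarrow> real) \<Rightarrow> real" where
  "wsum L ts F = (\<Sum>h\<in>words (L * length ts). wt L ts h * F h)"

definition wsum2 :: "nat \<Rightarrow> (bool list \<Rightarrow> real) list \<Rightarrow> (bool list \<Rightarrow> bool list \<Rightarrow> real) \<Rightarrow> real" where
  "wsum2 L ts K = (\<Sum>h\<in>words (L * length ts). \<Sum>h'\<in>words (L * length ts). wt L ts h * wt L ts h' * K h h')"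

lemma wsum_Nil [simp]: "wsum L [] F = F []"
  by (simp add: wsum_def)

lemma wsum_Cons: "wsum L (\<omega> # ts) F = (\<Sum>w\<in>words L. \<omega> w * wsum L ts (\<lambda>u. F (w @ u)))"
proof -
  have "wsum L (\<omega> # ts) F = (\<Sum>w\<in>words L. \<Sum>u\<in>words (L * length ts). wt L (\<omega> # ts) (w @ u) * F (w @ u))"
    using sum_words_add[of "\<lambda>h. wt L (\<omega> # ts) h * F h" L "L * length ts"] by (simp add: wsum_def)
  then show ?thesis
    by (simp add: wsum_def sum_distrib_left words_def mult.assoc)
qed

lemma wsum2_Nil [simp]: "wsum2 L [] K = K [] []"
  by (simp add: wsum2_def)

lemma wsum2_Cons:
  "wsum2 L (\<omega> # ts) K = (\<Sum>w\<in>words L. \<Sum>w'\<in>words L. \<omega> w * \<omega> w' * wsum2 L ts (\<lambda>u u'. K (w @ u) (w' @ u')))"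
proof -
  have "wsum2 L (\<omega> # ts) K = (\<Sum>w\<in>words L. \<Sum>u\<in>words (L * length ts). \<Sum>w'\<in>words L. \<Sum>u'\<in>words (L * length ts).
      wt L (\<omega> # ts) (w @ u) * wt L (\<omega> # ts) (w' @ u') * K (w @ u) (w' @ u'))"
    by (simp add: wsum2_def sum_words_add)
  also have "\<dots> = (\<Sum>w\<in>words L. \<Sum>w'\<in>words L. \<Sum>u\<in>words (L * length ts). \<Sum>u'\<in>words (L * length ts).
      wt L (\<omega> # ts) (w @ u) * wt L (\<omega> # ts) (w' @ u') * K (w @ u) (w' @ u'))"
    by (rule sum.cong[OF refl], rule sum.swap)
  also have "\<dots> = (\<Sum>w\<in>words L. \<Sum>w'\<in>words L. \<omega> w * \<omega> w' * wsum2 L ts (\<lambda>u u'. K (w @ u) (w' @ u')))"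
    unfolding wsum2_def sum_distrib_left
    by (intro sum.cong refl) (auto simp: words_def)
  finally show ?thesis .
qed

lemma wt_nonneg: "(\<And>\<omega> w. \<omega> \<in> set ts \<Longrightarrow> 0 \<le> \<omega> w) \<Longrightarrow> 0 \<le> wt L ts h"
  by (induction ts arbitrary: h) auto

lemma wsum_mono:
  assumes "\<And>\<omega> w. \<omega> \<in> set ts \<Longrightarrow> 0 \<le> \<omega> w" "\<And>h. length h = L * length ts \<Longrightarrow> F h \<le> G h"
  shows "wsum L ts F \<le> wsum L ts G"
  unfolding wsum_def using assms by (auto intro!: sum_mono mult_left_mono wt_nonneg simp: words_def)

lemma wsum2_mono:
  assumes "\<And>\<omega> w. \<omega> \<in> set ts \<Longrightarrow> 0 \<le> \<omega> w"
    "\<And>h h'. length h = L * length ts \<Longrightarrow> length h' = L * length ts \<Longrightarrow> K h h' \<le> K' h h'"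
  shows "wsum2 L ts K \<le> wsum2 L ts K'"
  unfolding wsum2_def using assms by (auto intro!: sum_mono mult_left_mono mult_nonneg_nonneg wt_nonneg simp: words_def)

lemma wsum_const: "wsum L ts (\<lambda>_. c) = c * wsum L ts (\<lambda>_. 1)"
  by (simp add: wsum_def sum_distrib_left mult.commute)

lemma wsum_mass_le:
  assumes "\<And>\<omega> w. \<omega> \<in> set ts \<Longrightarrow> 0 \<le> \<omega> w" "\<And>\<omega>. \<omega> \<in> set ts \<Longrightarrow> (\<Sum>w\<in>words L. \<omega> w) \<le> W" "0 \<le> W"
  shows "wsum L ts (\<lambda>_. 1) \<le> W ^ length ts"
  using assms
proof (induction ts)
  case (Cons \<omega> ts)
  have "wsum L (\<omega> # ts) (\<lambda>_. 1) = (\<Sum>w\<in>words L. \<omega> w) * wsum L ts (\<lambda>_. 1)"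
    by (simp add: wsum_Cons sum_distrib_right)
  also have "\<dots> \<le> W * W ^ length ts"
    using Cons by (intro mult_mono sum_nonneg) (auto simp: wsum_def intro!: sum_nonneg wt_nonneg)
  finally show ?case by simp
qed simp

lemma wsum2_const_1: "wsum2 L ts (\<lambda>_ _. 1) = (wsum L ts (\<lambda>_. 1))\<^sup>2"
  by (simp add: wsum2_def wsum_def power2_eq_square sum_product)

text \<open>
  The random-section trick: replacing each factor of a product measure by a near pair drawn once
  gives a kernel that dominates the collision sum of any map \<open>\<beta>\<close>, because equality kernels
  are positive semidefinite.
\<close>

fun unroll :: "nat \<Rightarrow> (bool list \<Rightarrow> bool list \<Rightarrow> bool) \<Rightarrow> (bool list \<Rightarrow> real) list \<Rightarrow> bool list \<Rightarrow> bool list \<Rightarrow> real" where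
  "unroll L near [] h h' = 1"
| "unroll L near (\<omega> # ts) h h' =
     (if near (take L h) (take L h')
      then if take L h = take L h'
           then \<omega> (take L h) * (\<Sum>v\<in>words L. \<omega> v * of_bool (near (take L h) v)) * unroll L near ts (drop L h) (drop L h')
           else 0
      else \<omega> (take L h) * \<omega> (take L h') * wt L ts (drop L h) * wt L ts (drop L h'))"

definition unroll_sum where
  "unroll_sum L near ts K =
     (\<Sum>h\<in>words (L * length ts). \<Sum>h'\<in>words (L * length ts). unroll L near ts h h' * K h h')"

lemma unroll_sum_Cons:
  fixes K :: "bool list \<Rightarrow> bool list \<Rightarrow> real"
  assumes near_refl: "\<And>w. near w w"
  shows "unroll_sum L near (\<omega> # ts) K =
    (\<Sum>w\<in>words L. \<Sum>w'\<in>words L. of_bool (\<not> near w w') * (\<omega> w * \<omega> w' * wsum2 L ts (\<lambda>u u'. K (w @ u) (w' @ u'))))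
    + (\<Sum>w\<in>words L. \<omega> w * (\<Sum>v\<in>words L. \<omega> v * of_bool (near w v)) * unroll_sum L near ts (\<lambda>u u'. K (w @ u) (w @ u')))"
    (is "_ = ?far + ?near")
proof -
  let ?n = "L * length ts"
  have "unroll_sum L near (\<omega> # ts) K = (\<Sum>w\<in>words L. \<Sum>u\<in>words ?n. \<Sum>w'\<in>words L. \<Sum>u'\<in>words ?n.
      unroll L near (\<omega> # ts) (w @ u) (w' @ u') * K (w @ u) (w' @ u'))"
    by (simp only: unroll_sum_def length_Cons mult_Suc_right sum_words_add)
  also have "\<dots> = (\<Sum>w\<in>words L. \<Sum>w'\<in>words L. \<Sum>u\<in>words ?n. \<Sum>u'\<in>words ?n.
      unroll L near (\<omega> # ts) (w @ u) (w' @ u') * K (w @ u) (w' @ u'))"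
    by (rule sum.cong[OF refl], rule sum.swap)
  also have "\<dots> = (\<Sum>w\<in>words L. \<Sum>w'\<in>words L.
      of_bool (\<not> near w w') * (\<omega> w * \<omega> w' * wsum2 L ts (\<lambda>u u'. K (w @ u) (w' @ u')))
      + (if w' = w then \<omega> w * (\<Sum>v\<in>words L. \<omega> v * of_bool (near w v)) * unroll_sum L near ts (\<lambda>u u'. K (w @ u) (w @ u')) else 0))"
  proof (intro sum.cong refl)
    fix w w' assume w: "w \<in> words L" "w' \<in> words L"
    show "(\<Sum>u\<in>words ?n. \<Sum>u'\<in>words ?n. unroll L near (\<omega> # ts) (w @ u) (w' @ u') * K (w @ u) (w' @ u'))
      = of_bool (\<not> near w w') * (\<omega> w * \<omega> w' * wsum2 L ts (\<lambda>u u'. K (w @ u) (w' @ u')))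
      + (if w' = w then \<omega> w * (\<Sum>v\<in>words L. \<omega> v * of_bool (near w v)) * unroll_sum L near ts (\<lambda>u u'. K (w @ u) (w @ u')) else 0)"
      using w near_refl[of w]
      by (cases "near w w'"; cases "w' = w")
        (auto simp: words_def unroll_sum_def wsum2_def sum_distrib_left mult_ac simp del: sum_mult_of_bool_eq)
  qed
  also have "\<dots> = ?far + ?near"
    by (simp add: sum.distrib)
  finally show ?thesis .
qed

text \<open>For two near first blocks, the collision mass of their continuations is at most the mean
  of the two self-collision masses by \<open>eq_kernel_le\<close>. Symmetry of \<open>near\<close>
  moves both halves onto the same block \<open>w\<close>, and for continuations of \<open>w\<close>
  with itself the induction hypothesis applies.\<close>

lemma wsum2_le_unroll_sum:
  fixes \<beta> :: "bool list \<Rightarrow> 'v"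
  assumes "\<And>\<omega> w. \<omega> \<in> set ts \<Longrightarrow> 0 \<le> \<omega> w" and near_refl: "\<And>w. near w w" and sym: "\<And>w w'. near w w' \<Longrightarrow> near w' w"
  shows "wsum2 L ts (\<lambda>h h'. of_bool (\<beta> h = \<beta> h')) \<le> unroll_sum L near ts (\<lambda>h h'. of_bool (\<beta> h = \<beta> h'))"
  using assms(1)
proof (induction ts arbitrary: \<beta>)
  case Nil
  then show ?case by (simp add: unroll_sum_def)
next
  case (Cons \<omega> ts)
  define X where "X w w' = wsum2 L ts (\<lambda>u u'. of_bool (\<beta> (w @ u) = \<beta> (w' @ u')))" for w w'
  have X: "X w w' \<le> (X w w + X w' w') / 2" for w w'
    using eq_kernel_le[OF finite_words[of "L * length ts"], of "wt L ts" "\<lambda>u. \<beta> (w @ u)" "\<lambda>u. \<beta> (w' @ u)"]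
    by (simp add: X_def wsum2_def)
  have \<omega>: "0 \<le> \<omega> w" for w using Cons.prems by simp
  have "(\<Sum>w\<in>words L. \<Sum>w'\<in>words L. of_bool (near w w') * (\<omega> w * \<omega> w' * X w w'))
      \<le> (\<Sum>w\<in>words L. \<Sum>w'\<in>words L. of_bool (near w w') * (\<omega> w * \<omega> w' * ((X w w + X w' w') / 2)))"
    using X \<omega> by (intro sum_mono mult_left_mono mult_nonneg_nonneg) auto
  also have "\<dots> = ((\<Sum>w\<in>words L. \<Sum>w'\<in>words L. of_bool (near w w') * (\<omega> w * \<omega> w' * X w w))
      + (\<Sum>w\<in>words L. \<Sum>w'\<in>words L. of_bool (near w w') * (\<omega> w * \<omega> w' * X w' w'))) / 2"
    by (simp add: sum.distrib[symmetric] sum_divide_distrib algebra_simps add_divide_distrib)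
  also have "(\<Sum>w\<in>words L. \<Sum>w'\<in>words L. of_bool (near w w') * (\<omega> w * \<omega> w' * X w' w'))
      = (\<Sum>w\<in>words L. \<Sum>w'\<in>words L. of_bool (near w w') * (\<omega> w * \<omega> w' * X w w))"
    using sym by (subst sum.swap, intro sum.cong refl) (auto simp: mult_ac of_bool_def)
  also have "((\<Sum>w\<in>words L. \<Sum>w'\<in>words L. of_bool (near w w') * (\<omega> w * \<omega> w' * X w w))
      + (\<Sum>w\<in>words L. \<Sum>w'\<in>words L. of_bool (near w w') * (\<omega> w * \<omega> w' * X w w))) / 2
      = (\<Sum>w\<in>words L. \<Sum>w'\<in>words L. of_bool (near w w') * (\<omega> w * \<omega> w' * X w w))"
    by simp
  also have "\<dots> = (\<Sum>w\<in>words L. \<omega> w * (\<Sum>v\<in>words L. \<omega> v * of_bool (near w v)) * X w w)"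
    by (simp only: sum_distrib_left sum_distrib_right mult_ac)
  also have "\<dots> \<le> (\<Sum>w\<in>words L. \<omega> w * (\<Sum>v\<in>words L. \<omega> v * of_bool (near w v))
      * unroll_sum L near ts (\<lambda>u u'. of_bool (\<beta> (w @ u) = \<beta> (w @ u'))))"
    unfolding X_def using Cons.prems \<omega>
    by (intro sum_mono mult_left_mono Cons.IH mult_nonneg_nonneg sum_nonneg) auto
  finally have near: "(\<Sum>w\<in>words L. \<Sum>w'\<in>words L. of_bool (near w w') * (\<omega> w * \<omega> w' * X w w')) \<le> \<dots>" .
  have "wsum2 L (\<omega> # ts) (\<lambda>h h'. of_bool (\<beta> h = \<beta> h'))
      = (\<Sum>w\<in>words L. \<Sum>w'\<in>words L. of_bool (\<not> near w w') * (\<omega> w * \<omega> w' * X w w'))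
      + (\<Sum>w\<in>words L. \<Sum>w'\<in>words L. of_bool (near w w') * (\<omega> w * \<omega> w' * X w w'))"
    unfolding wsum2_Cons X_def sum.distrib[symmetric] by (intro sum.cong refl) auto
  then show ?case
    using near unfolding unroll_sum_Cons[OF near_refl] X_def by linarith
qed

text \<open>In the unrolled kernel two words share their blocks up to the first far pair. Each
  shared block costs a factor \<open>q\<close>; a far pair after \<open>i\<close> shared blocks is
  charged \<open>\<kappa>\<close> at prefix length \<open>i * N\<close> further on; words that never
  separate are charged \<open>l\<close>. Here \<kappa> is any bound on \<mu> that depends only on
  the common prefix length.\<close>

lemma unroll_sum_le:
  fixes \<mu> :: "bool list \<Rightarrow> bool list \<Rightarrow> real" and \<kappa> :: "nat \<Rightarrow> real"
  assumes \<omega>: "\<And>\<omega> w. \<omega> \<in> set ts \<Longrightarrow> 0 \<le> \<omega> w"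
    and mass: "\<And>\<omega>. \<omega> \<in> set ts \<Longrightarrow> (\<Sum>w\<in>words N. \<omega> w) \<le> W"
    and coll: "\<And>\<omega>. \<omega> \<in> set ts \<Longrightarrow> (\<Sum>w\<in>words N. \<Sum>w'\<in>words N. \<omega> w * \<omega> w' * of_bool (near w w')) \<le> q * W\<^sup>2"
    and far: "\<And>p w w' u u'. length w = N \<Longrightarrow> length w' = N \<Longrightarrow> length u = length u' \<Longrightarrow> \<not> near w w' \<Longrightarrow>
      \<mu> (p @ w @ u) (p @ w' @ u') \<le> \<kappa> (length p)"
    and near_refl: "\<And>w. near w w" and \<mu>: "\<And>h h'. \<mu> h h' \<le> l" and pos: "0 \<le> W" "0 \<le> q" "0 \<le> l" "\<And>n. 0 \<le> \<kappa> n"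
  shows "unroll_sum N near ts (\<lambda>h h'. \<mu> (p @ h) (p @ h'))
    \<le> W ^ (2 * length ts) * ((\<Sum>i<length ts. q ^ i * \<kappa> (length p + i * N)) + q ^ length ts * l)"
  using \<omega> mass coll
proof (induction ts arbitrary: p)
  case Nil
  then show ?case using \<mu> by (simp add: unroll_sum_def)
next
  case (Cons \<omega> ts)
  let ?m = "length ts"
  define Z where "Z = (\<Sum>i<?m. q ^ i * \<kappa> (length p + N + i * N)) + q ^ ?m * l"
  have Z: "0 \<le> Z" using pos by (auto simp: Z_def intro!: sum_nonneg add_nonneg_nonneg)
  have w0: "0 \<le> \<omega> w" for w using Cons.prems by simp
  have mass1: "(\<Sum>w\<in>words N. \<omega> w) \<le> W" using Cons.prems by simp
  have mass2: "wsum N ts (\<lambda>_. 1) \<le> W ^ ?m"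
    using Cons.prems pos by (intro wsum_mass_le) auto
  have d0: "wsum2 N ts (\<lambda>_ _. c) \<le> c * W ^ (2 * ?m)" if "0 \<le> c" for c
  proof -
    have "wsum2 N ts (\<lambda>_ _. c) = c * (wsum N ts (\<lambda>_. 1))\<^sup>2"
      unfolding wsum2_const_1[symmetric] by (simp add: wsum2_def sum_distrib_left mult_ac)
    also have "\<dots> \<le> c * (W ^ ?m)\<^sup>2"
      using mass2 that Cons.prems
      by (intro mult_left_mono power_mono) (auto simp: wsum_def intro!: sum_nonneg wt_nonneg)
    finally show ?thesis by (simp add: power_mult[symmetric] mult.commute)
  qed
  have "(\<Sum>w\<in>words N. \<Sum>w'\<in>words N. of_bool (\<not> near w w') * (\<omega> w * \<omega> w' * wsum2 N ts (\<lambda>u u'. \<mu> (p @ w @ u) (p @ w' @ u'))))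
      \<le> (\<Sum>w\<in>words N. \<Sum>w'\<in>words N. \<omega> w * \<omega> w' * (\<kappa> (length p) * W ^ (2 * ?m)))"
  proof (intro sum_mono)
    fix w w' assume w: "w \<in> words N" "w' \<in> words N"
    show "of_bool (\<not> near w w') * (\<omega> w * \<omega> w' * wsum2 N ts (\<lambda>u u'. \<mu> (p @ w @ u) (p @ w' @ u')))
      \<le> \<omega> w * \<omega> w' * (\<kappa> (length p) * W ^ (2 * ?m))"
    proof (cases "near w w'")
      case True
      then show ?thesis using w0 pos by simp
    next
      case False
      have "wsum2 N ts (\<lambda>u u'. \<mu> (p @ w @ u) (p @ w' @ u')) \<le> wsum2 N ts (\<lambda>_ _. \<kappa> (length p))"
        using Cons.prems far False w by (intro wsum2_mono) (auto simp: words_def)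
      also have "\<dots> \<le> \<kappa> (length p) * W ^ (2 * ?m)" using pos by (intro d0)
      finally show ?thesis using False w0 by (simp add: mult_left_mono)
    qed
  qed
  also have "\<dots> = (\<Sum>w\<in>words N. \<omega> w)\<^sup>2 * (\<kappa> (length p) * W ^ (2 * ?m))"
    by (simp add: sum_product[symmetric] sum_distrib_right[symmetric] power2_eq_square)
  also have "\<dots> \<le> W\<^sup>2 * (\<kappa> (length p) * W ^ (2 * ?m))"
    using mass1 pos w0 by (intro mult_right_mono power_mono sum_nonneg) auto
  finally have far': "(\<Sum>w\<in>words N. \<Sum>w'\<in>words N. of_bool (\<not> near w w') * (\<omega> w * \<omega> w' * wsum2 N ts (\<lambda>u u'. \<mu> (p @ w @ u) (p @ w' @ u'))))
      \<le> W\<^sup>2 * (\<kappa> (length p) * W ^ (2 * ?m))" .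
  have "(\<Sum>w\<in>words N. \<omega> w * (\<Sum>v\<in>words N. \<omega> v * of_bool (near w v)) * unroll_sum N near ts (\<lambda>u u'. \<mu> (p @ w @ u) (p @ w @ u')))
      \<le> (\<Sum>w\<in>words N. \<omega> w * (\<Sum>v\<in>words N. \<omega> v * of_bool (near w v)) * (W ^ (2 * ?m) * Z))"
  proof (intro sum_mono mult_left_mono)
    fix w assume w: "w \<in> words N"
    show "unroll_sum N near ts (\<lambda>u u'. \<mu> (p @ w @ u) (p @ w @ u')) \<le> W ^ (2 * ?m) * Z"
      using Cons.IH[of "p @ w"] Cons.prems w by (simp add: words_def Z_def)
  qed (auto intro!: mult_nonneg_nonneg sum_nonneg w0)
  also have "\<dots> = (\<Sum>w\<in>words N. \<Sum>w'\<in>words N. \<omega> w * \<omega> w' * of_bool (near w w')) * (W ^ (2 * ?m) * Z)"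
    by (simp only: sum_distrib_left sum_distrib_right mult_ac)
  also have "\<dots> \<le> q * W\<^sup>2 * (W ^ (2 * ?m) * Z)"
    using Cons.prems Z pos by (intro mult_right_mono) auto
  finally have near': "(\<Sum>w\<in>words N. \<omega> w * (\<Sum>v\<in>words N. \<omega> v * of_bool (near w v)) * unroll_sum N near ts (\<lambda>u u'. \<mu> (p @ w @ u) (p @ w @ u')))
      \<le> q * W\<^sup>2 * (W ^ (2 * ?m) * Z)" .
  have "unroll_sum N near (\<omega> # ts) (\<lambda>h h'. \<mu> (p @ h) (p @ h'))
      \<le> W\<^sup>2 * (\<kappa> (length p) * W ^ (2 * ?m)) + q * W\<^sup>2 * (W ^ (2 * ?m) * Z)"
    unfolding unroll_sum_Cons[OF near_refl] using far' near' by linarith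
  also have "\<dots> = W ^ (2 * length (\<omega> # ts)) * ((\<Sum>i<length (\<omega> # ts). q ^ i * \<kappa> (length p + i * N)) + q ^ length (\<omega> # ts) * l)"
  proof -
    have "(\<Sum>i<length (\<omega> # ts). q ^ i * \<kappa> (length p + i * N)) + q ^ length (\<omega> # ts) * l = \<kappa> (length p) + q * Z"
      by (simp add: Z_def sum.lessThan_Suc_shift sum_distrib_left algebra_simps del: sum.lessThan_Suc)
    then show ?thesis by (simp add: algebra_simps power2_eq_square)
  qed
  finally show ?case .
qed

section \<open>Collisions of jets, and their average over the parameter\<close>

definition coll :: "nat \<Rightarrow> (bool list \<Rightarrow> real) list \<Rightarrow> nat \<Rightarrow> real \<Rightarrow> real \<Rightarrow> real" where
  "coll L ts j x \<rho> = wsum2 L ts (\<lambda>h h'. of_bool (\<forall>l<j. \<bar>jet l h x - jet l h' x\<bar> \<le> \<rho>))"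

text \<open>Rounding turns closeness of jets into equality, the kind of kernel that
  \<open>wsum2_le_unroll_sum\<close> treats.\<close>

definition bins :: "nat \<Rightarrow> real \<Rightarrow> real \<Rightarrow> bool list \<Rightarrow> int list" where
  "bins j x \<rho> h = map (\<lambda>l. \<lfloor>jet l h x / \<rho>\<rfloor>) [0..<j]"

lemma coll_le_bins:
  assumes "0 < \<rho>" "\<And>\<omega> w. \<omega> \<in> set ts \<Longrightarrow> 0 \<le> \<omega> w"
  shows "coll L ts j x \<rho> \<le> 3 ^ j * wsum2 L ts (\<lambda>h h'. of_bool (bins j x \<rho> h = bins j x \<rho> h'))"
proof -
  have "coll L ts j x \<rho> \<le> wsum2 L ts (\<lambda>h h'. of_bool (\<forall>l<j. \<bar>bins j x \<rho> h ! l - bins j x \<rho> h' ! l\<bar> \<le> 1))"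
    unfolding coll_def
  proof (intro wsum2_mono assms)
    fix h h'
    have "\<bar>\<lfloor>a\<rfloor> - \<lfloor>b\<rfloor>\<bar> \<le> 1" if "\<bar>a - b\<bar> \<le> 1" for a b :: real using that by linarith
    moreover have "\<bar>jet l h x / \<rho> - jet l h' x / \<rho>\<bar> \<le> 1" if "\<bar>jet l h x - jet l h' x\<bar> \<le> \<rho>" for l
      using that assms(1) by (simp add: diff_divide_distrib[symmetric] abs_divide)
    ultimately show "(of_bool (\<forall>l<j. \<bar>jet l h x - jet l h' x\<bar> \<le> \<rho>) :: real)
        \<le> of_bool (\<forall>l<j. \<bar>bins j x \<rho> h ! l - bins j x \<rho> h' ! l\<bar> \<le> 1)"
      by (auto simp: bins_def)
  qed
  also have "\<dots> \<le> 3 ^ j * wsum2 L ts (\<lambda>h h'. of_bool (bins j x \<rho> h = bins j x \<rho> h'))"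
    unfolding wsum2_def using assms(2)
    by (intro adjacent_kernel_le) (auto simp: bins_def intro!: wt_nonneg)
  finally show ?thesis .
qed

lemma fmeasurable_Icc [simp]: "{a..b :: real} \<in> fmeasurable lborel"
  by (simp add: fmeasurable_def emeasure_lborel_Icc_eq)

text \<open>By the mean value theorem two points of the sublevel set are at most
  \<open>2 * s / c\<close> apart, so it lies in an interval of that length starting at its
  infimum.\<close>

lemma measure_sublevel_le:
  fixes f D :: "real \<Rightarrow> real"
  assumes "0 < c" "0 \<le> s"
    and D: "\<And>x. x \<in> {a..b} \<Longrightarrow> (f has_real_derivative D x) (at x)"
    and sign: "(\<forall>x\<in>{a..b}. c \<le> D x) \<or> (\<forall>x\<in>{a..b}. D x \<le> - c)"
  shows "measure lborel {x \<in> {a..b}. \<bar>f x\<bar> \<le> s} \<le> 2 * s / c"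
proof (cases "{x \<in> {a..b}. \<bar>f x\<bar> \<le> s} = {}")
  case True
  show ?thesis unfolding True using assms by simp
next
  case False
  let ?S = "{x \<in> {a..b}. \<bar>f x\<bar> \<le> s}"
  have diff: "y - x \<le> 2 * s / c" if "x \<in> ?S" "y \<in> ?S" for x y
  proof (cases "x < y")
    case True
    have "\<exists>z>x. z < y \<and> f y - f x = (y - x) * D z"
      using True that by (intro MVT2 D) auto
    then obtain z where z: "x < z" "z < y" "f y - f x = (y - x) * D z" by blast
    then have "z \<in> {a..b}" using that by auto
    then have "c \<le> \<bar>D z\<bar>" using sign by (elim disjE ballE[of _ _ z]) auto
    then have "(y - x) * c \<le> (y - x) * \<bar>D z\<bar>" using True by (intro mult_left_mono) auto
    also have "\<dots> = \<bar>f y - f x\<bar>" using z True by (simp add: abs_mult)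
    also have "\<dots> \<le> 2 * s" using that by auto
    finally show ?thesis using assms by (simp add: field_simps)
  qed (use assms in \<open>auto intro: order_trans[of _ 0]\<close>)
  have bdd: "bdd_below ?S" by (rule bdd_belowI[of _ a]) auto
  have "?S \<subseteq> {Inf ?S..Inf ?S + 2 * s / c}"
  proof
    fix y assume y: "y \<in> ?S"
    have "y - 2 * s / c \<le> Inf ?S"
      using diff[OF _ y] by (intro cInf_greatest False) (simp add: algebra_simps)
    then show "y \<in> {Inf ?S..Inf ?S + 2 * s / c}"
      using cInf_lower[OF y bdd] by simp
  qed
  moreover have "continuous_on {a..b} f"
    using D by (intro continuous_at_imp_continuous_on ballI) (rule DERIV_isCont)
  then have "closed ({a..b} \<inter> f -` {- s..s})"
    by (intro continuous_closed_preimage) auto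
  moreover have "?S = {a..b} \<inter> f -` {- s..s}" by auto
  ultimately have "measure lborel ?S \<le> measure lborel {Inf ?S..Inf ?S + 2 * s / c}"
    by (intro measure_mono_fmeasurable) auto
  then show ?thesis using assms by simp
qed

lemma borel_measurable_sjet [measurable]: "(\<lambda>x. sjet n l w x) \<in> borel_measurable borel"
  by (intro borel_measurable_continuous_onI continuous_intros)

text \<open>Dividing out the common prefix \<open>p\<close> enlarges the scale to \<open>s\<close>.
  The letters after \<open>w\<close> and \<open>w'\<close> change the difference of jets by at most
  \<open>\<Delta> / 4\<close>, so the jet of order \<open>l\<close> of the difference stays above
  \<open>\<Delta> / 2\<close>. For \<open>l < j\<close> the set is empty or the bound is at least 1.
  For \<open>l = j\<close> the jet of order \<open>j - 1\<close> is small with a large derivative,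
  and \<open>measure_sublevel_le\<close> applies.\<close>

lemma far_measure_le:
  fixes lo hi \<rho> \<Delta> :: real
  assumes J: "0 < lo" "lo \<le> hi" "hi < 1" and j: "l \<le> j" "j \<le> k" "1 \<le> j"
    and \<Delta>: "0 < \<Delta>" "0 \<le> \<rho>"
    and len: "length w = N" "length w' = N"
    and far: "\<And>x. x \<in> {lo..hi} \<Longrightarrow> 3 / 4 * \<Delta> \<le> \<bar>jet l w x - jet l w' x\<bar>"
    and tail: "hi ^ N * (2 * (1 + real N) ^ k * jet_bound k hi) \<le> \<Delta> / 4"
  shows "measure lborel {x \<in> {lo..hi}. \<forall>l<j. \<bar>jet l (p @ w @ u) x - jet l (p @ w' @ u') x\<bar> \<le> \<rho>}
    \<le> 4 / \<Delta> * (1 + real (length p)) ^ k * \<rho> / lo ^ length p"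
proof -
  let ?n = "length p"
  define G where "G i x = jet i (w @ u) x - jet i (w' @ u') x" for i x
  define s where "s = (1 + real ?n) ^ k * \<rho> / lo ^ ?n"
  have s0: "0 \<le> s" using J \<Delta> by (simp add: s_def)
  have Gl: "\<Delta> / 2 \<le> \<bar>G l x\<bar>" if x: "x \<in> {lo..hi}" for x
  proof -
    have tl: "\<bar>x ^ N * sjet N l v x\<bar> \<le> \<Delta> / 8" for v
    proof -
      have "\<bar>x ^ N * sjet N l v x\<bar> \<le> hi ^ N * ((1 + real N) ^ k * jet_bound k hi)"
        unfolding abs_mult
        using x J j by (intro mult_mono abs_sjet_le) (auto simp: power_abs intro!: power_mono)
      then show ?thesis using tail by simp
    qed
    have "G l x = (jet l w x - jet l w' x) + (x ^ N * sjet N l u x - x ^ N * sjet N l u' x)"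
      by (simp add: G_def sjet_append len)
    then show ?thesis using far[OF x] tl[of u] tl[of u'] by linarith
  qed
  have small: "\<bar>G i x\<bar> \<le> s" if x: "x \<in> {lo..hi}" and i: "i < j"
    and "\<forall>l<j. \<bar>jet l (p @ w @ u) x - jet l (p @ w' @ u') x\<bar> \<le> \<rho>" for i x
  proof -
    have x0: "0 < x" using x J by simp
    have "\<bar>sjet ?n r (w @ u) x - sjet ?n r (w' @ u') x\<bar> \<le> \<rho> / lo ^ ?n" if "r \<le> i" for r
    proof -
      have "x ^ ?n * \<bar>sjet ?n r (w @ u) x - sjet ?n r (w' @ u') x\<bar> = \<bar>jet r (p @ w @ u) x - jet r (p @ w' @ u') x\<bar>"
        using x0 by (simp add: sjet_append[of 0 r p] abs_mult right_diff_distrib[symmetric])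
      also have "\<dots> \<le> \<rho>" using that i \<open>\<forall>l<j. _\<close> by simp
      finally have "\<bar>sjet ?n r (w @ u) x - sjet ?n r (w' @ u') x\<bar> \<le> \<rho> / x ^ ?n"
        using x0 by (simp add: field_simps)
      also have "\<dots> \<le> \<rho> / lo ^ ?n"
        using x J \<Delta> by (intro divide_left_mono power_mono) auto
      finally show ?thesis .
    qed
    then have "\<bar>G i x\<bar> \<le> (1 + real ?n) ^ i * (\<rho> / lo ^ ?n)"
      unfolding G_def by (rule abs_jet_diff_le)
    also have "\<dots> \<le> (1 + real ?n) ^ k * (\<rho> / lo ^ ?n)"
      using i j J \<Delta> by (intro mult_right_mono power_increasing) auto
    finally show ?thesis by (simp add: s_def)
  qed
  have S: "{x \<in> {lo..hi}. \<forall>l<j. \<bar>jet l (p @ w @ u) x - jet l (p @ w' @ u') x\<bar> \<le> \<rho>} \<in> sets lborel"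
    by measurable
  have "measure lborel {x \<in> {lo..hi}. \<forall>l<j. \<bar>jet l (p @ w @ u) x - jet l (p @ w' @ u') x\<bar> \<le> \<rho>} \<le> 4 / \<Delta> * s"
    (is "measure lborel ?S \<le> _")
  proof (cases "l < j")
    case True
    show ?thesis
    proof (cases "?S = {}")
      case True
      show ?thesis unfolding True using s0 \<Delta> by simp
    next
      case False
      then obtain x where x: "x \<in> ?S" by blast
      have "\<Delta> / 2 \<le> \<bar>G l x\<bar>" using x by (intro Gl) simp
      also have "\<dots> \<le> s" using x True by (intro small) simp_all
      finally have "\<Delta> / 2 \<le> s" .
      then have "1 \<le> 4 / \<Delta> * s" using \<Delta> by (simp add: field_simps)
      moreover have "measure lborel ?S \<le> measure lborel {lo..hi}"
        by (rule measure_mono_fmeasurable[OF _ S]) auto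
      ultimately show ?thesis using J by simp
    qed
  next
    case False
    then have l: "l = j" using j by simp
    have cont: "continuous_on {lo..hi} (G j)"
      unfolding G_def by (intro continuous_intros)
    \<comment> \<open>The jet does not vanish on the interval, so its sign is constant by
      connectedness.\<close>
    have "(\<forall>x\<in>{lo..hi}. \<Delta> / 2 \<le> G j x) \<or> (\<forall>x\<in>{lo..hi}. G j x \<le> - (\<Delta> / 2))"
    proof (rule ccontr)
      assume "\<not> ?thesis"
      then have ex: "\<exists>x\<in>{lo..hi}. G j x < \<Delta> / 2" "\<exists>y\<in>{lo..hi}. - (\<Delta> / 2) < G j y"
        by (simp_all add: Bex_def Ball_def not_le)
      obtain x where x: "x \<in> {lo..hi}" "G j x < \<Delta> / 2" using ex(1) by blast
      obtain y where y: "y \<in> {lo..hi}" "- (\<Delta> / 2) < G j y" using ex(2) by blast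
      have "G j x \<le> 0" "0 \<le> G j y"
        using Gl[OF x(1)] Gl[OF y(1)] x y \<Delta> unfolding l by linarith+
      moreover have "connected (G j ` {lo..hi})"
        by (rule connected_continuous_image[OF cont connected_Icc])
      ultimately have "0 \<in> G j ` {lo..hi}"
        using imageI[OF x(1), of "G j"] imageI[OF y(1), of "G j"] by (rule_tac connectedD_interval)
      then obtain z where "z \<in> {lo..hi}" "G j z = 0" by auto
      then show False using Gl[of z] l \<Delta> by simp
    qed
    then have sign: "(\<forall>x\<in>{lo..hi}. \<Delta> / 2 \<le> G j x / x) \<or> (\<forall>x\<in>{lo..hi}. G j x / x \<le> - (\<Delta> / 2))"
    proof (elim disjE, goal_cases)
      case 1
      have "\<Delta> / 2 \<le> G j x / x" if x: "x \<in> {lo..hi}" for x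
      proof -
        have "\<Delta> / 2 * x \<le> \<Delta> / 2 * 1" using x J \<Delta> by (intro mult_left_mono) auto
        then have "\<Delta> / 2 * x \<le> G j x" using 1 x by fastforce
        then show ?thesis using x J by (simp add: le_divide_eq)
      qed
      then show ?case by blast
    next
      case 2
      have "G j x / x \<le> - (\<Delta> / 2)" if x: "x \<in> {lo..hi}" for x
      proof -
        have "\<Delta> / 2 * x \<le> \<Delta> / 2 * 1" using x J \<Delta> by (intro mult_left_mono) auto
        then have "G j x \<le> - (\<Delta> / 2 * x)" using 2 x by fastforce
        then show ?thesis using x J by (simp add: divide_le_eq)
      qed
      then show ?case by blast
    qed
    have D: "(G (j - 1) has_real_derivative G j x / x) (at x)" if "x \<in> {lo..hi}" for x
      using jet_has_real_derivative[of x "j - 1" "w @ u"] jet_has_real_derivative[of x "j - 1" "w' @ u'"] that J j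
      unfolding G_def diff_divide_distrib by (intro DERIV_diff) auto
    have "measure lborel ?S \<le> measure lborel {x \<in> {lo..hi}. \<bar>G (j - 1) x\<bar> \<le> s}"
    proof (rule measure_mono_fmeasurable)
      show "?S \<subseteq> {x \<in> {lo..hi}. \<bar>G (j - 1) x\<bar> \<le> s}"
        using small[of _ "j - 1"] j by auto
      show "?S \<in> sets lborel" by (rule S)
      have "closed ({lo..hi} \<inter> G (j - 1) -` {- s..s})"
        unfolding G_def by (intro continuous_closed_preimage continuous_intros closed_atLeastAtMost)
      then have "{lo..hi} \<inter> G (j - 1) -` {- s..s} \<in> sets lborel" by simp
      moreover have "{x \<in> {lo..hi}. \<bar>G (j - 1) x\<bar> \<le> s} = {lo..hi} \<inter> G (j - 1) -` {- s..s}" by auto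
      ultimately show "{x \<in> {lo..hi}. \<bar>G (j - 1) x\<bar> \<le> s} \<in> fmeasurable lborel"
        using fmeasurableI2[OF fmeasurable_Icc[of lo hi], of "{lo..hi} \<inter> G (j - 1) -` {- s..s}"] by simp
    qed
    also have "\<dots> \<le> 2 * s / (\<Delta> / 2)"
      using \<Delta> s0 D sign by (intro measure_sublevel_le) auto
    finally show ?thesis by simp
  qed
  then show ?thesis by (simp add: s_def mult.assoc)
qed

text \<open>By Tonelli the sum of the \<open>f m\<close> has a finite integral; it is finite almost
  everywhere and dominates each term.\<close>

lemma AE_bounded_of_summable_integrals:
  fixes f :: "nat \<Rightarrow> 'a \<Rightarrow> real"
  assumes f: "\<And>m. integrable M (f m)" "\<And>m x. 0 \<le> f m x"
    and c: "\<And>m. integral\<^sup>L M (f m) \<le> c m" "summable c"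
  shows "AE x in M. \<exists>C. \<forall>m. f m x \<le> C"
proof -
  have c0: "0 \<le> c m" for m
    using Bochner_Integration.integral_nonneg[of M "f m"] f c(1)[of m] by (meson order_trans)
  have "(\<integral>\<^sup>+x. (\<Sum>m. ennreal (f m x)) \<partial>M) = (\<Sum>m. \<integral>\<^sup>+x. ennreal (f m x) \<partial>M)"
    using f by (intro nn_integral_suminf) auto
  also have "\<dots> \<le> (\<Sum>m. ennreal (c m))"
  proof (rule suminf_le)
    fix m show "(\<integral>\<^sup>+x. ennreal (f m x) \<partial>M) \<le> ennreal (c m)"
      using f c(1)[of m] by (subst nn_integral_eq_integral) (auto intro!: ennreal_leI)
  qed auto
  also have "\<dots> = ennreal (suminf c)"
    using c0 c by (intro suminf_ennreal2) auto
  finally have "(\<integral>\<^sup>+x. (\<Sum>m. ennreal (f m x)) \<partial>M) \<noteq> \<infinity>"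
    by (auto simp: top_unique)
  then have "AE x in M. (\<Sum>m. ennreal (f m x)) \<noteq> \<infinity>"
    using f by (intro nn_integral_PInf_AE) auto
  then show ?thesis
  proof eventually_elim
    case (elim x)
    have "f m x \<le> enn2real (\<Sum>m. ennreal (f m x))" for m
    proof -
      have "ennreal (f m x) \<le> (\<Sum>m. ennreal (f m x))"
        using sum_le_suminf[of "\<lambda>m. ennreal (f m x)" "{m}"] by simp
      then show ?thesis using elim f(2)
        by (metis enn2real_ennreal enn2real_mono infinity_ennreal_def top.not_eq_extremum)
    qed
    then show ?case by blast
  qed
qed


lemma summable_poly_exp:
  assumes "0 < (c :: real)" "0 < N"
  shows "summable (\<lambda>m. (real m * A * (1 + real m * real N) ^ k + 1) * exp (- c * real m))"
proof -
  have e: "exp (- c * real m) = exp (- c) ^ m" for m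
    by (simp add: exp_of_nat_mult[symmetric] mult.commute)
  have x: "0 \<le> exp (- c)" "exp (- c) < 1" using assms by auto
  have "summable (\<lambda>m. (\<bar>A\<bar> * real N ^ k + 1) * ((1 + real m) ^ Suc k * exp (- c) ^ m))"
    using summable_jet_bound[OF x] by (rule summable_mult)
  then show ?thesis
  proof (rule summable_comparison_test_ev[rotated], intro always_eventually allI)
    fix m
    have "(1 + real m * real N) ^ k \<le> (real N * (1 + real m)) ^ k"
      using assms by (intro power_mono) (auto simp: algebra_simps)
    then have "real m * \<bar>A\<bar> * (1 + real m * real N) ^ k \<le> (1 + real m) * \<bar>A\<bar> * (real N * (1 + real m)) ^ k"
      by (intro mult_mono) auto
    also have "\<dots> = \<bar>A\<bar> * real N ^ k * (1 + real m) ^ Suc k"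
      by (simp only: power_mult_distrib power_Suc mult_ac)
    finally have "real m * \<bar>A\<bar> * (1 + real m * real N) ^ k \<le> \<bar>A\<bar> * real N ^ k * (1 + real m) ^ Suc k" .
    moreover have "1 \<le> (1 + real m) ^ Suc k" by (rule one_le_power) simp
    ultimately have "real m * \<bar>A\<bar> * (1 + real m * real N) ^ k + 1 \<le> (\<bar>A\<bar> * real N ^ k + 1) * (1 + real m) ^ Suc k"
      by (simp only: distrib_right mult_1_left)
    moreover have "\<bar>real m * A * (1 + real m * real N) ^ k + 1\<bar> \<le> real m * \<bar>A\<bar> * (1 + real m * real N) ^ k + 1"
      by (rule order_trans[OF abs_triangle_ineq]) (simp add: abs_mult)
    ultimately have "\<bar>real m * A * (1 + real m * real N) ^ k + 1\<bar> * exp (- c) ^ m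
        \<le> (\<bar>A\<bar> * real N ^ k + 1) * (1 + real m) ^ Suc k * exp (- c) ^ m"
      by (intro mult_right_mono) auto
    then show "norm ((real m * A * (1 + real m * real N) ^ k + 1) * exp (- c * real m))
        \<le> (\<bar>A\<bar> * real N ^ k + 1) * ((1 + real m) ^ Suc k * exp (- c) ^ m)"
      unfolding e by (simp only: real_norm_def abs_mult mult.assoc power_abs abs_exp_cancel)
  qed
qed

lemma unroll_nonneg: "(\<And>\<omega> w. \<omega> \<in> set ts \<Longrightarrow> 0 \<le> \<omega> w) \<Longrightarrow> 0 \<le> unroll L near ts h h'"
  by (induction ts arbitrary: h h') (auto intro!: mult_nonneg_nonneg sum_nonneg wt_nonneg)

lemma local_step:
  fixes \<Theta> :: "(bool list \<Rightarrow> real) set" and x0 \<eta> V Q D :: real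
  assumes fin: "finite \<Theta>" and nonneg: "\<And>\<theta> w. \<theta> \<in> \<Theta> \<Longrightarrow> 0 \<le> \<theta> w"
    and mass: "\<And>\<theta>. \<theta> \<in> \<Theta> \<Longrightarrow> (\<Sum>w\<in>words N. \<theta> w) \<le> V"
    and T: "real (card \<Theta>) \<le> T" "1 \<le> T" and V: "1 \<le> V" and Q: "1 \<le> Q" and N: "0 < N"
    and x0: "0 < x0" "exp (\<eta> / 2) * x0 < 1" and \<eta>: "0 < \<eta>" and D: "0 \<le> D" and j: "1 \<le> j" "j \<le> k"
    and coll0: "\<And>\<theta>. \<theta> \<in> \<Theta> \<Longrightarrow> coll N [\<theta>] (Suc j) x0 ((exp \<eta> * x0) ^ N) \<le> Q * (exp (D * \<eta>) * x0) ^ N * V\<^sup>2"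
    and tail: "(exp (\<eta> / 2) * x0) ^ N * (2 * (1 + real N) ^ k * jet_bound k (exp (\<eta> / 2) * x0)) \<le> (exp \<eta> * x0) ^ N / 4"
  shows "\<exists>d>0. AE x in lborel. \<bar>x - x0\<bar> < d \<longrightarrow> (\<exists>C. \<forall>m \<theta>s. set \<theta>s \<subseteq> \<Theta> \<longrightarrow> length \<theta>s = m \<longrightarrow>
    coll N \<theta>s j x ((exp \<eta> * x) ^ (N * m)) \<le> C * ((T * Q) ^ m * (exp ((D + 4) * \<eta>) * x) ^ (N * m) * V ^ (2 * m)))"
proof -
  define \<Delta> where "\<Delta> = (exp \<eta> * x0) ^ N"
  have \<Delta>: "0 < \<Delta>" using x0 by (simp add: \<Delta>_def)
  define near where "near w w' \<longleftrightarrow> (\<forall>l<Suc j. \<bar>jet l w x0 - jet l w' x0\<bar> \<le> \<Delta>)" for w w'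
  have "\<exists>d>0. \<forall>w\<in>words N. \<forall>l\<in>{..j}. \<forall>x. \<bar>x - x0\<bar> < d \<longrightarrow> \<bar>jet l w x - jet l w x0\<bar> < \<Delta> / 8"
  proof -
    have "eventually (\<lambda>x. \<forall>w\<in>words N. \<forall>l\<in>{..j}. \<bar>jet l w x - jet l w x0\<bar> < \<Delta> / 8) (nhds x0)"
    proof (intro eventually_ball_finite ballI)
      fix w l
      have "isCont (jet l w) x0"
        using continuous_on_sjet[of UNIV 0 l w] by (simp add: continuous_on_eq_continuous_at)
      then have "(jet l w \<longlongrightarrow> jet l w x0) (nhds x0)"
        by (simp add: continuous_within tendsto_nhds_iff isCont_def)
      then have "eventually (\<lambda>x. dist (jet l w x) (jet l w x0) < \<Delta> / 8) (nhds x0)"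
        using \<Delta> by (intro tendstoD) auto
      then show "eventually (\<lambda>x. \<bar>jet l w x - jet l w x0\<bar> < \<Delta> / 8) (nhds x0)"
        by (simp add: dist_real_def)
    qed auto
    then show ?thesis by (auto simp: eventually_nhds_metric dist_real_def)
  qed
  then obtain d0 where d0: "0 < d0" "\<And>w l x. w \<in> words N \<Longrightarrow> l \<le> j \<Longrightarrow> \<bar>x - x0\<bar> < d0 \<Longrightarrow> \<bar>jet l w x - jet l w x0\<bar> < \<Delta> / 8"
    by auto
  \<comment> \<open>Small enough that jets of blocks move by less than \<open>\<Delta> / 8\<close>
    and that the neighbourhood lies between \<open>exp (- \<eta>) * x0\<close> and
    \<open>exp (\<eta> / 2) * x0\<close>.\<close>
  define d where "d = min (d0 / 2) (min (x0 - exp (- \<eta>) * x0) (exp (\<eta> / 2) * x0 - x0))"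
  have d: "0 < d" "d < d0" "exp (- \<eta>) * x0 \<le> x0 - d" "x0 + d \<le> exp (\<eta> / 2) * x0"
    using d0 x0 \<eta> by (auto simp: d_def min_def)
  define lo hi where "lo = x0 - d" and "hi = x0 + d"
  have "0 < exp (- \<eta>) * x0" using x0 by simp
  then have lohi: "0 < lo" "lo \<le> hi" "hi < 1"
    using d x0 unfolding lo_def hi_def by linarith+
  have Jd: "\<bar>x - x0\<bar> < d0" if "x \<in> {lo..hi}" for x
    using that d by (auto simp: lo_def hi_def)
  \<comment> \<open>A scale independent of \<open>x\<close> that dominates
    \<open>(exp \<eta> * x) ^ (N * m)\<close>, because
    \<open>x \<le> exp (\<eta> / 2) * x0\<close>.\<close>
  define \<rho> where "\<rho> m = (exp (3 / 2 * \<eta>) * x0) ^ (N * m)" for m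
  have \<rho>: "0 < \<rho> m" for m using x0 by (simp add: \<rho>_def)
  define lists where "lists m = {\<theta>s. set \<theta>s \<subseteq> \<Theta> \<and> length \<theta>s = m}" for m
  have fin_lists: "finite (lists m)" "real (card (lists m)) \<le> T ^ m" for m
  proof -
    show "finite (lists m)" unfolding lists_def by (rule finite_lists_length_eq[OF fin])
    show "real (card (lists m)) \<le> T ^ m"
      unfolding lists_def card_lists_length_eq[OF fin] of_nat_power using T by (intro power_mono) auto
  qed
  define B where "B m h h' = {x \<in> {lo..hi}. bins j x (\<rho> m) h = bins j x (\<rho> m) h'}" for m h h'
  have B_sets: "B m h h' \<in> sets lborel" for m h h'
  proof -
    have "B m h h' = {x \<in> {lo..hi}. \<forall>l<j. \<lfloor>jet l h x / \<rho> m\<rfloor> = \<lfloor>jet l h' x / \<rho> m\<rfloor>}"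
      by (auto simp: B_def bins_def)
    also have "\<dots> \<in> sets lborel" by measurable
    finally show ?thesis .
  qed
  have B_le: "measure lborel (B m h h') \<le> measure lborel {x \<in> {lo..hi}. \<forall>l<j. \<bar>jet l h x - jet l h' x\<bar> \<le> \<rho> m}" for m h h'
  proof (rule measure_mono_fmeasurable[OF _ B_sets])
    show "B m h h' \<subseteq> {x \<in> {lo..hi}. \<forall>l<j. \<bar>jet l h x - jet l h' x\<bar> \<le> \<rho> m}"
    proof (safe, goal_cases)
      case (1 x) then show ?case by (simp add: B_def)
    next
      case (2 x l)
      then have "\<lfloor>jet l h x / \<rho> m\<rfloor> = \<lfloor>jet l h' x / \<rho> m\<rfloor>" by (simp add: B_def bins_def)
      then have "\<bar>jet l h x / \<rho> m - jet l h' x / \<rho> m\<bar> \<le> 1" by linarith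
      then show ?case using \<rho>[of m] by (simp add: diff_divide_distrib[symmetric] abs_divide)
    qed
    have "{x \<in> {lo..hi}. \<forall>l<j. \<bar>jet l h x - jet l h' x\<bar> \<le> \<rho> m} \<in> sets lborel" by measurable
    then show "{x \<in> {lo..hi}. \<forall>l<j. \<bar>jet l h x - jet l h' x\<bar> \<le> \<rho> m} \<in> fmeasurable lborel"
      by (rule fmeasurableI2[OF fmeasurable_Icc[of lo hi], rotated]) auto
  qed
  have B_le_1: "measure lborel (B m h h') \<le> 1" for m h h'
  proof -
    have "measure lborel (B m h h') \<le> measure lborel {lo..hi}"
      by (rule measure_mono_fmeasurable[OF _ B_sets]) (auto simp: B_def)
    then show ?thesis using lohi by simp
  qed
  define F where "F m x = (\<Sum>\<theta>s\<in>lists m. wsum2 N \<theta>s (\<lambda>h h'. of_bool (bins j x (\<rho> m) h = bins j x (\<rho> m) h')))" for m x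
  \<comment> \<open>The integral reaches the exponent \<open>D + 5 / 2\<close>: 1 comes from
    \<open>lo \<ge> exp (- \<eta>) * x0\<close> and 3/2 from \<open>\<rho> m\<close>. The surplus of
    1/2 in \<open>D + 3\<close> makes the integrals of \<open>G m\<close> decay exponentially in
    \<open>m\<close>.\<close>
  define Z where "Z m = (T * Q) ^ m * (exp ((D + 3) * \<eta>) * x0) ^ (N * m) * V ^ (2 * m)" for m
  have Z: "0 < Z m" for m using T Q V x0 by (simp add: Z_def)
  define G where "G m x = (\<Sum>\<theta>s\<in>lists m. unroll_sum N near \<theta>s (\<lambda>h h'. indicator (B m h h') x)) / Z m" for m x
  have near: "near w w" "near w w' \<Longrightarrow> near w' w" for w w'
    using \<Delta> by (auto simp: near_def abs_minus_commute)
  have nonneg': "0 \<le> \<theta> w" if "\<theta>s \<in> lists m" "\<theta> \<in> set \<theta>s" for \<theta>s m \<theta> w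
    using that nonneg by (auto simp: lists_def)
  have FG: "F m x \<le> Z m * G m x" if x: "x \<in> {lo..hi}" for m x
  proof -
    have "F m x \<le> (\<Sum>\<theta>s\<in>lists m. unroll_sum N near \<theta>s (\<lambda>h h'. of_bool (bins j x (\<rho> m) h = bins j x (\<rho> m) h')))"
      unfolding F_def using near nonneg' by (intro sum_mono wsum2_le_unroll_sum) auto
    also have "\<dots> = (\<Sum>\<theta>s\<in>lists m. unroll_sum N near \<theta>s (\<lambda>h h'. indicator (B m h h') x))"
      using x unfolding unroll_sum_def by (intro sum.cong refl) (auto simp: B_def indicator_def)
    finally show ?thesis using Z[of m] by (simp add: G_def)
  qed
  have int_ind: "integrable lborel (\<lambda>x. c * indicator (B m h h') x :: real)" for c m h h'
  proof -
    have "B m h h' \<in> fmeasurable lborel"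
      by (rule fmeasurableI2[OF fmeasurable_Icc[of lo hi] _ B_sets]) (auto simp: B_def)
    then show ?thesis by (intro integrable_mult_right) (simp add: fmeasurable_def)
  qed
  have G_int: "integrable lborel (G m)" for m
    unfolding G_def unroll_sum_def by (intro integrable_divide_zero Bochner_Integration.integrable_sum int_ind)
  have G_nonneg: "0 \<le> G m x" for m x
    unfolding G_def unroll_sum_def using Z[of m] nonneg'
    by (intro divide_nonneg_pos sum_nonneg mult_nonneg_nonneg unroll_nonneg) auto
  define q where "q = Q * (exp (D * \<eta>) * x0) ^ N"
  have q: "0 \<le> q" using Q x0 by (simp add: q_def)
  define \<kappa> where "\<kappa> m n = 4 / \<Delta> * (1 + real n) ^ k * \<rho> m / lo ^ n" for m n
  have G_integral: "integral\<^sup>L lborel (G m) \<le> (real m * (4 / \<Delta>) * (1 + real m * real N) ^ k + 1) * exp (- (\<eta> / 2 * real N) * real m)" for m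
  proof -
    have "integral\<^sup>L lborel (G m) = (\<Sum>\<theta>s\<in>lists m. unroll_sum N near \<theta>s (\<lambda>h h'. measure lborel (B m h h'))) / Z m"
      unfolding G_def unroll_sum_def
      by (simp only: Bochner_Integration.integral_divide_zero Bochner_Integration.integral_sum int_ind
          Bochner_Integration.integrable_sum integral_mult_right_zero) simp
    also have "\<dots> \<le> (\<Sum>\<theta>s\<in>lists m. V ^ (2 * m) * ((\<Sum>i<m. q ^ i * \<kappa> m (i * N)) + q ^ m * 1)) / Z m"
    proof (intro divide_right_mono sum_mono)
      fix \<theta>s assume \<theta>s: "\<theta>s \<in> lists m"
      have "unroll_sum N near \<theta>s (\<lambda>h h'. measure lborel (B m ([] @ h) ([] @ h')))
          \<le> V ^ (2 * length \<theta>s) * ((\<Sum>i<length \<theta>s. q ^ i * \<kappa> m (length ([] :: bool list) + i * N)) + q ^ length \<theta>s * 1)"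
      proof (rule unroll_sum_le)
        fix \<theta> assume "\<theta> \<in> set \<theta>s"
        then have \<theta>: "\<theta> \<in> \<Theta>" using \<theta>s by (auto simp: lists_def)
        show "0 \<le> \<theta> w" for w using nonneg[OF \<theta>] .
        show "(\<Sum>w\<in>words N. \<theta> w) \<le> V" using mass[OF \<theta>] .
        have "coll N [\<theta>] (Suc j) x0 ((exp \<eta> * x0) ^ N) = (\<Sum>w\<in>words N. \<Sum>w'\<in>words N. \<theta> w * \<theta> w' * of_bool (near w w'))"
          by (simp add: coll_def wsum2_Cons near_def \<Delta>_def)
        then show "(\<Sum>w\<in>words N. \<Sum>w'\<in>words N. \<theta> w * \<theta> w' * of_bool (near w w')) \<le> q * V\<^sup>2"
          using coll0[OF \<theta>] by (simp add: q_def)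
      next
        fix p w w' u u' :: "bool list"
        assume len: "length w = N" "length w' = N" "length u = length u'" and "\<not> near w w'"
        then obtain l where l: "l \<le> j" "\<Delta> < \<bar>jet l w x0 - jet l w' x0\<bar>"
          by (auto simp: near_def less_Suc_eq_le)
        have "3 / 4 * \<Delta> \<le> \<bar>jet l w x - jet l w' x\<bar>" if "x \<in> {lo..hi}" for x
        proof -
          have "\<bar>jet l w x - jet l w x0\<bar> < \<Delta> / 8" "\<bar>jet l w' x - jet l w' x0\<bar> < \<Delta> / 8"
            using d0(2)[OF _ l(1) Jd[OF that]] len by (auto simp: words_def)
          then show ?thesis using l(2) by linarith
        qed
        moreover have "hi ^ N * (2 * (1 + real N) ^ k * jet_bound k hi) \<le> \<Delta> / 4"
        proof -
          have "hi ^ N * (2 * (1 + real N) ^ k * jet_bound k hi)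
              \<le> (exp (\<eta> / 2) * x0) ^ N * (2 * (1 + real N) ^ k * jet_bound k (exp (\<eta> / 2) * x0))"
            unfolding jet_bound_def using lohi d x0
            by (intro mult_mono power_mono suminf_le summable_jet_bound mult_nonneg_nonneg suminf_nonneg)
              (auto simp: hi_def intro!: mult_left_mono power_mono)
          then show ?thesis using tail unfolding \<Delta>_def by (rule order_trans)
        qed
        ultimately show "measure lborel (B m (p @ w @ u) (p @ w' @ u')) \<le> \<kappa> m (length p)"
          unfolding \<kappa>_def using lohi l j \<Delta> \<rho>[of m] len
          by (intro order_trans[OF B_le] far_measure_le[of lo hi l j]) auto
      qed (use near B_le_1 V q \<rho>[of m] \<Delta> lohi in \<open>auto simp: \<kappa>_def\<close>)
      then show "unroll_sum N near \<theta>s (\<lambda>h h'. measure lborel (B m h h'))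
          \<le> V ^ (2 * m) * ((\<Sum>i<m. q ^ i * \<kappa> m (i * N)) + q ^ m * 1)"
        using \<theta>s by (simp add: lists_def)
    qed (use Z[of m] in simp)
    also have "\<dots> = real (card (lists m)) * (V ^ (2 * m) * ((\<Sum>i<m. q ^ i * \<kappa> m (i * N)) + q ^ m)) / Z m"
      by simp
    also have "\<dots> \<le> T ^ m * (V ^ (2 * m) * ((real m * (4 / \<Delta>) * (1 + real m * real N) ^ k + 1)
        * (Q ^ m * (exp ((D + 5 / 2) * \<eta>) * x0) ^ (N * m)))) / Z m"
    proof (intro divide_right_mono mult_mono mult_left_mono)
      have "q ^ i * \<kappa> m (i * N) \<le> 4 / \<Delta> * (1 + real m * real N) ^ k * (Q ^ m * (exp ((D + 5 / 2) * \<eta>) * x0) ^ (N * m))"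
        if i: "i < m" for i
      proof -
        have "(q / lo ^ N) \<le> Q * exp ((D + 1) * \<eta>) ^ N"
        proof -
          have "q / lo ^ N \<le> q / (exp (- \<eta>) * x0) ^ N"
            using q lohi d x0 by (intro divide_left_mono power_mono mult_pos_pos zero_less_power) (auto simp: lo_def)
          also have "\<dots> = Q * (exp (D * \<eta>) * exp \<eta>) ^ N"
            using x0 by (simp add: q_def power_mult_distrib exp_minus field_simps)
          finally show ?thesis by (simp add: exp_add[symmetric] algebra_simps)
        qed
        then have "(q / lo ^ N) ^ i \<le> (Q * exp ((D + 1) * \<eta>) ^ N) ^ i"
          using q lohi by (intro power_mono) auto
        also have "\<dots> \<le> (Q * exp ((D + 1) * \<eta>) ^ N) ^ m"
          using Q D \<eta> i by (intro power_increasing mult_ge1_I one_le_power) auto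
        finally have 1: "(q / lo ^ N) ^ i \<le> (Q * exp ((D + 1) * \<eta>) ^ N) ^ m" .
        have 2: "(1 + real (i * N)) ^ k \<le> (1 + real m * real N) ^ k"
          using i by (intro power_mono) (auto intro!: mult_right_mono)
        have "q ^ i * \<kappa> m (i * N) = 4 / \<Delta> * ((1 + real (i * N)) ^ k * (\<rho> m * (q / lo ^ N) ^ i))"
          by (simp add: \<kappa>_def power_divide power_mult[symmetric] mult.commute)
        also have "\<dots> \<le> 4 / \<Delta> * ((1 + real m * real N) ^ k * (\<rho> m * (Q * exp ((D + 1) * \<eta>) ^ N) ^ m))"
          using 1 2 \<Delta> \<rho>[of m] q lohi by (intro mult_left_mono mult_mono) auto
        also have "\<rho> m * (Q * exp ((D + 1) * \<eta>) ^ N) ^ m = Q ^ m * (exp ((D + 5 / 2) * \<eta>) * x0) ^ (N * m)"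
        proof -
          have "exp ((D + 5 / 2) * \<eta>) = exp ((D + 1) * \<eta>) * exp (3 / 2 * \<eta>)"
            by (simp add: exp_add[symmetric] algebra_simps)
          then show ?thesis by (simp add: \<rho>_def power_mult_distrib power_mult mult_ac)
        qed
        finally show ?thesis by (simp add: mult.assoc)
      qed
      then have "(\<Sum>i<m. q ^ i * \<kappa> m (i * N)) \<le> real m * (4 / \<Delta> * (1 + real m * real N) ^ k * (Q ^ m * (exp ((D + 5 / 2) * \<eta>) * x0) ^ (N * m)))"
        by (intro order_trans[OF sum_bounded_above[of "{..<m}"]]) auto
      moreover have "q ^ m \<le> Q ^ m * (exp ((D + 5 / 2) * \<eta>) * x0) ^ (N * m)"
        using Q x0 \<eta> D by (simp add: q_def power_mult_distrib power_mult) (intro mult_left_mono mult_right_mono power_mono, auto)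
      ultimately show "(\<Sum>i<m. q ^ i * \<kappa> m (i * N)) + q ^ m \<le> (real m * (4 / \<Delta>) * (1 + real m * real N) ^ k + 1)
        * (Q ^ m * (exp ((D + 5 / 2) * \<eta>) * x0) ^ (N * m))"
        by (simp add: algebra_simps)
    qed (use fin_lists Z[of m] T V q \<rho>[of m] \<Delta> lohi in \<open>auto simp: \<kappa>_def intro!: mult_nonneg_nonneg add_nonneg_nonneg sum_nonneg less_imp_le[OF Z]\<close>)
    also have "\<dots> = (real m * (4 / \<Delta>) * (1 + real m * real N) ^ k + 1) * exp (- (\<eta> / 2 * real N) * real m)"
    proof -
      define E where "E = (exp ((D + 3) * \<eta>) * x0) ^ (N * m)"
      have E: "0 < E" using x0 by (simp add: E_def)
      have "exp ((D + 5 / 2) * \<eta>) = exp ((D + 3) * \<eta>) * exp (- (\<eta> / 2))"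
        by (simp add: exp_add[symmetric] algebra_simps)
      moreover have "exp (- (\<eta> / 2)) ^ (N * m) = exp (- (\<eta> / 2 * real N) * real m)"
        by (simp add: exp_of_nat_mult[symmetric] algebra_simps)
      ultimately have "(exp ((D + 5 / 2) * \<eta>) * x0) ^ (N * m) = E * exp (- (\<eta> / 2 * real N) * real m)"
        by (simp only: E_def power_mult_distrib mult_ac)
      moreover have "Z m = T ^ m * Q ^ m * E * V ^ (2 * m)"
        by (simp only: Z_def E_def power_mult_distrib)
      moreover have "T ^ m \<noteq> 0" "Q ^ m \<noteq> 0" "V ^ (2 * m) \<noteq> 0" "E \<noteq> 0" using T Q V E by auto
      ultimately show ?thesis by (simp only:) (simp add: divide_simps)
    qed
    finally show ?thesis .
  qed
  have "AE x in lborel. \<exists>C. \<forall>m. G m x \<le> C"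
    by (rule AE_bounded_of_summable_integrals[OF G_int G_nonneg G_integral summable_poly_exp]) (use \<eta> N in auto)
  then have "AE x in lborel. \<bar>x - x0\<bar> < d \<longrightarrow> (\<exists>C. \<forall>m \<theta>s. set \<theta>s \<subseteq> \<Theta> \<longrightarrow> length \<theta>s = m \<longrightarrow>
    coll N \<theta>s j x ((exp \<eta> * x) ^ (N * m)) \<le> C * ((T * Q) ^ m * (exp ((D + 4) * \<eta>) * x) ^ (N * m) * V ^ (2 * m)))"
  proof eventually_elim
    case (elim x)
    then obtain C where C: "\<And>m. G m x \<le> C" by blast
    show ?case
    proof (intro impI exI[of _ "3 ^ j * \<bar>C\<bar>"] allI)
      fix m \<theta>s assume xd: "\<bar>x - x0\<bar> < d" and \<theta>s: "set \<theta>s \<subseteq> \<Theta>" "length \<theta>s = m"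
      then have x: "x \<in> {lo..hi}" and x1: "0 < x" using lohi by (auto simp: lo_def hi_def)
      have "x \<le> exp (\<eta> / 2) * x0" "exp (- \<eta>) * x0 \<le> x" using xd d by auto
      have "coll N \<theta>s j x ((exp \<eta> * x) ^ (N * m)) \<le> coll N \<theta>s j x (\<rho> m)"
      proof -
        have "exp \<eta> * x \<le> exp \<eta> * (exp (\<eta> / 2) * x0)"
          using \<open>x \<le> exp (\<eta> / 2) * x0\<close> by simp
        also have "\<dots> = exp (3 / 2 * \<eta>) * x0" by (simp add: exp_add[symmetric])
        finally have "(exp \<eta> * x) ^ (N * m) \<le> \<rho> m"
          unfolding \<rho>_def using x1 by (intro power_mono) auto
        then show ?thesis
          unfolding coll_def using \<theta>s nonneg by (intro wsum2_mono) (auto intro: order_trans)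
      qed
      also have "\<dots> \<le> 3 ^ j * wsum2 N \<theta>s (\<lambda>h h'. of_bool (bins j x (\<rho> m) h = bins j x (\<rho> m) h'))"
        using \<theta>s nonneg \<rho> by (intro coll_le_bins) auto
      also have "\<dots> \<le> 3 ^ j * F m x"
        unfolding F_def using \<theta>s fin_lists nonneg
        by (intro mult_left_mono member_le_sum)
          (auto simp: lists_def wsum2_def intro!: sum_nonneg mult_nonneg_nonneg wt_nonneg)
      also have "\<dots> \<le> 3 ^ j * (Z m * \<bar>C\<bar>)"
        using FG[OF x, of m] C[of m] Z[of m]
        by (intro mult_left_mono) (auto intro: order_trans mult_left_mono less_imp_le)
      also have "\<dots> \<le> 3 ^ j * \<bar>C\<bar> * ((T * Q) ^ m * (exp ((D + 4) * \<eta>) * x) ^ (N * m) * V ^ (2 * m))"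
      proof -
        \<comment> \<open>The last unit of \<open>\<eta>\<close> pays for replacing
          \<open>x0\<close> by \<open>x \<ge> exp (- \<eta>) * x0\<close>.\<close>
        have "exp ((D + 3) * \<eta>) * x0 = exp ((D + 4) * \<eta>) * (exp (- \<eta>) * x0)"
          by (simp add: mult.assoc[symmetric] exp_add[symmetric] algebra_simps)
        also have "\<dots> \<le> exp ((D + 4) * \<eta>) * x"
          using \<open>exp (- \<eta>) * x0 \<le> x\<close> by simp
        finally have "(exp ((D + 3) * \<eta>) * x0) ^ (N * m) \<le> (exp ((D + 4) * \<eta>) * x) ^ (N * m)"
          using x0 by (intro power_mono) auto
        then have "Z m \<le> (T * Q) ^ m * (exp ((D + 4) * \<eta>) * x) ^ (N * m) * V ^ (2 * m)"
          unfolding Z_def using T Q V by (intro mult_right_mono mult_left_mono) auto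
        then have "3 ^ j * \<bar>C\<bar> * Z m \<le> 3 ^ j * \<bar>C\<bar> * ((T * Q) ^ m * (exp ((D + 4) * \<eta>) * x) ^ (N * m) * V ^ (2 * m))"
          by (intro mult_left_mono) auto
        then show ?thesis by (simp add: mult_ac)
      qed
      finally show "coll N \<theta>s j x ((exp \<eta> * x) ^ (N * m))
        \<le> 3 ^ j * \<bar>C\<bar> * ((T * Q) ^ m * (exp ((D + 4) * \<eta>) * x) ^ (N * m) * V ^ (2 * m))" .
    qed
  qed
  then show ?thesis using d by blast
qed

section \<open>Almost sure collision bounds\<close>

text \<open>\<open>M\<close> blocks of length \<open>L\<close> are one block of length
  \<open>L * M\<close> whose weight is itself a product, so the block length can be raised without
  changing a collision sum.\<close>

lemma wt_concat:
  assumes "\<And>ts. ts \<in> set tss \<Longrightarrow> length ts = M"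
  shows "wt L (concat tss) h = wt (L * M) (map (wt L) tss) h"
proof -
  have *: "wt L (ts @ us) h = wt L ts h * wt L us (drop (L * length ts) h)" for ts us h
    by (induction ts arbitrary: h) (auto simp: add.commute)
  have take: "wt L ts (take (L * length ts) h) = wt L ts h" for ts h
  proof (induction ts arbitrary: h)
    case (Cons \<omega> ts)
    have "drop L (take (L + L * length ts) h) = take (L * length ts) (drop L h)"
      by (simp add: drop_take)
    then show ?case using Cons[of "drop L h"] by (simp add: min_def)
  qed simp
  show ?thesis
    using assms
  proof (induction tss arbitrary: h)
    case (Cons ts tss)
    then show ?case using * take[of ts h] by auto
  qed simp
qed

lemma coll_concat:
  assumes "\<And>ts. ts \<in> set tss \<Longrightarrow> length ts = M"
  shows "coll L (concat tss) j x \<rho> = coll (L * M) (map (wt L) tss) j x \<rho>"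
proof -
  have "length (concat tss) = M * length tss"
    using assms by (induction tss) auto
  moreover have "wt L (concat tss) = wt (L * M) (map (wt L) tss)"
    using wt_concat[OF assms] by blast
  ultimately show ?thesis
    by (simp add: coll_def wsum2_def mult.assoc)
qed

lemma ex_concat:
  assumes "set ts \<subseteq> \<Omega>" "length ts = M * m"
  shows "\<exists>tss. ts = concat tss \<and> length tss = m \<and> (\<forall>us\<in>set tss. set us \<subseteq> \<Omega> \<and> length us = M)"
  using assms
proof (induction m arbitrary: ts)
  case 0
  then show ?case by (intro exI[of _ "[]"]) auto
next
  case (Suc m)
  have "set (drop M ts) \<subseteq> \<Omega>" "set (take M ts) \<subseteq> \<Omega>"
    using Suc.prems set_drop_subset[of M ts] set_take_subset[of M ts] by auto
  moreover have "length (drop M ts) = M * m" using Suc.prems by simp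
  ultimately obtain tss where "drop M ts = concat tss" "length tss = m" "\<forall>us\<in>set tss. set us \<subseteq> \<Omega> \<and> length us = M"
    using Suc.IH[of "drop M ts"] by auto
  then show ?case
    using Suc.prems \<open>set (take M ts) \<subseteq> \<Omega>\<close>
    by (intro exI[of _ "take M ts # tss"]) (use append_take_drop_id[of M ts] in auto)
qed

text \<open>By Lindelof countably many of the neighbourhoods cover \<open>A\<close>, so countably
  many null sets suffice even for an arbitrary set \<open>A\<close>.\<close>

lemma AE_of_local:
  fixes P :: "real \<Rightarrow> bool"
  assumes "\<And>y. y \<in> A \<Longrightarrow> \<exists>d>0. AE x in lborel. \<bar>x - y\<bar> < d \<longrightarrow> P x"
  shows "AE x in lborel. x \<in> A \<longrightarrow> P x"
proof -
  obtain d where d: "\<And>y. y \<in> A \<Longrightarrow> 0 < d y" "\<And>y. y \<in> A \<Longrightarrow> AE x in lborel. \<bar>x - y\<bar> < d y \<longrightarrow> P x"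
    using assms by metis
  obtain F where F: "F \<subseteq> (\<lambda>y. ball y (d y)) ` A" "countable F" "\<Union>F = (\<Union>y\<in>A. ball y (d y))"
    using Lindelof[of "(\<lambda>y. ball y (d y)) ` A"] by auto
  have "AE x in lborel. \<forall>B\<in>F. x \<in> B \<longrightarrow> P x"
  proof (subst AE_ball_countable[OF F(2)], intro ballI)
    fix B assume "B \<in> F"
    then obtain y where "y \<in> A" "B = ball y (d y)" using F(1) by auto
    then show "AE x in lborel. x \<in> B \<longrightarrow> P x"
      using d(2)[of y] by (auto simp: dist_real_def abs_minus_commute)
  qed
  then show ?thesis
  proof eventually_elim
    case (elim x)
    show ?case
    proof
      assume "x \<in> A"
      then have "x \<in> (\<Union>y\<in>A. ball y (d y))" using d(1)[of x] by (intro UN_I) auto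
      then have "x \<in> \<Union>F" using F(3) by simp
      then show "P x" using elim by auto
    qed
  qed
qed

text \<open>
  \<open>\<rho>\<close> times the squared mass is what perfectly spread jets would give at scale \<open>\<rho>\<close>; \<open>\<eta>\<close> is slack in the
  exponent, and the power of \<open>card \<Omega>\<close> pays for the union over all sequences of weights.
\<close>

definition coll_claim :: "nat \<Rightarrow> (bool list \<Rightarrow> real) set \<Rightarrow> real \<Rightarrow> real \<Rightarrow> nat \<Rightarrow> real \<Rightarrow> nat \<Rightarrow> real \<Rightarrow> bool" where
  "coll_claim L \<Omega> W \<eta> e D j x \<longleftrightarrow> (\<exists>M\<ge>1. \<exists>C. \<forall>m ts. set ts \<subseteq> \<Omega> \<longrightarrow> length ts = M * m \<longrightarrow>
     coll L ts j x ((exp \<eta> * x) ^ (L * M * m))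
       \<le> C * (real (card \<Omega>) ^ (e * M * m) * (exp (D * \<eta>) * x) ^ (L * M * m) * W ^ (2 * M * m)))"

lemma coll_mass_le:
  assumes "\<And>\<omega> w. \<omega> \<in> set ts \<Longrightarrow> 0 \<le> \<omega> w" "\<And>\<omega>. \<omega> \<in> set ts \<Longrightarrow> (\<Sum>w\<in>words L. \<omega> w) \<le> W" "0 \<le> W"
  shows "coll L ts j x \<rho> \<le> W ^ (2 * length ts)"
proof -
  have "coll L ts j x \<rho> \<le> wsum2 L ts (\<lambda>_ _. 1)"
    unfolding coll_def using assms by (intro wsum2_mono) auto
  also have "\<dots> \<le> (W ^ length ts)\<^sup>2"
    unfolding wsum2_const_1 using assms
    by (intro power_mono wsum_mass_le) (auto simp: wsum_def intro!: sum_nonneg wt_nonneg)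
  finally show ?thesis by (simp add: power_mult[symmetric] mult.commute)
qed

text \<open>Weights are at most 1, so \<open>\<omega>^2 \<le> \<omega>\<close>, and a block on which
  both words agree contributes at most \<open>W\<close> instead of \<open>W^2\<close>.\<close>

lemma wsum2_agree_le:
  assumes "\<And>\<omega> w. \<omega> \<in> set ts \<Longrightarrow> 0 \<le> \<omega> w \<and> \<omega> w \<le> 1" "\<And>\<omega>. \<omega> \<in> set ts \<Longrightarrow> (\<Sum>w\<in>words L. \<omega> w) \<le> W" "0 \<le> W"
    and "i \<le> length ts"
  shows "wsum2 L ts (\<lambda>h h'. of_bool (take (L * i) h = take (L * i) h')) \<le> W ^ i * W ^ (2 * (length ts - i))"
  using assms
proof (induction ts arbitrary: i)
  case (Cons \<omega> ts)
  show ?case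
  proof (cases i)
    case 0
    then show ?thesis
      using coll_mass_le[of "\<omega> # ts" L W 0 0 0] Cons.prems by (simp add: coll_def)
  next
    case (Suc i')
    define Y where "Y = wsum2 L ts (\<lambda>u u'. of_bool (take (L * i') u = take (L * i') u'))"
    have Y: "0 \<le> Y" "Y \<le> W ^ i' * W ^ (2 * (length ts - i'))"
    proof -
      show "0 \<le> Y" unfolding Y_def wsum2_def using Cons.prems
        by (intro sum_nonneg mult_nonneg_nonneg wt_nonneg) auto
      show "Y \<le> W ^ i' * W ^ (2 * (length ts - i'))"
        unfolding Y_def using Cons.prems Suc by (intro Cons.IH) auto
    qed
    have "wsum2 L (\<omega> # ts) (\<lambda>h h'. of_bool (take (L * i) h = take (L * i) h'))
        = (\<Sum>w\<in>words L. \<Sum>w'\<in>words L. if w' = w then \<omega> w * \<omega> w * Y else 0)"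
      unfolding wsum2_Cons Y_def
      by (intro sum.cong refl) (auto simp: Suc words_def wsum2_def)
    also have "\<dots> = (\<Sum>w\<in>words L. \<omega> w * \<omega> w) * Y"
      by (simp add: sum_distrib_right)
    also have "\<dots> \<le> W * (W ^ i' * W ^ (2 * (length ts - i')))"
    proof (rule mult_mono)
      have "(\<Sum>w\<in>words L. \<omega> w * \<omega> w) \<le> (\<Sum>w\<in>words L. \<omega> w * 1)"
        using Cons.prems by (intro sum_mono mult_left_mono) auto
      also have "\<dots> \<le> W" using Cons.prems by simp
      finally show "(\<Sum>w\<in>words L. \<omega> w * \<omega> w) \<le> W" .
    qed (use Y Cons.prems in auto)
    finally show ?thesis using Suc by (simp add: mult_ac)
  qed
qed simp

lemma eventually_poly_le_exp:
  assumes "0 < (c :: real)"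
  shows "eventually (\<lambda>n. (1 + real n) ^ k * A \<le> exp (c * real n)) sequentially"
proof -
  have "(\<lambda>n. (1 + real n) ^ k * exp (- c) ^ n) \<longlonglongrightarrow> 0"
    using assms by (intro summable_LIMSEQ_zero summable_jet_bound) auto
  then have "(\<lambda>n. (1 + real n) ^ k * exp (- c) ^ n * A) \<longlonglongrightarrow> 0 * A"
    by (intro tendsto_mult tendsto_const)
  then have "eventually (\<lambda>n. (1 + real n) ^ k * exp (- c) ^ n * A < 1) sequentially"
    by (intro order_tendstoD) auto
  then show ?thesis
  proof eventually_elim
    case (elim n)
    have "exp (- c) ^ n = 1 / exp (c * real n)"
      by (simp add: exp_of_nat_mult[symmetric] exp_minus field_simps)
    then have "(1 + real n) ^ k * A / exp (c * real n) < 1" using elim by simp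
    then show ?case by (simp add: divide_less_eq)
  qed
qed

text \<open>If two words first differ at position \<open>n\<close>, the remaining tails have jets at
  least \<open>c\<close> apart in some order below \<open>k\<close>, so some jet of the words
  differs by about \<open>x ^ n\<close>, up to a polynomial factor. Closeness therefore forces
  agreement on a long prefix, and each agreeing block saves a factor \<open>W\<close>, which is at
  least \<open>1 / x ^ L\<close>.\<close>

lemma coll_claim_base:
  assumes x: "0 < x" "x < 1" and L: "1 \<le> L" and c: "0 < c"
    and sep: "\<And>u v. length u = length v \<Longrightarrow> u \<noteq> [] \<Longrightarrow> u ! 0 \<noteq> v ! 0 \<Longrightarrow> \<exists>l<k. c \<le> \<bar>jet l u x - jet l v x\<bar>"
    and \<Omega>: "\<And>\<omega> w. \<omega> \<in> \<Omega> \<Longrightarrow> 0 \<le> \<omega> w \<and> \<omega> w \<le> 1" "\<And>\<omega>. \<omega> \<in> \<Omega> \<Longrightarrow> (\<Sum>w\<in>words L. \<omega> w) \<le> W"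
    and W: "1 \<le> W * x ^ L" and \<eta>: "0 < \<eta>"
  shows "coll_claim L \<Omega> W \<eta> 0 2 k x"
proof -
  have ts_\<Omega>: "\<omega> \<in> \<Omega>" if "set ts \<subseteq> \<Omega>" "\<omega> \<in> set ts" for ts \<omega>
    using that by blast
  have W0: "1 \<le> W"
  proof -
    have "x ^ L \<le> 1" using x by (simp add: power_le_one)
    moreover have "0 < W" using W x by (metis less_le_trans zero_less_mult_pos2 zero_less_one zero_less_power)
    ultimately have "W * x ^ L \<le> W * 1" by (intro mult_left_mono) auto
    then show ?thesis using W by simp
  qed
  obtain N0 where N0: "\<And>n. N0 \<le> n \<Longrightarrow> (1 + real n) ^ k * (1 / c) \<le> exp (\<eta> * real n)"
    using eventually_poly_le_exp[OF \<eta>, of k "1 / c"] by (auto simp: eventually_sequentially)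
  have "coll L ts k x ((exp \<eta> * x) ^ (L * (N0 + 1) * m))
      \<le> (1 / x ^ L) * (real (card \<Omega>) ^ (0 * (N0 + 1) * m) * (exp (2 * \<eta>) * x) ^ (L * (N0 + 1) * m) * W ^ (2 * (N0 + 1) * m))"
    if ts: "set ts \<subseteq> \<Omega>" "length ts = (N0 + 1) * m" for m ts
  proof (cases "m = 0")
    case True
    then have "coll L ts k x ((exp \<eta> * x) ^ (L * (N0 + 1) * m)) = 1" using ts by (simp add: coll_def)
    moreover have "1 \<le> 1 / x ^ L" using x by (simp add: power_le_one)
    ultimately show ?thesis using True by simp
  next
    case False
    define N where "N = L * length ts"
    have "N0 \<le> (N0 + 1) * m" using False by (cases m) auto
    also have "\<dots> \<le> N" using L ts by (simp add: N_def)
    finally have N: "(1 + real N) ^ k * (1 / c) \<le> exp (\<eta> * real N)" by (rule N0)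
    define \<Delta> where "\<Delta> = (exp \<eta> * x) ^ N"
    \<comment> \<open>The factor \<open>exp (2 * \<eta>)\<close>, against \<open>exp \<eta>\<close>
      in the scale \<open>\<Delta>\<close>, absorbs the polynomial loss from removing the shift of
      the jets.\<close>
    define n0 where "n0 = (LEAST n. x ^ n \<le> (exp (2 * \<eta>) * x) ^ N)"
    have "x \<le> exp (2 * \<eta>) * x" using x \<eta> by simp
    then have xN: "x ^ N \<le> (exp (2 * \<eta>) * x) ^ N" using x by (intro power_mono) auto
    have n0: "x ^ n0 \<le> (exp (2 * \<eta>) * x) ^ N" "n0 \<le> N"
      unfolding n0_def using xN by (auto intro: LeastI Least_le)
    have close: "take n0 h = take n0 h'"
      if len: "length h = N" "length h' = N" and close: "\<forall>l<k. \<bar>jet l h x - jet l h' x\<bar> \<le> \<Delta>" for h h'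
    proof (cases "h = h'")
      case False
      define n where "n = (LEAST i. h ! i \<noteq> h' ! i)"
      have "\<exists>i<N. h ! i \<noteq> h' ! i" using False len nth_equalityI[of h h'] by auto
      then obtain i where i: "i < N" "h ! i \<noteq> h' ! i" by blast
      have n: "h ! n \<noteq> h' ! n" "n \<le> i"
        unfolding n_def using i(2) by (rule LeastI, rule Least_le)
      have below: "h ! i = h' ! i" if "i < n" for i using not_less_Least that unfolding n_def by blast
      define p u u' where "p = take n h" and "u = drop n h" and "u' = drop n h'"
      have p: "take n h' = take n h" using below n i len by (auto intro!: nth_equalityI)
      have "h = p @ u" by (simp add: p_def u_def)
      moreover have "h' = p @ u'" by (simp add: p_def u'_def flip: p)
      moreover have "length p = n" "length u = length u'" "u \<noteq> []" "u ! 0 \<noteq> u' ! 0"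
        using n i len by (simp_all add: p_def u_def u'_def)
      ultimately have h: "h = p @ u" "h' = p @ u'" "length p = n" "length u = length u'" "u \<noteq> []" "u ! 0 \<noteq> u' ! 0" .
      obtain l where l: "l < k" "c \<le> \<bar>jet l u x - jet l u' x\<bar>" using sep[of u u'] h by blast
      have "\<bar>sjet n r u x - sjet n r u' x\<bar> \<le> \<Delta> / x ^ n" if "r \<le> l" for r
      proof -
        have "x ^ n * \<bar>sjet n r u x - sjet n r u' x\<bar> = \<bar>jet r h x - jet r h' x\<bar>"
          using x by (simp add: h sjet_append abs_mult right_diff_distrib[symmetric])
        also have "\<dots> \<le> \<Delta>" using close that l by simp
        finally show ?thesis using x by (simp add: field_simps)
      qed
      then have "\<bar>jet l u x - jet l u' x\<bar> \<le> (1 + real n) ^ l * (\<Delta> / x ^ n)"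
        by (rule abs_jet_diff_le)
      also have "\<dots> \<le> (1 + real N) ^ k * (\<Delta> / x ^ n)"
      proof -
        have "(1 + real n) ^ l \<le> (1 + real N) ^ l" using n i by (intro power_mono) auto
        also have "\<dots> \<le> (1 + real N) ^ k" using l by (intro power_increasing) auto
        finally show ?thesis using x by (intro mult_right_mono) (auto simp: \<Delta>_def)
      qed
      finally have "c \<le> (1 + real N) ^ k * (\<Delta> / x ^ n)" using l by simp
      then have "x ^ n \<le> (1 + real N) ^ k * (1 / c) * \<Delta>" using c x by (simp add: field_simps)
      also have "\<dots> \<le> exp (\<eta> * real N) * \<Delta>" using N x by (intro mult_right_mono) (auto simp: \<Delta>_def)
      also have "\<dots> = (exp (2 * \<eta>) * x) ^ N"
      proof -
        have "exp (\<eta> * real N) = exp \<eta> ^ N" by (simp add: exp_of_nat_mult[symmetric] mult.commute)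
        then have "exp (\<eta> * real N) * \<Delta> = ((exp \<eta> * exp \<eta>) * x) ^ N"
          by (simp only: \<Delta>_def power_mult_distrib mult_ac)
        then show ?thesis by (simp add: exp_add[symmetric])
      qed
      finally have "n0 \<le> n" unfolding n0_def by (rule Least_le)
      then show ?thesis using below len n i by (intro nth_equalityI) auto
    qed simp
    \<comment> \<open>Only whole blocks count; rounding loses at most one block, hence the constant
      \<open>1 / x ^ L\<close>.\<close>
    define i where "i = n0 div L"
    have iL: "L * i \<le> n0" "n0 \<le> L * (i + 1)"
      using dividend_less_times_div[of L n0] L by (simp_all add: i_def)
    have "n0 div L \<le> (L * length ts) div L" using n0 unfolding N_def by (intro div_le_mono)
    then have i_le: "i \<le> length ts" using L by (simp add: i_def)
    have "coll L ts k x \<Delta> \<le> wsum2 L ts (\<lambda>h h'. of_bool (take (L * i) h = take (L * i) h'))"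
      unfolding coll_def
    proof (rule wsum2_mono)
      fix h h' :: "bool list" assume len: "length h = L * length ts" "length h' = L * length ts"
      show "(of_bool (\<forall>l<k. \<bar>jet l h x - jet l h' x\<bar> \<le> \<Delta>) :: real) \<le> of_bool (take (L * i) h = take (L * i) h')"
      proof (cases "\<forall>l<k. \<bar>jet l h x - jet l h' x\<bar> \<le> \<Delta>")
        case True
        then have "take n0 h = take n0 h'" using close len by (simp add: N_def)
        then have "take (L * i) (take n0 h) = take (L * i) (take n0 h')" by simp
        then show ?thesis using iL by (simp add: min_def)
      next
        case False
        then show ?thesis unfolding of_bool_def by (simp only: if_False) simp
      qed
    next
      fix \<omega> w assume "\<omega> \<in> set ts"
      then show "0 \<le> \<omega> w" using \<Omega>(1)[OF ts_\<Omega>[OF ts(1)]] by blast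
    qed
    also have "\<dots> \<le> W ^ i * W ^ (2 * (length ts - i))"
    proof (rule wsum2_agree_le)
      fix \<omega> w assume "\<omega> \<in> set ts"
      then have "\<omega> \<in> \<Omega>" by (rule ts_\<Omega>[OF ts(1)])
      then show "0 \<le> \<omega> w \<and> \<omega> w \<le> 1" "(\<Sum>w\<in>words L. \<omega> w) \<le> W" by (fact \<Omega>)+
    qed (use W0 i_le in simp_all)
    also have "\<dots> \<le> W ^ (2 * length ts) * (x ^ L) ^ i"
    proof -
      have "W ^ (2 * length ts) = W ^ i * W ^ (2 * (length ts - i)) * W ^ i"
      proof -
        have "2 * length ts = i + 2 * (length ts - i) + i" using i_le by linarith
        then show ?thesis by (simp only: power_add)
      qed
      moreover have "1 \<le> (W * x ^ L) ^ i" using W by (rule one_le_power)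
      ultimately have "W ^ i * W ^ (2 * (length ts - i)) * 1 \<le> W ^ i * W ^ (2 * (length ts - i)) * (W * x ^ L) ^ i"
        using W0 by (intro mult_left_mono) auto
      then show ?thesis unfolding \<open>W ^ (2 * length ts) = _\<close> by (simp only: power_mult_distrib mult_ac mult_1_left)
    qed
    also have "\<dots> \<le> W ^ (2 * length ts) * ((1 / x ^ L) * (exp (2 * \<eta>) * x) ^ N)"
    proof (intro mult_left_mono)
      have "x ^ (L * (i + 1)) \<le> x ^ n0" using iL x by (intro power_decreasing) auto
      also have "\<dots> \<le> (exp (2 * \<eta>) * x) ^ N" by (rule n0)
      finally have *: "x ^ (L * (i + 1)) \<le> (exp (2 * \<eta>) * x) ^ N" .
      show "(x ^ L) ^ i \<le> (1 / x ^ L) * (exp (2 * \<eta>) * x) ^ N"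
      proof -
        have "x ^ (L * (i + 1)) = (x ^ L) ^ i * x ^ L"
          by (simp only: power_mult power_add power_one_right)
        then show ?thesis using * x by (simp add: pos_le_divide_eq)
      qed
    qed (use W0 in simp)
    finally have "coll L ts k x \<Delta> \<le> W ^ (2 * length ts) * (1 / x ^ L * (exp (2 * \<eta>) * x) ^ N)" .
    moreover have NN: "L * (N0 + 1) * m = N" "2 * (N0 + 1) * m = 2 * length ts"
      by (simp_all only: N_def ts mult.assoc)
    ultimately show ?thesis
      unfolding NN mult_0 power_0 \<Delta>_def mult_1_left by (simp only: mult_ac)
  qed
  then show ?thesis unfolding coll_claim_def by (intro exI[of _ "N0 + 1"] conjI exI[of _ "1 / x ^ L"]) auto
qed

text \<open>\<open>local_step\<close> is applied to superblocks of \<open>M\<close> blocks, around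
  every parameter where the bound for \<open>j + 1\<close> holds at this length with constant 1. A
  parameter with a claim for \<open>j + 1\<close> is of this kind for some \<open>M\<close>, since a
  long superblock absorbs the constant at the price of one unit of \<open>\<eta>\<close>, and there
  are only countably many \<open>M\<close>. The other 4 units added to \<open>D\<close> come from
  \<open>local_step\<close>; its sum over superblock weights adds 1 to \<open>e\<close>.\<close>

lemma coll_claim_step:
  assumes \<Omega>: "finite \<Omega>" "\<Omega> \<noteq> {}" "\<And>\<omega> w. \<omega> \<in> \<Omega> \<Longrightarrow> 0 \<le> \<omega> w" "\<And>\<omega>. \<omega> \<in> \<Omega> \<Longrightarrow> (\<Sum>w\<in>words L. \<omega> w) \<le> W"
    and W: "1 \<le> W" and L: "1 \<le> L" and \<eta>: "0 < \<eta>" and D: "0 \<le> D" and j: "1 \<le> j"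
  shows "AE x in lborel. 0 < x \<longrightarrow> exp (\<eta> / 2) * x < 1 \<longrightarrow> coll_claim L \<Omega> W \<eta> e D (Suc j) x \<longrightarrow>
    coll_claim L \<Omega> W \<eta> (Suc e) (D + 5) j x"
proof -
  define b where "b = real (card \<Omega>)"
  have b: "1 \<le> b" using \<Omega> by (simp add: b_def Suc_leI card_gt_0_iff)
  define \<Theta> where "\<Theta> M = wt L ` {ts. set ts \<subseteq> \<Omega> \<and> length ts = M}" for M
  define A where "A M = {x. 0 < x \<and> exp (\<eta> / 2) * x < 1
    \<and> (\<forall>ts. set ts \<subseteq> \<Omega> \<longrightarrow> length ts = M \<longrightarrow>
        coll L ts (Suc j) x ((exp \<eta> * x) ^ (L * M)) \<le> b ^ (e * M) * (exp ((D + 1) * \<eta>) * x) ^ (L * M) * W ^ (2 * M))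
    \<and> (exp (\<eta> / 2) * x) ^ (L * M) * (2 * (1 + real (L * M)) ^ j * jet_bound j (exp (\<eta> / 2) * x)) \<le> (exp \<eta> * x) ^ (L * M) / 4}" for M
  define P where "P M x \<longleftrightarrow> (\<exists>C. \<forall>m \<theta>s. set \<theta>s \<subseteq> \<Theta> M \<longrightarrow> length \<theta>s = m \<longrightarrow>
    coll (L * M) \<theta>s j x ((exp \<eta> * x) ^ (L * M * m))
      \<le> C * ((b ^ M * b ^ (e * M)) ^ m * (exp ((D + 1 + 4) * \<eta>) * x) ^ (L * M * m) * (W ^ M) ^ (2 * m)))" for M x
  have "AE x in lborel. x \<in> A M \<longrightarrow> P M x" if M: "1 \<le> M" for M
    unfolding P_def
  proof (rule AE_of_local, rule local_step[where k = j])
    fix y assume y: "y \<in> A M"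
    show "finite (\<Theta> M)" unfolding \<Theta>_def by (intro finite_imageI finite_lists_length_eq \<Omega>)
    have "card (\<Theta> M) \<le> card {ts. set ts \<subseteq> \<Omega> \<and> length ts = M}"
      unfolding \<Theta>_def by (intro card_image_le finite_lists_length_eq \<Omega>)
    then have "real (card (\<Theta> M)) \<le> real (card {ts. set ts \<subseteq> \<Omega> \<and> length ts = M})" by simp
    then show "real (card (\<Theta> M)) \<le> b ^ M"
      by (simp add: card_lists_length_eq \<Omega> b_def)
    show "0 \<le> \<theta> w" if "\<theta> \<in> \<Theta> M" for \<theta> w
      using that \<Omega>(3) by (auto simp: \<Theta>_def intro!: wt_nonneg)
    show "(\<Sum>w\<in>words (L * M). \<theta> w) \<le> W ^ M" if \<theta>: "\<theta> \<in> \<Theta> M" for \<theta>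
    proof -
      obtain ts where ts: "set ts \<subseteq> \<Omega>" "length ts = M" "\<theta> = wt L ts" using \<theta> by (auto simp: \<Theta>_def)
      have "wsum L ts (\<lambda>_. 1) \<le> W ^ length ts"
        using ts \<Omega> W by (intro wsum_mass_le) auto
      then show ?thesis using ts by (simp add: wsum_def)
    qed
    show "coll (L * M) [\<theta>] (Suc j) y ((exp \<eta> * y) ^ (L * M))
        \<le> b ^ (e * M) * (exp ((D + 1) * \<eta>) * y) ^ (L * M) * (W ^ M)\<^sup>2" if \<theta>: "\<theta> \<in> \<Theta> M" for \<theta>
    proof -
      obtain ts where ts: "set ts \<subseteq> \<Omega>" "length ts = M" "\<theta> = wt L ts" using \<theta> by (auto simp: \<Theta>_def)
      have "coll (L * M) [\<theta>] (Suc j) y ((exp \<eta> * y) ^ (L * M)) = coll L ts (Suc j) y ((exp \<eta> * y) ^ (L * M))"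
        using coll_concat[of "[ts]" M L] ts by simp
      then show ?thesis using y ts by (simp add: A_def power_mult[symmetric] mult.commute)
    qed
  qed (use b W L M \<eta> D j in \<open>auto simp: A_def one_le_power\<close>)
  then have "AE x in lborel. \<forall>M\<in>{1..}. x \<in> A M \<longrightarrow> P M x"
    by (intro AE_ball_countable' countable_subset[OF _ countableI_type]) auto
  then show ?thesis
  proof eventually_elim
    case (elim x)
    show ?case
    proof (intro impI)
      assume x: "0 < x" "exp (\<eta> / 2) * x < 1" and cl: "coll_claim L \<Omega> W \<eta> e D (Suc j) x"
      obtain M0 C where M0: "1 \<le> M0" and C: "\<And>m ts. set ts \<subseteq> \<Omega> \<Longrightarrow> length ts = M0 * m \<Longrightarrow>
        coll L ts (Suc j) x ((exp \<eta> * x) ^ (L * M0 * m)) \<le> C * (b ^ (e * M0 * m) * (exp (D * \<eta>) * x) ^ (L * M0 * m) * W ^ (2 * M0 * m))"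
        using cl unfolding coll_claim_def b_def by blast
      have "eventually (\<lambda>n. (1 + real n) ^ 0 * C \<le> exp (\<eta> * real n)) sequentially"
        using \<eta> by (rule eventually_poly_le_exp)
      moreover have "eventually (\<lambda>n. (1 + real n) ^ j * (8 * jet_bound j (exp (\<eta> / 2) * x)) \<le> exp (\<eta> / 2 * real n)) sequentially"
        using \<eta> by (intro eventually_poly_le_exp) simp
      ultimately have "eventually (\<lambda>n. C \<le> exp (\<eta> * real n)
          \<and> (1 + real n) ^ j * (8 * jet_bound j (exp (\<eta> / 2) * x)) \<le> exp (\<eta> / 2 * real n)) sequentially"
        by eventually_elim simp
      then obtain n0 where n0: "\<And>n. n0 \<le> n \<Longrightarrow> C \<le> exp (\<eta> * real n)"
        "\<And>n. n0 \<le> n \<Longrightarrow> (1 + real n) ^ j * (8 * jet_bound j (exp (\<eta> / 2) * x)) \<le> exp (\<eta> / 2 * real n)"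
        by (auto simp: eventually_sequentially)
      define M where "M = M0 * (n0 + 1)"
      have "n0 \<le> 1 * (1 * (n0 + 1))" by simp
      also have "\<dots> \<le> L * M" unfolding M_def using L M0 by (intro mult_le_mono) auto
      finally have big: "n0 \<le> L * M" .
      have M: "1 \<le> M" using M0 by (simp add: M_def)
      have "x \<in> A M"
        unfolding A_def
      proof (intro CollectI conjI allI impI x)
        fix ts assume ts: "set ts \<subseteq> \<Omega>" "length ts = M"
        have "coll L ts (Suc j) x ((exp \<eta> * x) ^ (L * M)) \<le> C * (b ^ (e * M) * (exp (D * \<eta>) * x) ^ (L * M) * W ^ (2 * M))"
          using C[of ts "n0 + 1"] ts unfolding M_def by (simp only: mult.assoc)
        also have "\<dots> \<le> exp (\<eta> * real (L * M)) * (b ^ (e * M) * (exp (D * \<eta>) * x) ^ (L * M) * W ^ (2 * M))"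
          using n0(1)[OF big] b x W by (intro mult_right_mono) auto
        also have "exp (\<eta> * real (L * M)) = exp \<eta> ^ (L * M)"
          by (simp add: exp_of_nat_mult[symmetric] mult.commute)
        also have "exp \<eta> ^ (L * M) * (b ^ (e * M) * (exp (D * \<eta>) * x) ^ (L * M) * W ^ (2 * M))
            = b ^ (e * M) * ((exp (D * \<eta>) * exp \<eta>) * x) ^ (L * M) * W ^ (2 * M)"
          by (simp only: power_mult_distrib mult_ac)
        also have "exp (D * \<eta>) * exp \<eta> = exp ((D + 1) * \<eta>)"
          by (simp add: exp_add[symmetric] algebra_simps)
        finally show "coll L ts (Suc j) x ((exp \<eta> * x) ^ (L * M)) \<le> b ^ (e * M) * (exp ((D + 1) * \<eta>) * x) ^ (L * M) * W ^ (2 * M)" .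
      next
        let ?J = "jet_bound j (exp (\<eta> / 2) * x)"
        have "(exp (\<eta> / 2) * x) ^ (L * M) * ((1 + real (L * M)) ^ j * (8 * ?J)) \<le> (exp (\<eta> / 2) * x) ^ (L * M) * exp (\<eta> / 2 * real (L * M))"
          using n0(2)[OF big] x by (intro mult_left_mono) auto
        also have "exp (\<eta> / 2 * real (L * M)) = exp (\<eta> / 2) ^ (L * M)"
          by (simp add: exp_of_nat_mult[symmetric] mult.commute)
        also have "(exp (\<eta> / 2) * x) ^ (L * M) * exp (\<eta> / 2) ^ (L * M) = ((exp (\<eta> / 2) * exp (\<eta> / 2)) * x) ^ (L * M)"
          by (simp only: power_mult_distrib mult_ac)
        also have "exp (\<eta> / 2) * exp (\<eta> / 2) = exp \<eta>" by (simp add: exp_add[symmetric])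
        finally show "(exp (\<eta> / 2) * x) ^ (L * M) * (2 * (1 + real (L * M)) ^ j * ?J) \<le> (exp \<eta> * x) ^ (L * M) / 4"
          by (simp add: mult_ac)
      qed
      then obtain C' where C': "\<And>m \<theta>s. set \<theta>s \<subseteq> \<Theta> M \<Longrightarrow> length \<theta>s = m \<Longrightarrow> coll (L * M) \<theta>s j x ((exp \<eta> * x) ^ (L * M * m))
          \<le> C' * ((b ^ M * b ^ (e * M)) ^ m * (exp ((D + 1 + 4) * \<eta>) * x) ^ (L * M * m) * (W ^ M) ^ (2 * m))"
      proof -
        have "P M x" using elim M \<open>x \<in> A M\<close> by simp
        then show ?thesis using that unfolding P_def by blast
      qed
      show "coll_claim L \<Omega> W \<eta> (Suc e) (D + 5) j x"
        unfolding coll_claim_def b_def[symmetric]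
      proof (intro exI[of _ M] conjI M exI[of _ C'] allI impI)
        fix m ts assume ts: "set ts \<subseteq> \<Omega>" "length ts = M * m"
        obtain tss where tss: "ts = concat tss" "length tss = m" "\<forall>us\<in>set tss. set us \<subseteq> \<Omega> \<and> length us = M"
          using ex_concat[OF ts] by blast
        have "coll L ts j x ((exp \<eta> * x) ^ (L * M * m)) = coll (L * M) (map (wt L) tss) j x ((exp \<eta> * x) ^ (L * M * m))"
          unfolding tss(1) using tss by (intro coll_concat) auto
        also have "\<dots> \<le> C' * ((b ^ M * b ^ (e * M)) ^ m * (exp ((D + 1 + 4) * \<eta>) * x) ^ (L * M * m) * (W ^ M) ^ (2 * m))"
          using tss by (intro C') (auto simp: \<Theta>_def)
        also have "\<dots> = C' * (b ^ (Suc e * M * m) * (exp ((D + 5) * \<eta>) * x) ^ (L * M * m) * W ^ (2 * M * m))"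
          by (simp add: power_add[symmetric] power_mult[symmetric] algebra_simps)
        finally show "coll L ts j x ((exp \<eta> * x) ^ (L * M * m))
          \<le> C' * (b ^ (Suc e * M * m) * (exp ((D + 5) * \<eta>) * x) ^ (L * M * m) * W ^ (2 * M * m))" .
      qed
    qed
  qed
qed

text \<open>Finitely many functions for each \<open>L\<close>, so an exceptional null set of
  parameters can be discarded for all of them in advance. The counting weights of the walk depend on
  the parameter but always belong to this set. The value 0 off \<open>words L\<close> makes the set
  finite.\<close>

definition dyadic_weights :: "nat \<Rightarrow> (bool list \<Rightarrow> real) set" where
  "dyadic_weights L = {\<omega>. \<forall>w. (w \<in> words L \<longrightarrow> \<omega> w \<in> (\<lambda>c. real c / 2 ^ L) ` {..2 ^ L}) \<and> (w \<notin> words L \<longrightarrow> \<omega> w = 0)}"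

lemma finite_dyadic_weights [simp]: "finite (dyadic_weights L)"
  unfolding dyadic_weights_def by (intro finite_set_of_finite_funs) auto

lemma dyadic_weights_bounds:
  assumes "\<omega> \<in> dyadic_weights L"
  shows "0 \<le> \<omega> w \<and> \<omega> w \<le> 1"
proof (cases "w \<in> words L")
  case True
  then obtain c :: nat where c: "c \<le> 2 ^ L" "\<omega> w = real c / 2 ^ L"
    using assms by (auto simp: dyadic_weights_def)
  then have "real c \<le> real (2 ^ L)" by (simp only: of_nat_le_iff)
  then show ?thesis using c by simp
qed (use assms in \<open>simp add: dyadic_weights_def\<close>)

text \<open>Only countably many data are quantified: \<open>L\<close>, an integer mass bound
  \<open>W\<close>, a slack \<open>1 / (i + 1)\<close> and a set of dyadic weights, so one null set
  serves all. The constants \<open>e\<close> and \<open>D\<close> come before these data, which may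
  therefore be chosen in terms of \<open>e\<close> and \<open>D\<close>. Order 1 means that no
  derivatives are left, only values of the polynomials.\<close>

definition collision_regular :: "real \<Rightarrow> nat \<Rightarrow> real \<Rightarrow> bool" where
  "collision_regular x e D \<longleftrightarrow> (\<forall>L\<ge>1. \<forall>W :: nat. \<forall>i :: nat. \<forall>\<Omega>\<subseteq>dyadic_weights L.
     \<Omega> \<noteq> {} \<longrightarrow> (\<forall>\<omega>\<in>\<Omega>. (\<Sum>w\<in>words L. \<omega> w) \<le> real W) \<longrightarrow> 1 \<le> real W * x ^ L \<longrightarrow>
     exp (1 / real (i + 1)) * x < 1 \<longrightarrow> coll_claim L \<Omega> (real W) (1 / real (i + 1)) e D 1 x)"

text \<open>On a compact subinterval of (0,1) \<open>jets_separate\<close> provides one order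
  \<open>k\<close>. \<open>coll_claim_base\<close> starts there with \<open>D = 2\<close>, and
  \<open>k - 1\<close> descents lead to order 1, each adding 1 to \<open>e\<close> and 5 to
  \<open>D\<close>.\<close>

theorem AE_collision_regular:
  "AE x in lborel. 0 < x \<longrightarrow> x < 1 \<longrightarrow> (\<exists>e D. 0 \<le> D \<and> collision_regular x e D)"
proof -
  define d :: "nat \<Rightarrow> real" where "d i = 1 / real (i + 1)" for i
  have d: "0 < d i" for i by (simp add: d_def)
  have "AE x in lborel. x \<in> {1 / real (p + 2)..1 - 1 / real (p + 2)} \<longrightarrow> (\<exists>e D. 0 \<le> D \<and> collision_regular x e D)" for p :: nat
  proof -
    define I where "I = {1 / real (p + 2)..1 - 1 / real (p + 2)}"
    have "1 / real (p + 2) \<le> 1 - 1 / real (p + 2)" by (simp add: field_simps)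
    then have "\<exists>k c. 0 < c \<and> 1 \<le> k \<and> (\<forall>x\<in>I. \<forall>u v. length u = length v \<longrightarrow> u \<noteq> [] \<longrightarrow> u ! 0 \<noteq> v ! 0 \<longrightarrow>
        (\<exists>l<k. c \<le> \<bar>jet l u x - jet l v x\<bar>))"
      unfolding I_def by (intro jets_separate) auto
    then obtain k c where c: "0 < c" "1 \<le> k"
      and sep: "\<And>x u v. x \<in> I \<Longrightarrow> length u = length v \<Longrightarrow> u \<noteq> [] \<Longrightarrow> u ! 0 \<noteq> v ! 0 \<Longrightarrow> \<exists>l<k. c \<le> \<bar>jet l u x - jet l v x\<bar>"
      by blast
    have I: "0 < x \<and> x < 1" if "x \<in> I" for x
    proof -
      have "0 < 1 / real (p + 2)" by simp
      then show ?thesis using that unfolding I_def atLeastAtMost_iff by linarith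
    qed
    have claim: "AE x in lborel. x \<in> I \<longrightarrow> \<Omega> \<noteq> {} \<longrightarrow> (\<forall>\<omega>\<in>\<Omega>. (\<Sum>w\<in>words L. \<omega> w) \<le> real W) \<longrightarrow> 1 \<le> real W * x ^ L \<longrightarrow>
      exp (d i) * x < 1 \<longrightarrow> coll_claim L \<Omega> (real W) (d i) n (2 + 5 * real n) (k - n) x"
      if L: "1 \<le> L" and \<Omega>: "\<Omega> \<subseteq> dyadic_weights L" and n: "n \<le> k - 1" for L W i \<Omega> n
      using n
    proof (induction n)
      case 0
      have bd: "0 \<le> \<omega> w \<and> \<omega> w \<le> 1" if "\<omega> \<in> \<Omega>" for \<omega> w using \<Omega> dyadic_weights_bounds that by auto
      have "coll_claim L \<Omega> (real W) (d i) 0 2 k x"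
        if "x \<in> I" "\<forall>\<omega>\<in>\<Omega>. (\<Sum>w\<in>words L. \<omega> w) \<le> real W" "1 \<le> real W * x ^ L" for x
      proof (rule coll_claim_base[where c = c])
        show "\<exists>l<k. c \<le> \<bar>jet l u x - jet l v x\<bar>" if "length u = length v" "u \<noteq> []" "u ! 0 \<noteq> v ! 0" for u v
          using sep[OF \<open>x \<in> I\<close>] that by blast
        show "0 \<le> \<omega> w \<and> \<omega> w \<le> 1" if "\<omega> \<in> \<Omega>" for \<omega> w using bd[OF that] .
      qed (use that(2,3) I[OF that(1)] L c d in auto)
      moreover have "2 + 5 * real 0 = 2" "k - 0 = k" by simp_all
      ultimately show ?case by (intro AE_I2 impI) (simp only:)
    next
      case (Suc n)
      show ?case
      proof (cases "\<Omega> \<noteq> {} \<and> (\<forall>\<omega>\<in>\<Omega>. (\<Sum>w\<in>words L. \<omega> w) \<le> real W) \<and> 1 \<le> W")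
        case True
        have "AE x in lborel. 0 < x \<longrightarrow> exp ((d i) / 2) * x < 1 \<longrightarrow>
            coll_claim L \<Omega> (real W) (d i) n (2 + 5 * real n) (Suc (k - Suc n)) x \<longrightarrow>
            coll_claim L \<Omega> (real W) (d i) (Suc n) (2 + 5 * real n + 5) (k - Suc n) x"
        proof (rule coll_claim_step)
          show "finite \<Omega>" using finite_subset[OF \<Omega>] by simp
          show "0 \<le> \<omega> w" if "\<omega> \<in> \<Omega>" for \<omega> w using \<Omega> dyadic_weights_bounds that by auto
          show "(\<Sum>w\<in>words L. \<omega> w) \<le> real W" if "\<omega> \<in> \<Omega>" for \<omega> using True that by blast
          show "1 \<le> k - Suc n" using Suc.prems by linarith
          show "1 \<le> real W" using True by simp
          show "\<Omega> \<noteq> {}" using True by blast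
        qed (use L d in simp_all)
        with Suc.IH[OF Suc_leD[OF Suc.prems]] show ?thesis
        proof eventually_elim
          case (elim x)
          have "exp ((d i) / 2) * x < 1" if "exp (d i) * x < 1" "x \<in> I"
          proof -
            have "exp ((d i) / 2) * x \<le> exp (d i) * x"
              using d[of i] I[OF that(2)] by (intro mult_right_mono) auto
            then show ?thesis using that by linarith
          qed
          moreover have "Suc (k - Suc n) = k - n" using Suc.prems by simp
          moreover have "2 + 5 * real n + 5 = 2 + 5 * real (Suc n)" by simp
          ultimately show ?case using elim I[of x] by (simp only:) blast
        qed
      next
        case False
        have "1 \<le> W" if "1 \<le> real W * x ^ L" for x :: real using that by (cases W) auto
        then show ?thesis by (intro AE_I2) (use False in blast)
      qed
    qed
    have "AE x in lborel. \<forall>L W i. \<forall>\<Omega>\<in>Pow (dyadic_weights L). 1 \<le> L \<longrightarrow> x \<in> I \<longrightarrow> \<Omega> \<noteq> {} \<longrightarrow>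
      (\<forall>\<omega>\<in>\<Omega>. (\<Sum>w\<in>words L. \<omega> w) \<le> real W) \<longrightarrow> 1 \<le> real W * x ^ L \<longrightarrow>
      exp (d i) * x < 1 \<longrightarrow> coll_claim L \<Omega> (real W) (d i) (k - 1) (2 + 5 * real (k - 1)) (k - (k - 1)) x"
      unfolding AE_all_countable
    proof (intro allI AE_finite_allI)
      fix L W i \<Omega> assume "\<Omega> \<in> Pow (dyadic_weights L)"
      then show "AE x in lborel. 1 \<le> L \<longrightarrow> x \<in> I \<longrightarrow> \<Omega> \<noteq> {} \<longrightarrow>
        (\<forall>\<omega>\<in>\<Omega>. (\<Sum>w\<in>words L. \<omega> w) \<le> real W) \<longrightarrow> 1 \<le> real W * x ^ L \<longrightarrow>
        exp (d i) * x < 1 \<longrightarrow> coll_claim L \<Omega> (real W) (d i) (k - 1) (2 + 5 * real (k - 1)) (k - (k - 1)) x"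
      proof (cases "1 \<le> L")
        case True
        have "\<Omega> \<subseteq> dyadic_weights L" using \<open>\<Omega> \<in> Pow _\<close> by blast
        from claim[OF True this le_refl, of W i] show ?thesis by eventually_elim (rule impI)
      qed simp
    qed simp
    then show ?thesis
      unfolding I_def[symmetric]
    proof eventually_elim
      case (elim x)
      have "k - (k - 1) = 1" using c by simp
      show ?case
      proof (intro impI exI[of _ "k - 1"] exI[of _ "2 + 5 * real (k - 1)"] conjI)
        assume "x \<in> I"
        then show "collision_regular x (k - 1) (2 + 5 * real (k - 1))"
          unfolding collision_regular_def
        proof (intro allI impI)
          fix L W i \<Omega>
          assume a: "1 \<le> L" "\<Omega> \<subseteq> dyadic_weights L" "\<Omega> \<noteq> {}" "\<forall>\<omega>\<in>\<Omega>. (\<Sum>w\<in>words L. \<omega> w) \<le> real W"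
            "1 \<le> real W * x ^ L" "exp (1 / real (i + 1)) * x < 1"
          have "\<Omega> \<in> Pow (dyadic_weights L)" using a(2) by (rule PowI)
          from elim[THEN spec, THEN spec, THEN spec, THEN bspec, OF this, THEN mp, THEN mp, THEN mp, THEN mp, THEN mp, THEN mp,
              OF a(1) \<open>x \<in> I\<close> a(3-5) a(6)[folded d_def]]
          show "coll_claim L \<Omega> (real W) (1 / real (i + 1)) (k - 1) (2 + 5 * real (k - 1)) 1 x"
            unfolding \<open>k - (k - 1) = 1\<close> d_def .
        qed
      qed simp
    qed
  qed
  then have "AE x in lborel. \<forall>p :: nat. x \<in> {1 / real (p + 2)..1 - 1 / real (p + 2)} \<longrightarrow> (\<exists>e D. 0 \<le> D \<and> collision_regular x e D)"
    unfolding AE_all_countable by (rule allI)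
  then show ?thesis
  proof eventually_elim
    case (elim x)
    show ?case
    proof (intro impI)
      assume x: "0 < x" "x < 1"
      obtain p where p: "1 / real (Suc p) < min x (1 - x)"
      proof -
        have "0 < min x (1 - x)" using x by simp
        then show ?thesis using that reals_Archimedean unfolding inverse_eq_divide by blast
      qed
      have "1 / real (p + 2) \<le> 1 / real (Suc p)" by (simp add: frac_le)
      then have "x \<in> {1 / real (p + 2)..1 - 1 / real (p + 2)}"
        using p unfolding atLeastAtMost_iff min_less_iff_conj by linarith
      then show "\<exists>e D. 0 \<le> D \<and> collision_regular x e D" using elim by blast
    qed
  qed
qed

section \<open>The Haar kernel\<close>

text \<open>The autocorrelation of a box of width \<open>r\<close> and height \<open>1 / r\<close>,
  see \<open>integral_box_product\<close>.\<close>

definition tri :: "real \<Rightarrow> real \<Rightarrow> real" where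
  "tri r z = max 0 (r - \<bar>z\<bar>) / r\<^sup>2"

text \<open>The autocorrelation of the Haar wavelet \<open>hbox\<close>, see
  \<open>integral_hbox_product\<close>. It is positive definite, which allows cross terms to be
  dropped, and has integral 0, which is the source of the gain when averaging over slopes.\<close>

definition haar :: "real \<Rightarrow> real \<Rightarrow> real" where
  "haar r z = tri r z - tri (2 * r) z"

lemma tri_nonneg: "0 \<le> tri r z"
  by (simp add: tri_def)

lemma tri_le: "0 < r \<Longrightarrow> tri r z \<le> 1 / r"
  by (simp add: tri_def power2_eq_square max_def field_simps)

lemma tri_eq_0: "0 < r \<Longrightarrow> r \<le> \<bar>z\<bar> \<Longrightarrow> tri r z = 0"
  by (simp add: tri_def)

lemma tri_ge: "0 < r \<Longrightarrow> \<bar>z\<bar> \<le> r / 2 \<Longrightarrow> 1 / (2 * r) \<le> tri r z"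
  by (simp add: tri_def power2_eq_square max_def field_simps)

lemma tri_scale: "0 < g \<Longrightarrow> tri r (g * z) = tri (r / g) z / g"
proof -
  assume g: "0 < g"
  have "max 0 (r - \<bar>g * z\<bar>) = g * max 0 (r / g - \<bar>z\<bar>)"
    using g by (simp add: max_def abs_mult field_simps)
  then show ?thesis using g by (simp add: tri_def power2_eq_square field_simps)
qed

lemma tri_lipschitz: "0 < r \<Longrightarrow> \<bar>tri r z - tri r z'\<bar> \<le> \<bar>z - z'\<bar> / r\<^sup>2"
  unfolding tri_def diff_divide_distrib[symmetric] abs_divide abs_power2
  by (intro divide_right_mono) (linarith, simp)

lemma haar_bound: "0 < r \<Longrightarrow> \<bar>haar r z\<bar> \<le> 1 / r"
proof -
  assume r: "0 < r"
  have "tri (2 * r) z \<le> 1 / (2 * r)" "1 / (2 * r) \<le> 1 / r" using tri_le[of "2 * r" z] r by (auto simp: field_simps)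
  then show ?thesis using tri_le[OF r, of z] tri_nonneg[of r z] tri_nonneg[of "2 * r" z] unfolding haar_def by linarith
qed

lemma haar_eq_0: "0 < r \<Longrightarrow> 2 * r \<le> \<bar>z\<bar> \<Longrightarrow> haar r z = 0"
  by (simp add: haar_def tri_eq_0)

lemma haar_scale: "0 < g \<Longrightarrow> haar r (g * z) = haar (r / g) z / g"
  by (simp add: haar_def tri_scale diff_divide_distrib)

lemma haar_lipschitz: "0 < r \<Longrightarrow> \<bar>haar r z - haar r z'\<bar> \<le> 2 * \<bar>z - z'\<bar> / r\<^sup>2"
proof -
  assume r: "0 < r"
  have "\<bar>z - z'\<bar> / (2 * r)\<^sup>2 \<le> \<bar>z - z'\<bar> / r\<^sup>2"
    using r by (intro divide_left_mono power_mono) auto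
  then show ?thesis
    using tri_lipschitz[OF r, of z z'] tri_lipschitz[of "2 * r" z z'] r unfolding haar_def by linarith
qed

text \<open>A box of width \<open>2 * r\<close> is the mean of two adjacent boxes of width
  \<open>r\<close>; the formula is this relation for autocorrelations.\<close>

lemma tri_refine:
  assumes r: "0 < r"
  shows "tri (2 * r) z = tri r z / 2 + (tri r (z - r) + tri r (z + r)) / 4"
proof -
  have pos: "max 0 (2 * r - z) = 2 * max 0 (r - z) + max 0 (r - \<bar>z - r\<bar>)" if "0 \<le> z" for z
    using that r by (cases "z \<le> r"; cases "z \<le> 2 * r") simp_all
  have "max 0 (2 * r - \<bar>z\<bar>) = 2 * max 0 (r - \<bar>z\<bar>) + (max 0 (r - \<bar>z - r\<bar>) + max 0 (r - \<bar>z + r\<bar>))"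
  proof (cases "0 \<le> z")
    case True
    then show ?thesis using pos[OF True] r by simp
  next
    case False
    then have "\<bar>- z - r\<bar> = \<bar>z + r\<bar>" "\<bar>z - r\<bar> = r - z" "\<bar>z\<bar> = - z" using r by auto
    then show ?thesis using pos[of "- z"] False r by simp
  qed
  then show ?thesis
    using r unfolding tri_def by (simp add: power2_eq_square field_simps)
qed

definition box :: "real \<Rightarrow> real \<Rightarrow> real \<Rightarrow> real" where
  "box r x s = indicator {x - r<..x} s / r"

lemma emeasure_Ioc_finite [simp]: "emeasure lborel {a<..b::real} < \<top>"
  by (cases "a \<le> b") simp_all

lemma measure_lborel_Ioc: "measure lborel {a<..b::real} = max 0 (b - a)"
  by (cases "a \<le> b") (simp_all add: measure_def max_def)

lemma box_product: "0 < r \<Longrightarrow> box r x s * box r y s = indicator {max x y - r<..min x y} s / r\<^sup>2"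
  by (auto simp: box_def indicator_def power2_eq_square)

lemma integrable_box_product: "0 < r \<Longrightarrow> integrable lborel (\<lambda>s. box r x s * box r y s)"
  unfolding box_product by (intro integrable_divide_zero integrable_real_indicator impI) simp_all

lemma integral_box_product:
  assumes "0 < r"
  shows "(\<integral>s. box r x s * box r y s \<partial>lborel) = tri r (x - y)"
proof -
  have "measure lborel {max x y - r<..min x y} = max 0 (r - \<bar>x - y\<bar>)"
    unfolding measure_lborel_Ioc by (simp add: max_def min_def abs_if)
  then show ?thesis unfolding box_product[OF assms] tri_def by simp
qed

definition hbox :: "real \<Rightarrow> real \<Rightarrow> real \<Rightarrow> real" where
  "hbox r x s = (box r x s - box r (x + r) s) / 2"

lemma integrable_hbox_product: "0 < r \<Longrightarrow> integrable lborel (\<lambda>s. hbox r x s * hbox r y s)"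
  unfolding hbox_def by (simp add: algebra_simps integrable_box_product)

lemma integral_hbox_product:
  assumes "0 < r"
  shows "(\<integral>s. hbox r x s * hbox r y s \<partial>lborel) = haar r (x - y)"
proof -
  have "(\<integral>s. hbox r x s * hbox r y s \<partial>lborel)
      = (\<integral>s. (box r x s * box r y s - box r x s * box r (y + r) s - box r (x + r) s * box r y s
          + box r (x + r) s * box r (y + r) s) / 4 \<partial>lborel)"
    by (intro Bochner_Integration.integral_cong refl) (simp add: hbox_def algebra_simps)
  also have "\<dots> = (tri r (x - y) - tri r (x - (y + r)) - tri r (x + r - y) + tri r (x + r - (y + r))) / 4"
    by (simp add: integral_box_product integrable_box_product assms)
  also have "x - (y + r) = x - y - r" by simp
  also have "x + r - y = x - y + r" by simp
  also have "x + r - (y + r) = x - y" by simp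
  also have "(tri r (x - y) - tri r (x - y - r) - tri r (x - y + r) + tri r (x - y)) / 4
      = tri r (x - y) / 2 - (tri r (x - y - r) + tri r (x - y + r)) / 4"
    by (simp add: field_simps)
  also have "\<dots> = haar r (x - y)"
    using tri_refine[OF assms, of "x - y"] by (simp add: haar_def)
  finally show ?thesis .
qed

lemma haar_kernel_eq:
  assumes "0 < r"
  shows "(\<Sum>i\<in>I. \<Sum>j\<in>J. p i * q j * haar r (x i - y j))
    = (\<integral>s. (\<Sum>i\<in>I. p i * hbox r (x i) s) * (\<Sum>j\<in>J. q j * hbox r (y j) s) \<partial>lborel)"
    and "integrable lborel (\<lambda>s. (\<Sum>i\<in>I. p i * hbox r (x i) s) * (\<Sum>j\<in>J. q j * hbox r (y j) s))"
proof -
  have *: "(\<Sum>i\<in>I. p i * hbox r (x i) s) * (\<Sum>j\<in>J. q j * hbox r (y j) s)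
      = (\<Sum>i\<in>I. \<Sum>j\<in>J. p i * q j * (hbox r (x i) s * hbox r (y j) s))" for s
    by (simp add: sum_product mult_ac)
  show "integrable lborel (\<lambda>s. (\<Sum>i\<in>I. p i * hbox r (x i) s) * (\<Sum>j\<in>J. q j * hbox r (y j) s))"
    unfolding * by (intro Bochner_Integration.integrable_sum integrable_mult_right integrable_hbox_product assms)
  show "(\<Sum>i\<in>I. \<Sum>j\<in>J. p i * q j * haar r (x i - y j))
    = (\<integral>s. (\<Sum>i\<in>I. p i * hbox r (x i) s) * (\<Sum>j\<in>J. q j * hbox r (y j) s) \<partial>lborel)"
    unfolding * by (simp add: Bochner_Integration.integral_sum Bochner_Integration.integrable_sum integrable_mult_right
        integrable_hbox_product integral_hbox_product assms)
qed

lemma haar_kernel_nonneg: "0 < r \<Longrightarrow> 0 \<le> (\<Sum>i\<in>I. \<Sum>j\<in>I. p i * p j * haar r (x i - x j))"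
  unfolding haar_kernel_eq(1) by (intro Bochner_Integration.integral_nonneg) simp

text \<open>All three sums are integrals of products of superposed wavelets, so
  \<open>P * Q \<le> (P^2 + Q^2) / 2\<close> can be used pointwise.\<close>

lemma haar_kernel_le:
  assumes "0 < r"
  shows "(\<Sum>i\<in>I. \<Sum>j\<in>J. p i * q j * haar r (x i - y j))
    \<le> ((\<Sum>i\<in>I. \<Sum>j\<in>I. p i * p j * haar r (x i - x j)) + (\<Sum>i\<in>J. \<Sum>j\<in>J. q i * q j * haar r (y i - y j))) / 2"
proof -
  define P where "P s = (\<Sum>i\<in>I. p i * hbox r (x i) s)" for s
  define Q where "Q s = (\<Sum>j\<in>J. q j * hbox r (y j) s)" for s
  have int: "integrable lborel (\<lambda>s. P s * Q s)" "integrable lborel (\<lambda>s. P s * P s)" "integrable lborel (\<lambda>s. Q s * Q s)"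
    unfolding P_def Q_def by (intro haar_kernel_eq(2) assms)+
  have "(\<integral>s. P s * Q s \<partial>lborel) \<le> (\<integral>s. (P s * P s + Q s * Q s) / 2 \<partial>lborel)"
  proof (rule integral_mono)
    show "P s * Q s \<le> (P s * P s + Q s * Q s) / 2" for s
      using sum_squares_bound[of "P s" "Q s"] by (simp add: power2_eq_square)
  qed (use int in auto)
  also have "\<dots> = ((\<integral>s. P s * P s \<partial>lborel) + (\<integral>s. Q s * Q s \<partial>lborel)) / 2"
    using int by simp
  finally show ?thesis unfolding haar_kernel_eq(1)[OF assms] P_def Q_def .
qed

lemma borel_measurable_tri [measurable]: "(\<lambda>z. tri r z) \<in> borel_measurable borel"
  unfolding tri_def by measurable

lemma borel_measurable_haar [measurable]: "(\<lambda>z. haar r z) \<in> borel_measurable borel"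
  unfolding haar_def by measurable

lemma integrable_haar: "0 < r \<Longrightarrow> integrable lborel (haar r)"
proof (rule Bochner_Integration.integrable_bound)
  assume r: "0 < r"
  show "integrable lborel (\<lambda>z. indicator {- 2 * r..2 * r} z / r)"
    by (intro integrable_divide_zero integrable_real_indicator impI) (simp_all add: emeasure_lborel_Icc_eq)
  show "AE z in lborel. norm (haar r z) \<le> norm (indicator {- 2 * r..2 * r} z / r)"
  proof (intro AE_I2)
    fix z show "norm (haar r z) \<le> norm (indicator {- 2 * r..2 * r} z / r)"
    proof (cases "2 * r \<le> \<bar>z\<bar>")
      case False
      then have "z \<in> {- 2 * r..2 * r}" by auto
      then show ?thesis using haar_bound[OF r, of z] r by simp
    qed (simp add: haar_eq_0[OF r])
  qed
qed simp

lemma integral_haar: "0 < r \<Longrightarrow> (\<integral>z. haar r z \<partial>lborel) = 0"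
proof -
  assume r: "0 < r"
  have int: "integrable lborel (tri r)" if "0 < r" for r
  proof (rule Bochner_Integration.integrable_bound)
    show "integrable lborel (\<lambda>z. indicator {- r..r} z / r)"
      by (intro integrable_divide_zero integrable_real_indicator impI) (simp_all add: emeasure_lborel_Icc_eq)
    show "AE z in lborel. norm (tri r z) \<le> norm (indicator {- r..r} z / r)"
    proof (intro AE_I2)
      fix z show "norm (tri r z) \<le> norm (indicator {- r..r} z / r)"
      proof (cases "r \<le> \<bar>z\<bar>")
        case False
        then have "z \<in> {- r..r}" by auto
        then show ?thesis using tri_le[OF that, of z] tri_nonneg[of r z] that by simp
      qed (simp add: tri_eq_0[OF that])
    qed
  qed simp
  have "tri r (z / 2) = 2 * tri (2 * r) z" for z
    using tri_scale[of "1 / 2" r z] by (simp add: mult.commute)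
  then have "(\<integral>z. tri r z \<partial>lborel) = (\<integral>z. tri (2 * r) z \<partial>lborel)"
    using lborel_integral_real_affine[of "1 / 2" "tri r" 0] by simp
  then show ?thesis using int[of r] int[of "2 * r"] r unfolding haar_def by simp
qed

text \<open>A Lipschitz majorant of the indicator of \<open>[-C, C]\<close>, supported in
  \<open>[-2 * C, 2 * C]\<close>; the Lipschitz bound is what lets the vanishing integral of
  \<open>haar\<close> take effect.\<close>

definition tent :: "real \<Rightarrow> real \<Rightarrow> real" where
  "tent C c = max 0 (2 - \<bar>c\<bar> / C)"

lemma tent_props:
  assumes "0 < C"
  shows "0 \<le> tent C c" "tent C c \<le> 2" "\<bar>c\<bar> \<le> C \<Longrightarrow> 1 \<le> tent C c" "2 * C \<le> \<bar>c\<bar> \<Longrightarrow> tent C c = 0"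
    "\<bar>tent C c - tent C c'\<bar> \<le> \<bar>c - c'\<bar> / C"
proof -
  have "\<bar>c\<bar> / C - \<bar>c'\<bar> / C \<le> \<bar>c - c'\<bar> / C" "\<bar>c'\<bar> / C - \<bar>c\<bar> / C \<le> \<bar>c - c'\<bar> / C"
    using assms by (auto simp: diff_divide_distrib[symmetric] intro!: divide_right_mono)
  then show "\<bar>tent C c - tent C c'\<bar> \<le> \<bar>c - c'\<bar> / C"
    unfolding tent_def by linarith
qed (use assms in \<open>auto simp: tent_def field_simps\<close>)

lemma continuous_on_tent [continuous_intros]: "continuous_on A (tent C)"
  unfolding tent_def divide_inverse by (intro continuous_intros)

lemma borel_measurable_tent [measurable]: "tent C \<in> borel_measurable borel"
  by (intro borel_measurable_continuous_onI continuous_intros)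

text \<open>In the variable \<open>z = d + u * c\<close> the cutoff deviates from its value at
  \<open>z = 0\<close> by at most \<open>2 * r / (|u| * C)\<close> on the support of the kernel, and
  this value may be subtracted because \<open>haar\<close> has integral 0. Without the cancellation
  the bound would have no power of \<open>r\<close>.\<close>

lemma integral_tent_haar_le:
  assumes "0 < r" "0 < C" "u \<noteq> 0"
  shows "(\<integral>c. tent C c * haar r (d + u * c) \<partial>lborel) \<le> 8 * r / (C * u\<^sup>2)"
proof -
  define f where "f z = tent C ((z - d) / u) * haar r z" for z
  have f_meas: "f \<in> borel_measurable borel"
    unfolding f_def by (intro borel_measurable_times measurable_compose[OF _ borel_measurable_tent] borel_measurable_haar) measurable
  have "(\<integral>c. tent C c * haar r (d + u * c) \<partial>lborel) = (\<integral>c. f (d + u * c) \<partial>lborel)"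
    using assms by (simp add: f_def)
  also have "\<dots> = (\<integral>z. f z \<partial>lborel) / \<bar>u\<bar>"
    using lborel_integral_real_affine[of u f d] assms by simp
  finally have 1: "(\<integral>c. tent C c * haar r (d + u * c) \<partial>lborel) = (\<integral>z. f z \<partial>lborel) / \<bar>u\<bar>" .
  have "(\<integral>z. f z \<partial>lborel) = (\<integral>z. f z - tent C (- d / u) * haar r z \<partial>lborel)"
  proof -
    have "integrable lborel f"
    proof (rule Bochner_Integration.integrable_bound)
      show "integrable lborel (\<lambda>z. 2 * haar r z)" using integrable_haar[OF assms(1)] by simp
      show "AE z in lborel. norm (f z) \<le> norm (2 * haar r z)"
      proof (intro AE_I2)
        fix z
        have "\<bar>tent C ((z - d) / u)\<bar> \<le> 2"
          using tent_props(1,2)[OF assms(2), of "(z - d) / u"] by simp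
        then show "norm (f z) \<le> norm (2 * haar r z)"
          by (simp add: f_def abs_mult mult_right_mono)
      qed
    qed (use f_meas in simp)
    then show ?thesis using integrable_haar[OF assms(1)] integral_haar[OF assms(1)] by simp
  qed
  also have "\<dots> \<le> (\<integral>z. indicator {- 2 * r..2 * r} z * (2 * r / (\<bar>u\<bar> * C) * (1 / r)) \<partial>lborel)"
  proof (rule integral_mono')
    fix z
    show "f z - tent C (- d / u) * haar r z \<le> indicator {- 2 * r..2 * r} z * (2 * r / (\<bar>u\<bar> * C) * (1 / r))"
    proof (cases "\<bar>z\<bar> \<le> 2 * r")
      case True
      have "f z - tent C (- d / u) * haar r z = (tent C ((z - d) / u) - tent C (- d / u)) * haar r z"
        by (simp add: f_def algebra_simps)
      also have "\<dots> \<le> \<bar>tent C ((z - d) / u) - tent C (- d / u)\<bar> * \<bar>haar r z\<bar>"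
        by (metis abs_ge_self abs_mult)
      also have "\<dots> \<le> (\<bar>(z - d) / u - (- d / u)\<bar> / C) * (1 / r)"
        using assms by (intro mult_mono tent_props haar_bound) auto
      also have "\<dots> = \<bar>z\<bar> * (1 / (\<bar>u\<bar> * C) * (1 / r))"
        by (simp add: diff_divide_distrib)
      also have "\<dots> \<le> 2 * r * (1 / (\<bar>u\<bar> * C) * (1 / r))"
        using True assms by (intro mult_right_mono) auto
      finally show ?thesis using True by (simp add: indicator_def abs_le_iff)
    next
      case False
      then have "haar r z = 0" using assms by (intro haar_eq_0) auto
      then show ?thesis using assms by (simp add: f_def indicator_def)
    qed
  next
    show "integrable lborel (\<lambda>z. indicator {- 2 * r..2 * r} z * (2 * r / (\<bar>u\<bar> * C) * (1 / r)))"
      by (intro integrable_mult_left integrable_real_indicator) (simp_all add: emeasure_lborel_Icc_eq)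
    show "0 \<le> indicator {- 2 * r..2 * r} z * (2 * r / (\<bar>u\<bar> * C) * (1 / r))" for z
      using assms by (intro mult_nonneg_nonneg) auto
  qed
  also have "\<dots> = 4 * r * (2 * r / (\<bar>u\<bar> * C) * (1 / r))" using assms by simp
  finally have "(\<integral>z. f z \<partial>lborel) / \<bar>u\<bar> \<le> 4 * r * (2 * r / (\<bar>u\<bar> * C) * (1 / r)) / \<bar>u\<bar>"
    by (intro divide_right_mono) auto
  also have "\<dots> = 8 * r / (C * u\<^sup>2)"
    using assms by (simp add: power2_eq_square field_simps)
  finally show ?thesis unfolding 1 .
qed

section \<open>Energies of the walk\<close>

text \<open>\<open>g\<close> and \<open>k\<close> stand for \<gamma> and \<kappa>. \<open>a\<close>
  is the coefficient of the first chaos relative to the second, and 0 for the occupation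
  measure.\<close>

locale walk =
  fixes g k a :: real
  assumes g_gt: "1 / 2 < g" and g_lt: "g < 1" and gk: "2 * g * k = 1"
begin

lemma g_pos: "0 < g"
  using g_gt by simp

lemma k_pos: "0 < k"
  using gk g_pos by (metis mult_less_cancel_left_pos mult_zero_right zero_less_one mult_2 add_pos_pos)

lemma k_eq: "k = 1 / (2 * g)"
  using gk g_pos by (simp add: field_simps)

lemma k_lt: "k < 1"
  using g_gt by (simp add: k_eq field_simps)

lemma k_gt: "1 / 2 < k"
  using g_pos g_lt by (simp add: k_eq field_simps)

lemma abs_sg [simp]: "\<bar>sg b\<bar> = 1"
  by (simp add: sg_def)

text \<open>
  The partial sums of \<open>Y\<^sub>c\<close> are \<open>tv c w = tv 0 w + c * uv w\<close>, and \<open>uv w\<close> is a partial sum of a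
  variable uniform on \<open>[-1,1]\<close>.
\<close>

primrec slope :: "real \<Rightarrow> bool list \<Rightarrow> real" where
  "slope c [] = c"
| "slope c (b # w) = slope (k * c + sg b) w"

primrec tv :: "real \<Rightarrow> bool list \<Rightarrow> real" where
  "tv c [] = 0"
| "tv c (b # w) = sg b * (g * a + c / 2) + g * tv (k * c + sg b) w"

primrec uv :: "bool list \<Rightarrow> real" where
  "uv [] = 0"
| "uv (b # w) = (sg b + uv w) / 2"

lemma slope_append: "slope c (w @ v) = slope (slope c w) v"
  by (induction w arbitrary: c) simp_all

lemma slope_diff: "slope c w - slope c' w = k ^ length w * (c - c')"
proof (induction w arbitrary: c c')
  case (Cons b w)
  show ?case using Cons[of "k * c + sg b" "k * c' + sg b"] by (simp add: algebra_simps)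
qed simp

text \<open>The most recent sign carries the power 0 of \<open>k\<close>, so the slope is the sign
  polynomial of the reversed word; weights have to be reversed before collision bounds
  apply.\<close>

lemma slope_eq_jet: "slope c w = k ^ length w * c + jet 0 (rev w) k"
proof (induction w arbitrary: c)
  case (Cons b w)
  have "jet 0 (rev w @ [b]) k = jet 0 (rev w) k + k ^ length w * sg b"
    by (simp add: sjet_append) (simp add: sjet_def)
  then show ?case by (simp add: Cons algebra_simps)
qed (simp add: sjet_def)

text \<open>The maps \<open>c \<mapsto> k * c \<plusminus> 1\<close> have the fixed points
  \<open>\<plusminus> 1 / (1 - k)\<close>, so every symmetric interval containing these is
  invariant.\<close>

lemma abs_slope_le: "1 / (1 - k) \<le> C \<Longrightarrow> \<bar>c\<bar> \<le> C \<Longrightarrow> \<bar>slope c w\<bar> \<le> C"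
proof (induction w arbitrary: c)
  case (Cons b w)
  have "1 \<le> C * (1 - k)"
    using Cons.prems(1) k_lt by (simp add: pos_divide_le_eq)
  moreover have "\<bar>k * c + sg b\<bar> \<le> k * C + 1"
    using k_pos Cons.prems(2) abs_triangle_ineq[of "k * c" "sg b"] by (simp add: abs_mult) (smt (verit) mult_left_mono)
  ultimately have "\<bar>k * c + sg b\<bar> \<le> C" by (simp add: algebra_simps)
  then show ?case using Cons.IH[OF Cons.prems(1)] by simp
qed simp

lemma tv_append: "tv c (w @ v) = tv c w + g ^ length w * tv (slope c w) v"
  by (induction w arbitrary: c) (simp_all add: algebra_simps)

text \<open>The powers of \<open>k\<close> in the slopes and of \<open>g\<close> in the sum combine
  to powers of 1/2 because \<open>2 * g * k = 1\<close>; hence the dependence on the starting slope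
  is a dyadic sum.\<close>

lemma tv_diff: "tv c w - tv c' w = (c - c') * uv w"
proof (induction w arbitrary: c c')
  case (Cons b w)
  have "tv (k * c + sg b) w - tv (k * c' + sg b) w = k * (c - c') * uv w"
    by (simp add: Cons algebra_simps)
  then have "g * tv (k * c + sg b) w - g * tv (k * c' + sg b) w = g * (k * (c - c') * uv w)"
    by (metis right_diff_distrib)
  also have "\<dots> = (c - c') * uv w / 2"
    by (simp add: k_eq) (use g_pos in simp)
  finally show ?case by (simp add: field_simps)
qed simp

lemma uv_append: "uv (w @ v) = uv w + uv v / 2 ^ length w"
  by (induction w) (simp_all add: field_simps)

lemma abs_uv_le: "\<bar>uv w\<bar> \<le> 1 - 1 / 2 ^ length w"
proof (induction w)
  case (Cons b w)
  have "\<bar>sg b + uv w\<bar> \<le> 1 + \<bar>uv w\<bar>"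
    using abs_triangle_ineq[of "sg b" "uv w"] by simp
  also have "\<dots> \<le> 2 - 1 / 2 ^ length w" using Cons by simp
  finally have "\<bar>sg b + uv w\<bar> / 2 \<le> (2 - 1 / 2 ^ length w) / 2" by simp
  then show ?case by (simp add: diff_divide_distrib mult.commute)
qed simp

lemma abs_uv_le_1: "\<bar>uv w\<bar> \<le> 1"
proof -
  have "0 \<le> 1 / (2::real) ^ length w" by simp
  then show ?thesis using abs_uv_le[of w] by linarith
qed

lemma uv_separated: "length w = length v \<Longrightarrow> w \<noteq> v \<Longrightarrow> 2 / 2 ^ length w \<le> \<bar>uv w - uv v\<bar>"
proof (induction w v rule: list_induct2)
  case (Cons b w d v)
  show ?case
  proof (cases "b = d")
    case True
    then show ?thesis using Cons by (simp add: diff_divide_distrib[symmetric] field_simps)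
  next
    case False
    then have "\<bar>sg b - sg d\<bar> = 2" by (auto simp: sg_def)
    then have "2 - (\<bar>uv w\<bar> + \<bar>uv v\<bar>) \<le> \<bar>(sg b + uv w) - (sg d + uv v)\<bar>" by linarith
    then have "2 / 2 ^ length w \<le> \<bar>(sg b + uv w) - (sg d + uv v)\<bar>"
      using abs_uv_le[of w] abs_uv_le[of v] Cons.hyps by simp
    then have "2 / 2 ^ length w / 2 \<le> \<bar>(sg b + uv w) - (sg d + uv v)\<bar> / 2"
      by (intro divide_right_mono) auto
    then show ?thesis by (simp flip: diff_divide_distrib)
  qed
qed simp

lemma card_uv_near:
  assumes "u \<in> words n"
  shows "card {v \<in> words n. \<bar>uv u - uv v\<bar> < 4 / 2 ^ n} \<le> 4"
proof -
  define f where "f v = \<lfloor>(uv v - uv u) * 2 ^ n / 2\<rfloor>" for v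
  define A where "A = {v \<in> words n. \<bar>uv u - uv v\<bar> < 4 / 2 ^ n}"
  have "inj_on f A"
  proof (rule inj_onI, rule ccontr)
    fix v w assume *: "v \<in> A" "w \<in> A" "f v = f w" "v \<noteq> w"
    then have "2 / 2 ^ n \<le> \<bar>uv v - uv w\<bar>"
      using uv_separated[of v w] by (simp add: A_def words_def)
    moreover have "\<bar>(uv v - uv u) * 2 ^ n / 2 - (uv w - uv u) * 2 ^ n / 2\<bar> < 1"
      using *(3) unfolding f_def by linarith
    moreover have "(uv v - uv u) * 2 ^ n / 2 - (uv w - uv u) * 2 ^ n / 2 = (uv v - uv w) * (2 ^ n / 2)"
      by (simp add: field_simps)
    ultimately have "\<bar>(uv v - uv w) * (2 ^ n / 2)\<bar> < 1" "2 / 2 ^ n \<le> \<bar>uv v - uv w\<bar>" by simp_all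
    moreover from this(2) have "2 / 2 ^ n * (2 ^ n / 2) \<le> \<bar>uv v - uv w\<bar> * (2 ^ n / 2)"
      by (rule mult_right_mono) simp
    ultimately show False by (simp add: abs_mult)
  qed
  moreover have "f ` A \<subseteq> {- 2..1}"
  proof
    fix i assume "i \<in> f ` A"
    then obtain v where v: "\<bar>uv u - uv v\<bar> < 4 / 2 ^ n" "i = f v" by (auto simp: A_def)
    then have "\<bar>uv v - uv u\<bar> * (2 ^ n / 2) < 4 / 2 ^ n * (2 ^ n / 2)"
      by (intro mult_strict_right_mono) auto
    then have "\<bar>(uv v - uv u) * 2 ^ n / 2\<bar> < 2" by (simp add: abs_mult)
    then show "i \<in> {- 2..1}" unfolding v(2) f_def by (simp add: abs_less_iff)
  qed
  ultimately have "card A \<le> card {- 2..1::int}"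
    by (metis card_image card_mono finite_atLeastAtMost_int)
  then show ?thesis by (simp add: A_def)
qed

text \<open>The sum of a geometric series of ratio \<open>g\<close> whose terms come from
  \<open>g * |a| + C / 2\<close>, a bound for one step as long as slopes stay in
  \<open>[-C, C]\<close>.\<close>

definition Yb :: "real \<Rightarrow> real" where
  "Yb C = (g * \<bar>a\<bar> + C / 2) / (1 - g)"

lemma Yb_nonneg: "0 \<le> C \<Longrightarrow> 0 \<le> Yb C"
  using g_pos g_lt by (simp add: Yb_def)

lemma abs_tv_le: "1 / (1 - k) \<le> C \<Longrightarrow> \<bar>c\<bar> \<le> C \<Longrightarrow> \<bar>tv c w\<bar> \<le> Yb C"
proof (induction w arbitrary: c)
  case (Cons b w)
  have "\<bar>tv (k * c + sg b) w\<bar> \<le> Yb C"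
    using Cons.IH[OF Cons.prems(1)] abs_slope_le[OF Cons.prems, of "[b]"] by simp
  then have 1: "\<bar>g * tv (k * c + sg b) w\<bar> \<le> g * Yb C"
    using g_pos by (simp add: abs_mult)
  have "\<bar>sg b * (g * a + c / 2)\<bar> \<le> g * \<bar>a\<bar> + C / 2"
    using abs_triangle_ineq[of "g * a" "c / 2"] Cons.prems(2) g_pos by (simp add: abs_mult)
  also have "\<dots> = Yb C * (1 - g)" using g_lt by (simp add: Yb_def)
  finally have "\<bar>sg b * (g * a + c / 2)\<bar> \<le> Yb C - g * Yb C" by (simp add: algebra_simps)
  then show ?case
    using 1 abs_triangle_ineq[of "sg b * (g * a + c / 2)" "g * tv (k * c + sg b) w"] by simp
next
  case Nil
  then have "0 \<le> C" by linarith
  then show ?case by (simp add: Yb_nonneg)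
qed

text \<open>By \<open>integral_hbox_product\<close> this is the squared L2 distance between two box
  smoothings of the law of the \<open>N\<close>-th partial sum, see
  \<open>nn_integral_fN_diff\<close>. With finite words every energy is a finite sum;
  \<open>B\<close> is the limit.\<close>

definition BN :: "nat \<Rightarrow> real \<Rightarrow> real \<Rightarrow> real" where
  "BN N r c = (\<Sum>w\<in>words N. \<Sum>w'\<in>words N. haar r (tv c w - tv c w')) / 4 ^ N"

definition B :: "real \<Rightarrow> real \<Rightarrow> real" where
  "B r c = lim (\<lambda>N. BN N r c)"

lemma sum_words_abs_le:
  assumes "\<And>w w'. w \<in> words N \<Longrightarrow> w' \<in> words N \<Longrightarrow> \<bar>f w w'\<bar> \<le> (e::real)"
  shows "\<bar>(\<Sum>w\<in>words N. \<Sum>w'\<in>words N. f w w') / 4 ^ N\<bar> \<le> e"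
proof -
  have "\<bar>\<Sum>w\<in>words N. \<Sum>w'\<in>words N. f w w'\<bar> \<le> (\<Sum>w\<in>words N. \<Sum>w'\<in>words N. e)"
    by (rule order_trans[OF sum_abs], rule sum_mono, rule order_trans[OF sum_abs], rule sum_mono) (rule assms)
  also have "\<dots> = 4 ^ N * e"
    by (simp add: card_words power_mult_distrib[symmetric] mult.assoc[symmetric])
  finally show ?thesis by (simp add: abs_divide field_simps)
qed

lemma BN_nonneg: "0 < r \<Longrightarrow> 0 \<le> BN N r c"
  using haar_kernel_nonneg[of r "\<lambda>_. 1" "tv c" "words N"] by (simp add: BN_def)

lemma BN_le: "0 < r \<Longrightarrow> BN N r c \<le> 1 / r"
proof -
  assume "0 < r"
  then have "\<bar>BN N r c\<bar> \<le> 1 / r" unfolding BN_def by (intro sum_words_abs_le haar_bound)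
  then show ?thesis by simp
qed

lemma BN_lipschitz:
  assumes "0 < r"
  shows "\<bar>BN N r c - BN N r c'\<bar> \<le> 4 * \<bar>c - c'\<bar> / r\<^sup>2"
proof -
  have *: "BN N r c - BN N r c'
      = (\<Sum>w\<in>words N. \<Sum>w'\<in>words N. haar r (tv c w - tv c w') - haar r (tv c' w - tv c' w')) / 4 ^ N"
    by (simp add: BN_def sum_subtractf diff_divide_distrib)
  show ?thesis unfolding *
  proof (rule sum_words_abs_le)
    fix w w'
    have "\<bar>uv w - uv w'\<bar> \<le> 2" using abs_uv_le_1[of w] abs_uv_le_1[of w'] by linarith
    moreover have "tv c w - tv c w' - (tv c' w - tv c' w') = (c - c') * (uv w - uv w')"
      using tv_diff[of c w c'] tv_diff[of c w' c'] by (simp add: algebra_simps)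
    ultimately have "\<bar>tv c w - tv c w' - (tv c' w - tv c' w')\<bar> \<le> \<bar>c - c'\<bar> * 2"
      by (simp add: abs_mult mult_left_mono)
    then have "2 * \<bar>tv c w - tv c w' - (tv c' w - tv c' w')\<bar> / r\<^sup>2 \<le> 4 * \<bar>c - c'\<bar> / r\<^sup>2"
      by (intro divide_right_mono) auto
    then show "\<bar>haar r (tv c w - tv c w') - haar r (tv c' w - tv c' w')\<bar> \<le> 4 * \<bar>c - c'\<bar> / r\<^sup>2"
      using haar_lipschitz[OF assms] order_trans by blast
  qed
qed

text \<open>Letters after the first \<open>N\<close> move \<open>tv\<close> by at most
  \<open>g ^ N * Yb C\<close>, and \<open>haar\<close> is Lipschitz.\<close>

lemma BN_cauchy:
  assumes "0 < r" "1 / (1 - k) \<le> C" "\<bar>c\<bar> \<le> C"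
  shows "\<bar>BN (N + n) r c - BN N r c\<bar> \<le> 4 * Yb C * g ^ N / r\<^sup>2"
proof -
  have const: "(\<Sum>w\<in>words N. \<Sum>w'\<in>words N. haar r (tv c w - tv c w'))
      = (\<Sum>w\<in>words N. \<Sum>v\<in>words n. \<Sum>w'\<in>words N. \<Sum>v'\<in>words n. haar r (tv c w - tv c w')) / 4 ^ n"
    by (simp add: card_words sum_distrib_left[symmetric] power_mult_distrib[symmetric] mult.assoc[symmetric])
  have *: "BN (N + n) r c - BN N r c = (\<Sum>w\<in>words (N + n). \<Sum>w'\<in>words (N + n).
      haar r (tv c w - tv c w') - haar r (tv c (take N w) - tv c (take N w'))) / 4 ^ (N + n)"
  proof -
    have "take N (w @ v) = w" if "w \<in> words N" for w v :: "bool list"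
      using that by (simp add: words_def)
    then have "(\<Sum>w\<in>words (N + n). \<Sum>w'\<in>words (N + n). haar r (tv c (take N w) - tv c (take N w')))
      = (\<Sum>w\<in>words N. \<Sum>v\<in>words n. \<Sum>w'\<in>words N. \<Sum>v'\<in>words n. haar r (tv c w - tv c w'))"
      unfolding sum_words_add by (intro sum.cong refl) simp
    then show ?thesis
      unfolding BN_def const by (simp add: sum_subtractf diff_divide_distrib power_add)
  qed
  show ?thesis unfolding *
  proof (rule sum_words_abs_le)
    fix w w' assume w: "w \<in> words (N + n)" "w' \<in> words (N + n)"
    have est: "\<bar>tv c w - tv c (take N w)\<bar> \<le> g ^ N * Yb C" if "w \<in> words (N + n)" for w
    proof -
      have "tv c w - tv c (take N w) = g ^ N * tv (slope c (take N w)) (drop N w)"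
        using tv_append[of c "take N w" "drop N w"] that by (simp add: words_def)
      moreover have "\<bar>tv (slope c (take N w)) (drop N w)\<bar> \<le> Yb C"
        by (intro abs_tv_le abs_slope_le assms)
      ultimately show ?thesis using g_pos by (simp add: abs_mult)
    qed
    have "\<bar>tv c w - tv c w' - (tv c (take N w) - tv c (take N w'))\<bar> \<le> 2 * (g ^ N * Yb C)"
      using est[OF w(1)] est[OF w(2)] by linarith
    then have "2 * \<bar>tv c w - tv c w' - (tv c (take N w) - tv c (take N w'))\<bar> / r\<^sup>2 \<le> 4 * Yb C * g ^ N / r\<^sup>2"
      by (intro divide_right_mono) auto
    then show "\<bar>haar r (tv c w - tv c w') - haar r (tv c (take N w) - tv c (take N w'))\<bar> \<le> 4 * Yb C * g ^ N / r\<^sup>2"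
      using haar_lipschitz[OF assms(1)] order_trans by blast
  qed
qed

lemma BN_tendsto:
  assumes "0 < r"
  shows "(\<lambda>N. BN N r c) \<longlonglongrightarrow> B r c"
proof -
  define C where "C = max (1 / (1 - k)) \<bar>c\<bar>"
  have C: "1 / (1 - k) \<le> C" "\<bar>c\<bar> \<le> C" by (auto simp: C_def)
  have "Cauchy (\<lambda>N. BN N r c)"
  proof (rule CauchyI')
    fix e :: real assume e: "0 < e"
    have "(\<lambda>N. 4 * Yb C * g ^ N / r\<^sup>2) \<longlonglongrightarrow> 4 * Yb C * 0 / r\<^sup>2"
      using g_pos g_lt assms by (intro tendsto_intros LIMSEQ_power_zero) auto
    then have "eventually (\<lambda>N. 4 * Yb C * g ^ N / r\<^sup>2 < e) sequentially"
      using e by (intro order_tendstoD) auto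
    then obtain M where M: "\<And>N. N \<ge> M \<Longrightarrow> 4 * Yb C * g ^ N / r\<^sup>2 < e"
      by (auto simp: eventually_sequentially)
    have "dist (BN m r c) (BN n r c) < e" if "m \<ge> M" "n > m" for m n
      using BN_cauchy[OF assms C, of m "n - m"] M[OF that(1)] that(2) by (simp add: dist_real_def)
    then show "\<exists>M. \<forall>m\<ge>M. \<forall>n>m. dist (BN m r c) (BN n r c) < e" by blast
  qed
  then show ?thesis unfolding B_def by (simp add: Cauchy_convergent_iff convergent_LIMSEQ_iff)
qed

lemma B_nonneg: "0 < r \<Longrightarrow> 0 \<le> B r c"
  by (rule LIMSEQ_le_const[OF BN_tendsto]) (auto simp: BN_nonneg)

lemma B_le: "0 < r \<Longrightarrow> B r c \<le> 1 / r"
  by (rule LIMSEQ_le_const2[OF BN_tendsto]) (auto simp: BN_le)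

lemma B_lipschitz:
  assumes "0 < r"
  shows "\<bar>B r c - B r c'\<bar> \<le> 4 * \<bar>c - c'\<bar> / r\<^sup>2"
  by (rule LIMSEQ_le_const2[OF tendsto_rabs[OF tendsto_diff[OF BN_tendsto BN_tendsto]]])
     (use assms BN_lipschitz in auto)

lemma B_BN:
  assumes "0 < r" "1 / (1 - k) \<le> C" "\<bar>c\<bar> \<le> C"
  shows "\<bar>B r c - BN N r c\<bar> \<le> 4 * Yb C * g ^ N / r\<^sup>2"
proof (rule LIMSEQ_le_const2[OF tendsto_rabs[OF tendsto_diff[OF BN_tendsto tendsto_const]]])
  show "\<exists>M. \<forall>m\<ge>M. \<bar>BN m r c - BN N r c\<bar> \<le> 4 * Yb C * g ^ N / r\<^sup>2"
    using BN_cauchy[OF assms, of N] by (metis le_Suc_ex)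
qed (use assms in simp)

definition near :: "real \<Rightarrow> nat \<Rightarrow> real \<Rightarrow> bool list \<Rightarrow> bool list \<Rightarrow> bool" where
  "near R n c w w' \<longleftrightarrow> \<bar>tv c w - tv c w'\<bar> \<le> R * g ^ n"

text \<open>Division by \<open>2 ^ n\<close> makes this weight dyadic and at most 1, as the
  collision bounds require.\<close>

definition nb :: "real \<Rightarrow> nat \<Rightarrow> real \<Rightarrow> bool list \<Rightarrow> real" where
  "nb R n c w = real (card {w' \<in> words n. near R n c w w'}) / 2 ^ n"

lemma near_sym: "near R n c w w' \<longleftrightarrow> near R n c w' w"
  by (simp add: near_def abs_minus_commute)

lemma sum_sym_half:
  fixes f :: "'x \<Rightarrow> real"
  assumes "finite A" and "\<And>x y. P x y \<longleftrightarrow> P y x"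
  shows "(\<Sum>x\<in>A. \<Sum>y\<in>A. if P x y then (f x + f y) / 2 else 0) = (\<Sum>x\<in>A. real (card {y \<in> A. P x y}) * f x)"
proof -
  have 1: "(\<Sum>x\<in>A. \<Sum>y\<in>A. if P x y then f x else 0) = (\<Sum>x\<in>A. real (card {y \<in> A. P x y}) * f x)"
    using assms(1) by (intro sum.cong refl) (simp add: sum.If_cases Int_def)
  have "(\<Sum>x\<in>A. \<Sum>y\<in>A. if P x y then f y else 0) = (\<Sum>x\<in>A. \<Sum>y\<in>A. if P x y then f x else 0)"
    by (subst sum.swap, intro sum.cong refl) (simp add: assms(2))
  moreover have "(\<Sum>x\<in>A. \<Sum>y\<in>A. if P x y then (f x + f y) / 2 else 0)
      = (\<Sum>x\<in>A. \<Sum>y\<in>A. (if P x y then f x else 0) / 2 + (if P x y then f y else 0) / 2)"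
    by (intro sum.cong refl) (simp add: add_divide_distrib)
  ultimately show ?thesis using 1 by (simp add: sum.distrib sum_divide_distrib[symmetric])
qed

text \<open>After the prefixes \<open>w\<close> and \<open>w'\<close> the walk restarts at two
  slopes, scaled by \<open>g ^ length w\<close> and translated. The cross energy is at most the mean
  of the two self-energies, and from these the translations disappear.\<close>

lemma haar_block_le:
  assumes "0 < r" and that: "length w = length w'"
  shows "(\<Sum>v\<in>words N. \<Sum>v'\<in>words N. haar r (tv c (w @ v) - tv c (w' @ v')))
    \<le> 4 ^ N * (BN N (r / g ^ length w) (slope c w) + BN N (r / g ^ length w) (slope c w')) / 2 / g ^ length w"
proof -
  let ?n = "length w"
  have gn: "0 < g ^ ?n" "0 < r / g ^ ?n" using g_pos assms(1) by auto
  define x where "x v = tv c w / g ^ ?n + tv (slope c w) v" for v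
  define y where "y v = tv c w' / g ^ ?n + tv (slope c w') v" for v
  have "haar r (tv c (w @ v) - tv c (w' @ v')) = 1 * (1 / g ^ ?n) * haar (r / g ^ ?n) (x v - y v')" for v v'
  proof -
    have "tv c (w @ v) - tv c (w' @ v') = g ^ ?n * (x v - y v')"
    proof -
      have "g ^ ?n * (tv c w / g ^ ?n) = tv c w" "g ^ ?n * (tv c w' / g ^ ?n) = tv c w'"
        using gn(1) by (metis less_irrefl nonzero_mult_div_cancel_left times_divide_eq_right)+
      then show ?thesis using that unfolding tv_append x_def y_def right_diff_distrib distrib_left by simp
    qed
    then show ?thesis using haar_scale[OF gn(1)] by simp
  qed
  then have "(\<Sum>v\<in>words N. \<Sum>v'\<in>words N. haar r (tv c (w @ v) - tv c (w' @ v')))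
      = (\<Sum>v\<in>words N. \<Sum>v'\<in>words N. 1 * 1 * haar (r / g ^ ?n) (x v - y v')) / g ^ ?n"
    by (simp add: sum_divide_distrib)
  also have "\<dots> \<le> (((\<Sum>v\<in>words N. \<Sum>v'\<in>words N. 1 * 1 * haar (r / g ^ ?n) (x v - x v')) +
      (\<Sum>v\<in>words N. \<Sum>v'\<in>words N. 1 * 1 * haar (r / g ^ ?n) (y v - y v'))) / 2) / g ^ ?n"
    using gn by (intro divide_right_mono haar_kernel_le) auto
  also have "\<dots> = 4 ^ N * (BN N (r / g ^ ?n) (slope c w) + BN N (r / g ^ ?n) (slope c w')) / 2 / g ^ ?n"
    unfolding BN_def by (simp add: x_def y_def distrib_left)
  finally show ?thesis .
qed

text \<open>Only near prefixes interact at scale \<open>r\<close>. In the radius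
  \<open>2 * Yb C + 3\<close> the two continuations take \<open>2 * Yb C\<close>, the passage from
  the slope \<open>c\<close> to the grid slope \<open>t\<close> takes 2, and the support of the
  kernel takes 1 because \<open>2 * r \<le> g ^ n\<close>.\<close>

lemma B_renormalize:
  assumes "0 < r" "2 * r \<le> g ^ n" "1 / (1 - k) \<le> C" "\<bar>c\<bar> \<le> C" "\<bar>c - t\<bar> \<le> g ^ n"
  shows "B r c \<le> k ^ n * (\<Sum>w\<in>words n. nb (2 * Yb C + 3) n t w * B (r / g ^ n) (slope c w))"
proof -
  let ?R = "2 * Yb C + 3"
  have gn: "0 < g ^ n" "0 < r / g ^ n" using g_pos assms(1) by auto
  have "BN (n + N) r c \<le> k ^ n * (\<Sum>w\<in>words n. nb ?R n t w * BN N (r / g ^ n) (slope c w))" for N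
  proof -
    let ?b = "\<lambda>w. BN N (r / g ^ n) (slope c w)"
    have pair: "(\<Sum>v\<in>words N. \<Sum>v'\<in>words N. haar r (tv c (w @ v) - tv c (w' @ v')))
      \<le> (if near ?R n t w w' then (?b w + ?b w') / 2 else 0) * (4 ^ N / g ^ n)"
      if w: "w \<in> words n" "w' \<in> words n" for w w'
    proof (cases "near ?R n t w w'")
      case True
      then show ?thesis using haar_block_le[OF assms(1), of w w' c N] w by (simp add: words_def mult_ac)
    next
      case False
      have "haar r (tv c (w @ v) - tv c (w' @ v')) = 0" for v v'
      proof (rule haar_eq_0[OF assms(1)])
        have u: "\<bar>uv w - uv w'\<bar> \<le> 2" using abs_uv_le_1[of w] abs_uv_le_1[of w'] by linarith
        have "tv c w - tv c w' - (tv t w - tv t w') = (c - t) * (uv w - uv w')"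
          using tv_diff[of c w t] tv_diff[of c w' t] by (simp add: algebra_simps)
        then have "\<bar>tv c w - tv c w' - (tv t w - tv t w')\<bar> \<le> g ^ n * 2"
          using u assms(5) gn by (simp add: abs_mult mult_mono)
        moreover have "?R * g ^ n < \<bar>tv t w - tv t w'\<bar>" using False by (simp add: near_def)
        moreover have "\<bar>g ^ n * tv (slope c w) v\<bar> \<le> g ^ n * Yb C" "\<bar>g ^ n * tv (slope c w') v'\<bar> \<le> g ^ n * Yb C"
          using gn abs_tv_le[OF assms(3) abs_slope_le[OF assms(3,4)]] by (simp_all add: abs_mult)
        moreover have "tv c (w @ v) = tv c w + g ^ n * tv (slope c w) v" "tv c (w' @ v') = tv c w' + g ^ n * tv (slope c w') v'"
          using w by (simp_all add: tv_append words_def)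
        ultimately show "2 * r \<le> \<bar>tv c (w @ v) - tv c (w' @ v')\<bar>"
          using assms(2) by (simp add: algebra_simps)
      qed
      then show ?thesis using False by simp
    qed
    have "BN (n + N) r c = (\<Sum>w\<in>words n. \<Sum>w'\<in>words n. \<Sum>v\<in>words N. \<Sum>v'\<in>words N. haar r (tv c (w @ v) - tv c (w' @ v'))) / 4 ^ (n + N)"
      unfolding BN_def sum_words_add
      by (rule arg_cong2[where f = "(/)"], rule sum.cong[OF refl], rule sum.swap) simp
    also have "\<dots> \<le> (\<Sum>w\<in>words n. \<Sum>w'\<in>words n. (if near ?R n t w w' then (?b w + ?b w') / 2 else 0) * (4 ^ N / g ^ n)) / 4 ^ (n + N)"
      by (intro divide_right_mono sum_mono pair) auto
    also have "\<dots> = (\<Sum>w\<in>words n. \<Sum>w'\<in>words n. if near ?R n t w w' then (?b w + ?b w') / 2 else 0) * (4 ^ N / g ^ n) / 4 ^ (n + N)"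
      by (simp only: sum_distrib_right)
    also have "\<dots> = (\<Sum>w\<in>words n. nb ?R n t w * ?b w) * (2 ^ n * (4 ^ N / g ^ n) / 4 ^ (n + N))"
      unfolding sum_sym_half[OF finite_words near_sym] nb_def by (simp add: sum_distrib_right mult.assoc)
    also have "2 ^ n * (4 ^ N / g ^ n) / 4 ^ (n + N) = k ^ n"
    proof -
      have "(4::real) ^ n = 2 ^ n * 2 ^ n" by (simp add: power_mult_distrib[symmetric])
      then show ?thesis using g_pos by (simp add: k_eq power_add power_divide power_mult_distrib)
    qed
    finally show ?thesis by (simp add: mult.commute)
  qed
  then have "\<exists>M. \<forall>N\<ge>M. BN (N + n) r c \<le> k ^ n * (\<Sum>w\<in>words n. nb ?R n t w * BN N (r / g ^ n) (slope c w))"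
    by (simp add: add.commute[of _ n])
  moreover have "(\<lambda>N. BN (N + n) r c) \<longlonglongrightarrow> B r c"
    by (intro LIMSEQ_ignore_initial_segment BN_tendsto assms)
  ultimately show ?thesis
  proof (intro LIMSEQ_le)
    show "(\<lambda>N. k ^ n * (\<Sum>w\<in>words n. nb ?R n t w * BN N (r / g ^ n) (slope c w)))
      \<longlonglongrightarrow> k ^ n * (\<Sum>w\<in>words n. nb ?R n t w * B (r / g ^ n) (slope c w))"
      by (intro tendsto_intros BN_tendsto gn)
  qed
qed

end

section \<open>Averages of the energy over the starting slope\<close>

lemma integrable_tent_times:
  assumes "0 < C" "F \<in> borel_measurable borel" "\<And>c. \<bar>F c\<bar> \<le> K"
  shows "integrable lborel (\<lambda>c. tent C c * F c)"
proof (rule Bochner_Integration.integrable_bound)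
  show "integrable lborel (\<lambda>c. indicator {- 2 * C..2 * C} c * (2 * K))"
    by (intro integrable_mult_left integrable_real_indicator) (simp_all add: emeasure_lborel_Icc_eq)
  show "AE c in lborel. norm (tent C c * F c) \<le> norm (indicator {- 2 * C..2 * C} c * (2 * K))"
  proof (intro AE_I2)
    fix c
    show "norm (tent C c * F c) \<le> norm (indicator {- 2 * C..2 * C} c * (2 * K))"
    proof (cases "2 * C \<le> \<bar>c\<bar>")
      case True
      then show ?thesis by (simp add: tent_props(4)[OF assms(1)])
    next
      case False
      have "tent C c * \<bar>F c\<bar> \<le> 2 * K"
        using tent_props(1,2)[OF assms(1), of c] assms(3)[of c] by (intro mult_mono) auto
      moreover have "c \<in> {- 2 * C..2 * C}" using False by auto
      ultimately show ?thesis
        using tent_props(1)[OF assms(1), of c] assms(3)[of c] by (simp add: abs_mult)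
    qed
  qed
qed (use assms(2) in measurable)

lemma integral_tent_le:
  assumes "0 < C"
  shows "integrable lborel (tent C)" "(\<integral>c. tent C c \<partial>lborel) \<le> 8 * C"
proof -
  show int: "integrable lborel (tent C)"
    using integrable_tent_times[OF assms, of "\<lambda>_. 1" 1] by simp
  have "(\<integral>c. tent C c \<partial>lborel) \<le> (\<integral>c. indicator {- 2 * C..2 * C} c * 2 \<partial>lborel)"
  proof (rule integral_mono[OF int])
    show "integrable lborel (\<lambda>c. indicator {- 2 * C..2 * C} c * 2 :: real)"
      by (intro integrable_mult_left integrable_real_indicator) (simp_all add: emeasure_lborel_Icc_eq)
    show "tent C c \<le> indicator {- 2 * C..2 * C} c * 2" for c
      using tent_props(2,4)[OF assms, of c] by (cases "2 * C \<le> \<bar>c\<bar>") (auto simp: indicator_def)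
  qed
  also have "\<dots> = 8 * C" using assms by simp
  finally show "(\<integral>c. tent C c \<partial>lborel) \<le> 8 * C" .
qed

context walk
begin

lemma continuous_on_tv: "continuous_on A (\<lambda>c. tv c w)"
proof -
  have "continuous_on A (\<lambda>c. tv 0 w + c * uv w)" by (intro continuous_intros)
  moreover have "tv 0 w + c * uv w = tv c w" for c using tv_diff[of c w 0] by simp
  ultimately show ?thesis by (simp only:)
qed

lemma borel_measurable_tv [measurable]: "(\<lambda>c. tv c w) \<in> borel_measurable borel"
  by (intro borel_measurable_continuous_onI continuous_on_tv)

lemma borel_measurable_BN [measurable]: "(\<lambda>c. BN N r c) \<in> borel_measurable borel"
  unfolding BN_def by measurable

lemma borel_measurable_B: "0 < r \<Longrightarrow> (\<lambda>c. B r c) \<in> borel_measurable borel"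
  by (rule borel_measurable_LIMSEQ_real[OF BN_tendsto]) auto

text \<open>Transversality. Prefixes whose \<open>uv\<close> are \<open>4 / 2 ^ n\<close> apart
  still have \<open>uv\<close> at least \<open>2 / 2 ^ n\<close> apart after any continuation; the
  difference of the two sums then moves with \<open>c\<close> at this speed, and the average is of
  order \<open>\<rho> * 4 ^ n\<close>. Every prefix has at most 4 partners that are closer, and for
  these the energy at the renormalised scale \<open>\<rho> / g ^ n\<close> is bounded by
  \<open>S\<close>.\<close>

lemma integral_tent_BN_le:
  assumes "0 < \<rho>" "1 / (1 - k) \<le> C" and S: "\<And>c. \<bar>c\<bar> \<le> 2 * C \<Longrightarrow> BN N (\<rho> / g ^ n) c \<le> S"
  shows "(\<integral>c. tent C c * BN (n + N) \<rho> c \<partial>lborel) \<le> 2 * \<rho> * 4 ^ n / C + 32 * C * k ^ n * S"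
proof -
  have C: "0 < C" using assms(2) k_lt by (smt (verit) divide_pos_pos)
  have C2: "1 / (1 - k) \<le> 2 * C" using C assms(2) by simp
  have gn: "0 < g ^ n" "0 < \<rho> / g ^ n" using g_pos assms(1) by auto
  have S0: "0 \<le> S" using BN_nonneg[OF gn(2), of N 0] S[of 0] C by simp
  define h where "h u u' v v' c = haar \<rho> (tv c (u @ v) - tv c (u' @ v'))" for u u' v v' c
  have int: "integrable lborel (\<lambda>c. tent C c * h u u' v v' c)" for u u' v v'
    using C haar_bound[OF assms(1)] unfolding h_def by (intro integrable_tent_times) auto
  define I where "I u u' = (\<integral>c. (\<Sum>v\<in>words N. \<Sum>v'\<in>words N. tent C c * h u u' v v' c) \<partial>lborel)" for u u'
  define nr where "nr u u' \<longleftrightarrow> \<bar>uv u - uv u'\<bar> < 4 / 2 ^ n" for u u'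
  have far: "I u u' \<le> 4 ^ N * (2 * \<rho> * 4 ^ n / C)" if u: "u \<in> words n" "u' \<in> words n" "\<not> nr u u'" for u u'
  proof -
    have "(\<integral>c. tent C c * h u u' v v' c \<partial>lborel) \<le> 2 * \<rho> * 4 ^ n / C" for v v'
    proof -
      define z where "z = uv (u @ v) - uv (u' @ v')"
      have "uv (u @ v) = uv u + uv v / 2 ^ n" "uv (u' @ v') = uv u' + uv v' / 2 ^ n"
        using u by (simp_all add: uv_append words_def)
      moreover have "\<bar>uv v / 2 ^ n\<bar> \<le> 1 / 2 ^ n" "\<bar>uv v' / 2 ^ n\<bar> \<le> 1 / 2 ^ n"
        using abs_uv_le_1 by (simp_all add: abs_divide divide_right_mono)
      moreover have "4 / 2 ^ n \<le> \<bar>uv u - uv u'\<bar>" using u(3) by (simp add: nr_def)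
      ultimately have z: "2 / 2 ^ n \<le> \<bar>z\<bar>" unfolding z_def by linarith
      then have z0: "z \<noteq> 0" by (smt (verit) zero_less_divide_iff zero_less_power)
      have "(\<integral>c. tent C c * h u u' v v' c \<partial>lborel)
          = (\<integral>c. tent C c * haar \<rho> ((tv 0 (u @ v) - tv 0 (u' @ v')) + z * c) \<partial>lborel)"
      proof -
        have "(tv 0 (u @ v) - tv 0 (u' @ v')) + z * c = tv c (u @ v) - tv c (u' @ v')" for c
          using tv_diff[of c "u @ v" 0] tv_diff[of c "u' @ v'" 0] by (simp add: z_def algebra_simps)
        then show ?thesis by (simp only: h_def)
      qed
      also have "\<dots> \<le> 8 * \<rho> / (C * z\<^sup>2)"
        by (rule integral_tent_haar_le[OF assms(1) C z0])
      also have "\<dots> \<le> 8 * \<rho> / (C * (2 / 2 ^ n)\<^sup>2)"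
      proof (rule divide_left_mono)
        have "(2 / 2 ^ n)\<^sup>2 \<le> \<bar>z\<bar>\<^sup>2" using z by (intro power_mono) auto
        then show "C * (2 / 2 ^ n)\<^sup>2 \<le> C * z\<^sup>2" using C by simp
        show "0 < C * z\<^sup>2 * (C * (2 / 2 ^ n)\<^sup>2)" using C z0 by (intro mult_pos_pos) auto
      qed (use assms in simp)
      also have "\<dots> = 2 * \<rho> * 4 ^ n / C"
      proof -
        have "(4::real) ^ n = 2 ^ n * 2 ^ n" by (simp add: power_mult_distrib[symmetric])
        then show ?thesis using C by (simp add: power2_eq_square field_simps)
      qed
      finally show ?thesis .
    qed
    then have "(\<Sum>v\<in>words N. \<Sum>v'\<in>words N. \<integral>c. tent C c * h u u' v v' c \<partial>lborel)
        \<le> (\<Sum>v\<in>words N. \<Sum>v'\<in>words N. 2 * \<rho> * 4 ^ n / C)" by (intro sum_mono)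
    also have "\<dots> = 4 ^ N * (2 * \<rho> * 4 ^ n / C)"
      by (simp add: card_words power_mult_distrib[symmetric] mult.assoc[symmetric])
    finally show ?thesis unfolding I_def by (simp add: Bochner_Integration.integral_sum int)
  qed
  have near: "I u u' \<le> 8 * C * (4 ^ N * S / g ^ n)" if u: "u \<in> words n" "u' \<in> words n" for u u'
  proof -
    have "I u u' \<le> (\<integral>c. tent C c * (4 ^ N * S / g ^ n) \<partial>lborel)"
      unfolding I_def
    proof (rule integral_mono)
      fix c
      show "(\<Sum>v\<in>words N. \<Sum>v'\<in>words N. tent C c * h u u' v v' c) \<le> tent C c * (4 ^ N * S / g ^ n)"
      proof (cases "2 * C \<le> \<bar>c\<bar>")
        case True
        then show ?thesis by (simp add: tent_props(4)[OF C])
      next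
        case False
        then have c: "\<bar>c\<bar> \<le> 2 * C" by simp
        have "(\<Sum>v\<in>words N. \<Sum>v'\<in>words N. h u u' v v' c)
            \<le> 4 ^ N * (BN N (\<rho> / g ^ n) (slope c u) + BN N (\<rho> / g ^ n) (slope c u')) / 2 / g ^ n"
          unfolding h_def using haar_block_le[OF assms(1), of u u' c N] u by (simp add: words_def)
        also have "\<dots> \<le> 4 ^ N * (S + S) / 2 / g ^ n"
          using gn by (intro divide_right_mono mult_left_mono add_mono S abs_slope_le[OF C2 c]) auto
        also have "\<dots> = 4 ^ N * S / g ^ n" by simp
        finally show ?thesis
          unfolding sum_distrib_left[symmetric] by (rule mult_left_mono[OF _ tent_props(1)[OF C]])
      qed
    qed (use integral_tent_le(1)[OF C] in \<open>auto intro!: Bochner_Integration.integrable_sum int\<close>)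
    also have "\<dots> = (\<integral>c. tent C c \<partial>lborel) * (4 ^ N * S / g ^ n)" by simp
    also have "\<dots> \<le> 8 * C * (4 ^ N * S / g ^ n)"
      using S0 gn by (intro mult_right_mono integral_tent_le(2)[OF C]) simp
    finally show ?thesis .
  qed
  have "(\<integral>c. tent C c * BN (n + N) \<rho> c \<partial>lborel)
      = (\<integral>c. (\<Sum>u\<in>words n. \<Sum>u'\<in>words n. \<Sum>v\<in>words N. \<Sum>v'\<in>words N. tent C c * h u u' v v' c) / 4 ^ (n + N) \<partial>lborel)"
  proof (intro Bochner_Integration.integral_cong refl)
    fix c
    have "(\<Sum>w\<in>words (n + N). \<Sum>w'\<in>words (n + N). haar \<rho> (tv c w - tv c w'))
       = (\<Sum>u\<in>words n. \<Sum>u'\<in>words n. \<Sum>v\<in>words N. \<Sum>v'\<in>words N. h u u' v v' c)"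
      unfolding sum_words_add h_def by (rule sum.cong[OF refl], rule sum.swap)
    then show "tent C c * BN (n + N) \<rho> c
      = (\<Sum>u\<in>words n. \<Sum>u'\<in>words n. \<Sum>v\<in>words N. \<Sum>v'\<in>words N. tent C c * h u u' v v' c) / 4 ^ (n + N)"
      unfolding BN_def by (simp add: sum_distrib_left)
  qed
  also have "\<dots> = (\<Sum>u\<in>words n. \<Sum>u'\<in>words n. I u u') / 4 ^ (n + N)"
    unfolding I_def by (simp add: Bochner_Integration.integral_sum Bochner_Integration.integrable_sum int)
  also have "\<dots> \<le> (\<Sum>u\<in>words n. \<Sum>u'\<in>words n. 4 ^ N * (2 * \<rho> * 4 ^ n / C)
      + (if nr u u' then 8 * C * (4 ^ N * S / g ^ n) else 0)) / 4 ^ (n + N)"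
  proof (intro divide_right_mono sum_mono)
    fix u u' assume u: "u \<in> words n" "u' \<in> words n"
    have "0 \<le> 4 ^ N * (2 * \<rho> * 4 ^ n / C)" using C assms(1) by simp
    then show "I u u' \<le> 4 ^ N * (2 * \<rho> * 4 ^ n / C) + (if nr u u' then 8 * C * (4 ^ N * S / g ^ n) else 0)"
      using far[OF u] near[OF u] by (cases "nr u u'") auto
  qed simp
  also have "\<dots> \<le> (4 ^ n * (4 ^ N * (2 * \<rho> * 4 ^ n / C)) + 2 ^ n * (4 * (8 * C * (4 ^ N * S / g ^ n)))) / 4 ^ (n + N)"
  proof (intro divide_right_mono)
    have "(\<Sum>u\<in>words n. \<Sum>u'\<in>words n. if nr u u' then 8 * C * (4 ^ N * S / g ^ n) else 0)
        \<le> (\<Sum>u\<in>words n. 4 * (8 * C * (4 ^ N * S / g ^ n)))"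
    proof (intro sum_mono)
      fix u assume "u \<in> words n"
      then have "real (card {v \<in> words n. nr u v}) \<le> 4"
        using card_uv_near[of u n] by (simp add: nr_def)
      then have "real (card {v \<in> words n. nr u v}) * (8 * C * (4 ^ N * S / g ^ n)) \<le> 4 * (8 * C * (4 ^ N * S / g ^ n))"
        using C S0 gn by (intro mult_right_mono) auto
      then show "(\<Sum>u'\<in>words n. if nr u u' then 8 * C * (4 ^ N * S / g ^ n) else 0) \<le> 4 * (8 * C * (4 ^ N * S / g ^ n))"
        by (simp add: sum.If_cases Int_def)
    qed
    then show "(\<Sum>u\<in>words n. \<Sum>u'\<in>words n. 4 ^ N * (2 * \<rho> * 4 ^ n / C)
      + (if nr u u' then 8 * C * (4 ^ N * S / g ^ n) else 0))
      \<le> 4 ^ n * (4 ^ N * (2 * \<rho> * 4 ^ n / C)) + 2 ^ n * (4 * (8 * C * (4 ^ N * S / g ^ n)))"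
      by (simp add: sum.distrib card_words power_mult_distrib[symmetric] mult.assoc[symmetric])
  qed simp
  also have "\<dots> = 2 * \<rho> * 4 ^ n / C + 32 * C * k ^ n * S"
  proof -
    have "(4::real) ^ n = 2 ^ n * 2 ^ n" by (simp add: power_mult_distrib[symmetric])
    moreover have "k ^ n = 1 / (2 ^ n * g ^ n)" by (simp add: k_eq power_divide power_mult_distrib)
    ultimately show ?thesis using g_pos C by (simp add: add_divide_distrib power_add mult_ac)
  qed
  finally show ?thesis .
qed

lemma integral_tent_B_le:
  assumes "0 < \<rho>" "1 / (1 - k) \<le> C" and S: "\<And>c. \<bar>c\<bar> \<le> 2 * C \<Longrightarrow> B (\<rho> / g ^ n) c \<le> S"
  shows "(\<integral>c. tent C c * B \<rho> c \<partial>lborel) \<le> 2 * \<rho> * 4 ^ n / C + 32 * C * k ^ n * S"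
proof -
  have C: "0 < C" using assms(2) k_lt by (smt (verit) divide_pos_pos)
  have C2: "1 / (1 - k) \<le> 2 * C" using C assms(2) by simp
  have gn: "0 < g ^ n" "0 < \<rho> / g ^ n" using g_pos assms(1) by auto
  define d where "d N = 4 * Yb (2 * C) * g ^ (n + N) / \<rho>\<^sup>2" for N
  define e where "e N = 4 * Yb (2 * C) * g ^ N / (\<rho> / g ^ n)\<^sup>2" for N
  have B1: "\<bar>B \<rho> c\<bar> \<le> 1 / \<rho>" for c using B_nonneg[OF assms(1), of c] B_le[OF assms(1), of c] by simp
  have intB: "integrable lborel (\<lambda>c. tent C c * B \<rho> c)"
    by (rule integrable_tent_times[OF C borel_measurable_B[OF assms(1)] B1])
  have BN1: "\<bar>BN M \<rho> c\<bar> \<le> 1 / \<rho>" for M c using BN_nonneg[OF assms(1), of M c] BN_le[OF assms(1), of M c] by simp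
  have intBN: "integrable lborel (\<lambda>c. tent C c * BN M \<rho> c)" for M
    by (rule integrable_tent_times[OF C borel_measurable_BN BN1])
  have bound: "(\<integral>c. tent C c * B \<rho> c \<partial>lborel) \<le> 2 * \<rho> * 4 ^ n / C + 32 * C * k ^ n * (S + e N) + d N * (8 * C)" for N
  proof -
    have "(\<integral>c. tent C c * B \<rho> c \<partial>lborel) \<le> (\<integral>c. tent C c * BN (n + N) \<rho> c + tent C c * d N \<partial>lborel)"
    proof (rule integral_mono[OF intB])
      fix c
      show "tent C c * B \<rho> c \<le> tent C c * BN (n + N) \<rho> c + tent C c * d N"
      proof (cases "2 * C \<le> \<bar>c\<bar>")
        case True
        then show ?thesis by (simp add: tent_props(4)[OF C])
      next
        case False
        then have "B \<rho> c \<le> BN (n + N) \<rho> c + d N"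
          using B_BN[OF assms(1) C2, of c "n + N"] unfolding d_def by linarith
        then show ?thesis
          using tent_props(1)[OF C, of c] by (simp add: distrib_left[symmetric] mult_left_mono)
      qed
    qed (use intBN integral_tent_le(1)[OF C] in auto)
    also have "\<dots> = (\<integral>c. tent C c * BN (n + N) \<rho> c \<partial>lborel) + d N * (\<integral>c. tent C c \<partial>lborel)"
      using intBN integral_tent_le(1)[OF C] by simp
    also have "\<dots> \<le> (2 * \<rho> * 4 ^ n / C + 32 * C * k ^ n * (S + e N)) + d N * (8 * C)"
    proof (intro add_mono mult_left_mono integral_tent_le(2)[OF C] integral_tent_BN_le[OF assms(1,2)])
      show "BN N (\<rho> / g ^ n) c \<le> S + e N" if "\<bar>c\<bar> \<le> 2 * C" for c
        using B_BN[OF gn(2) C2 that, of N] S[OF that] unfolding e_def by linarith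
      show "0 \<le> d N" using Yb_nonneg[of "2 * C"] C g_pos by (simp add: d_def)
    qed
    finally show ?thesis .
  qed
  have g0: "(\<lambda>N. g ^ N) \<longlonglongrightarrow> 0" using g_pos g_lt by (intro LIMSEQ_power_zero) auto
  have "d \<longlonglongrightarrow> 4 * Yb (2 * C) * (g ^ n * 0) / \<rho>\<^sup>2"
    unfolding d_def power_add using assms(1) by (intro tendsto_divide tendsto_mult tendsto_const g0) simp
  moreover have "e \<longlonglongrightarrow> 4 * Yb (2 * C) * 0 / (\<rho> / g ^ n)\<^sup>2"
    unfolding e_def using assms(1) g_pos by (intro tendsto_divide tendsto_mult tendsto_const g0) simp
  ultimately have "(\<lambda>N. 2 * \<rho> * 4 ^ n / C + 32 * C * k ^ n * (S + e N) + d N * (8 * C))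
      \<longlonglongrightarrow> 2 * \<rho> * 4 ^ n / C + 32 * C * k ^ n * (S + 0) + 0 * (8 * C)"
    by (intro tendsto_intros) auto
  then show ?thesis
    using bound by (intro LIMSEQ_le_const) auto
qed

text \<open>The growth rate of the energies as \<open>r\<close> tends to 0:
  \<open>\<alpha> = 1\<close> is trivial, a negative \<open>\<alpha>\<close> is the decay wanted in
  the end.\<close>

definition power_bound :: "real \<Rightarrow> bool" where
  "power_bound \<alpha> \<longleftrightarrow> (\<forall>C. \<exists>A. \<forall>r c. 0 < r \<longrightarrow> r \<le> 1 \<longrightarrow> \<bar>c\<bar> \<le> C \<longrightarrow> B r c \<le> A * r powr (- \<alpha>))"

lemma power_boundD:
  assumes "power_bound \<alpha>"
  shows "\<exists>A\<ge>1. \<forall>r c. 0 < r \<longrightarrow> r \<le> 1 \<longrightarrow> \<bar>c\<bar> \<le> C \<longrightarrow> B r c \<le> A * r powr (- \<alpha>)"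
proof -
  obtain A where A: "\<forall>r c. 0 < r \<longrightarrow> r \<le> 1 \<longrightarrow> \<bar>c\<bar> \<le> C \<longrightarrow> B r c \<le> A * r powr (- \<alpha>)"
    using assms[unfolded power_bound_def, THEN spec, of C] by (elim exE)
  have "B r c \<le> max 1 A * r powr (- \<alpha>)" if "0 < r" "r \<le> 1" "\<bar>c\<bar> \<le> C" for r c
    by (rule order_trans[OF A[rule_format, OF that]]) (simp add: mult_right_mono)
  then show ?thesis by (intro exI[of _ "max 1 A"]) simp
qed

lemma power_bound_1: "power_bound 1"
  unfolding power_bound_def
proof (intro allI exI[of _ 1] impI)
  fix r c :: real assume "0 < r"
  then show "B r c \<le> 1 * r powr - 1"
    using B_le[of r c] by (simp add: powr_minus field_simps)
qed

lemma power_bound_mono: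
  assumes "power_bound \<alpha>" "\<alpha> \<le> \<beta>"
  shows "power_bound \<beta>"
  unfolding power_bound_def
proof
  fix C
  obtain A where A: "1 \<le> A" "\<forall>r c. 0 < r \<longrightarrow> r \<le> 1 \<longrightarrow> \<bar>c\<bar> \<le> C \<longrightarrow> B r c \<le> A * r powr (- \<alpha>)"
    using power_boundD[OF assms(1), of C] by (elim exE conjE)
  have "B r c \<le> A * r powr (- \<beta>)" if "0 < r" "r \<le> 1" "\<bar>c\<bar> \<le> C" for r c
  proof -
    have "r powr (- \<alpha>) \<le> r powr (- \<beta>)" using that assms(2) by (intro powr_mono') auto
    then show ?thesis using A(1) by (intro order_trans[OF A(2)[rule_format, OF that]] mult_left_mono) auto
  qed
  then show "\<exists>A. \<forall>r c. 0 < r \<longrightarrow> r \<le> 1 \<longrightarrow> \<bar>c\<bar> \<le> C \<longrightarrow> B r c \<le> A * r powr (- \<beta>)" by auto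
qed

text \<open>If \<open>16 ^ n\<close> is about \<open>1 / \<rho>\<close>, then \<open>k ^ n\<close>
  is about \<open>\<rho> powr (2 * sig)\<close>. Half of this gain survives the balancing in
  \<open>B_block_bound\<close>.\<close>

definition sig :: real where
  "sig = ln (1 / k) / (8 * ln 2)"

lemma sig_pos: "0 < sig"
  unfolding sig_def using k_pos k_lt by (intro divide_pos_pos ln_gt_zero) (auto simp: field_simps)

lemma sig_le: "sig \<le> 1 / 8"
proof -
  have "1 / k \<le> 2" using k_gt by (simp add: field_simps)
  then have "ln (1 / k) \<le> ln 2" using k_pos by (intro ln_mono) auto
  then have "sig \<le> ln 2 / (8 * ln 2)" unfolding sig_def by (intro divide_right_mono) auto
  then show ?thesis by simp
qed

text \<open>\<open>integral_tent_B_le\<close> with \<open>16 ^ n\<close> about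
  \<open>1 / \<rho>\<close>: the far pairs contribute \<open>\<rho> * 4 ^ n\<close>, at most the
  square root of \<open>\<rho>\<close>, and the near pairs gain \<open>k ^ n\<close> over the
  pointwise bound.\<close>

lemma integral_B_le:
  assumes "power_bound \<alpha>" "0 \<le> \<alpha>" "1 / (1 - k) \<le> C"
  obtains K where "0 \<le> K"
    "\<And>\<rho>. 0 < \<rho> \<Longrightarrow> \<rho> \<le> 1 \<Longrightarrow> (\<integral>c. indicator {- C..C} c * B \<rho> c \<partial>lborel) \<le> K * \<rho> powr (2 * sig - \<alpha>)"
proof -
  have C: "0 < C" using assms(3) k_lt by (smt (verit) divide_pos_pos)
  obtain A where A: "1 \<le> A" "\<forall>r c. 0 < r \<longrightarrow> r \<le> 1 \<longrightarrow> \<bar>c\<bar> \<le> 2 * C \<longrightarrow> B r c \<le> A * r powr (- \<alpha>)"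
    using power_boundD[OF assms(1), of "2 * C"] by (elim exE conjE)
  define K where "K = 2 / C + 32 * C * (1 / k) * A"
  have "(\<integral>c. indicator {- C..C} c * B \<rho> c \<partial>lborel) \<le> K * \<rho> powr (2 * sig - \<alpha>)"
    if \<rho>: "0 < \<rho>" "\<rho> \<le> 1" for \<rho>
  proof -
    define y where "y = ln (1 / \<rho>) / ln 16"
    define n where "n = nat \<lfloor>y\<rfloor>"
    have l16: "0 < ln (16::real)" by simp
    have y0: "0 \<le> y" using \<rho> l16 unfolding y_def by (intro divide_nonneg_pos) auto
    then have n: "real n \<le> y" "y < real n + 1" unfolding n_def by linarith+
    have \<rho>_eq: "\<rho> = exp (- y * ln 16)"
    proof -
      have "- y * ln 16 = ln \<rho>" using \<rho> l16 unfolding y_def by (simp add: ln_div)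
      then show ?thesis using \<rho> by simp
    qed
    have e16: "\<rho> \<le> exp (- real n * ln 16)"
      unfolding \<rho>_eq using n(1) l16 by simp
    have ln16: "ln (16::real) = 4 * ln 2" using ln_realpow[of "2::real" 4] by simp
    have ln4: "ln (4::real) = 2 * ln 2" using ln_realpow[of "2::real" 2] by simp
    have p16: "exp (- real n * ln 16) = (1 / 16) ^ n"
    proof -
      have "exp (- real n * ln 16) = exp (- ln 16) ^ n" by (simp add: exp_of_nat_mult[symmetric])
      then show ?thesis by (simp add: exp_minus)
    qed
    have "(1 / 16) ^ n \<le> g ^ n" using g_gt by (intro power_mono) auto
    then have \<rho>g: "\<rho> \<le> g ^ n" using e16 p16 by simp
    have gn: "0 < g ^ n" "g ^ n \<le> 1" using g_pos g_lt by (auto intro: power_le_one)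
    have r1: "0 < \<rho> / g ^ n" "\<rho> / g ^ n \<le> 1" using \<rho> \<rho>g gn by (auto simp: field_simps)
    have S: "B (\<rho> / g ^ n) c \<le> A * \<rho> powr (- \<alpha>)" if "\<bar>c\<bar> \<le> 2 * C" for c
    proof -
      have "\<rho> \<le> \<rho> / g ^ n" using \<rho> gn by (simp add: field_simps)
      then have "(\<rho> / g ^ n) powr (- \<alpha>) \<le> \<rho> powr (- \<alpha>)"
        using \<rho> assms(2) by (intro powr_mono2') auto
      then show ?thesis using A(1) by (intro order_trans[OF A(2)[rule_format, OF r1 that]] mult_left_mono) auto
    qed
    have B1: "\<bar>B \<rho> c\<bar> \<le> 1 / \<rho>" for c using B_nonneg[OF \<rho>(1), of c] B_le[OF \<rho>(1), of c] by simp
    have "(\<integral>c. indicator {- C..C} c * B \<rho> c \<partial>lborel) \<le> (\<integral>c. tent C c * B \<rho> c \<partial>lborel)"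
    proof (rule integral_mono')
      show "integrable lborel (\<lambda>c. tent C c * B \<rho> c)"
        by (rule integrable_tent_times[OF C borel_measurable_B[OF \<rho>(1)] B1])
      show "indicator {- C..C} c * B \<rho> c \<le> tent C c * B \<rho> c" for c
        using tent_props(1,3)[OF C, of c] B_nonneg[OF \<rho>(1), of c]
        by (intro mult_right_mono) (cases "c \<in> {- C..C}"; simp add: abs_le_iff)
      show "0 \<le> tent C c * B \<rho> c" for c
        using tent_props(1)[OF C, of c] B_nonneg[OF \<rho>(1), of c] by simp
    qed
    also have "\<dots> \<le> 2 * \<rho> * 4 ^ n / C + 32 * C * k ^ n * (A * \<rho> powr (- \<alpha>))"
      by (rule integral_tent_B_le[OF \<rho>(1) assms(3) S])
    also have "\<dots> \<le> 2 / C * \<rho> powr (2 * sig - \<alpha>) + 32 * C * (1 / k) * A * \<rho> powr (2 * sig - \<alpha>)"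
    proof (rule add_mono)
      have "4 ^ n = exp (real n * ln 4)" by (simp add: exp_of_nat_mult)
      also have "\<dots> \<le> exp (y * ln 4)" using n(1) by simp
      finally have "\<rho> * 4 ^ n \<le> \<rho> * exp (y * ln 4)" using \<rho> by simp
      also have "\<dots> = exp (y * ln 4 - y * ln 16)"
        unfolding \<rho>_eq by (simp add: exp_diff exp_minus field_simps)
      also have "\<dots> = exp ((1 / 2) * (- y * ln 16))" by (simp add: ln16 ln4)
      also have "\<dots> = \<rho> powr (1 / 2)" using \<rho> by (simp add: powr_def \<rho>_eq)
      also have "\<dots> \<le> \<rho> powr (2 * sig - \<alpha>)"
        using \<rho> sig_le assms(2) by (intro powr_mono') auto
      finally have "2 / C * (\<rho> * 4 ^ n) \<le> 2 / C * \<rho> powr (2 * sig - \<alpha>)"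
        using C by (intro mult_left_mono) auto
      then show "2 * \<rho> * 4 ^ n / C \<le> 2 / C * \<rho> powr (2 * sig - \<alpha>)" by (simp add: mult_ac)
    next
      have "k ^ n = exp (real n * ln k)" using k_pos by (simp add: exp_of_nat_mult)
      also have "\<dots> \<le> exp ((y - 1) * ln k)" using n(2) k_pos k_lt by simp
      also have "\<dots> = 1 / k * exp (y * ln k)" using k_pos by (simp add: left_diff_distrib exp_diff)
      also have "exp (y * ln k) = \<rho> powr (2 * sig)"
        using \<rho> k_pos by (simp add: powr_def \<rho>_eq sig_def ln16 ln_div)
      finally have "k ^ n \<le> 1 / k * \<rho> powr (2 * sig)" .
      then have "32 * C * k ^ n * (A * \<rho> powr (- \<alpha>)) \<le> 32 * C * (1 / k * \<rho> powr (2 * sig)) * (A * \<rho> powr (- \<alpha>))"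
        using C A(1) by (intro mult_right_mono mult_left_mono) auto
      also have "\<dots> = 32 * C * (1 / k) * A * (\<rho> powr (2 * sig) * \<rho> powr (- \<alpha>))" by (simp only: mult_ac)
      also have "\<rho> powr (2 * sig) * \<rho> powr (- \<alpha>) = \<rho> powr (2 * sig - \<alpha>)"
        by (simp add: powr_add[symmetric])
      finally show "32 * C * k ^ n * (A * \<rho> powr (- \<alpha>)) \<le> 32 * C * (1 / k) * A * \<rho> powr (2 * sig - \<alpha>)" .
    qed
    also have "\<dots> = K * \<rho> powr (2 * sig - \<alpha>)" by (simp add: K_def algebra_simps)
    finally show ?thesis .
  qed
  moreover have "0 \<le> K" using C k_pos A(1) by (simp add: K_def)
  ultimately show ?thesis using that by blast
qed

text \<open>The energy of the law smoothed at a single scale; \<open>BN\<close> is its increment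
  between the scales \<open>r\<close> and \<open>2 * r\<close>.\<close>

definition GN :: "nat \<Rightarrow> real \<Rightarrow> real \<Rightarrow> real" where
  "GN N r c = (\<Sum>w\<in>words N. \<Sum>w'\<in>words N. tri r (tv c w - tv c w')) / 4 ^ N"

lemma GN_le: "0 < r \<Longrightarrow> GN N r c \<le> 1 / r"
proof -
  assume "0 < r"
  then have "\<bar>GN N r c\<bar> \<le> 1 / r" unfolding GN_def
    by (intro sum_words_abs_le) (simp add: tri_nonneg tri_le)
  then show ?thesis by simp
qed

lemma GN_telescope: "GN N r c = GN N (2 ^ J * r) c + (\<Sum>i<J. BN N (2 ^ i * r) c)"
proof (induction J)
  case (Suc J)
  have "GN N (2 ^ J * r) c = GN N (2 * (2 ^ J * r)) c + BN N (2 ^ J * r) c"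
    unfolding GN_def BN_def haar_def by (simp add: sum_subtractf diff_divide_distrib)
  then show ?case using Suc by (simp add: mult.assoc)
qed simp

text \<open>The triangle kernel at a scale \<open>r0\<close> comparable to \<open>g ^ n\<close>
  counts near pairs, and its energy telescopes into \<open>BN\<close> at doubled scales until scale
  1 is reached. As \<open>2 * g > 1\<close>, at most \<open>n\<close> doublings are needed, so the
  increments cost no more than a factor linear in \<open>n\<close>.\<close>

lemma near_mass_le:
  assumes "1 / (1 - k) \<le> C" "\<bar>t\<bar> \<le> C" "1 \<le> R" "1 \<le> A" "0 \<le> \<alpha>"
    and A: "\<And>r. 0 < r \<Longrightarrow> r \<le> 1 \<Longrightarrow> B r t \<le> A * r powr (- \<alpha>)"
  shows "(\<Sum>w\<in>words n. nb R n t w) \<le> 4 * (R + 2 * Yb C) * (1 + real n * A) * (g ^ n) powr (- \<alpha>) / k ^ n"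
proof -
  have C: "0 < C" using assms(1) k_lt by (smt (verit) divide_pos_pos)
  define R' where "R' = R + 2 * Yb C"
  have R': "1 \<le> R'" using assms(3) Yb_nonneg[of C] C by (simp add: R'_def)
  have gn: "0 < g ^ n" "g ^ n \<le> 1" using g_pos g_lt by (auto intro: power_le_one)
  \<comment> \<open>Continuations of two near words stay within \<open>r0 / 2\<close> of each other,
    where \<open>tri r0\<close> is at least \<open>1 / (2 * r0)\<close>.\<close>
  define r0 where "r0 = 2 * R' * g ^ n"
  have r0: "2 * g ^ n \<le> r0" "0 < r0" using R' gn by (auto simp: r0_def)
  have "\<exists>J. 1 \<le> 2 ^ J * r0"
  proof -
    obtain J where "1 / r0 < 2 ^ J" using real_arch_pow[of 2 "1 / r0"] by auto
    then have "1 \<le> 2 ^ J * r0" using r0 by (simp add: field_simps)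
    then show ?thesis by blast
  qed
  define J where "J = (LEAST J. 1 \<le> 2 ^ J * r0)"
  have J1: "1 \<le> 2 ^ J * r0" unfolding J_def by (rule LeastI_ex) fact
  have J2: "2 ^ i * r0 < 1" if "i < J" for i
    using not_less_Least[of i "\<lambda>J. 1 \<le> 2 ^ J * r0"] that unfolding J_def by auto
  have Jn: "J \<le> n"
  proof (rule ccontr)
    assume "\<not> J \<le> n"
    then have *: "2 ^ n * r0 < 1" using J2 by simp
    have "1 \<le> (2 * g) ^ n" using g_gt by (intro one_le_power) auto
    then have "1 \<le> 2 ^ n * g ^ n" by (simp add: power_mult_distrib)
    also have "\<dots> \<le> 2 ^ n * r0" using r0(1) gn by (intro mult_left_mono) auto
    finally show False using * by simp
  qed
  have le: "(\<Sum>w\<in>words n. nb R n t w) \<le> 2 ^ n * (2 * r0 * (1 + (\<Sum>i<J. BN (n + N) (2 ^ i * r0) t)))" for N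
  proof -
    have one: "(if near R n t w w' then 1 else 0) * 4 ^ N
        \<le> 2 * r0 * (\<Sum>v\<in>words N. \<Sum>v'\<in>words N. tri r0 (tv t (w @ v) - tv t (w' @ v')))"
      if w: "w \<in> words n" "w' \<in> words n" for w w'
    proof (cases "near R n t w w'")
      case True
      have "1 \<le> 2 * r0 * tri r0 (tv t (w @ v) - tv t (w' @ v'))" for v v'
      proof -
        have "\<bar>g ^ n * tv (slope t w) v\<bar> \<le> g ^ n * Yb C" "\<bar>g ^ n * tv (slope t w') v'\<bar> \<le> g ^ n * Yb C"
          using gn abs_tv_le[OF assms(1) abs_slope_le[OF assms(1,2)]] by (simp_all add: abs_mult)
        moreover have "tv t (w @ v) = tv t w + g ^ n * tv (slope t w) v" "tv t (w' @ v') = tv t w' + g ^ n * tv (slope t w') v'"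
          using w by (simp_all add: tv_append words_def)
        moreover have "\<bar>tv t w - tv t w'\<bar> \<le> R * g ^ n" using True by (simp add: near_def)
        moreover have "r0 / 2 = R * g ^ n + 2 * (g ^ n * Yb C)"
          by (simp add: r0_def R'_def algebra_simps)
        ultimately have "\<bar>tv t (w @ v) - tv t (w' @ v')\<bar> \<le> r0 / 2"
          by linarith
        then have "1 / (2 * r0) \<le> tri r0 (tv t (w @ v) - tv t (w' @ v'))" by (intro tri_ge r0)
        then show ?thesis using r0(2) by (simp add: field_simps)
      qed
      then have "(\<Sum>v\<in>words N. \<Sum>v'\<in>words N. 1) \<le> (\<Sum>v\<in>words N. \<Sum>v'\<in>words N. 2 * r0 * tri r0 (tv t (w @ v) - tv t (w' @ v')))"
        by (intro sum_mono)
      then show ?thesis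
        using True by (simp add: card_words power_mult_distrib[symmetric] sum_distrib_left)
    next
      case False
      then show ?thesis using r0 by (simp add: sum_nonneg tri_nonneg)
    qed
    have "(\<Sum>w\<in>words n. nb R n t w) * 2 ^ n * 4 ^ N = (\<Sum>w\<in>words n. \<Sum>w'\<in>words n. (if near R n t w w' then 1 else 0) * 4 ^ N)"
      unfolding nb_def sum_distrib_right by (intro sum.cong refl) (simp add: sum.If_cases Int_def sum_distrib_right[symmetric])
    also have "\<dots> \<le> (\<Sum>w\<in>words n. \<Sum>w'\<in>words n. 2 * r0 * (\<Sum>v\<in>words N. \<Sum>v'\<in>words N. tri r0 (tv t (w @ v) - tv t (w' @ v'))))"
      by (intro sum_mono one)
    also have "\<dots> = 2 * r0 * (\<Sum>w\<in>words n. \<Sum>w'\<in>words n. \<Sum>v\<in>words N. \<Sum>v'\<in>words N. tri r0 (tv t (w @ v) - tv t (w' @ v')))"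
      by (simp only: sum_distrib_left)
    also have "(\<Sum>w\<in>words n. \<Sum>w'\<in>words n. \<Sum>v\<in>words N. \<Sum>v'\<in>words N. tri r0 (tv t (w @ v) - tv t (w' @ v')))
        = 4 ^ (n + N) * GN (n + N) r0 t"
    proof -
      have "(\<Sum>w\<in>words n. \<Sum>w'\<in>words n. \<Sum>v\<in>words N. \<Sum>v'\<in>words N. tri r0 (tv t (w @ v) - tv t (w' @ v')))
        = (\<Sum>w\<in>words (n + N). \<Sum>w'\<in>words (n + N). tri r0 (tv t w - tv t w'))"
        unfolding sum_words_add by (rule sum.cong[OF refl], rule sum.swap)
      then show ?thesis by (simp add: GN_def)
    qed
    also have "2 * r0 * (4 ^ (n + N) * GN (n + N) r0 t) \<le> 2 * r0 * (4 ^ (n + N) * (1 + (\<Sum>i<J. BN (n + N) (2 ^ i * r0) t)))"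
    proof -
      have "GN (n + N) (2 ^ J * r0) t \<le> 1 / (2 ^ J * r0)" using r0 by (intro GN_le) auto
      also have "\<dots> \<le> 1" using J1 r0 by simp
      finally show ?thesis
        using r0(2) GN_telescope[of "n + N" r0 t J] by (intro mult_left_mono) auto
    qed
    also have "\<dots> = (2 ^ n * (2 * r0 * (1 + (\<Sum>i<J. BN (n + N) (2 ^ i * r0) t)))) * (2 ^ n * 4 ^ N)"
    proof -
      have "(4::real) ^ n = 2 ^ n * 2 ^ n" by (simp add: power_mult_distrib[symmetric])
      then show ?thesis by (simp add: power_add)
    qed
    finally show ?thesis by (simp add: mult_ac)
  qed
  have "(\<lambda>N. 2 ^ n * (2 * r0 * (1 + (\<Sum>i<J. BN (n + N) (2 ^ i * r0) t))))
      \<longlonglongrightarrow> 2 ^ n * (2 * r0 * (1 + (\<Sum>i<J. B (2 ^ i * r0) t)))"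
  proof (intro tendsto_intros)
    fix i
    have "(\<lambda>N. BN (N + n) (2 ^ i * r0) t) \<longlonglongrightarrow> B (2 ^ i * r0) t"
      using r0 by (intro LIMSEQ_ignore_initial_segment BN_tendsto) auto
    then show "(\<lambda>N. BN (n + N) (2 ^ i * r0) t) \<longlonglongrightarrow> B (2 ^ i * r0) t" by (simp add: add.commute)
  qed
  then have "(\<Sum>w\<in>words n. nb R n t w) \<le> 2 ^ n * (2 * r0 * (1 + (\<Sum>i<J. B (2 ^ i * r0) t)))"
    using le by (elim LIMSEQ_le_const) blast
  also have "\<dots> \<le> 2 ^ n * (2 * r0 * ((1 + real n * A) * (g ^ n) powr (- \<alpha>)))"
  proof (intro mult_left_mono)
    have one: "1 \<le> (g ^ n) powr (- \<alpha>)"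
    proof -
      have "(g ^ n) powr 0 \<le> (g ^ n) powr (- \<alpha>)" using gn assms(5) by (intro powr_mono') auto
      then show ?thesis using g_pos by simp
    qed
    have "(\<Sum>i<J. B (2 ^ i * r0) t) \<le> (\<Sum>i<J. A * (g ^ n) powr (- \<alpha>))"
    proof (intro sum_mono)
      fix i assume "i \<in> {..<J}"
      then have *: "0 < 2 ^ i * r0" "2 ^ i * r0 \<le> 1" using J2[of i] r0 by auto
      have "1 * g ^ n \<le> 2 ^ i * r0" using r0 gn by (intro mult_mono) auto
      then have "(2 ^ i * r0) powr (- \<alpha>) \<le> (g ^ n) powr (- \<alpha>)"
        using gn assms(5) by (intro powr_mono2') auto
      then show "B (2 ^ i * r0) t \<le> A * (g ^ n) powr (- \<alpha>)"
        using assms(4) by (intro order_trans[OF A[OF *]] mult_left_mono) auto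
    qed
    also have "\<dots> = real J * (A * (g ^ n) powr (- \<alpha>))" by simp
    also have "\<dots> \<le> real n * (A * (g ^ n) powr (- \<alpha>))"
      using Jn assms(4) by (intro mult_right_mono) auto
    finally show "1 + (\<Sum>i<J. B (2 ^ i * r0) t) \<le> (1 + real n * A) * (g ^ n) powr (- \<alpha>)"
      using one by (simp add: algebra_simps)
  qed (use r0 in auto)
  also have "\<dots> = 4 * (R + 2 * Yb C) * (1 + real n * A) * (g ^ n) powr (- \<alpha>) / k ^ n"
  proof -
    have "1 / k ^ n = 2 ^ n * g ^ n" using g_pos by (simp add: k_eq power_divide power_mult_distrib)
    then have E: "x / k ^ n = x * (2 ^ n * g ^ n)" for x
      by (simp only: divide_inverse mult_1)
    show ?thesis unfolding E R'_def[symmetric] r0_def by (simp add: mult_ac)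
  qed
  finally show ?thesis .
qed

end

section \<open>Unrolling the energy over product weights\<close>

lemma wt_append:
  "length u = L * length ts \<Longrightarrow> wt L (ts @ us) (u @ v) = wt L ts u * wt L us v"
proof (induction ts arbitrary: u)
  case (Cons \<omega> ts)
  then have "L \<le> length u" "length (drop L u) = L * length ts" by auto
  then show ?case using Cons.IH[of "drop L u"] by simp
qed simp

abbreviation reversed :: "(bool list \<Rightarrow> real) list \<Rightarrow> (bool list \<Rightarrow> real) list" where
  "reversed ts \<equiv> rev (map (\<lambda>\<omega>. \<omega> \<circ> rev) ts)"

lemma wt_reversed: "length h = L * length ts \<Longrightarrow> wt L (reversed ts) (rev h) = wt L ts h"
proof (induction ts arbitrary: h)
  case (Cons \<omega> ts)
  have L: "length (take L h) = L" "length (drop L h) = L * length ts" using Cons.prems by auto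
  have "rev h = rev (drop L h) @ rev (take L h)"
    by (metis append_take_drop_id rev_append)
  then have "wt L (reversed (\<omega> # ts)) (rev h) = wt L (reversed ts @ [\<omega> \<circ> rev]) (rev (drop L h) @ rev (take L h))"
    by simp
  also have "\<dots> = wt L (reversed ts) (rev (drop L h)) * wt L [\<omega> \<circ> rev] (rev (take L h))"
    using L by (intro wt_append) simp
  also have "\<dots> = wt L ts (drop L h) * \<omega> (take L h)"
    by (simp only: Cons.IH[OF L(2)]) (use L(1) in simp)
  finally show ?case by (simp add: o_def mult.commute)
qed simp

lemma sum_words_rev: "(\<Sum>h\<in>words n. f (rev h)) = (\<Sum>h\<in>words n. f h)"
  by (rule sum.reindex_bij_witness[of _ rev rev]) (auto simp: words_def)

lemma wsum2_reversed: "wsum2 L ts K = wsum2 L (reversed ts) (\<lambda>h h'. K (rev h) (rev h'))"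
proof -
  have "wsum2 L ts K = (\<Sum>h\<in>words (L * length ts). \<Sum>h'\<in>words (L * length ts).
      wt L ts (rev h) * wt L ts (rev h') * K (rev h) (rev h'))"
    unfolding wsum2_def
    by (subst sum_words_rev[symmetric], rule sum.cong[OF refl], rule sum_words_rev[symmetric])
  also have "\<dots> = wsum2 L (reversed ts) (\<lambda>h h'. K (rev h) (rev h'))"
  proof -
    have "wt L ts (rev h) = wt L (reversed ts) h" if "h \<in> words (L * length ts)" for h
      using wt_reversed[of "rev h" L ts] that by (simp add: words_def)
    then show ?thesis unfolding wsum2_def by (intro sum.cong) auto
  qed
  finally show ?thesis .
qed

lemma sum_lists_Suc:
  assumes "finite \<Omega>"
  shows "(\<Sum>ts | set ts \<subseteq> \<Omega> \<and> length ts = Suc m. f ts) = (\<Sum>\<omega>\<in>\<Omega>. \<Sum>ts | set ts \<subseteq> \<Omega> \<and> length ts = m. f (\<omega> # ts))"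
proof -
  have inj: "inj_on (\<lambda>(\<omega>, ts). \<omega> # ts) (\<Omega> \<times> {ts. set ts \<subseteq> \<Omega> \<and> length ts = m})"
    by (auto simp: inj_on_def)
  have "{ts. set ts \<subseteq> \<Omega> \<and> length ts = Suc m} = (\<lambda>(\<omega>, ts). \<omega> # ts) ` (\<Omega> \<times> {ts. set ts \<subseteq> \<Omega> \<and> length ts = m})"
    by (auto simp: length_Suc_conv image_iff)
  then have "(\<Sum>ts | set ts \<subseteq> \<Omega> \<and> length ts = Suc m. f ts) = (\<Sum>(\<omega>, ts)\<in>\<Omega> \<times> {ts. set ts \<subseteq> \<Omega> \<and> length ts = m}. f (\<omega> # ts))"
    using sum.reindex[OF inj, of f] by (simp add: case_prod_unfold o_def)
  then show ?thesis by (simp add: sum.cartesian_product)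
qed

context walk
begin

definition coll_slope :: "nat \<Rightarrow> (bool list \<Rightarrow> real) list \<Rightarrow> real \<Rightarrow> real \<Rightarrow> real" where
  "coll_slope L ts c \<delta> = wsum2 L ts (\<lambda>h h'. of_bool (\<bar>slope c h - slope c h'\<bar> \<le> \<delta>))"

text \<open>The starting slope contributes the same amount to all words of one length and cancels,
  so only the sign polynomials themselves are compared.\<close>

lemma coll_slope_eq: "coll_slope L ts c \<delta> = coll L (reversed ts) 1 k \<delta>"
proof -
  have "coll_slope L ts c \<delta> = wsum2 L (reversed ts) (\<lambda>h h'. of_bool (\<bar>slope c (rev h) - slope c (rev h')\<bar> \<le> \<delta>))"
    unfolding coll_slope_def by (rule wsum2_reversed)
  also have "\<dots> = coll L (reversed ts) 1 k \<delta>"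
    unfolding coll_def wsum2_def
    by (intro sum.cong refl) (auto simp: words_def slope_eq_jet)
  finally show ?thesis .
qed

text \<open>
  The slope \<open>t\<close> is a grid point near the true slope \<open>c\<close>. Since the walk contracts slopes, it may follow
  its own orbit through all \<open>s\<close> blocks, so the number of different weights does not depend on \<open>s\<close>.
\<close>

primrec om :: "real \<Rightarrow> nat \<Rightarrow> nat \<Rightarrow> real \<Rightarrow> bool list \<Rightarrow> real" where
  "om R n 0 t h = (if h = [] then 1 else 0)"
| "om R n (Suc s) t h = (if length h = n * Suc s then nb R n t (take n h) * om R n s (slope t (take n h)) (drop n h) else 0)"

lemma nb_dyadic: "\<exists>c\<le>2 ^ n. nb R n t w = real c / 2 ^ n"
proof (intro exI conjI)
  have "card {w' \<in> words n. near R n t w w'} \<le> card (words n)" by (intro card_mono) auto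
  then show "card {w' \<in> words n. near R n t w w'} \<le> 2 ^ n" by (simp add: card_words)
qed (simp add: nb_def)

lemma nb_nonneg: "0 \<le> nb R n t w"
  by (simp add: nb_def)

lemma om_dyadic: "om R n s t \<in> dyadic_weights (n * s)"
proof (induction s arbitrary: t)
  case 0
  have "om R n 0 t w \<in> (\<lambda>c. real c / 2 ^ (n * 0)) ` {..2 ^ (n * 0)}" for w
    by (auto simp: image_iff intro: bexI[of _ 0] bexI[of _ 1])
  then show ?case by (auto simp: dyadic_weights_def)
next
  case (Suc s)
  have "om R n (Suc s) t w \<in> (\<lambda>c. real c / 2 ^ (n * Suc s)) ` {..2 ^ (n * Suc s)}" if w: "w \<in> words (n * Suc s)" for w
  proof -
    have "drop n w \<in> words (n * s)" using w by (auto simp: words_def)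
    then obtain d :: nat where d: "d \<le> 2 ^ (n * s)" "om R n s (slope t (take n w)) (drop n w) = real d / 2 ^ (n * s)"
      using Suc[of "slope t (take n w)"] by (auto simp: dyadic_weights_def)
    obtain c :: nat where c: "c \<le> 2 ^ n" "nb R n t (take n w) = real c / 2 ^ n"
      using nb_dyadic[of n R t "take n w"] by (elim exE conjE)
    have "c * d \<le> 2 ^ (n * Suc s)" using mult_le_mono[OF c(1) d(1)] by (simp add: power_add)
    moreover have "om R n (Suc s) t w = real (c * d) / 2 ^ (n * Suc s)"
      using w c(2) d(2) by (simp add: words_def power_add)
    ultimately show ?thesis by blast
  qed
  moreover have "om R n (Suc s) t w = 0" if "w \<notin> words (n * Suc s)" for w
    using that by (auto simp: words_def)
  ultimately show ?case unfolding dyadic_weights_def by blast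
qed

lemma om_nonneg: "0 \<le> om R n s t h"
  using dyadic_weights_bounds[OF om_dyadic] by blast

lemma sum_om_Suc:
  "(\<Sum>h\<in>words (n * Suc s). om R n (Suc s) t h * F h)
    = (\<Sum>w\<in>words n. nb R n t w * (\<Sum>u\<in>words (n * s). om R n s (slope t w) u * F (w @ u)))"
proof -
  have "(\<Sum>h\<in>words (n * Suc s). om R n (Suc s) t h * F h)
      = (\<Sum>w\<in>words n. \<Sum>u\<in>words (n * s). om R n (Suc s) t (w @ u) * F (w @ u))"
    using sum_words_add[of "\<lambda>h. om R n (Suc s) t h * F h" n "n * s"] by simp
  also have "\<dots> = (\<Sum>w\<in>words n. nb R n t w * (\<Sum>u\<in>words (n * s). om R n s (slope t w) u * F (w @ u)))"
    unfolding sum_distrib_left by (intro sum.cong refl) (auto simp: words_def)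
  finally show ?thesis .
qed

lemma om_mass_le:
  assumes "1 / (1 - k) \<le> C" "\<And>t. \<bar>t\<bar> \<le> C \<Longrightarrow> (\<Sum>w\<in>words n. nb R n t w) \<le> W" "0 \<le> W"
  shows "\<bar>t\<bar> \<le> C \<Longrightarrow> (\<Sum>h\<in>words (n * s). om R n s t h) \<le> W ^ s"
proof (induction s arbitrary: t)
  case (Suc s)
  have "(\<Sum>h\<in>words (n * Suc s). om R n (Suc s) t h)
      = (\<Sum>w\<in>words n. nb R n t w * (\<Sum>u\<in>words (n * s). om R n s (slope t w) u))"
    using sum_om_Suc[of R n s t "\<lambda>_. 1"] by simp
  also have "\<dots> \<le> (\<Sum>w\<in>words n. nb R n t w * W ^ s)"
    using Suc.IH[OF abs_slope_le[OF assms(1) Suc.prems]] by (intro sum_mono mult_left_mono nb_nonneg)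
  also have "\<dots> = (\<Sum>w\<in>words n. nb R n t w) * W ^ s" by (simp add: sum_distrib_right)
  also have "\<dots> \<le> W * W ^ s" using assms(3) Suc.prems by (intro mult_right_mono assms(2)) auto
  finally show ?case by simp
qed simp

text \<open>Iterates \<open>B_renormalize\<close> with \<open>t\<close> following the same letters
  as \<open>c\<close>. Their distance shrinks by \<open>k ^ n\<close> per block and stays below
  \<open>g ^ n\<close>, so one grid point serves the whole superblock.\<close>

lemma B_superblock:
  assumes "1 / (1 - k) \<le> C"
  shows "0 < r \<Longrightarrow> 2 * r \<le> g ^ (n * s) \<Longrightarrow> \<bar>c\<bar> \<le> C \<Longrightarrow> \<bar>c - t\<bar> \<le> g ^ n \<Longrightarrow>
    B r c \<le> k ^ (n * s) * (\<Sum>h\<in>words (n * s). om (2 * Yb C + 3) n s t h * B (r / g ^ (n * s)) (slope c h))"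
proof (induction s arbitrary: r c t)
  case (Suc s)
  let ?R = "2 * Yb C + 3"
  have gn: "0 < g ^ n" "g ^ n \<le> 1" "g ^ (n * s) \<le> 1" using g_pos g_lt by (auto intro: power_le_one)
  have r': "0 < r / g ^ n" "2 * (r / g ^ n) \<le> g ^ (n * s)"
    using Suc.prems(1,2) gn by (auto simp: power_add field_simps)
  have r2: "2 * r \<le> g ^ n"
  proof -
    have "g ^ n * g ^ (n * s) \<le> g ^ n * 1" using gn by (intro mult_left_mono) auto
    then show ?thesis using Suc.prems(2) by (simp add: power_add)
  qed
  have "B r c \<le> k ^ n * (\<Sum>w\<in>words n. nb ?R n t w * B (r / g ^ n) (slope c w))"
    by (rule B_renormalize[OF Suc.prems(1) r2 assms Suc.prems(3,4)])
  also have "\<dots> \<le> k ^ n * (\<Sum>w\<in>words n. nb ?R n t w * (k ^ (n * s) *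
      (\<Sum>u\<in>words (n * s). om ?R n s (slope t w) u * B (r / g ^ n / g ^ (n * s)) (slope (slope c w) u))))"
  proof (intro mult_left_mono sum_mono nb_nonneg)
    fix w assume w: "w \<in> words n"
    have "\<bar>slope c w - slope t w\<bar> = k ^ n * \<bar>c - t\<bar>"
      using w k_pos by (simp add: slope_diff words_def abs_mult)
    also have "\<dots> \<le> 1 * g ^ n"
      using k_pos k_lt Suc.prems(4) by (intro mult_mono power_le_one) auto
    finally show "B (r / g ^ n) (slope c w) \<le> k ^ (n * s) *
      (\<Sum>u\<in>words (n * s). om ?R n s (slope t w) u * B (r / g ^ n / g ^ (n * s)) (slope (slope c w) u))"
      by (intro Suc.IH[OF r'] abs_slope_le assms Suc.prems) simp
  qed (use k_pos in simp)
  also have "\<dots> = k ^ (n * Suc s) * (\<Sum>w\<in>words n. nb ?R n t w *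
      (\<Sum>u\<in>words (n * s). om ?R n s (slope t w) u * B (r / g ^ (n * Suc s)) (slope c (w @ u))))"
    by (simp add: slope_append power_add sum_distrib_left mult_ac)
  finally show ?case unfolding sum_om_Suc .
qed simp

text \<open>The weight of a superblock depends on the slope reached before it. Summing over all
  weights in \<open>\<Omega>\<close> removes this dependence and leaves genuine product weights, to
  which collision bounds apply.\<close>

lemma B_unroll:
  fixes n s :: nat
  defines "L \<equiv> n * s"
  assumes "1 / (1 - k) \<le> C" "finite \<Omega>" and cover: "\<And>c. \<bar>c\<bar> \<le> C \<Longrightarrow> \<exists>t. \<bar>c - t\<bar> \<le> g ^ n \<and> om (2 * Yb C + 3) n s t \<in> \<Omega>"
    and nonneg: "\<And>\<omega> h. \<omega> \<in> \<Omega> \<Longrightarrow> 0 \<le> \<omega> h"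
  shows "0 < r \<Longrightarrow> 2 * r \<le> g ^ (L * m) \<Longrightarrow> \<bar>c\<bar> \<le> C \<Longrightarrow>
    B r c \<le> k ^ (L * m) * (\<Sum>ts | set ts \<subseteq> \<Omega> \<and> length ts = m. wsum L ts (\<lambda>h. B (r / g ^ (L * m)) (slope c h)))"
proof (induction m arbitrary: r c)
  case 0
  have "{ts. set ts \<subseteq> \<Omega> \<and> length ts = 0} = {[]}" by auto
  then show ?case by simp
next
  case (Suc m)
  have gn: "0 < g ^ L" "g ^ L \<le> 1" "g ^ (L * m) \<le> 1" using g_pos g_lt by (auto intro: power_le_one)
  have r': "0 < r / g ^ L" "2 * (r / g ^ L) \<le> g ^ (L * m)"
    using Suc.prems(1,2) gn by (auto simp: power_add field_simps)
  have r2: "2 * r \<le> g ^ L"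
  proof -
    have "g ^ L * g ^ (L * m) \<le> g ^ L * 1" using gn by (intro mult_left_mono) auto
    then show ?thesis using Suc.prems(2) by (simp add: power_add)
  qed
  define E where "E h = (\<Sum>ts | set ts \<subseteq> \<Omega> \<and> length ts = m. wsum L ts (\<lambda>u. B (r / g ^ (L * Suc m)) (slope c (h @ u))))" for h
  have E0: "0 \<le> E h" for h
    unfolding E_def wsum_def using Suc.prems(1) g_pos
    by (intro sum_nonneg mult_nonneg_nonneg wt_nonneg B_nonneg nonneg) (auto simp: subset_eq)
  obtain t where t: "\<bar>c - t\<bar> \<le> g ^ n" "om (2 * Yb C + 3) n s t \<in> \<Omega>"
    using cover[OF Suc.prems(3)] by (elim exE conjE)
  have "B r c \<le> k ^ L * (\<Sum>h\<in>words L. om (2 * Yb C + 3) n s t h * B (r / g ^ L) (slope c h))"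
    using B_superblock[OF assms(2) Suc.prems(1) _ Suc.prems(3) t(1), of s] r2 by (simp add: L_def)
  also have "\<dots> \<le> k ^ L * (\<Sum>h\<in>words L. om (2 * Yb C + 3) n s t h * (k ^ (L * m) * E h))"
  proof (intro mult_left_mono sum_mono om_nonneg)
    fix h
    have "B (r / g ^ L) (slope c h) \<le> k ^ (L * m) * (\<Sum>ts | set ts \<subseteq> \<Omega> \<and> length ts = m.
        wsum L ts (\<lambda>u. B (r / g ^ L / g ^ (L * m)) (slope (slope c h) u)))"
      by (intro Suc.IH[OF r'] abs_slope_le assms Suc.prems)
    then show "B (r / g ^ L) (slope c h) \<le> k ^ (L * m) * E h"
      by (simp add: E_def slope_append power_add mult_ac)
  qed (use k_pos in simp)
  also have "\<dots> = k ^ (L * Suc m) * (\<Sum>h\<in>words L. om (2 * Yb C + 3) n s t h * E h)"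
    by (simp add: power_add sum_distrib_left mult_ac)
  also have "\<dots> \<le> k ^ (L * Suc m) * (\<Sum>\<omega>\<in>\<Omega>. \<Sum>h\<in>words L. \<omega> h * E h)"
    using k_pos E0 nonneg t(2) assms(3)
    by (intro mult_left_mono member_le_sum[of _ _ "\<lambda>\<omega>. \<Sum>h\<in>words L. \<omega> h * E h"]) (auto intro!: sum_nonneg)
  also have "(\<Sum>\<omega>\<in>\<Omega>. \<Sum>h\<in>words L. \<omega> h * E h)
      = (\<Sum>\<omega>\<in>\<Omega>. \<Sum>ts | set ts \<subseteq> \<Omega> \<and> length ts = m. wsum L (\<omega> # ts) (\<lambda>h. B (r / g ^ (L * Suc m)) (slope c h)))"
    unfolding E_def wsum_Cons sum_distrib_left by (rule sum.cong[OF refl], rule sum.swap)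
  finally show ?case unfolding sum_lists_Suc[OF assms(3)] .
qed

text \<open>A grid of spacing \<open>g ^ n\<close> on the slopes. Its size does not depend on the
  number \<open>s\<close> of blocks, so the cost of choosing a weight per superblock becomes
  negligible for large \<open>s\<close>.\<close>

lemma om_cover:
  assumes "0 < C"
  obtains \<Omega> where "finite \<Omega>" "\<Omega> \<noteq> {}" "real (card \<Omega>) \<le> 2 * (C / g ^ n) + 5" "\<Omega> \<subseteq> om R n s ` {- C - 1..C + 1}"
    "\<And>c. \<bar>c\<bar> \<le> C \<Longrightarrow> \<exists>t. \<bar>c - t\<bar> \<le> g ^ n \<and> om R n s t \<in> \<Omega>"
proof -
  have gn: "0 < g ^ n" "g ^ n \<le> 1" using g_pos g_lt by (auto intro: power_le_one)
  define N where "N = \<lfloor>C / g ^ n\<rfloor>"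
  have N0: "0 \<le> N" using gn assms by (simp add: N_def)
  have N1: "real_of_int N * g ^ n \<le> C" using gn unfolding N_def by (simp add: pos_le_divide_eq[symmetric])
  define \<Omega> where "\<Omega> = (\<lambda>i. om R n s (real_of_int i * g ^ n)) ` {- N - 1..N}"
  have "card \<Omega> \<le> card {- N - 1..N}" unfolding \<Omega>_def by (rule card_image_le) simp
  also have "\<dots> = nat (2 * N + 2)" by simp
  finally have "real (card \<Omega>) \<le> 2 * real_of_int N + 2" using N0 by linarith
  moreover have "real_of_int N \<le> C / g ^ n" by (simp add: N_def)
  ultimately have 1: "real (card \<Omega>) \<le> 2 * (C / g ^ n) + 5" by linarith
  have 2: "\<Omega> \<subseteq> om R n s ` {- C - 1..C + 1}"
  proof
    fix \<omega> assume "\<omega> \<in> \<Omega>"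
    then obtain i where i: "- N - 1 \<le> i" "i \<le> N" "\<omega> = om R n s (real_of_int i * g ^ n)" by (auto simp: \<Omega>_def)
    have "real_of_int i * g ^ n \<le> real_of_int N * g ^ n" using i(2) gn by (intro mult_right_mono) auto
    moreover have "(- real_of_int N - 1) * g ^ n \<le> real_of_int i * g ^ n" using i(1) gn by (intro mult_right_mono) linarith+
    moreover have "(- real_of_int N - 1) * g ^ n = - (real_of_int N * g ^ n) - g ^ n" by (simp add: left_diff_distrib)
    ultimately have "real_of_int i * g ^ n \<in> {- C - 1..C + 1}"
      using N1 gn unfolding atLeastAtMost_iff by linarith
    then show "\<omega> \<in> om R n s ` {- C - 1..C + 1}" using i(3) by blast
  qed
  have 3: "\<exists>t. \<bar>c - t\<bar> \<le> g ^ n \<and> om R n s t \<in> \<Omega>" if c: "\<bar>c\<bar> \<le> C" for c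
  proof (intro exI conjI)
    define i where "i = \<lfloor>c / g ^ n\<rfloor>"
    have i: "real_of_int i \<le> c / g ^ n" "c / g ^ n < real_of_int i + 1" unfolding i_def by linarith+
    then have i': "real_of_int i * g ^ n \<le> c" "c < (real_of_int i + 1) * g ^ n"
      using gn by (auto simp: pos_le_divide_eq pos_divide_less_eq)
    then show "\<bar>c - real_of_int i * g ^ n\<bar> \<le> g ^ n" by (simp add: distrib_right)
    have "\<bar>c / g ^ n\<bar> \<le> C / g ^ n"
      using c gn by (simp add: abs_divide divide_right_mono)
    then have "c / g ^ n \<le> C / g ^ n" "- (C / g ^ n) \<le> c / g ^ n" by linarith+
    then have "i \<le> N" "- N - 1 \<le> i" unfolding N_def i_def by (auto intro: floor_mono) linarith
    then show "om R n s (real_of_int i * g ^ n) \<in> \<Omega>" by (auto simp: \<Omega>_def)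
  qed
  show ?thesis
    by (rule that[of \<Omega>]) (use 1 2 3 N0 in \<open>auto simp: \<Omega>_def\<close>)
qed

section \<open>The gain in the exponent\<close>

text \<open>By Lipschitz continuity \<open>B\<close> at a slope is nearly its mean over an interval
  of radius \<open>\<delta>\<close>; \<open>G\<close> is the distribution of the slopes smoothed at
  this radius. A weighted inequality of arithmetic and geometric means separates the factors:
  \<open>\<integral> b^2 \<le> S * \<integral> b\<close> uses the average over slopes, and
  \<open>\<integral> G^2\<close> is a collision sum.\<close>

lemma wsum_B_le:
  fixes L :: nat
  assumes C: "1 / (1 - k) \<le> C" "\<bar>c\<bar> \<le> C" and \<rho>: "0 < \<rho>" and \<delta>: "0 < \<delta>" "\<delta> \<le> 1" and \<tau>: "0 < \<tau>"
    and nonneg: "\<And>\<omega> h. \<omega> \<in> set ts \<Longrightarrow> 0 \<le> \<omega> h"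
    and S: "\<And>x. \<bar>x\<bar> \<le> C + 1 \<Longrightarrow> B \<rho> x \<le> S"
  shows "wsum L ts (\<lambda>h. B \<rho> (slope c h))
    \<le> (\<tau> * S * (\<integral>x. indicator {- (C + 1)..C + 1} x * B \<rho> x \<partial>lborel) + coll_slope L ts c (2 * \<delta>) / (2 * \<delta>) / \<tau>) / 2
      + 4 * \<delta> / \<rho>\<^sup>2 * wsum L ts (\<lambda>_. 1)"
proof -
  define b where "b x = indicator {- (C + 1)..C + 1} x * B \<rho> x" for x
  define J where "J h = {slope c h - \<delta>..slope c h + \<delta>}" for h
  define I where "I h x = (indicator (J h) x :: real)" for h x
  define G where "G x = wsum L ts (\<lambda>h. I h x) / (2 * \<delta>)" for x
  let ?W = "words (L * length ts)"
  have wt0: "0 \<le> wt L ts h" for h by (intro wt_nonneg nonneg)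
  have [measurable]: "(\<lambda>x. B \<rho> x) \<in> borel_measurable borel" by (rule borel_measurable_B[OF \<rho>])
  have b_meas [measurable]: "b \<in> borel_measurable borel" unfolding b_def by measurable
  have b0: "0 \<le> b x" for x using B_nonneg[OF \<rho>] by (simp add: b_def)
  have bS: "b x \<le> S" for x
  proof -
    have "0 \<le> S" using S[of c] C(2) B_nonneg[OF \<rho>, of c] by simp
    then show ?thesis using S[of x] unfolding b_def by (cases "x \<in> {- (C + 1)..C + 1}") (auto simp: abs_le_iff)
  qed
  have int_ind: "integrable lborel (\<lambda>x. indicator {u..v::real} x :: real)" for u v
    by (intro integrable_real_indicator) (simp_all add: emeasure_lborel_Icc_eq)
  have int_b: "integrable lborel b"
  proof (rule Bochner_Integration.integrable_bound[OF integrable_mult_left[OF int_ind[of "- (C + 1)" "C + 1"], of S]])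
    show "AE x in lborel. norm (b x) \<le> norm (indicator {- (C + 1)..C + 1} x * S)"
    proof (intro AE_I2)
      fix x show "norm (b x) \<le> norm (indicator {- (C + 1)..C + 1} x * S)"
        using b0[of x] bS[of x] by (cases "x \<in> {- (C + 1)..C + 1}") (simp_all add: b_def)
    qed
  qed simp
  have int_I: "integrable lborel (I h)" for h unfolding I_def J_def by (rule int_ind)
  have int_bI: "integrable lborel (\<lambda>x. b x * I h x)" for h
  proof (rule Bochner_Integration.integrable_bound[OF int_b])
    show "AE x in lborel. norm (b x * I h x) \<le> norm (b x)" by (intro AE_I2) (simp add: I_def indicator_def)
  qed (simp add: I_def J_def)
  have int_II: "integrable lborel (\<lambda>x. I h x * I h' x)" for h h'
  proof (rule Bochner_Integration.integrable_bound[OF int_I[of h]])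
    show "AE x in lborel. norm (I h x * I h' x) \<le> norm (I h x)" by (intro AE_I2) (simp add: I_def indicator_def)
  qed (simp add: I_def J_def)
  have II: "(\<integral>x. I h x * I h' x \<partial>lborel) \<le> 2 * \<delta> * of_bool (\<bar>slope c h - slope c h'\<bar> \<le> 2 * \<delta>)" for h h'
  proof (cases "\<bar>slope c h - slope c h'\<bar> \<le> 2 * \<delta>")
    case True
    have "(\<integral>x. I h x * I h' x \<partial>lborel) \<le> (\<integral>x. I h x \<partial>lborel)"
      by (intro integral_mono int_II int_I) (simp add: I_def indicator_def)
    also have "\<dots> = 2 * \<delta>" unfolding I_def J_def using \<delta>(1) by simp
    finally show ?thesis using True by simp
  next
    case False
    have "(\<lambda>x. I h x * I h' x) = (\<lambda>_. 0)"
      using False by (intro ext) (auto simp: I_def J_def indicator_def)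
    then show ?thesis using False by simp
  qed
  have point: "B \<rho> (slope c h) \<le> (\<integral>x. b x * I h x \<partial>lborel) / (2 * \<delta>) + 4 * \<delta> / \<rho>\<^sup>2" for h
  proof -
    have h: "\<bar>slope c h\<bar> \<le> C" by (rule abs_slope_le[OF C])
    have "(\<integral>x. I h x * (B \<rho> (slope c h) - 4 * \<delta> / \<rho>\<^sup>2) \<partial>lborel) \<le> (\<integral>x. b x * I h x \<partial>lborel)"
    proof (intro integral_mono int_bI integrable_mult_left int_I)
      fix x
      show "I h x * (B \<rho> (slope c h) - 4 * \<delta> / \<rho>\<^sup>2) \<le> b x * I h x"
      proof (cases "x \<in> J h")
        case True
        then have x: "\<bar>slope c h - x\<bar> \<le> \<delta>" "\<bar>x\<bar> \<le> C + 1" using h \<delta>(2) by (auto simp: J_def)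
        have "B \<rho> (slope c h) - B \<rho> x \<le> 4 * \<bar>slope c h - x\<bar> / \<rho>\<^sup>2" using B_lipschitz[OF \<rho>, of "slope c h" x] by linarith
        also have "\<dots> \<le> 4 * \<delta> / \<rho>\<^sup>2" using x(1) by (intro divide_right_mono) auto
        finally have "B \<rho> (slope c h) - 4 * \<delta> / \<rho>\<^sup>2 \<le> B \<rho> x" by simp
        moreover have "b x = B \<rho> x" using x(2) by (simp add: b_def abs_le_iff)
        ultimately show ?thesis using True by (simp add: I_def)
      qed (simp add: I_def)
    qed
    moreover have "(\<integral>x. I h x * (B \<rho> (slope c h) - 4 * \<delta> / \<rho>\<^sup>2) \<partial>lborel) = (2 * \<delta>) * (B \<rho> (slope c h) - 4 * \<delta> / \<rho>\<^sup>2)"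
      unfolding I_def J_def using \<delta>(1) by simp
    ultimately have "(2 * \<delta>) * (B \<rho> (slope c h) - 4 * \<delta> / \<rho>\<^sup>2) \<le> (\<integral>x. b x * I h x \<partial>lborel)"
      by (simp only:)
    moreover have "0 < 2 * \<delta>" using \<delta>(1) by simp
    ultimately have "B \<rho> (slope c h) - 4 * \<delta> / \<rho>\<^sup>2 \<le> (\<integral>x. b x * I h x \<partial>lborel) / (2 * \<delta>)"
      by (metis pos_le_divide_eq mult.commute)
    then show ?thesis by simp
  qed
  have GG: "G x * G x = (\<Sum>h\<in>?W. \<Sum>h'\<in>?W. wt L ts h * wt L ts h' * (I h x * I h' x)) / (2 * \<delta>)\<^sup>2" for x
    unfolding G_def wsum_def times_divide_times_eq sum_product power2_eq_square
    by (intro arg_cong2[where f = "(/)"] sum.cong refl) (simp add: mult_ac)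
  have int_GG: "integrable lborel (\<lambda>x. G x * G x)"
    unfolding GG by (intro integrable_divide_zero Bochner_Integration.integrable_sum integrable_mult_right int_II)
  have bG: "b x * G x = (\<Sum>h\<in>?W. wt L ts h * (b x * I h x)) / (2 * \<delta>)" for x
    by (simp add: G_def wsum_def sum_distrib_left mult_ac)
  have "wsum L ts (\<lambda>h. B \<rho> (slope c h)) \<le> wsum L ts (\<lambda>h. (\<integral>x. b x * I h x \<partial>lborel) / (2 * \<delta>) + 4 * \<delta> / \<rho>\<^sup>2)"
    by (intro wsum_mono nonneg point)
  also have "\<dots> = wsum L ts (\<lambda>h. (\<integral>x. b x * I h x \<partial>lborel) / (2 * \<delta>)) + 4 * \<delta> / \<rho>\<^sup>2 * wsum L ts (\<lambda>_. 1)"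
    unfolding wsum_const[symmetric] by (simp add: wsum_def sum.distrib distrib_left)
  also have "wsum L ts (\<lambda>h. (\<integral>x. b x * I h x \<partial>lborel) / (2 * \<delta>)) = (\<integral>x. b x * G x \<partial>lborel)"
      by (simp add: bG wsum_def Bochner_Integration.integral_sum integrable_mult_right int_bI sum_divide_distrib)
  also have "(\<integral>x. b x * G x \<partial>lborel) \<le> (\<integral>x. (\<tau> * S * b x + G x * G x / \<tau>) / 2 \<partial>lborel)"
  proof (rule integral_mono)
    show "integrable lborel (\<lambda>x. b x * G x)"
      unfolding bG by (intro integrable_divide_zero Bochner_Integration.integrable_sum integrable_mult_right int_bI)
    show "integrable lborel (\<lambda>x. (\<tau> * S * b x + G x * G x / \<tau>) / 2)"
      by (intro integrable_divide_zero Bochner_Integration.integrable_add integrable_mult_right int_b int_GG)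
    fix x
    have "0 \<le> (sqrt \<tau> * b x - G x / sqrt \<tau>)\<^sup>2" by simp
    also have "\<dots> = \<tau> * (b x * b x) + G x * G x / \<tau> - 2 * (b x * G x)"
      using \<tau> by (simp add: power2_diff power_mult_distrib power_divide power2_eq_square[symmetric])
    also have "\<dots> \<le> \<tau> * (S * b x) + G x * G x / \<tau> - 2 * (b x * G x)"
      using \<tau> b0[of x] bS[of x] by (intro add_mono diff_mono mult_left_mono mult_right_mono order_refl) auto
    finally show "b x * G x \<le> (\<tau> * S * b x + G x * G x / \<tau>) / 2" by (simp add: mult.assoc)
  qed
  also have "\<dots> = (\<tau> * S * (\<integral>x. b x \<partial>lborel) + (\<integral>x. G x * G x \<partial>lborel) / \<tau>) / 2"
    using int_b int_GG by simp
  also have "\<dots> \<le> (\<tau> * S * (\<integral>x. b x \<partial>lborel) + coll_slope L ts c (2 * \<delta>) / (2 * \<delta>) / \<tau>) / 2"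
  proof -
    have "(\<integral>x. G x * G x \<partial>lborel) = (\<Sum>h\<in>?W. \<Sum>h'\<in>?W. wt L ts h * wt L ts h' * (\<integral>x. I h x * I h' x \<partial>lborel)) / (2 * \<delta>)\<^sup>2"
      unfolding GG by (simp add: Bochner_Integration.integral_sum Bochner_Integration.integrable_sum integrable_mult_right int_II)
    also have "\<dots> \<le> (\<Sum>h\<in>?W. \<Sum>h'\<in>?W. wt L ts h * wt L ts h' * (2 * \<delta> * of_bool (\<bar>slope c h - slope c h'\<bar> \<le> 2 * \<delta>))) / (2 * \<delta>)\<^sup>2"
      by (intro divide_right_mono sum_mono mult_left_mono II mult_nonneg_nonneg wt0) simp
    also have "\<dots> = (2 * \<delta>) * coll_slope L ts c (2 * \<delta>) / (2 * \<delta>)\<^sup>2"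
      unfolding coll_slope_def wsum2_def by (simp only: sum_distrib_left mult_ac)
    also have "\<dots> = coll_slope L ts c (2 * \<delta>) / (2 * \<delta>)"
      using \<delta>(1) by (simp add: power2_eq_square)
    finally show ?thesis using \<tau> by (intro divide_right_mono add_left_mono) auto
  qed
  finally show ?thesis unfolding b_def by simp
qed

text \<open>After \<open>N\<close> letters the scale is \<open>\<rho> = r / g ^ N\<close>. The
  assumed pointwise bound, its average and the collision bound together improve the power of \<rho>
  by \<open>sig\<close> on each sequence of weights; \<open>P ^ m\<close> pays for the number of
  sequences.\<close>

lemma B_block_bound:
  fixes n s m :: nat and \<theta> :: real
  defines "L \<equiv> n * s"
  defines "N \<equiv> L * m"
  assumes C: "1 / (1 - k) \<le> C" "\<bar>c\<bar> \<le> C" and \<alpha>: "0 \<le> \<alpha>"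
    and A: "1 \<le> A" "\<And>r x. 0 < r \<Longrightarrow> r \<le> 1 \<Longrightarrow> \<bar>x\<bar> \<le> C + 1 \<Longrightarrow> B r x \<le> A * r powr (- \<alpha>)"
    and K: "0 \<le> K" "\<And>\<rho>. 0 < \<rho> \<Longrightarrow> \<rho> \<le> 1 \<Longrightarrow>
      (\<integral>x. indicator {- (C + 1)..C + 1} x * B \<rho> x \<partial>lborel) \<le> K * \<rho> powr (2 * sig - \<alpha>)"
    and \<Omega>: "finite \<Omega>" "real (card \<Omega>) \<le> P" "\<And>\<omega> h. \<omega> \<in> \<Omega> \<Longrightarrow> 0 \<le> \<omega> h"
      "\<And>c. \<bar>c\<bar> \<le> C \<Longrightarrow> \<exists>t. \<bar>c - t\<bar> \<le> g ^ n \<and> om (2 * Yb C + 3) n s t \<in> \<Omega>"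
    and W: "\<And>\<omega>. \<omega> \<in> \<Omega> \<Longrightarrow> (\<Sum>w\<in>words L. \<omega> w) \<le> W" "1 \<le> W"
    and \<theta>: "0 < \<theta>" "\<theta> \<le> 1" "\<theta> ^ N \<le> Z * (r / g ^ N) ^ 3"
    and Q: "0 \<le> Q" "\<And>ts. set ts \<subseteq> \<Omega> \<Longrightarrow> length ts = m \<Longrightarrow> coll_slope L ts c (\<theta> ^ N) \<le> Q * \<theta> ^ N * W ^ (2 * m)"
    and r: "0 < r" "2 * r \<le> g ^ N"
  shows "B r c \<le> k ^ N * (P ^ m * (W ^ m * ((A * K + Q) / 2 + 2 * Z) * (r / g ^ N) powr (sig - \<alpha>)))"
proof -
  define \<rho> where "\<rho> = r / g ^ N"
  define R where "R = \<rho> powr (sig - \<alpha>)"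
  have gN: "0 < g ^ N" using g_pos by simp
  have \<rho>: "0 < \<rho>" "\<rho> \<le> 1" using r gN by (auto simp: \<rho>_def field_simps)
  have R: "0 < R" using \<rho> by (simp add: R_def)
  have \<theta>N: "0 < \<theta> ^ N" "\<theta> ^ N \<le> 1" using \<theta>(1,2) by (auto intro: power_le_one)
  have Z: "0 \<le> Z"
  proof (rule ccontr)
    assume "\<not> 0 \<le> Z"
    then have "Z * \<rho> ^ 3 < 0" using \<rho> by (intro mult_neg_pos) auto
    then show False using \<theta>(3) \<theta>N unfolding \<rho>_def by linarith
  qed
  have main: "wsum L ts (\<lambda>h. B \<rho> (slope c h)) \<le> W ^ m * ((A * K + Q) / 2 + 2 * Z) * R"
    if ts: "set ts \<subseteq> \<Omega>" "length ts = m" for ts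
  proof -
    have nonneg: "0 \<le> \<omega> h" if "\<omega> \<in> set ts" for \<omega> h using ts(1) that by (intro \<Omega>(3)) auto
    \<comment> \<open>Balances the two terms: the average part is of order
      \<open>\<rho> powr (2 * sig - 2 * \<alpha>)\<close>, the collision part of order
      \<open>W ^ (2 * m)\<close>, and this \<open>\<tau>\<close> makes both
      \<open>W ^ m * \<rho> powr (sig - \<alpha>)\<close>.\<close>
    define \<tau> where "\<tau> = \<rho> powr (\<alpha> - sig) * W ^ m"
    have Wm: "0 < W ^ m" using W(2) by simp
    have \<tau>: "0 < \<tau>" using \<rho> Wm by (simp add: \<tau>_def)
    define I where "I = (\<integral>x. indicator {- (C + 1)..C + 1} x * B \<rho> x \<partial>lborel)"
    have "wsum L ts (\<lambda>h. B \<rho> (slope c h)) \<le> (\<tau> * (A * \<rho> powr (- \<alpha>)) * I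
        + coll_slope L ts c (2 * (\<theta> ^ N / 2)) / (2 * (\<theta> ^ N / 2)) / \<tau>) / 2
        + 4 * (\<theta> ^ N / 2) / \<rho>\<^sup>2 * wsum L ts (\<lambda>_. 1)"
      unfolding I_def
    proof (rule wsum_B_le[OF C \<rho>(1)])
      show "0 < \<theta> ^ N / 2" "\<theta> ^ N / 2 \<le> 1" using \<theta>N by auto
      show "B \<rho> x \<le> A * \<rho> powr (- \<alpha>)" if "\<bar>x\<bar> \<le> C + 1" for x using that by (rule A(2)[OF \<rho>])
    qed (use \<tau> nonneg in auto)
    also have "\<dots> = (\<tau> * (A * \<rho> powr (- \<alpha>)) * I + coll_slope L ts c (\<theta> ^ N) / \<theta> ^ N / \<tau>) / 2
        + 2 * \<theta> ^ N / \<rho>\<^sup>2 * wsum L ts (\<lambda>_. 1)" by simp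
    also have "\<dots> \<le> (W ^ m * (A * K) * R + W ^ m * Q * R) / 2 + 2 * Z * R * W ^ m"
    proof (intro add_mono divide_right_mono)
      have "\<tau> * (A * \<rho> powr (- \<alpha>)) * I \<le> \<tau> * (A * \<rho> powr (- \<alpha>)) * (K * \<rho> powr (2 * sig - \<alpha>))"
        unfolding I_def using \<tau> A(1) by (intro mult_left_mono K(2) \<rho>) auto
      also have "\<dots> = W ^ m * (A * K) * (\<rho> powr (\<alpha> - sig) * \<rho> powr (- \<alpha>) * \<rho> powr (2 * sig - \<alpha>))"
        by (simp add: \<tau>_def mult_ac)
      also have "\<rho> powr (\<alpha> - sig) * \<rho> powr (- \<alpha>) * \<rho> powr (2 * sig - \<alpha>) = R"
        unfolding R_def powr_add[symmetric] by simp
      finally show "\<tau> * (A * \<rho> powr (- \<alpha>)) * I \<le> W ^ m * (A * K) * R" .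
    next
      have "coll_slope L ts c (\<theta> ^ N) / \<theta> ^ N / \<tau> \<le> Q * \<theta> ^ N * W ^ (2 * m) / \<theta> ^ N / \<tau>"
        using Q(2)[OF ts] \<theta>N \<tau> by (intro divide_right_mono) auto
      also have "\<dots> = Q * (W ^ m * W ^ m) / \<tau>" using \<theta>(1) by (simp add: mult_2 power_add)
      also have "\<dots> = W ^ m * Q * (1 / \<rho> powr (\<alpha> - sig))" using Wm by (simp add: \<tau>_def)
      also have "1 / \<rho> powr (\<alpha> - sig) = R" unfolding R_def powr_minus_divide[symmetric] by simp
      finally show "coll_slope L ts c (\<theta> ^ N) / \<theta> ^ N / \<tau> \<le> W ^ m * Q * R" .
    next
      \<comment> \<open>The Lipschitz error is of order \<open>\<theta> ^ N / \<rho>^2\<close>; the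
        cube in the hypothesis on \<open>\<theta>\<close> turns it into a multiple of \<rho>, which
        is smaller than required.\<close>
      have "\<rho> powr 1 \<le> R" unfolding R_def using \<rho> sig_le \<alpha> by (intro powr_mono') auto
      then have "\<rho> \<le> R" using \<rho> by simp
      then have 1: "Z * \<rho> \<le> Z * R" using Z by (intro mult_left_mono) auto
      have "2 * \<theta> ^ N / \<rho>\<^sup>2 \<le> 2 * (Z * \<rho> ^ 3) / \<rho>\<^sup>2"
        using \<theta>(3) unfolding \<rho>_def[symmetric] by (intro divide_right_mono) auto
      also have "\<dots> = 2 * (Z * \<rho>)" using \<rho> by (simp add: power2_eq_square power3_eq_cube)
      also have "\<dots> \<le> 2 * Z * R" using 1 by simp
      finally have 2: "2 * \<theta> ^ N / \<rho>\<^sup>2 \<le> 2 * Z * R" .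
      have 3: "wsum L ts (\<lambda>_. 1) \<le> W ^ m"
        using wsum_mass_le[of ts L W] nonneg W ts by auto
      show "2 * \<theta> ^ N / \<rho>\<^sup>2 * wsum L ts (\<lambda>_. 1) \<le> 2 * Z * R * W ^ m"
      proof (rule mult_mono[OF 2 3])
        show "0 \<le> wsum L ts (\<lambda>_. 1)"
          unfolding wsum_def by (intro sum_nonneg mult_nonneg_nonneg wt_nonneg) (simp_all add: nonneg)
      qed (use Z R in simp)
    qed simp
    also have "\<dots> = W ^ m * ((A * K + Q) / 2 + 2 * Z) * R"
      by (simp add: algebra_simps add_divide_distrib)
    finally show ?thesis .
  qed
  have fin: "finite {ts. set ts \<subseteq> \<Omega> \<and> length ts = m}" using \<Omega>(1) by (rule finite_lists_length_eq)
  have "B r c \<le> k ^ N * (\<Sum>ts | set ts \<subseteq> \<Omega> \<and> length ts = m. wsum L ts (\<lambda>h. B (r / g ^ (L * m)) (slope c h)))"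
    unfolding N_def L_def
  proof (rule B_unroll[OF C(1) \<Omega>(1)])
    show "2 * r \<le> g ^ (n * s * m)" using r(2) by (simp add: N_def L_def)
  qed (use \<Omega>(3,4) r C in auto)
  also have "\<dots> \<le> k ^ N * (\<Sum>ts | set ts \<subseteq> \<Omega> \<and> length ts = m. W ^ m * ((A * K + Q) / 2 + 2 * Z) * R)"
    using main k_pos unfolding N_def[symmetric] \<rho>_def[symmetric] by (intro mult_left_mono sum_mono) auto
  also have "\<dots> = k ^ N * (real (card \<Omega>) ^ m * (W ^ m * ((A * K + Q) / 2 + 2 * Z) * R))"
    using card_lists_length_eq[OF \<Omega>(1), of m] by simp
  also have "\<dots> \<le> k ^ N * (P ^ m * (W ^ m * ((A * K + Q) / 2 + 2 * Z) * R))"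
    using \<Omega>(2) k_pos W(2) A(1) K(1) Q(1) Z R
    by (intro mult_left_mono mult_right_mono power_mono mult_nonneg_nonneg add_nonneg_nonneg) auto
  finally show ?thesis unfolding R_def \<rho>_def .
qed

text \<open>The gain must not depend on \<alpha>, since the step is iterated. The choices are
  nested: a large \<open>n\<close> makes the polynomial loss in the near mass negligible, a large
  \<open>s\<close> then makes the number of weights negligible, and the slack \<open>\<eta>\<close>
  is small against \<open>\<epsilon> / (D + 1)\<close>. Regularity for these data determines the
  length of the collision blocks, and \<open>m\<close> is matched to \<open>r\<close>.\<close>

lemma power_bound_step:
  assumes reg: "collision_regular k e D" and D: "0 \<le> D"
  shows "\<exists>\<gamma>>0. \<forall>\<alpha>. 0 \<le> \<alpha> \<longrightarrow> \<alpha> \<le> 1 \<longrightarrow> power_bound \<alpha> \<longrightarrow> power_bound (\<alpha> - \<gamma>)"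
proof -
  define lk where "lk = ln (1 / k)"
  define lg where "lg = ln (1 / g)"
  \<comment> \<open>The number \<open>N\<close> of letters is chosen with \<open>r\<close> about
    \<open>exp (- q0 * N)\<close>. Then \<open>r / g ^ N\<close> is about
    \<open>exp (- lk * N / 3)\<close>, whose cube is the resolution \<open>k ^ N\<close> of the
    slopes.\<close>
  define q0 where "q0 = lg + lk / 3"
  define \<epsilon> where "\<epsilon> = sig * lk / 18"
  define \<gamma> where "\<gamma> = sig * lk / (6 * q0)"
  have lk: "0 < lk" "k = exp (- lk)" using k_pos k_lt by (simp_all add: lk_def ln_div)
  have lg: "0 < lg" "g = exp (- lg)" using g_pos g_lt by (simp_all add: lg_def ln_div)
  have q0: "0 < q0" using lk lg by (simp add: q0_def)
  have \<epsilon>: "0 < \<epsilon>" using lk sig_pos by (simp add: \<epsilon>_def)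
  have \<gamma>: "0 < \<gamma>" using lk sig_pos q0 by (simp add: \<gamma>_def)
  have kN: "k ^ N = exp (- (lk * real N))" for N
    unfolding lk(2) by (simp add: exp_of_nat_mult[symmetric] mult.commute)
  have gN: "g ^ N = exp (- (lg * real N))" for N
    unfolding lg(2) by (simp add: exp_of_nat_mult[symmetric] mult.commute)
  have expN: "exp x ^ N = exp (x * real N)" for x :: real and N
    by (simp add: exp_of_nat_mult[symmetric] mult.commute)
  have "power_bound (\<alpha> - \<gamma>)" if \<alpha>: "0 \<le> \<alpha>" "\<alpha> \<le> 1" and pb: "power_bound \<alpha>" for \<alpha>
    unfolding power_bound_def
  proof
    fix C' :: real
    define C where "C = max C' (1 / (1 - k))"
    have C: "1 / (1 - k) \<le> C" "C' \<le> C" "0 < C" "1 / (1 - k) \<le> C + 1"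
      using k_lt by (auto simp: C_def less_max_iff_disj)
    obtain A where A: "1 \<le> A" "\<forall>r c. 0 < r \<longrightarrow> r \<le> 1 \<longrightarrow> \<bar>c\<bar> \<le> C + 1 \<longrightarrow> B r c \<le> A * r powr (- \<alpha>)"
      using power_boundD[OF pb, of "C + 1"] by (elim exE conjE)
    obtain K where K: "0 \<le> K" "\<And>\<rho>. 0 < \<rho> \<Longrightarrow> \<rho> \<le> 1 \<Longrightarrow>
      (\<integral>x. indicator {- (C + 1)..C + 1} x * B \<rho> x \<partial>lborel) \<le> K * \<rho> powr (2 * sig - \<alpha>)"
      using integral_B_le[OF pb \<alpha>(1) C(4)] by metis
    define R where "R = 2 * Yb C + 3"
    define R' where "R' = R + 2 * Yb (C + 1)"
    have R: "1 \<le> R" "1 \<le> R'" using Yb_nonneg[of C] Yb_nonneg[of "C + 1"] C(3) by (auto simp: R_def R'_def)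
    obtain n where n: "1 \<le> n" "(1 + real n) * (4 * R' * A) \<le> exp (\<epsilon> * real n)"
      using eventually_conj[OF eventually_ge_at_top[of 1] eventually_poly_le_exp[OF \<epsilon>, of 1 "4 * R' * A"]]
      by (auto simp: eventually_sequentially)
    define \<Lambda> where "\<Lambda> = 4 * R' * (1 + real n * A)"
    have \<Lambda>: "1 \<le> \<Lambda>" "\<Lambda> \<le> exp (\<epsilon> * real n)"
    proof -
      have "1 * 1 \<le> R' * (1 + real n * A)" using R A by (intro mult_mono) auto
      then show "1 \<le> \<Lambda>" by (simp add: \<Lambda>_def)
      have "1 + real n * A \<le> (1 + real n) * A" using A(1) by (simp add: algebra_simps)
      then have "4 * R' * (1 + real n * A) \<le> 4 * R' * ((1 + real n) * A)" using R by (intro mult_left_mono) auto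
      then show "\<Lambda> \<le> exp (\<epsilon> * real n)" using n(2) by (simp add: \<Lambda>_def mult_ac)
    qed
    define W0 where "W0 = \<Lambda> * (g ^ n) powr (- \<alpha>) / k ^ n"
    have gpow: "(g ^ n) powr (- \<alpha>) = exp (\<alpha> * lg * real n)" unfolding gN by (simp add: powr_def)
    have W0_eq: "W0 = \<Lambda> * exp (\<alpha> * lg * real n) * exp (lk * real n)"
      unfolding W0_def gpow kN by (simp add: exp_minus field_simps)
    have W0: "1 \<le> W0"
    proof -
      have "1 * 1 * 1 \<le> \<Lambda> * exp (\<alpha> * lg * real n) * exp (lk * real n)"
        using \<Lambda>(1) \<alpha>(1) lk(1) lg(1) by (intro mult_mono) auto
      then show ?thesis by (simp add: W0_eq)
    qed
    define P where "P = 2 * (C / g ^ n) + 5"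
    have P: "1 \<le> P" using C(3) g_pos by (simp add: P_def)
    \<comment> \<open>One power of \<open>P\<close> pays for the sum over weights, \<open>e\<close>
      powers for the collision bound, and the factor 2 for rounding the mass to an integer.\<close>
    obtain s where s: "2 * P ^ (e + 1) < exp (\<epsilon> * real n) ^ s"
      using real_arch_pow[of "exp (\<epsilon> * real n)" "2 * P ^ (e + 1)"] \<epsilon> n(1) by auto
    have "1 \<le> P ^ (e + 1)" using P by (rule one_le_power)
    then have s0: "1 \<le> s" using s by (cases s) auto
    define L where "L = n * s"
    have L: "1 \<le> L" using n(1) s0 by (simp add: L_def)
    obtain i where i: "inverse (real (Suc i)) < min lk (\<epsilon> / (D + 1))"
      using reals_Archimedean[of "min lk (\<epsilon> / (D + 1))"] lk(1) \<epsilon> D by auto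
    define \<eta> where "\<eta> = 1 / real (i + 1)"
    have \<eta>: "0 < \<eta>" "\<eta> < lk" "(D + 1) * \<eta> \<le> \<epsilon>"
      using i D by (auto simp: \<eta>_def inverse_eq_divide field_simps)
    define \<theta> where "\<theta> = exp \<eta> * k"
    have \<theta>_eq: "\<theta> = exp (\<eta> - lk)" unfolding \<theta>_def by (simp add: lk(2) exp_add[symmetric])
    have \<theta>: "0 < \<theta>" "\<theta> < 1" using \<eta> by (simp_all add: \<theta>_eq)
    obtain \<Omega> where \<Omega>: "finite \<Omega>" "\<Omega> \<noteq> {}" "real (card \<Omega>) \<le> P" "\<Omega> \<subseteq> om R n s ` {- C - 1..C + 1}"
      "\<And>c. \<bar>c\<bar> \<le> C \<Longrightarrow> \<exists>t. \<bar>c - t\<bar> \<le> g ^ n \<and> om R n s t \<in> \<Omega>"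
      unfolding P_def using om_cover[OF C(3), of n R s] by metis
    define \<Omega>' where "\<Omega>' = (\<lambda>\<omega>. \<omega> \<circ> rev) ` \<Omega>"
    \<comment> \<open>Regularity is available for integer mass bounds; as
      \<open>W0 ^ s \<ge> 1\<close>, rounding up loses at most a factor 2.\<close>
    define W where "W = nat \<lceil>W0 ^ s\<rceil>"
    have W0s: "1 \<le> W0 ^ s" using W0 by (rule one_le_power)
    have W: "W0 ^ s \<le> real W" "real W \<le> 2 * W0 ^ s" using W0s unfolding W_def by linarith+
    have mass: "(\<Sum>w\<in>words L. \<omega> w) \<le> real W" if "\<omega> \<in> \<Omega>" for \<omega>
    proof -
      obtain t where "t \<in> {- C - 1..C + 1}" and t2: "\<omega> = om R n s t" using \<Omega>(4) \<open>\<omega> \<in> \<Omega>\<close> by blast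
      then have t: "\<bar>t\<bar> \<le> C + 1" by auto
      have "(\<Sum>w\<in>words n. nb R n t w) \<le> W0" if "\<bar>t\<bar> \<le> C + 1" for t
        unfolding W0_def \<Lambda>_def R'_def
        by (rule near_mass_le[OF C(4) that R(1) A(1) \<alpha>(1)]) (use A(2) that in auto)
      then have "(\<Sum>h\<in>words (n * s). om R n s t h) \<le> W0 ^ s"
        using W0 t by (intro om_mass_le[OF C(4)]) auto
      then show ?thesis using W(1) t2 by (simp add: L_def)
    qed
    have dyad: "\<Omega> \<subseteq> dyadic_weights L" using \<Omega>(4) om_dyadic by (auto simp: L_def)
    have dyad': "\<Omega>' \<subseteq> dyadic_weights L"
    proof
      fix \<omega> assume "\<omega> \<in> \<Omega>'"
      then obtain \<omega>' where \<omega>': "\<omega> = \<omega>' \<circ> rev" "\<omega>' \<in> dyadic_weights L" using dyad by (auto simp: \<Omega>'_def)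
      have "rev w \<in> words L \<longleftrightarrow> w \<in> words L" for w :: "bool list" by (simp add: words_def)
      then show "\<omega> \<in> dyadic_weights L" using \<omega>' unfolding dyadic_weights_def by simp
    qed
    have card': "real (card \<Omega>') \<le> P" "0 < card \<Omega>'"
    proof -
      have "card \<Omega>' \<le> card \<Omega>" unfolding \<Omega>'_def by (rule card_image_le[OF \<Omega>(1)])
      then show "real (card \<Omega>') \<le> P" using \<Omega>(3) by linarith
      show "0 < card \<Omega>'" using \<Omega>(1,2) by (simp add: \<Omega>'_def card_gt_0_iff)
    qed
    have nonneg: "0 \<le> \<omega> h" if "\<omega> \<in> \<Omega>" for \<omega> h using dyadic_weights_bounds[of \<omega> L h] dyad that by blast
    have "coll_claim L \<Omega>' (real W) \<eta> e D 1 k"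
      unfolding \<eta>_def
    proof (rule reg[unfolded collision_regular_def, rule_format])
      show "(\<Sum>w\<in>words L. \<omega> w) \<le> real W" if "\<omega> \<in> \<Omega>'" for \<omega>
      proof -
        obtain \<omega>' where \<omega>': "\<omega> = \<omega>' \<circ> rev" "\<omega>' \<in> \<Omega>" using \<open>\<omega> \<in> \<Omega>'\<close> by (auto simp: \<Omega>'_def)
        have "(\<Sum>w\<in>words L. \<omega> w) = (\<Sum>w\<in>words L. \<omega>' w)" unfolding \<omega>'(1) o_def by (rule sum_words_rev)
        then show ?thesis using mass[OF \<omega>'(2)] by simp
      qed
      have "1 * 1 \<le> \<Lambda> * exp (\<alpha> * lg * real n)" using \<Lambda>(1) \<alpha>(1) lg(1) by (intro mult_mono) auto
      then have "1 * exp (lk * real n) \<le> W0" unfolding W0_eq by (intro mult_right_mono) auto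
      then have "exp (lk * real n) ^ s \<le> W0 ^ s" by (intro power_mono) auto
      then have "exp (lk * real n) ^ s * k ^ L \<le> real W * k ^ L" using W(1) k_pos by (intro mult_right_mono) auto
      moreover have "exp (lk * real n) ^ s * k ^ L = 1"
        unfolding kN expN L_def by (simp add: exp_add[symmetric] mult.assoc)
      ultimately show "1 \<le> real W * k ^ L" by simp
      show "exp (1 / real (i + 1)) * k < 1" using \<theta>(2) by (simp add: \<theta>_def \<eta>_def)
    qed (use L dyad' \<Omega>(2) in \<open>auto simp: \<Omega>'_def\<close>)
    then obtain M Cc where M: "1 \<le> M" and coll: "\<And>m ts. set ts \<subseteq> \<Omega>' \<Longrightarrow> length ts = M * m \<Longrightarrow>
        coll L ts 1 k (\<theta> ^ (L * M * m))
        \<le> Cc * (real (card \<Omega>') ^ (e * M * m) * (exp (D * \<eta>) * k) ^ (L * M * m) * real W ^ (2 * M * m))"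
      unfolding coll_claim_def \<theta>_def by (elim exE conjE) blast
    define q where "q = L * M"
    have q: "1 \<le> q" using L M by (simp add: q_def)
    define Z where "Z = exp (3 * q0 * real q)"
    define K2 where "K2 = A * K + \<bar>Cc\<bar> + 2 * Z"
    define y0 where "y0 = q0 * (3 * ln 2 / lk + real q)"
    define A' where "A' = K2 * exp (\<gamma> * q0 * real q) + exp (y0 * (1 + \<gamma>))"
    have K2: "0 \<le> K2" using A(1) K(1) by (simp add: K2_def Z_def)
    have "B r c \<le> A' * r powr (- (\<alpha> - \<gamma>))" if r: "0 < r" "r \<le> 1" and c: "\<bar>c\<bar> \<le> C'" for r c
    proof -
      define y where "y = - ln r"
      have y: "0 \<le> y" "r = exp (- y)" using r by (simp_all add: y_def)
      have target: "r powr (- (\<alpha> - \<gamma>)) = exp ((\<alpha> - \<gamma>) * y)" using r by (simp add: powr_def y_def algebra_simps)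
      define m where "m = nat \<lfloor>y / (q0 * real q)\<rfloor>"
      define N where "N = L * (M * m)"
      have Nq: "real N = real q * real m" by (simp add: N_def q_def)
      have qq: "0 < q0 * real q" using q0 q by simp
      have "real m \<le> y / (q0 * real q)" "y / (q0 * real q) < real m + 1"
      proof -
        have "0 \<le> y / (q0 * real q)" using y(1) qq by simp
        then show "real m \<le> y / (q0 * real q)" "y / (q0 * real q) < real m + 1" unfolding m_def by linarith+
      qed
      then have yN: "q0 * real N \<le> y" "y < q0 * (real N + real q)"
        using qq by (simp_all add: pos_le_divide_eq pos_divide_less_eq Nq algebra_simps)
      \<comment> \<open>For few letters \<open>r\<close> is bounded away from 0 and the trivial
        bound \<open>1 / r\<close> suffices. Otherwise \<open>\<rho> \<le> 1 / 2\<close>, which is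
        the condition \<open>2 * r \<le> g ^ N\<close> of \<open>B_block_bound\<close>.\<close>
      show ?thesis
      proof (cases "lk * real N / 3 < ln 2")
        case True
        then have "real N \<le> 3 * ln 2 / lk" using lk(1) by (simp add: field_simps)
        then have "q0 * (real N + real q) \<le> y0" unfolding y0_def using q0 by (intro mult_left_mono) auto
        then have "y \<le> y0" using yN(2) by linarith
        then have "y * (1 + \<gamma>) \<le> y0 * (1 + \<gamma>)" using \<gamma> by (intro mult_right_mono) auto
        moreover have "0 \<le> \<alpha> * y" using \<alpha> y by simp
        ultimately have "y \<le> y0 * (1 + \<gamma>) + (\<alpha> - \<gamma>) * y" by (simp add: algebra_simps)
        have "B r c \<le> 1 / r" by (rule B_le[OF r(1)])
        also have "\<dots> = exp y" by (simp add: y(2) exp_minus field_simps)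
        also have "\<dots> \<le> exp (y0 * (1 + \<gamma>) + (\<alpha> - \<gamma>) * y)" using \<open>y \<le> y0 * (1 + \<gamma>) + (\<alpha> - \<gamma>) * y\<close> by simp
        also have "\<dots> = exp (y0 * (1 + \<gamma>)) * exp ((\<alpha> - \<gamma>) * y)" by (simp add: exp_add)
        also have "\<dots> \<le> A' * exp ((\<alpha> - \<gamma>) * y)" using K2 by (intro mult_right_mono) (auto simp: A'_def)
        finally show ?thesis unfolding target .
      next
        case False
        define \<rho> where "\<rho> = r / g ^ N"
        define l where "l = - y + lg * real N"
        have \<rho>: "\<rho> = exp l" unfolding \<rho>_def y(2) gN l_def by (simp flip: exp_diff)
        have l: "l \<le> - (lk * real N / 3)" "- (q0 * real q) - lk * real N / 3 \<le> l"
          using yN unfolding l_def q0_def by (simp_all add: algebra_simps add_divide_distrib)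
        define E where "E = P ^ (e * (M * m)) * exp ((D + 1) * \<eta> * real N)"
        define Q where "Q = \<bar>Cc\<bar> * (P ^ (e * (M * m)) * exp (D * \<eta> * real N))"
        define Z' where "Z' = exp (\<eta> * real N) * Z"
        have exps: "exp (D * \<eta> * real N) \<le> exp ((D + 1) * \<eta> * real N)" "exp (\<eta> * real N) \<le> exp ((D + 1) * \<eta> * real N)"
          "1 \<le> exp ((D + 1) * \<eta> * real N)"
          using \<eta>(1) D by (auto simp: algebra_simps)
        have PE: "1 \<le> P ^ (e * (M * m))" using P by (rule one_le_power)
        have E: "P ^ (e * (M * m)) * exp (D * \<eta> * real N) \<le> E" "exp (\<eta> * real N) \<le> E" "1 \<le> E"
        proof -
          show "P ^ (e * (M * m)) * exp (D * \<eta> * real N) \<le> E"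
            unfolding E_def using exps(1) PE by (intro mult_left_mono) auto
          have *: "1 * exp ((D + 1) * \<eta> * real N) \<le> E" unfolding E_def using PE by (intro mult_right_mono) auto
          show "exp (\<eta> * real N) \<le> E" "1 \<le> E" using * exps(2,3) by linarith+
        qed
        have nsN: "n * s * (M * m) = N" by (simp add: N_def L_def)
        have block: "B r c \<le> k ^ N * (P ^ (M * m) * (real W ^ (M * m) * ((A * K + Q) / 2 + 2 * Z') * \<rho> powr (sig - \<alpha>)))"
          unfolding \<rho>_def nsN[symmetric]
        proof (rule B_block_bound[where \<Omega> = \<Omega> and \<theta> = \<theta> and C = C])
          show "\<bar>c\<bar> \<le> C" using c C(2) by simp
          show "B r x \<le> A * r powr (- \<alpha>)" if "0 < r" "r \<le> 1" "\<bar>x\<bar> \<le> C + 1" for r x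
            using A(2) that by blast
          show "(\<Sum>w\<in>words (n * s). \<omega> w) \<le> real W" if "\<omega> \<in> \<Omega>" for \<omega>
            using mass[OF that] by (simp add: L_def)
          show "1 \<le> real W" using W(1) W0s by linarith
          show "\<exists>t. \<bar>c - t\<bar> \<le> g ^ n \<and> om (2 * Yb C + 3) n s t \<in> \<Omega>" if "\<bar>c\<bar> \<le> C" for c
            using \<Omega>(5)[OF that] by (simp add: R_def)
          show "\<theta> ^ (n * s * (M * m)) \<le> Z' * (r / g ^ (n * s * (M * m))) ^ 3"
          proof -
            have "\<theta> ^ N = exp (\<eta> * real N) * exp (- (lk * real N))"
              unfolding \<theta>_def power_mult_distrib expN kN ..
            also have "\<dots> \<le> exp (\<eta> * real N) * exp (3 * q0 * real q + 3 * l)"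
              using l(2) by (intro mult_left_mono) auto
            also have "\<dots> = Z' * \<rho> ^ 3"
              unfolding \<rho> Z'_def Z_def expN by (simp add: exp_add mult.commute)
            finally show ?thesis unfolding nsN \<rho>_def .
          qed
          show "0 \<le> Q" unfolding Q_def using P by (intro mult_nonneg_nonneg) auto
          show "coll_slope (n * s) ts c (\<theta> ^ (n * s * (M * m))) \<le> Q * \<theta> ^ (n * s * (M * m)) * real W ^ (2 * (M * m))"
            if ts: "set ts \<subseteq> \<Omega>" "length ts = M * m" for ts
          proof -
            have "set (reversed ts) \<subseteq> \<Omega>'" using ts(1) by (auto simp: \<Omega>'_def)
            then have "coll L (reversed ts) 1 k (\<theta> ^ (L * M * m))
              \<le> Cc * (real (card \<Omega>') ^ (e * M * m) * (exp (D * \<eta>) * k) ^ (L * M * m) * real W ^ (2 * M * m))"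
              using ts(2) by (intro coll) auto
            also have "\<dots> \<le> \<bar>Cc\<bar> * (P ^ (e * M * m) * (exp (D * \<eta> * real N) * \<theta> ^ N) * real W ^ (2 * M * m))"
            proof (intro mult_mono)
              have "(exp (D * \<eta>) * k) ^ N = exp (D * \<eta> * real N) * k ^ N" unfolding power_mult_distrib expN ..
              also have "\<dots> \<le> exp (D * \<eta> * real N) * \<theta> ^ N"
                using \<eta>(1) k_pos unfolding \<theta>_def by (intro mult_left_mono power_mono) auto
              finally show "(exp (D * \<eta>) * k) ^ (L * M * m) \<le> exp (D * \<eta> * real N) * \<theta> ^ N"
                by (simp add: N_def mult.assoc)
            qed (use card'(1) P k_pos \<theta>(1) in \<open>auto intro!: power_mono mult_nonneg_nonneg\<close>)
            also have "\<dots> = Q * \<theta> ^ N * real W ^ (2 * (M * m))"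
              unfolding Q_def by (simp add: mult_ac)
            finally show ?thesis unfolding coll_slope_eq nsN by (simp add: N_def L_def mult.assoc)
          qed
          show "2 * r \<le> g ^ (n * s * (M * m))"
          proof -
            have "l \<le> - ln 2" using False l(1) by linarith
            then have "\<rho> \<le> exp (- ln 2)" unfolding \<rho> by simp
            then have "\<rho> \<le> 1 / 2" by (simp add: exp_minus)
            then show ?thesis unfolding nsN \<rho>_def using g_pos by (simp add: field_simps)
          qed
        qed (use C \<alpha> A K \<Omega> \<theta> r nonneg in auto)
        have KE: "(A * K + Q) / 2 + 2 * Z' \<le> K2 * E"
        proof -
          have *: "(u + v) / 2 + 2 * w \<le> u' + v' + 2 * w'"
            if "u \<le> u'" "v \<le> v'" "w \<le> w'" "0 \<le> u" "0 \<le> v" for u u' v v' w w' :: real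
            using that by (simp add: field_simps)
          have "A * K * 1 \<le> A * K * E" using A(1) K(1) E(3) by (intro mult_left_mono) auto
          then have "(A * K + Q) / 2 + 2 * Z' \<le> A * K * E + \<bar>Cc\<bar> * E + 2 * (E * Z)"
          proof (intro *)
            show "Q \<le> \<bar>Cc\<bar> * E" unfolding Q_def using E(1) by (intro mult_left_mono) auto
            show "Z' \<le> E * Z" unfolding Z'_def using E(2) by (intro mult_right_mono) (auto simp: Z_def)
            show "0 \<le> A * K" "0 \<le> Q" using A(1) K(1) P by (auto simp: Q_def)
          qed simp
          then show ?thesis unfolding K2_def by (simp add: algebra_simps)
        qed
        have WE: "real W ^ (M * m) \<le> 2 ^ (M * m) * exp ((\<epsilon> + \<alpha> * lg + lk) * real N)"
        proof -
          have "W0 \<le> exp (\<epsilon> * real n) * exp (\<alpha> * lg * real n) * exp (lk * real n)"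
            unfolding W0_eq using \<Lambda>(2) by (intro mult_right_mono) auto
          also have "\<dots> = exp ((\<epsilon> + \<alpha> * lg + lk) * real n)" by (simp add: exp_add[symmetric] algebra_simps)
          finally have "W0 ^ (s * (M * m)) \<le> exp ((\<epsilon> + \<alpha> * lg + lk) * real n) ^ (s * (M * m))"
            using W0 by (intro power_mono) auto
          also have "\<dots> = exp ((\<epsilon> + \<alpha> * lg + lk) * real N)"
            unfolding expN nsN[symmetric] by (simp add: mult.assoc)
          finally have 1: "(W0 ^ s) ^ (M * m) \<le> exp ((\<epsilon> + \<alpha> * lg + lk) * real N)" by (simp only: power_mult)
          have "real W ^ (M * m) \<le> (2 * W0 ^ s) ^ (M * m)" using W(2) by (intro power_mono) auto
          also have "\<dots> = 2 ^ (M * m) * (W0 ^ s) ^ (M * m)" by (rule power_mult_distrib)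
          also have "\<dots> \<le> 2 ^ (M * m) * exp ((\<epsilon> + \<alpha> * lg + lk) * real N)" using 1 by (intro mult_left_mono) auto
          finally show ?thesis .
        qed
        have PP: "P ^ (M * m) * 2 ^ (M * m) * P ^ (e * (M * m)) \<le> exp (\<epsilon> * real N)"
        proof -
          have "P ^ (M * m) * 2 ^ (M * m) * P ^ (e * (M * m)) = (2 * P ^ (e + 1)) ^ (M * m)"
            by (simp add: power_mult_distrib power_mult[symmetric] power_add[symmetric] algebra_simps)
          also have "\<dots> \<le> (exp (\<epsilon> * real n) ^ s) ^ (M * m)" using s P by (intro power_mono) auto
          also have "\<dots> = exp (\<epsilon> * real N)" unfolding power_mult[symmetric] expN nsN[symmetric] by (simp add: mult.assoc)
          finally show ?thesis .
        qed
        have EE: "exp ((D + 1) * \<eta> * real N) \<le> exp (\<epsilon> * real N)"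
          using \<eta>(3) by (simp add: mult_right_mono)
        have pw: "\<rho> powr (sig - \<alpha>) = exp ((sig - \<alpha>) * l)" by (simp add: powr_def \<rho>)
        note block
        also have "k ^ N * (P ^ (M * m) * (real W ^ (M * m) * ((A * K + Q) / 2 + 2 * Z') * \<rho> powr (sig - \<alpha>)))
          \<le> k ^ N * (P ^ (M * m) * ((2 ^ (M * m) * exp ((\<epsilon> + \<alpha> * lg + lk) * real N)) * (K2 * E) * \<rho> powr (sig - \<alpha>)))"
          using k_pos P WE KE A(1) K(1) K2 E(3)
          by (intro mult_left_mono mult_right_mono mult_mono) (auto simp: Q_def Z'_def Z_def)
        also have "\<dots> = K2 * (exp (- (lk * real N)) * (P ^ (M * m) * 2 ^ (M * m) * P ^ (e * (M * m)))
            * exp ((\<epsilon> + \<alpha> * lg + lk) * real N) * exp ((D + 1) * \<eta> * real N) * exp ((sig - \<alpha>) * l))"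
          unfolding kN pw E_def by (simp only: mult_ac)
        also have "\<dots> \<le> K2 * (exp (- (lk * real N)) * exp (\<epsilon> * real N)
            * exp ((\<epsilon> + \<alpha> * lg + lk) * real N) * exp (\<epsilon> * real N) * exp ((sig - \<alpha>) * l))"
          using K2 PP EE P by (intro mult_left_mono mult_right_mono mult_mono) auto
        also have "\<dots> = K2 * exp (- (lk * real N) + \<epsilon> * real N + (\<epsilon> + \<alpha> * lg + lk) * real N + \<epsilon> * real N + (sig - \<alpha>) * l)"
          by (simp only: exp_add)
        also have "\<dots> \<le> K2 * exp (\<gamma> * q0 * real q + (\<alpha> - \<gamma>) * y)"
        proof (intro mult_left_mono K2)
          have "sig * l \<le> sig * - (lk * real N / 3)" using l(1) sig_pos by (intro mult_left_mono) auto
          moreover have "\<gamma> * y \<le> \<gamma> * (q0 * (real N + real q))" using yN(2) \<gamma> by (intro mult_left_mono) auto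
          moreover have "\<gamma> * (q0 * (real N + real q)) = sig * lk / 6 * real N + \<gamma> * q0 * real q"
            using q0 by (simp add: \<gamma>_def field_simps)
          moreover have "\<epsilon> * real N = sig * lk / 18 * real N" by (simp add: \<epsilon>_def)
          moreover have "sig * - (lk * real N / 3) = - 6 * (sig * lk / 18 * real N)" "sig * lk / 6 * real N = 3 * (sig * lk / 18 * real N)" by simp_all
          moreover have "- (lk * real N) + \<epsilon> * real N + (\<epsilon> + \<alpha> * lg + lk) * real N + \<epsilon> * real N + (sig - \<alpha>) * l
            = 3 * (\<epsilon> * real N) + \<alpha> * y + sig * l"
            by (simp add: l_def algebra_simps)
          moreover have "(\<alpha> - \<gamma>) * y = \<alpha> * y - \<gamma> * y" by (rule left_diff_distrib)
          ultimately have "- (lk * real N) + \<epsilon> * real N + (\<epsilon> + \<alpha> * lg + lk) * real N + \<epsilon> * real N + (sig - \<alpha>) * l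
            \<le> \<gamma> * q0 * real q + (\<alpha> - \<gamma>) * y" by linarith
          then show "exp (- (lk * real N) + \<epsilon> * real N + (\<epsilon> + \<alpha> * lg + lk) * real N + \<epsilon> * real N + (sig - \<alpha>) * l)
            \<le> exp (\<gamma> * q0 * real q + (\<alpha> - \<gamma>) * y)" by simp
        qed
        also have "\<dots> = K2 * exp (\<gamma> * q0 * real q) * exp ((\<alpha> - \<gamma>) * y)" by (simp only: exp_add mult.assoc)
        also have "\<dots> \<le> A' * exp ((\<alpha> - \<gamma>) * y)" by (intro mult_right_mono) (auto simp: A'_def)
        finally show ?thesis unfolding target .
      qed
    qed
    then show "\<exists>A. \<forall>r c. 0 < r \<longrightarrow> r \<le> 1 \<longrightarrow> \<bar>c\<bar> \<le> C' \<longrightarrow> B r c \<le> A * r powr (- (\<alpha> - \<gamma>))" by blast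
  qed
  then show ?thesis using \<gamma> by blast
qed

end

section \<open>Square integrable densities and characteristic functions\<close>

lemma measure_Ico_split:
  assumes "finite_measure \<mu>" "sets \<mu> = sets (borel :: real measure)" "0 \<le> r"
  shows "measure \<mu> {s..<s + r} = measure \<mu> {..<s + r} - measure \<mu> {..<s}"
proof -
  interpret finite_measure \<mu> by fact
  have "measure \<mu> ({..<s + r} - {..<s}) = measure \<mu> {..<s + r} - measure \<mu> {..<s}"
    using assms(2,3) by (intro finite_measure_Diff) auto
  moreover have "{..<s + r} - {..<s} = {s..<s + r}" by auto
  ultimately show ?thesis by simp
qed

lemma borel_measurable_measure_Ico:
  assumes "finite_measure \<mu>" "sets \<mu> = sets (borel :: real measure)" "0 \<le> r"
  shows "(\<lambda>s. measure \<mu> {s..<s + r}) \<in> borel_measurable borel"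
proof -
  interpret finite_measure \<mu> by fact
  have "mono (\<lambda>s. measure \<mu> {..<s + t})" for t
    using assms(2) by (intro monoI finite_measure_mono) auto
  then have "(\<lambda>s. measure \<mu> {..<s + t}) \<in> borel_measurable borel" for t
    by (rule borel_measurable_mono)
  from this[of r] this[of 0] show ?thesis
    unfolding measure_Ico_split[OF assms] by simp
qed

text \<open>Let \<open>F j\<close> be the density of \<mu> smoothed at scale \<open>2 ^ -j\<close>.
  On a bounded interval the L2 decay makes the increments summable in L1, so \<open>F j\<close>
  converges almost everywhere under an integrable majorant. Tails identify \<mu> with the limit
  density, and Fatou with the uniform bound \<open>K\<close> puts the limit into L2.\<close>

lemma L2_density_criterion:
  fixes \<mu> :: "real measure"
  assumes "prob_space \<mu>" and sets [simp, measurable_cong]: "sets \<mu> = sets borel"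
    and supp: "measure \<mu> {- Y..Y} = 1"
    and A: "\<And>r. 0 < r \<Longrightarrow> r \<le> 1 \<Longrightarrow>
      (\<integral>\<^sup>+s. ennreal ((measure \<mu> {s..<s + r} / r - measure \<mu> {s..<s + 2 * r} / (2 * r))\<^sup>2) \<partial>lborel) \<le> ennreal (A * r powr \<beta>)"
    and \<beta>: "0 < \<beta>" and A0: "0 \<le> A"
    and K: "\<And>r. 0 < r \<Longrightarrow> r \<le> 1 \<Longrightarrow> (\<integral>\<^sup>+s. ennreal ((measure \<mu> {s..<s + r} / r)\<^sup>2) \<partial>lborel) \<le> ennreal K"
  shows "\<exists>h. h \<in> borel_measurable borel \<and> (\<forall>x. 0 \<le> h x) \<and> integrable lborel (\<lambda>x. (h x)\<^sup>2)
      \<and> \<mu> = density lborel (\<lambda>x. ennreal (h x))"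
proof -
  interpret prob_space \<mu> by fact
  have fm: "finite_measure \<mu>" by unfold_locales
  have [simp]: "space \<mu> = UNIV" using sets_eq_imp_space_eq[OF sets] by simp
  have Y: "0 \<le> Y"
  proof (rule ccontr)
    assume "\<not> 0 \<le> Y"
    then have "{- Y..Y} = {}" by auto
    then show False using supp by simp
  qed
  define \<rho> where "\<rho> j = (1 / 2 :: real) ^ j" for j :: nat
  have \<rho>: "0 < \<rho> j" "\<rho> j \<le> 1" "\<rho> j = 2 * \<rho> (Suc j)" for j
    by (auto simp: \<rho>_def power_le_one)
  define F where "F j s = measure \<mu> {s..<s + \<rho> j} / \<rho> j" for j s
  define D where "D j s = F (Suc j) s - F j s" for j s
  have [measurable]: "F j \<in> borel_measurable borel" for j
    unfolding F_def using borel_measurable_measure_Ico[OF fm sets, of "\<rho> j"] \<rho>(1)[of j] by simp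
  have [measurable]: "D j \<in> borel_measurable borel" for j unfolding D_def by measurable
  let ?I = "{- Y - 1..Y}"
  have F0: "0 \<le> F j s" "F j s \<le> 1 / \<rho> j" for j s
    using \<rho>(1)[of j] by (auto simp: F_def divide_right_mono)
  have Fsupp: "F j s = 0" if "s \<notin> ?I" for j s
  proof -
    have "{s..<s + \<rho> j} \<subseteq> space \<mu> - {- Y..Y}"
      using that \<rho>(2)[of j] by auto
    then have "measure \<mu> {s..<s + \<rho> j} \<le> measure \<mu> (space \<mu> - {- Y..Y})" by (intro finite_measure_mono) auto
    also have "\<dots> = 0" using prob_compl[of "{- Y..Y}"] supp by simp
    finally show ?thesis by (simp add: F_def measure_le_0_iff)
  qed
  have int_I1: "integrable lborel (indicator ?I :: real \<Rightarrow> real)"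
    by (intro integrable_real_indicator) (simp_all add: emeasure_lborel_Icc_eq)
  have int_I: "integrable lborel (\<lambda>s. indicator ?I s * x :: real)" for x
    by (intro integrable_mult_left int_I1)
  have bdd: "integrable lborel f" if f: "f \<in> borel_measurable borel" "\<And>s. s \<notin> ?I \<Longrightarrow> f s = 0" "\<And>s. \<bar>f s\<bar> \<le> x"
    for f :: "real \<Rightarrow> real" and x
  proof (rule Bochner_Integration.integrable_bound[OF int_I[of x]])
    show "AE s in lborel. norm (f s) \<le> norm (indicator ?I s * x)"
    proof (intro AE_I2)
      fix s show "norm (f s) \<le> norm (indicator ?I s * x)"
        using f(2)[of s] f(3)[of s] by (cases "s \<in> ?I") auto
    qed
  qed (use f(1) in simp)
  have intF: "integrable lborel (F j)" for j
    using F0[of j] Fsupp by (intro bdd[of _ "1 / \<rho> j"]) auto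
  have intD: "integrable lborel (D j)" for j unfolding D_def using intF by simp
  have Dabs: "\<bar>D j s\<bar> \<le> 1 / \<rho> (Suc j) + 1 / \<rho> j" for j s
    using F0[of "Suc j" s] F0[of j s] unfolding D_def by linarith
  have Dsupp: "D j s = 0" if "s \<notin> ?I" for j s using Fsupp[OF that] by (simp add: D_def)
  have intD2: "integrable lborel (\<lambda>s. (D j s)\<^sup>2)" for j
  proof (rule bdd)
    show "\<bar>(D j s)\<^sup>2\<bar> \<le> (1 / \<rho> (Suc j) + 1 / \<rho> j)\<^sup>2" for s
      using power_mono[OF Dabs[of j s], of 2] by simp
  qed (use Dsupp in auto)
  \<comment> \<open>Half of the exponent \<beta>: the squares decay like \<open>q ^ (2 * j)\<close>,
    and weighting by \<open>q ^ j\<close> leaves the rate \<open>q ^ j\<close> for the L1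
    norms.\<close>
  define q where "q = 2 powr (- (\<beta> / 2))"
  have q: "0 < q" "q < 1" using \<beta> by (auto simp: q_def powr_less_one)
  have D2: "(\<integral>s. (D j s)\<^sup>2 \<partial>lborel) \<le> A * q ^ (2 * Suc j)" for j
  proof -
    have "\<rho> (Suc j) powr \<beta> = q ^ (2 * Suc j)"
      unfolding \<rho>_def q_def
      by (simp only: powr_realpow[symmetric] powr_powr zero_less_divide_1_iff zero_less_numeral powr_gt_zero)
         (simp add: powr_divide powr_minus_divide[symmetric] powr_powr algebra_simps)
    moreover have "ennreal (\<integral>s. (D j s)\<^sup>2 \<partial>lborel) \<le> ennreal (A * \<rho> (Suc j) powr \<beta>)"
      using A[OF \<rho>(1,2), of "Suc j"] nn_integral_eq_integral[OF intD2[of j]]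
      unfolding D_def F_def \<rho>(3)[of j] by simp
    ultimately show ?thesis using A0 q by (simp add: ennreal_le_iff)
  qed
  have absD: "(\<integral>s. \<bar>D j s\<bar> \<partial>lborel) \<le> q ^ j * ((2 * Y + 1 + A) / 2)" for j
  proof -
    have "(\<integral>s. \<bar>D j s\<bar> \<partial>lborel) \<le> (\<integral>s. (indicator ?I s * q ^ j + (D j s)\<^sup>2 / q ^ j) / 2 \<partial>lborel)"
    proof (rule integral_mono)
      fix s
      show "\<bar>D j s\<bar> \<le> (indicator ?I s * q ^ j + (D j s)\<^sup>2 / q ^ j) / 2"
      proof (cases "s \<in> ?I")
        case True
        have "0 \<le> (q ^ j - \<bar>D j s\<bar>)\<^sup>2" by simp
        then have "2 * q ^ j * \<bar>D j s\<bar> \<le> q ^ j * q ^ j + (D j s)\<^sup>2"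
          by (simp add: power2_diff power2_eq_square[of "q ^ j"])
        then have "2 * q ^ j * \<bar>D j s\<bar> / q ^ j \<le> (q ^ j * q ^ j + (D j s)\<^sup>2) / q ^ j"
          using q by (intro divide_right_mono) auto
        then show ?thesis using True q by (simp add: add_divide_distrib)
      qed (use Dsupp q in simp)
    qed (use intD int_I1 intD2 in auto)
    also have "\<dots> = ((2 * Y + 1) * q ^ j + (\<integral>s. (D j s)\<^sup>2 \<partial>lborel) / q ^ j) / 2"
      using int_I1 intD2 Y by simp
    also have "\<dots> \<le> ((2 * Y + 1) * q ^ j + A * q ^ j) / 2"
    proof (intro divide_right_mono add_left_mono)
      have "(\<integral>s. (D j s)\<^sup>2 \<partial>lborel) / q ^ j \<le> A * q ^ (2 * Suc j) / q ^ j"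
        using q by (intro divide_right_mono D2) auto
      also have "\<dots> = A * q ^ (j + 2)" using q by (simp add: power_add mult_2 power2_eq_square)
      also have "\<dots> \<le> A * q ^ j" using q A0 by (intro mult_left_mono power_decreasing) auto
      finally show "(\<integral>s. (D j s)\<^sup>2 \<partial>lborel) / q ^ j \<le> A * q ^ j" .
    qed simp
    also have "\<dots> = q ^ j * ((2 * Y + 1 + A) / 2)" by (simp add: algebra_simps)
    finally show ?thesis .
  qed
  have sumD: "summable (\<lambda>j. \<integral>s. norm (D j s) \<partial>lborel)"
  proof (rule summable_comparison_test)
    show "summable (\<lambda>j. q ^ j * ((2 * Y + 1 + A) / 2))" using q by (intro summable_mult2 summable_geometric) simp
    show "\<exists>N. \<forall>j\<ge>N. norm (\<integral>s. norm (D j s) \<partial>lborel) \<le> q ^ j * ((2 * Y + 1 + A) / 2)"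
      using absD by simp
  qed
  have aeD: "AE s in lborel. summable (\<lambda>j. norm (D j s))"
  proof -
    have "(\<integral>\<^sup>+s. (\<Sum>j. ennreal (norm (D j s))) \<partial>lborel) = (\<Sum>j. \<integral>\<^sup>+s. ennreal (norm (D j s)) \<partial>lborel)"
      by (intro nn_integral_suminf) simp
    also have "\<dots> = (\<Sum>j. ennreal (\<integral>s. norm (D j s) \<partial>lborel))"
      using intD by (intro suminf_cong nn_integral_eq_integral) auto
    also have "\<dots> = ennreal (\<Sum>j. \<integral>s. norm (D j s) \<partial>lborel)"
      by (intro suminf_ennreal2 sumD) simp
    finally have "(\<integral>\<^sup>+s. (\<Sum>j. ennreal (norm (D j s))) \<partial>lborel) \<noteq> \<infinity>" by simp
    then have "AE s in lborel. (\<Sum>j. ennreal (norm (D j s))) \<noteq> \<infinity>"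
      by (intro nn_integral_PInf_AE) auto
    then show ?thesis
      by eventually_elim (auto intro: summable_suminf_not_top)
  qed
  define W where "W s = F 0 s + (\<Sum>j. norm (D j s))" for s
  have intW: "integrable lborel W"
    unfolding W_def using aeD sumD intD intF
    by (intro Bochner_Integration.integrable_add integrable_suminf) auto
  \<comment> \<open>The limit is nonnegative wherever the increments are absolutely summable; the
    maximum only corrects the null set where they are not.\<close>
  define h where "h s = max 0 (F 0 s + (\<Sum>j. D j s))" for s
  have [measurable]: "h \<in> borel_measurable borel" unfolding h_def by measurable
  have telescope: "F j s = F 0 s + (\<Sum>i<j. D i s)" for j s
    by (induction j) (simp_all add: D_def)
  have conv: "AE s in lborel. (\<lambda>j. F j s) \<longlonglongrightarrow> h s"
    using aeD
  proof eventually_elim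
    case (elim s)
    have "(\<lambda>j. F 0 s + (\<Sum>i<j. D i s)) \<longlonglongrightarrow> F 0 s + (\<Sum>j. D j s)"
      by (intro tendsto_add tendsto_const summable_LIMSEQ summable_norm_cancel[OF elim])
    then have *: "(\<lambda>j. F j s) \<longlonglongrightarrow> F 0 s + (\<Sum>j. D j s)" by (simp only: telescope[symmetric])
    then have "0 \<le> F 0 s + (\<Sum>j. D j s)" by (rule LIMSEQ_le_const) (use F0 in auto)
    then show ?case using * by (simp add: h_def max_def)
  qed
  have dom: "AE s in lborel. norm (F j s) \<le> W s" for j
    using aeD
  proof eventually_elim
    case (elim s)
    have "\<bar>F j s\<bar> \<le> F 0 s + (\<Sum>i<j. norm (D i s))"
      unfolding telescope[of j s] real_norm_def using F0(1)[of 0 s] sum_abs[of "\<lambda>i. D i s" "{..<j}"] by linarith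
    also have "\<dots> \<le> W s" unfolding W_def using elim by (intro add_left_mono sum_le_suminf) auto
    finally show ?case by simp
  qed
  have tail: "emeasure \<mu> {t<..} = emeasure (density lborel (\<lambda>s. ennreal (h s))) {t<..}" for t
  proof -
    have inth: "integrable lborel (\<lambda>s. indicator {t<..} s * h s)"
      and lim1: "(\<lambda>j. \<integral>s. indicator {t<..} s * F j s \<partial>lborel) \<longlonglongrightarrow> (\<integral>s. indicator {t<..} s * h s \<partial>lborel)"
    proof -
      have c: "AE s in lborel. (\<lambda>j. indicator {t<..} s * F j s) \<longlonglongrightarrow> indicator {t<..} s * h s"
        using conv by eventually_elim (intro tendsto_mult tendsto_const)
      have d: "AE s in lborel. norm (indicator {t<..} s * F j s) \<le> W s" for j
        using dom[of j] by eventually_elim (auto simp: indicator_def intro: order_trans[OF norm_ge_zero])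
      show "integrable lborel (\<lambda>s. indicator {t<..} s * h s)"
        by (rule integrable_dominated_convergence[OF _ _ intW c d]) auto
      show "(\<lambda>j. \<integral>s. indicator {t<..} s * F j s \<partial>lborel) \<longlonglongrightarrow> (\<integral>s. indicator {t<..} s * h s \<partial>lborel)"
        by (rule integral_dominated_convergence[OF _ _ intW c d]) auto
    qed
    \<comment> \<open>After exchanging the integrals, a point \<open>x\<close> is charged with the
      proportion of \<open>s\<close> in \<open>(x - \<rho> j, x]\<close> that exceed
      \<open>t\<close>. This ramp tends to the indicator of \<open>x > t\<close>.\<close>
    have val: "(\<integral>s. indicator {t<..} s * F j s \<partial>lborel) = (\<integral>x. min 1 (max 0 ((x - t) / \<rho> j)) \<partial>\<mu>)" for j
    proof -
      interpret P: pair_sigma_finite \<mu> lborel by unfold_locales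
      have "(\<integral>\<^sup>+s. ennreal (indicator {t<..} s * F j s) \<partial>lborel)
          = (\<integral>\<^sup>+s. \<integral>\<^sup>+x. indicator {(x, s). t < s \<and> s \<le> x \<and> x < s + \<rho> j} (x, s) / ennreal (\<rho> j) \<partial>\<mu> \<partial>lborel)"
      proof (intro nn_integral_cong)
        fix s
        have "(\<integral>\<^sup>+x. indicator {(x, s). t < s \<and> s \<le> x \<and> x < s + \<rho> j} (x, s) / ennreal (\<rho> j) \<partial>\<mu>)
            = (\<integral>\<^sup>+x. indicator {s..<s + \<rho> j} x * (indicator {t<..} s / ennreal (\<rho> j)) \<partial>\<mu>)"
          by (intro nn_integral_cong) (simp add: indicator_def)
        also have "\<dots> = emeasure \<mu> {s..<s + \<rho> j} * (indicator {t<..} s / ennreal (\<rho> j))"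
          by (subst nn_integral_multc) auto
        also have "\<dots> = ennreal (indicator {t<..} s * F j s)"
          using \<rho>(1)[of j] unfolding F_def emeasure_eq_measure
          by (simp add: indicator_def divide_ennreal[symmetric] divide_ennreal_def)
        finally show "ennreal (indicator {t<..} s * F j s)
          = (\<integral>\<^sup>+x. indicator {(x, s). t < s \<and> s \<le> x \<and> x < s + \<rho> j} (x, s) / ennreal (\<rho> j) \<partial>\<mu>)" ..
      qed
      also have "\<dots> = (\<integral>\<^sup>+x. \<integral>\<^sup>+s. indicator {(x, s). t < s \<and> s \<le> x \<and> x < s + \<rho> j} (x, s) / ennreal (\<rho> j) \<partial>lborel \<partial>\<mu>)"
        by (rule P.Fubini'[where f = "\<lambda>x s. indicator {(x, s). t < s \<and> s \<le> x \<and> x < s + \<rho> j} (x, s) / ennreal (\<rho> j)"]) measurable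
      also have "\<dots> = (\<integral>\<^sup>+x. ennreal (min 1 (max 0 ((x - t) / \<rho> j))) \<partial>\<mu>)"
      proof (intro nn_integral_cong)
        fix x
        have "(\<integral>\<^sup>+s. indicator {(x, s). t < s \<and> s \<le> x \<and> x < s + \<rho> j} (x, s) / ennreal (\<rho> j) \<partial>lborel)
            = (\<integral>\<^sup>+s. indicator {max t (x - \<rho> j)<..x} s / ennreal (\<rho> j) \<partial>lborel)"
          by (intro nn_integral_cong) (auto simp: indicator_def)
        also have "\<dots> = emeasure lborel {max t (x - \<rho> j)<..x} / ennreal (\<rho> j)"
          by (subst nn_integral_divide) auto
        also have "\<dots> = ennreal (min 1 (max 0 ((x - t) / \<rho> j)))"
        proof (cases "max t (x - \<rho> j) \<le> x")
          case True
          then have "t \<le> x" by simp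
          have "(x - max t (x - \<rho> j)) / \<rho> j = min 1 (max 0 ((x - t) / \<rho> j))"
          proof (cases "t \<le> x - \<rho> j")
            case True
            then have "1 \<le> (x - t) / \<rho> j" using \<rho>(1)[of j] by (simp add: field_simps)
            then show ?thesis using True \<rho>(1)[of j] by simp
          next
            case False
            then have "(x - t) / \<rho> j \<le> 1" "0 \<le> (x - t) / \<rho> j" using \<rho>(1)[of j] \<open>t \<le> x\<close> by (simp_all add: field_simps)
            then show ?thesis using False by simp
          qed
          moreover have "emeasure lborel {max t (x - \<rho> j)<..x} = ennreal (x - max t (x - \<rho> j))"
            using True by (rule emeasure_lborel_Ioc)
          moreover have "0 \<le> x - max t (x - \<rho> j)" using True by simp
          ultimately show ?thesis
            using \<rho>(1)[of j] by (simp only: divide_ennreal)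
        next
          case False
          then have "{max t (x - \<rho> j)<..x} = {}" "x - t < 0" using \<rho>(1)[of j] by auto
          moreover from this(2) have "(x - t) / \<rho> j < 0" using \<rho>(1)[of j] by (rule divide_neg_pos)
          ultimately show ?thesis by (simp add: max_def)
        qed
        finally show "(\<integral>\<^sup>+s. indicator {(x, s). t < s \<and> s \<le> x \<and> x < s + \<rho> j} (x, s) / ennreal (\<rho> j) \<partial>lborel)
          = ennreal (min 1 (max 0 ((x - t) / \<rho> j)))" .
      qed
      finally have "enn2real (\<integral>\<^sup>+s. ennreal (indicator {t<..} s * F j s) \<partial>lborel)
        = enn2real (\<integral>\<^sup>+x. ennreal (min 1 (max 0 ((x - t) / \<rho> j))) \<partial>\<mu>)" by simp
      then show ?thesis
        using F0 by (simp add: integral_eq_nn_integral)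
    qed
    have lim2: "(\<lambda>j. \<integral>x. min 1 (max 0 ((x - t) / \<rho> j)) \<partial>\<mu>) \<longlonglongrightarrow> (\<integral>x. indicator {t<..} x \<partial>\<mu>)"
    proof (rule integral_dominated_convergence[where w = "\<lambda>_. 1"])
      show "AE x in \<mu>. (\<lambda>j. min 1 (max 0 ((x - t) / \<rho> j))) \<longlonglongrightarrow> indicator {t<..} x"
      proof (intro AE_I2)
        fix x
        show "(\<lambda>j. min 1 (max 0 ((x - t) / \<rho> j))) \<longlonglongrightarrow> indicator {t<..} x"
        proof (cases "t < x")
          case True
          obtain m where m: "1 / (x - t) < 2 ^ m" using real_arch_pow[of 2 "1 / (x - t)"] by auto
          have "min 1 (max 0 ((x - t) / \<rho> j)) = 1" if "m \<le> j" for j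
          proof -
            have "(2::real) ^ m \<le> 2 ^ j" using that by (intro power_increasing) auto
            then have "1 / (x - t) \<le> 2 ^ j" using m by linarith
            then have "1 \<le> (x - t) * 2 ^ j" using True by (simp add: field_simps)
            then show ?thesis by (simp add: \<rho>_def power_one_over)
          qed
          then have "eventually (\<lambda>j. min 1 (max 0 ((x - t) / \<rho> j)) = indicator {t<..} x) sequentially"
            using True by (auto simp: eventually_sequentially)
          then show ?thesis by (rule tendsto_eventually)
        next
          case False
          then have "(x - t) / \<rho> j \<le> 0" for j using \<rho>(1)[of j] by (simp add: divide_le_0_iff)
          then have "max 0 ((x - t) / \<rho> j) = 0" for j by (simp add: max_def antisym)
          then show ?thesis using False by simp
        qed
      qed
    qed auto
    have "(\<integral>s. indicator {t<..} s * h s \<partial>lborel) = measure \<mu> {t<..}"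
      using LIMSEQ_unique[OF lim1] lim2 unfolding val by simp
    moreover have "emeasure (density lborel (\<lambda>s. ennreal (h s))) {t<..} = ennreal (\<integral>s. indicator {t<..} s * h s \<partial>lborel)"
    proof -
      have "emeasure (density lborel (\<lambda>s. ennreal (h s))) {t<..} = (\<integral>\<^sup>+s. ennreal (indicator {t<..} s * h s) \<partial>lborel)"
        by (subst emeasure_density) (auto intro!: nn_integral_cong simp: indicator_def)
      then show ?thesis using nn_integral_eq_integral[OF inth] by (simp add: h_def)
    qed
    ultimately show ?thesis by (simp add: emeasure_eq_measure)
  qed
  have eq: "\<mu> = density lborel (\<lambda>s. ennreal (h s))"
  proof (rule measure_eqI_lessThan)
    show "emeasure \<mu> {t<..} < \<infinity>" for t by (simp add: emeasure_eq_measure)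
  qed (use tail in auto)
  have "(\<integral>\<^sup>+s. ennreal ((h s)\<^sup>2) \<partial>lborel) \<le> (\<integral>\<^sup>+s. liminf (\<lambda>j. ennreal ((F j s)\<^sup>2)) \<partial>lborel)"
  proof (rule nn_integral_mono_AE)
    show "AE s in lborel. ennreal ((h s)\<^sup>2) \<le> liminf (\<lambda>j. ennreal ((F j s)\<^sup>2))"
      using conv
    proof eventually_elim
      case (elim s)
      have *: "(\<lambda>j. ennreal ((F j s)\<^sup>2)) \<longlonglongrightarrow> ennreal ((h s)\<^sup>2)" by (intro tendsto_ennrealI tendsto_power elim)
      show ?case using lim_imp_Liminf[OF _ *] by simp
    qed
  qed
  also have "\<dots> \<le> liminf (\<lambda>j. \<integral>\<^sup>+s. ennreal ((F j s)\<^sup>2) \<partial>lborel)"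
    by (intro nn_integral_liminf) auto
  also have "\<dots> \<le> ennreal K"
    using K[OF \<rho>(1,2)] unfolding F_def by (intro Liminf_le) auto
  finally have "(\<integral>\<^sup>+s. ennreal ((h s)\<^sup>2) \<partial>lborel) < \<infinity>" by (auto intro: le_less_trans)
  then have "integrable lborel (\<lambda>s. (h s)\<^sup>2)" by (intro integrableI_nonneg) auto
  then show ?thesis using eq by (intro exI[of _ h]) (auto simp: h_def)
qed

context walk
begin

text \<open>Steps of fixed length lead from the trivial exponent 1 to 0, with the exponent kept in
  the range \<open>[0, 1]\<close> where the step is available; one step from 0 then gives
  decay.\<close>

lemma power_bound_decay:
  assumes "collision_regular k e D" "0 \<le> D"
  shows "\<exists>\<beta>>0. power_bound (- \<beta>)"
proof -
  obtain \<gamma> where \<gamma>: "0 < \<gamma>" "\<forall>\<alpha>. 0 \<le> \<alpha> \<longrightarrow> \<alpha> \<le> 1 \<longrightarrow> power_bound \<alpha> \<longrightarrow> power_bound (\<alpha> - \<gamma>)"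
    using power_bound_step[OF assms] by (elim exE conjE)
  have *: "power_bound (max 0 (1 - real j * \<gamma>))" for j
  proof (induction j)
    case 0
    show ?case using power_bound_1 by simp
  next
    case (Suc j)
    have "power_bound (max 0 (1 - real j * \<gamma>) - \<gamma>)" using \<gamma> Suc by (intro \<gamma>(2)[rule_format]) auto
    then show ?case by (rule power_bound_mono) (use \<gamma>(1) in \<open>auto simp: algebra_simps\<close>)
  qed
  obtain j :: nat where "1 < real j * \<gamma>" using reals_Archimedean3[OF \<gamma>(1)] by blast
  then have "power_bound 0" using *[of j] by simp
  then have "power_bound (0 - \<gamma>)" using \<gamma>(2)[rule_format, of 0] by simp
  then show ?thesis using \<gamma>(1) by (intro exI[of _ \<gamma>]) simp
qed

text \<open>Telescoping over doubled scales up to 1: the decay of \<open>B\<close> makes the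
  increments a geometric series, so \<open>K\<close> is uniform in \<open>r\<close>. The threshold
  for \<open>N\<close> is not uniform, because the number of scales grows as \<open>r\<close>
  shrinks.\<close>

lemma GN_eventually_le:
  assumes "power_bound (- \<beta>)" "0 < \<beta>"
  shows "\<exists>K\<ge>1. \<forall>r>0. eventually (\<lambda>N. GN N r c \<le> K) sequentially"
proof -
  obtain A where A: "1 \<le> A" "\<forall>r c'. 0 < r \<longrightarrow> r \<le> 1 \<longrightarrow> \<bar>c'\<bar> \<le> \<bar>c\<bar> \<longrightarrow> B r c' \<le> A * r powr (- (- \<beta>))"
    using power_boundD[OF assms(1), of "\<bar>c\<bar>"] by (elim exE conjE)
  define q where "q = 2 powr (- \<beta>)"
  have q: "0 < q" "q < 1" using assms(2) by (auto simp: q_def powr_less_one)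
  define K where "K = 2 + A / (1 - q)"
  have K: "1 \<le> K" using A q by (simp add: K_def add_increasing2)
  have "eventually (\<lambda>N. GN N r c \<le> K) sequentially" if r: "0 < r" for r
  proof -
    have "\<exists>J. 1 \<le> 2 ^ J * r"
    proof -
      obtain J where "1 / r < 2 ^ J" using real_arch_pow[of 2 "1 / r"] by auto
      then have "1 \<le> 2 ^ J * r" using r by (simp add: field_simps)
      then show ?thesis by blast
    qed
    define J where "J = (LEAST J. 1 \<le> 2 ^ J * r)"
    have J1: "1 \<le> 2 ^ J * r" unfolding J_def by (rule LeastI_ex) fact
    have J2: "2 ^ i * r < 1" if "i < J" for i
      using not_less_Least[of i "\<lambda>J. 1 \<le> 2 ^ J * r"] that unfolding J_def by auto
    have "(\<Sum>i<J. B (2 ^ i * r) c) \<le> (\<Sum>i<J. A * q ^ (J - Suc i))"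
    proof (intro sum_mono)
      fix i assume "i \<in> {..<J}"
      then have i: "i < J" by simp
      then have J': "J - 1 = i + (J - Suc i)" by simp
      have "2 ^ (J - 1) * r < 1" using i by (intro J2) auto
      then have "2 ^ i * r * 2 ^ (J - Suc i) \<le> 1" unfolding J' power_add by (simp add: mult_ac)
      then have "2 ^ i * r \<le> 2 powr (- real (J - Suc i))"
        by (simp add: powr_minus powr_realpow field_simps)
      then have "(2 ^ i * r) powr \<beta> \<le> (2 powr (- real (J - Suc i))) powr \<beta>"
        using r assms(2) by (intro powr_mono2) auto
      also have "\<dots> = q ^ (J - Suc i)"
        unfolding q_def by (simp add: powr_powr powr_realpow[symmetric] mult.commute)
      finally have "A * (2 ^ i * r) powr \<beta> \<le> A * q ^ (J - Suc i)" using A(1) by (intro mult_left_mono) auto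
      moreover have "B (2 ^ i * r) c \<le> A * (2 ^ i * r) powr \<beta>"
        using A(2)[rule_format, of "2 ^ i * r" c] J2[OF i] r by simp
      ultimately show "B (2 ^ i * r) c \<le> A * q ^ (J - Suc i)" by linarith
    qed
    also have "\<dots> = A * (\<Sum>i<J. q ^ i)"
      unfolding sum_distrib_left[symmetric] by (simp only: sum.nat_diff_reindex)
    also have "(\<Sum>i<J. q ^ i) = (1 - q ^ J) / (1 - q)" using q by (simp add: sum_gp_strict)
    also have "A * ((1 - q ^ J) / (1 - q)) \<le> A * (1 / (1 - q))"
      using A q by (intro mult_left_mono divide_right_mono) auto
    finally have sumB: "(\<Sum>i<J. B (2 ^ i * r) c) < A / (1 - q) + 1" by simp
    have "(\<lambda>N. \<Sum>i<J. BN N (2 ^ i * r) c) \<longlonglongrightarrow> (\<Sum>i<J. B (2 ^ i * r) c)"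
      using r by (intro tendsto_sum BN_tendsto) auto
    then have "eventually (\<lambda>N. (\<Sum>i<J. BN N (2 ^ i * r) c) < A / (1 - q) + 1) sequentially"
      using sumB by (rule order_tendstoD)
    then show ?thesis
    proof eventually_elim
      case (elim N)
      have "GN N (2 ^ J * r) c \<le> 1 / (2 ^ J * r)" using r by (intro GN_le) auto
      also have "\<dots> \<le> 1" using J1 r by simp
      finally show ?case using elim GN_telescope[of N r c J] by (simp add: K_def)
    qed
  qed
  then show ?thesis using K by blast
qed

end

section \<open>The law of the walk driven by fair bits\<close>

lemma box_kernel_eq:
  assumes "0 < r"
  shows "(\<Sum>i\<in>I. \<Sum>j\<in>I. tri r (x i - x j)) = (\<integral>s. (\<Sum>i\<in>I. box r (x i) s)\<^sup>2 \<partial>lborel)"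
    and "integrable lborel (\<lambda>s. (\<Sum>i\<in>I. box r (x i) s)\<^sup>2)"
  unfolding power2_eq_square sum_product
  by (simp_all add: Bochner_Integration.integral_sum Bochner_Integration.integrable_sum integrable_box_product integral_box_product assms)

lemma box_halve:
  assumes "0 < r"
  shows "box r x s - box (2 * r) x s = - hbox r (x - r) s"
proof -
  have "indicator {x - 2 * r<..x} s = (indicator {x - r<..x} s + indicator {x - r - r<..x - r} s :: real)"
    using assms by (auto simp: indicator_def)
  then show ?thesis using assms by (simp add: box_def hbox_def field_simps)
qed

lemma borel_measurable_box [measurable]: "(\<lambda>s. box r x s) \<in> borel_measurable borel"
  unfolding box_def by measurable

lemma box_measurable_fst [measurable]: "(\<lambda>x. box r x s) \<in> borel_measurable borel"
proof -
  have "(\<lambda>x. box r x s) = (\<lambda>x. indicator {s..<s + r} x / r)"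
    by (auto simp: box_def indicator_def fun_eq_iff)
  then show ?thesis by simp
qed

lemma abs_box_le: "0 < r \<Longrightarrow> \<bar>box r x s\<bar> \<le> 1 / r"
  by (simp add: box_def indicator_def)

lemma tendsto_box:
  assumes "x \<longlonglongrightarrow> y" "y \<noteq> s" "y \<noteq> s + r"
  shows "(\<lambda>N. box r (x N) s) \<longlonglongrightarrow> box r y s"
proof (rule tendsto_eventually)
  consider "s < y" "y < s + r" | "s + r < y" | "y < s" using assms by linarith
  then show "eventually (\<lambda>N. box r (x N) s = box r y s) sequentially"
  proof cases
    case 1
    have "eventually (\<lambda>N. x N < s + r) sequentially" "eventually (\<lambda>N. s < x N) sequentially"
      using assms(1) 1 by (auto intro: order_tendstoD)
    then show ?thesis
      by eventually_elim (use 1 in \<open>simp add: box_def indicator_def\<close>)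
  next
    case 2
    with assms(1) have "eventually (\<lambda>N. s + r < x N) sequentially" by (rule order_tendstoD)
    then show ?thesis
      by eventually_elim (use 2 in \<open>simp add: box_def indicator_def\<close>)
  next
    case 3
    with assms(1) have "eventually (\<lambda>N. x N < s) sequentially" by (rule order_tendstoD)
    then show ?thesis
      by eventually_elim (use 3 in \<open>simp add: box_def indicator_def\<close>)
  qed
qed

text \<open>Beyond measurability only the laws of finite prefixes are fixed. This covers Rademacher
  sequences as well as the binary digits of a uniform point.\<close>

locale fair_bits = prob_space M for M :: "'w measure" +
  fixes d :: "nat \<Rightarrow> 'w \<Rightarrow> bool"
  assumes bits_measurable [measurable]: "d i \<in> measurable M (count_space UNIV)"
    and bits_law: "prob {\<omega> \<in> space M. map (\<lambda>i. d i \<omega>) [0..<length w] = w} = 1 / 2 ^ length w"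
begin

definition pre :: "nat \<Rightarrow> 'w \<Rightarrow> bool list" where
  "pre N \<omega> = map (\<lambda>i. d i \<omega>) [0..<N]"

lemma pre_words [simp]: "pre N \<omega> \<in> words N"
  by (simp add: pre_def words_def)

lemma pre_sets [measurable]: "{\<omega> \<in> space M. pre N \<omega> = w} \<in> sets M"
proof -
  have "{\<omega> \<in> space M. pre N \<omega> = w} = {\<omega> \<in> space M. N = length w \<and> (\<forall>i\<in>{..<N}. d i \<omega> = w ! i)}"
    by (auto simp: pre_def list_eq_iff_nth_eq)
  also have "\<dots> \<in> sets M" by measurable
  finally show ?thesis .
qed

lemma
  fixes F :: "bool list \<Rightarrow> 'b :: {banach, second_countable_topology}"
  shows integrable_pre: "integrable M (\<lambda>\<omega>. F (pre N \<omega>))"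
    and integral_pre: "(\<integral>\<omega>. F (pre N \<omega>) \<partial>M) = (\<Sum>w\<in>words N. (1 / 2 ^ N) *\<^sub>R F w)"
proof -
  let ?E = "\<lambda>w. {\<omega> \<in> space M. pre N \<omega> = w}"
  have eq: "F (pre N \<omega>) = (\<Sum>w\<in>words N. indicator (?E w) \<omega> *\<^sub>R F w)" if "\<omega> \<in> space M" for \<omega>
  proof -
    have "(\<Sum>w\<in>words N. indicator (?E w) \<omega> *\<^sub>R F w) = (\<Sum>w\<in>words N. if pre N \<omega> = w then F w else 0)"
      using that by (intro sum.cong refl) simp
    then show ?thesis by simp
  qed
  have int: "integrable M (\<lambda>\<omega>. indicator (?E w) \<omega> *\<^sub>R F w)" for w
    by (intro integrable_scaleR_left integrable_real_indicator) (auto simp: emeasure_eq_measure)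
  have prob: "prob (?E w) = 1 / 2 ^ N" if "w \<in> words N" for w
    using bits_law[of w] that by (simp add: words_def pre_def)
  have "integrable M (\<lambda>\<omega>. F (pre N \<omega>)) \<longleftrightarrow> integrable M (\<lambda>\<omega>. \<Sum>w\<in>words N. indicator (?E w) \<omega> *\<^sub>R F w)"
    by (intro Bochner_Integration.integrable_cong refl eq)
  then show "integrable M (\<lambda>\<omega>. F (pre N \<omega>))"
    by (rule iffD2) (intro Bochner_Integration.integrable_sum int)
  have "(\<integral>\<omega>. F (pre N \<omega>) \<partial>M) = (\<integral>\<omega>. (\<Sum>w\<in>words N. indicator (?E w) \<omega> *\<^sub>R F w) \<partial>M)"
    by (intro Bochner_Integration.integral_cong refl eq)
  also have "\<dots> = (\<Sum>w\<in>words N. \<integral>\<omega>. indicator (?E w) \<omega> *\<^sub>R F w \<partial>M)"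
    by (rule Bochner_Integration.integral_sum[OF int])
  also have "\<dots> = (\<Sum>w\<in>words N. prob (?E w) *\<^sub>R F w)"
    by (intro sum.cong refl, subst integral_scaleR_left)
      (auto intro!: integrable_real_indicator arg_cong[where f = prob] arg_cong2[where f = scaleR] simp: emeasure_eq_measure)
  also have "\<dots> = (\<Sum>w\<in>words N. (1 / 2 ^ N) *\<^sub>R F w)"
    using prob by (intro sum.cong refl) simp
  finally show "(\<integral>\<omega>. F (pre N \<omega>) \<partial>M) = (\<Sum>w\<in>words N. (1 / 2 ^ N) *\<^sub>R F w)" .
qed

end

context walk
begin

text \<open>The value of \<open>Y\<^sub>c\<close> along one sequence of signs, defined for every
  sequence and without reference to a measure.\<close>

definition Tlim :: "real \<Rightarrow> (nat \<Rightarrow> bool) \<Rightarrow> real" where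
  "Tlim c s = lim (\<lambda>N. tv c (map s [0..<N]))"

lemma Tlim_tendsto: "(\<lambda>N. tv c (map s [0..<N])) \<longlonglongrightarrow> Tlim c s"
proof -
  define C where "C = max (1 / (1 - k)) \<bar>c\<bar>"
  have C: "1 / (1 - k) \<le> C" "\<bar>c\<bar> \<le> C" by (auto simp: C_def)
  have diff: "\<bar>tv c (map s [0..<N + n]) - tv c (map s [0..<N])\<bar> \<le> g ^ N * Yb C" for N n
  proof -
    have "map s [0..<N + n] = map s [0..<N] @ map s [N..<N + n]" by (simp add: upt_add_eq_append[of 0 N n])
    then have "tv c (map s [0..<N + n]) - tv c (map s [0..<N]) = g ^ N * tv (slope c (map s [0..<N])) (map s [N..<N + n])"
      by (simp only: tv_append) simp
    moreover have "\<bar>tv (slope c (map s [0..<N])) (map s [N..<N + n])\<bar> \<le> Yb C"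
      by (intro abs_tv_le abs_slope_le C)
    ultimately show ?thesis using g_pos by (simp add: abs_mult)
  qed
  have "Cauchy (\<lambda>N. tv c (map s [0..<N]))"
  proof (rule CauchyI')
    fix e :: real assume e: "0 < e"
    have "(\<lambda>N. g ^ N * Yb C) \<longlonglongrightarrow> 0 * Yb C"
      using g_pos g_lt by (intro tendsto_mult tendsto_const LIMSEQ_power_zero) auto
    then have "eventually (\<lambda>N. g ^ N * Yb C < e) sequentially"
      using e by (intro order_tendstoD) auto
    then obtain m where m: "\<And>N. N \<ge> m \<Longrightarrow> g ^ N * Yb C < e"
      by (auto simp: eventually_sequentially)
    have "dist (tv c (map s [0..<i])) (tv c (map s [0..<j])) < e" if "i \<ge> m" "j > i" for i j
      using diff[of i "j - i"] m[OF that(1)] that(2) by (simp add: dist_real_def)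
    then show "\<exists>M. \<forall>m\<ge>M. \<forall>n>m. dist (tv c (map s [0..<m])) (tv c (map s [0..<n])) < e" by blast
  qed
  then show ?thesis unfolding Tlim_def by (simp add: Cauchy_convergent_iff convergent_LIMSEQ_iff)
qed

lemma abs_Tlim_le: "1 / (1 - k) \<le> C \<Longrightarrow> \<bar>c\<bar> \<le> C \<Longrightarrow> \<bar>Tlim c s\<bar> \<le> Yb C"
  by (rule LIMSEQ_le_const2[OF tendsto_rabs[OF Tlim_tendsto]]) (auto intro!: abs_tv_le)

end

locale walk_bits = walk g k a + fair_bits M d for g k a :: real and M :: "'w measure" and d +
  fixes c \<beta> :: real
  assumes pb: "power_bound (- \<beta>)" and \<beta>_pos: "0 < \<beta>"
begin

abbreviation T :: "'w \<Rightarrow> real" where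
  "T \<omega> \<equiv> Tlim c (\<lambda>i. d i \<omega>)"

definition C0 :: real where
  "C0 = max (1 / (1 - k)) \<bar>c\<bar>"

lemma C0: "1 / (1 - k) \<le> C0" "\<bar>c\<bar> \<le> C0"
  by (auto simp: C0_def)

lemma T_tendsto: "(\<lambda>N. tv c (pre N \<omega>)) \<longlonglongrightarrow> T \<omega>"
  unfolding pre_def by (rule Tlim_tendsto)

lemma T_measurable [measurable]: "T \<in> borel_measurable M"
  by (rule borel_measurable_LIMSEQ_real[OF T_tendsto]) (rule borel_measurable_integrable[OF integrable_pre])

lemma abs_T_le: "\<bar>T \<omega>\<bar> \<le> Yb C0"
  by (rule abs_Tlim_le[OF C0])

definition law :: "real measure" where
  "law = distr M borel T"

lemma law_prob: "prob_space law"
  unfolding law_def by (intro prob_space_distr) simp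

lemma sets_law [simp]: "sets law = sets borel"
  by (simp add: law_def)

text \<open>The density of the law of the \<open>N\<close>-th partial sum after smoothing with a box
  of width \<open>r\<close>.\<close>

definition fN :: "nat \<Rightarrow> real \<Rightarrow> real \<Rightarrow> real" where
  "fN N r s = (\<Sum>w\<in>words N. box r (tv c w) s) / 2 ^ N"

text \<open>As a function of \<open>x\<close>, \<open>box r x s\<close> jumps only at
  \<open>s\<close> and \<open>s + r\<close>, and these are atoms of the law for at most countably
  many \<open>s\<close>.\<close>

lemma fN_tendsto:
  assumes "0 < r"
  shows "AE s in lborel. (\<lambda>N. fN N r s) \<longlonglongrightarrow> measure law {s..<s + r} / r"
proof -
  interpret law: prob_space law by (rule law_prob)
  define At where "At = {x. measure law {x} \<noteq> 0}"
  have "countable At" unfolding At_def by (rule law.countable_support)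
  moreover have "countable ((\<lambda>x. x - r) ` At)" using \<open>countable At\<close> by simp
  ultimately have "At \<union> (\<lambda>x. x - r) ` At \<in> null_sets lborel" by (intro countable_imp_null_set_lborel) auto
  then have "AE s in lborel. s \<notin> At \<union> (\<lambda>x. x - r) ` At" by (rule AE_not_in)
  then show ?thesis
  proof eventually_elim
    case (elim s)
    then have at: "s \<notin> At" "s + r \<notin> At" by (auto simp: image_iff)
    have null: "AE \<omega> in M. T \<omega> \<noteq> x" if "x \<notin> At" for x
    proof -
      have "measure law {x} = prob {\<omega> \<in> space M. T \<omega> = x}"
        unfolding law_def by (simp add: measure_distr vimage_def Int_def conj_commute)
      then have "prob {\<omega> \<in> space M. T \<omega> = x} = 0" using that by (simp add: At_def)
      then have "{\<omega> \<in> space M. T \<omega> = x} \<in> null_sets M" by (simp add: null_sets_def emeasure_eq_measure)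
      from AE_not_in[OF this] AE_space show ?thesis by eventually_elim auto
    qed
    have "(\<lambda>N. \<integral>\<omega>. box r (tv c (pre N \<omega>)) s \<partial>M) \<longlonglongrightarrow> (\<integral>\<omega>. box r (T \<omega>) s \<partial>M)"
    proof (rule integral_dominated_convergence[where w = "\<lambda>_. 1 / r"])
      show "AE \<omega> in M. (\<lambda>N. box r (tv c (pre N \<omega>)) s) \<longlonglongrightarrow> box r (T \<omega>) s"
        using null[OF at(1)] null[OF at(2)]
        by eventually_elim (rule tendsto_box[OF T_tendsto])
      show "(\<lambda>\<omega>. box r (tv c (pre N \<omega>)) s) \<in> borel_measurable M" for N
        by (rule borel_measurable_integrable[OF integrable_pre])
    qed (use abs_box_le[OF assms] in auto)
    moreover have "(\<integral>\<omega>. box r (tv c (pre N \<omega>)) s \<partial>M) = fN N r s" for N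
      unfolding integral_pre[of "\<lambda>w. box r (tv c w) s"] fN_def by (simp add: sum_divide_distrib)
    moreover have "(\<integral>\<omega>. box r (T \<omega>) s \<partial>M) = measure law {s..<s + r} / r"
    proof -
      have "(\<integral>\<omega>. box r (T \<omega>) s \<partial>M) = (\<integral>\<omega>. indicator (T -` {s..<s + r} \<inter> space M) \<omega> / r \<partial>M)"
        by (intro Bochner_Integration.integral_cong refl) (auto simp: box_def indicator_def)
      then show ?thesis unfolding law_def by (simp add: measure_distr)
    qed
    ultimately show "(\<lambda>N. fN N r s) \<longlonglongrightarrow> measure law {s..<s + r} / r" by simp
  qed
qed

lemma fN_measurable [measurable]: "fN N r \<in> borel_measurable borel"
  unfolding fN_def by measurable

lemma nn_integral_fN:
  assumes "0 < r"
  shows "(\<integral>\<^sup>+s. ennreal ((fN N r s)\<^sup>2) \<partial>lborel) = ennreal (GN N r c)"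
proof -
  have *: "(fN N r s)\<^sup>2 = (\<Sum>w\<in>words N. box r (tv c w) s)\<^sup>2 / 4 ^ N" for s
    by (simp add: fN_def power_divide power_mult[symmetric] mult.commute power2_eq_square power_mult_distrib[symmetric])
  have "(\<integral>\<^sup>+s. ennreal ((fN N r s)\<^sup>2) \<partial>lborel) = ennreal (\<integral>s. (fN N r s)\<^sup>2 \<partial>lborel)"
    unfolding * by (intro nn_integral_eq_integral integrable_divide_zero box_kernel_eq(2) assms) simp
  also have "(\<integral>s. (fN N r s)\<^sup>2 \<partial>lborel) = GN N r c"
    unfolding * GN_def box_kernel_eq(1)[OF assms] by simp
  finally show ?thesis .
qed

lemma nn_integral_fN_diff:
  assumes "0 < r"
  shows "(\<integral>\<^sup>+s. ennreal ((fN N r s - fN N (2 * r) s)\<^sup>2) \<partial>lborel) = ennreal (BN N r c)"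
proof -
  let ?h = "\<lambda>s. \<Sum>w\<in>words N. 1 / 2 ^ N * hbox r (tv c w - r) s"
  have *: "(fN N r s - fN N (2 * r) s)\<^sup>2 = ?h s * ?h s" for s
  proof -
    have "fN N r s - fN N (2 * r) s = (\<Sum>w\<in>words N. box r (tv c w) s - box (2 * r) (tv c w) s) / 2 ^ N"
      by (simp add: fN_def sum_subtractf diff_divide_distrib)
    also have "\<dots> = - ?h s" unfolding box_halve[OF assms] by (simp add: sum_negf sum_divide_distrib)
    finally show ?thesis by (simp add: power2_eq_square)
  qed
  have "(\<integral>\<^sup>+s. ennreal ((fN N r s - fN N (2 * r) s)\<^sup>2) \<partial>lborel) = ennreal (\<integral>s. (fN N r s - fN N (2 * r) s)\<^sup>2 \<partial>lborel)"
    unfolding * by (intro nn_integral_eq_integral haar_kernel_eq(2) assms) simp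
  also have "(\<integral>s. (fN N r s - fN N (2 * r) s)\<^sup>2 \<partial>lborel) = BN N r c"
    unfolding * haar_kernel_eq(1)[OF assms, symmetric] BN_def
    by (simp add: sum_divide_distrib power_mult_distrib[symmetric])
  finally show ?thesis .
qed

text \<open>Fatou carries the bounds from finite words over to the law: the energies
  \<open>BN\<close> converge to \<open>B\<close>, which decays, and \<open>GN\<close> is eventually
  bounded uniformly in the scale.\<close>

theorem law_density:
  "\<exists>h. h \<in> borel_measurable borel \<and> (\<forall>x. 0 \<le> h x) \<and> integrable lborel (\<lambda>x. (h x)\<^sup>2)
      \<and> law = density lborel (\<lambda>x. ennreal (h x))"
proof -
  obtain A where A: "1 \<le> A" "\<forall>r c'. 0 < r \<longrightarrow> r \<le> 1 \<longrightarrow> \<bar>c'\<bar> \<le> \<bar>c\<bar> \<longrightarrow> B r c' \<le> A * r powr (- (- \<beta>))"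
    using power_boundD[OF pb, of "\<bar>c\<bar>"] by (elim exE conjE)
  obtain K where K: "1 \<le> K" "\<forall>r>0. eventually (\<lambda>N. GN N r c \<le> K) sequentially"
    using GN_eventually_le[OF pb \<beta>_pos, of c] by (elim exE conjE)
  have fm: "finite_measure law" using law_prob by (simp add: prob_space_def)
  have meas: "(\<lambda>s. measure law {s..<s + r}) \<in> borel_measurable borel" if "0 < r" for r
    using that by (intro borel_measurable_measure_Ico fm) auto
  show ?thesis
  proof (rule L2_density_criterion[OF law_prob sets_law])
    have "T -` {- Yb C0..Yb C0} \<inter> space M = space M"
      using abs_T_le by (auto simp: abs_le_iff minus_le_iff)
    then have "measure law {- Yb C0..Yb C0} = prob (space M)"
      unfolding law_def by (simp add: measure_distr)
    then show "measure law {- Yb C0..Yb C0} = 1" by (simp add: prob_space)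
  next
    fix r :: real assume r: "0 < r" "r \<le> 1"
    have r2: "0 < 2 * r" using r by simp
    have "(\<integral>\<^sup>+s. ennreal ((measure law {s..<s + r} / r - measure law {s..<s + 2 * r} / (2 * r))\<^sup>2) \<partial>lborel)
        \<le> (\<integral>\<^sup>+s. liminf (\<lambda>N. ennreal ((fN N r s - fN N (2 * r) s)\<^sup>2)) \<partial>lborel)"
    proof (rule nn_integral_mono_AE)
      show "AE s in lborel. ennreal ((measure law {s..<s + r} / r - measure law {s..<s + 2 * r} / (2 * r))\<^sup>2)
          \<le> liminf (\<lambda>N. ennreal ((fN N r s - fN N (2 * r) s)\<^sup>2))"
        using fN_tendsto[OF r(1)] fN_tendsto[OF r2]
      proof eventually_elim
        case (elim s)
        have *: "(\<lambda>N. ennreal ((fN N r s - fN N (2 * r) s)\<^sup>2))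
            \<longlonglongrightarrow> ennreal ((measure law {s..<s + r} / r - measure law {s..<s + 2 * r} / (2 * r))\<^sup>2)"
          by (intro tendsto_ennrealI tendsto_power tendsto_diff elim)
        show ?case using lim_imp_Liminf[OF _ *] by simp
      qed
    qed
    also have "\<dots> \<le> liminf (\<lambda>N. \<integral>\<^sup>+s. ennreal ((fN N r s - fN N (2 * r) s)\<^sup>2) \<partial>lborel)"
      by (intro nn_integral_liminf) auto
    also have "\<dots> = ennreal (B r c)"
      unfolding nn_integral_fN_diff[OF r(1)]
      using lim_imp_Liminf[OF _ tendsto_ennrealI[OF BN_tendsto[OF r(1), of c]]] by simp
    also have "\<dots> \<le> ennreal (A * r powr \<beta>)" using A(2)[rule_format, OF r, of c] by (intro ennreal_leI) simp
    finally show "(\<integral>\<^sup>+s. ennreal ((measure law {s..<s + r} / r - measure law {s..<s + 2 * r} / (2 * r))\<^sup>2) \<partial>lborel)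
      \<le> ennreal (A * r powr \<beta>)" .
    have "(\<integral>\<^sup>+s. ennreal ((measure law {s..<s + r} / r)\<^sup>2) \<partial>lborel)
        \<le> (\<integral>\<^sup>+s. liminf (\<lambda>N. ennreal ((fN N r s)\<^sup>2)) \<partial>lborel)"
    proof (rule nn_integral_mono_AE)
      show "AE s in lborel. ennreal ((measure law {s..<s + r} / r)\<^sup>2) \<le> liminf (\<lambda>N. ennreal ((fN N r s)\<^sup>2))"
        using fN_tendsto[OF r(1)]
      proof eventually_elim
        case (elim s)
        have *: "(\<lambda>N. ennreal ((fN N r s)\<^sup>2)) \<longlonglongrightarrow> ennreal ((measure law {s..<s + r} / r)\<^sup>2)"
          by (intro tendsto_ennrealI tendsto_power elim)
        show ?case using lim_imp_Liminf[OF _ *] by simp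
      qed
    qed
    also have "\<dots> \<le> liminf (\<lambda>N. \<integral>\<^sup>+s. ennreal ((fN N r s)\<^sup>2) \<partial>lborel)"
      by (intro nn_integral_liminf) auto
    also have "\<dots> = liminf (\<lambda>N. ennreal (GN N r c))" unfolding nn_integral_fN[OF r(1)] ..
    also have "\<dots> \<le> ennreal K"
    proof -
      have "eventually (\<lambda>N. ennreal (GN N r c) \<le> ennreal K) sequentially"
        using K(2) r(1) by (auto elim!: eventually_mono intro: ennreal_leI)
      then have "liminf (\<lambda>N. ennreal (GN N r c)) \<le> liminf (\<lambda>N. ennreal K)" by (rule Liminf_mono)
      then show ?thesis by (simp add: Liminf_const)
    qed
    finally show "(\<integral>\<^sup>+s. ennreal ((measure law {s..<s + r} / r)\<^sup>2) \<partial>lborel) \<le> ennreal K" .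
  qed (use \<beta>_pos A in auto)
qed

end

section \<open>Square integrability of the characteristic function\<close>

lemma gaussian_cos_integral:
  fixes r z :: real
  assumes "0 < r"
  shows "integrable lborel (\<lambda>u. exp (- (r * u)\<^sup>2 / 2) * cos (u * z))"
    and "(\<integral>u. exp (- (r * u)\<^sup>2 / 2) * cos (u * z) \<partial>lborel) = sqrt (2 * pi) / r * exp (- (z / r)\<^sup>2 / 2)"
proof -
  define t where "t = z / r"
  define f where "f x = std_normal_density x * cos (t * x)" for x
  have intc: "integrable lborel (\<lambda>x. std_normal_density x *\<^sub>R iexp (t * x))"
    by (rule Bochner_Integration.integrable_bound[OF integrable_normal_density[OF zero_less_one, of 0]])
       (auto simp: norm_mult)
  have f_eq: "f x = Re (std_normal_density x *\<^sub>R iexp (t * x))" for x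
    by (simp add: f_def Re_exp)
  have intf: "integrable lborel f"
    using integrable_Re[OF intc] unfolding f_eq by simp
  have "char std_normal_distribution t = (\<integral>x. std_normal_density x *\<^sub>R iexp (t * x) \<partial>lborel)"
    unfolding char_def by (subst integral_density) auto
  then have "(\<integral>x. std_normal_density x *\<^sub>R iexp (t * x) \<partial>lborel) = complex_of_real (exp (- t\<^sup>2 / 2))"
    by (simp add: char_std_normal_distribution)
  then have val: "(\<integral>x. f x \<partial>lborel) = exp (- t\<^sup>2 / 2)"
    unfolding f_eq using integral_Re[OF intc] by simp
  have g_eq: "exp (- (r * u)\<^sup>2 / 2) * cos (u * z) = sqrt (2 * pi) * f (0 + r * u)" for u
    using assms by (simp add: f_def t_def std_normal_density_def mult.commute)
  show "integrable lborel (\<lambda>u. exp (- (r * u)\<^sup>2 / 2) * cos (u * z))"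
    unfolding g_eq using lborel_integrable_real_affine[OF intf, of r 0] assms by (intro integrable_mult_right) simp
  have "(\<integral>u. exp (- (r * u)\<^sup>2 / 2) * cos (u * z) \<partial>lborel) = sqrt (2 * pi) * (\<integral>u. f (0 + r * u) \<partial>lborel)"
    unfolding g_eq by simp
  also have "(\<integral>u. f (0 + r * u) \<partial>lborel) = exp (- t\<^sup>2 / 2) / r"
    using lborel_integral_real_affine[of r f 0] assms val by (simp add: field_simps)
  finally show "(\<integral>u. exp (- (r * u)\<^sup>2 / 2) * cos (u * z) \<partial>lborel) = sqrt (2 * pi) / r * exp (- (z / r)\<^sup>2 / 2)"
    by (simp add: t_def)
qed

lemma cmod_sum_iexp:
  fixes x :: "'i \<Rightarrow> real"
  shows "(cmod (\<Sum>i\<in>I. exp (\<i> * complex_of_real (u * x i))))\<^sup>2 = (\<Sum>i\<in>I. \<Sum>j\<in>I. cos (u * (x i - x j)))"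
proof -
  have "(cmod (\<Sum>i\<in>I. exp (\<i> * complex_of_real (u * x i))))\<^sup>2
      = (\<Sum>i\<in>I. cos (u * x i))\<^sup>2 + (\<Sum>i\<in>I. sin (u * x i))\<^sup>2"
    unfolding cmod_power2 by (simp add: Re_exp Im_exp)
  also have "\<dots> = (\<Sum>i\<in>I. \<Sum>j\<in>I. cos (u * (x i - x j)))"
    unfolding power2_eq_square sum_product sum.distrib[symmetric] by (simp add: right_diff_distrib cos_diff)
  finally show ?thesis .
qed

text \<open>For \<open>m\<close> the integer part of \<open>|z| / r\<close>, capped at
  \<open>m0\<close>, the Gaussian is at most \<open>exp (- m / 2)\<close>, while the triangle of
  half-width \<open>2 * (m + 1) * r\<close> is at least \<open>1 / (4 * (m + 1) * r)\<close> at
  \<open>z\<close>. Cutting the sum at \<open>m0\<close> keeps the number of scales finite.\<close>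

lemma gaussian_le_tri:
  assumes "0 < r" "\<bar>z\<bar> \<le> (real m0 + 1) * r"
  shows "exp (- (z / r)\<^sup>2 / 2) \<le> (\<Sum>m\<le>m0. exp (- 1 / 2) ^ m * (4 * (real m + 1) * r) * tri (2 * (real m + 1) * r) z)"
proof -
  define x where "x = \<bar>z\<bar> / r"
  define m where "m = min m0 (nat \<lfloor>x\<rfloor>)"
  have x0: "0 \<le> x" using assms by (simp add: x_def)
  have m: "real m \<le> x" using x0 unfolding m_def by linarith
  have m': "\<bar>z\<bar> \<le> (real m + 1) * r"
  proof (cases "nat \<lfloor>x\<rfloor> \<le> m0")
    case True
    then have "x \<le> real m + 1" using x0 unfolding m_def by linarith
    then show ?thesis using assms(1) by (simp add: x_def pos_divide_le_eq)
  next
    case False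
    then show ?thesis using assms(2) by (simp add: m_def)
  qed
  have "exp (- (z / r)\<^sup>2 / 2) = exp (- x\<^sup>2 / 2)" by (simp add: x_def power_divide)
  also have "\<dots> \<le> exp (- real m / 2)"
  proof -
    have "real m \<le> real (m * m)" by (simp only: of_nat_le_iff) (cases m; simp)
    also have "\<dots> \<le> x * x" using m x0 by (simp add: mult_mono)
    finally show ?thesis by (simp add: power2_eq_square)
  qed
  also have "\<dots> = exp (- 1 / 2) ^ m" by (simp add: exp_of_nat_mult[symmetric])
  finally have 1: "exp (- (z / r)\<^sup>2 / 2) \<le> exp (- 1 / 2) ^ m" .
  have R: "0 < 2 * (real m + 1) * r" using assms(1) by simp
  have "1 / (2 * (2 * (real m + 1) * r)) \<le> tri (2 * (real m + 1) * r) z"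
    using m' by (intro tri_ge R) (simp add: algebra_simps)
  then have 2: "1 \<le> 4 * (real m + 1) * r * tri (2 * (real m + 1) * r) z"
  proof -
    assume "1 / (2 * (2 * (real m + 1) * r)) \<le> tri (2 * (real m + 1) * r) z"
    then have "1 \<le> tri (2 * (real m + 1) * r) z * (2 * (2 * (real m + 1) * r))"
      using R by (subst (asm) pos_divide_le_eq) auto
    then show ?thesis by (simp add: mult_ac)
  qed
  have "exp (- 1 / 2) ^ m * 1 \<le> exp (- 1 / 2) ^ m * (4 * (real m + 1) * r * tri (2 * (real m + 1) * r) z)"
    by (intro mult_left_mono 2) simp
  also have "\<dots> \<le> (\<Sum>m\<le>m0. exp (- 1 / 2) ^ m * (4 * (real m + 1) * r * tri (2 * (real m + 1) * r) z))"
    using assms(1) by (intro member_le_sum) (auto simp: m_def tri_nonneg)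
  finally show ?thesis using 1 by (simp add: mult.assoc)
qed

context walk_bits
begin

definition \<phi>N :: "nat \<Rightarrow> real \<Rightarrow> complex" where
  "\<phi>N N u = (\<Sum>w\<in>words N. exp (\<i> * complex_of_real (u * tv c w))) / 2 ^ N"

lemma \<phi>N_tendsto: "(\<lambda>N. \<phi>N N u) \<longlonglongrightarrow> (\<integral>\<omega>. exp (\<i> * complex_of_real (u * T \<omega>)) \<partial>M)"
proof -
  have "\<phi>N N u = (\<integral>\<omega>. exp (\<i> * complex_of_real (u * tv c (pre N \<omega>))) \<partial>M)" for N
    unfolding integral_pre[of "\<lambda>w. exp (\<i> * complex_of_real (u * tv c w))"] \<phi>N_def
    by (simp add: sum_divide_distrib scaleR_conv_of_real)
  moreover have "(\<lambda>N. \<integral>\<omega>. exp (\<i> * complex_of_real (u * tv c (pre N \<omega>))) \<partial>M)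
      \<longlonglongrightarrow> (\<integral>\<omega>. exp (\<i> * complex_of_real (u * T \<omega>)) \<partial>M)"
  proof (rule integral_dominated_convergence[where w = "\<lambda>_. 1"])
    show "(\<lambda>\<omega>. exp (\<i> * complex_of_real (u * tv c (pre N \<omega>)))) \<in> borel_measurable M" for N
      by (rule borel_measurable_integrable[OF integrable_pre])
    show "AE \<omega> in M. (\<lambda>N. exp (\<i> * complex_of_real (u * tv c (pre N \<omega>)))) \<longlonglongrightarrow> exp (\<i> * complex_of_real (u * T \<omega>))"
      by (intro AE_I2 tendsto_intros T_tendsto)
  qed auto
  ultimately show ?thesis by simp
qed

lemma \<phi>N_measurable [measurable]: "\<phi>N N \<in> borel_measurable borel"
  unfolding \<phi>N_def by (intro borel_measurable_continuous_onI continuous_intros) simp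

lemma gaussian_\<phi>N:
  assumes "0 < r"
  shows "(\<integral>\<^sup>+u. ennreal (exp (- (r * u)\<^sup>2 / 2) * (cmod (\<phi>N N u))\<^sup>2) \<partial>lborel)
    = ennreal (sqrt (2 * pi) / r * ((\<Sum>w\<in>words N. \<Sum>w'\<in>words N. exp (- ((tv c w - tv c w') / r)\<^sup>2 / 2)) / 4 ^ N))"
proof -
  have *: "exp (- (r * u)\<^sup>2 / 2) * (cmod (\<phi>N N u))\<^sup>2
      = (\<Sum>w\<in>words N. \<Sum>w'\<in>words N. exp (- (r * u)\<^sup>2 / 2) * cos (u * (tv c w - tv c w'))) / 4 ^ N" for u
  proof -
    have "(cmod (\<phi>N N u))\<^sup>2 = (cmod (\<Sum>w\<in>words N. exp (\<i> * complex_of_real (u * tv c w))))\<^sup>2 / 4 ^ N"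
      unfolding \<phi>N_def norm_divide power_divide by (simp add: norm_power power2_eq_square power_mult_distrib[symmetric])
    then show ?thesis unfolding cmod_sum_iexp by (simp add: sum_distrib_left)
  qed
  have "(\<integral>\<^sup>+u. ennreal (exp (- (r * u)\<^sup>2 / 2) * (cmod (\<phi>N N u))\<^sup>2) \<partial>lborel)
      = ennreal (\<integral>u. exp (- (r * u)\<^sup>2 / 2) * (cmod (\<phi>N N u))\<^sup>2 \<partial>lborel)"
  proof (rule nn_integral_eq_integral)
    show "integrable lborel (\<lambda>u. exp (- (r * u)\<^sup>2 / 2) * (cmod (\<phi>N N u))\<^sup>2)"
      unfolding * by (intro integrable_divide_zero Bochner_Integration.integrable_sum gaussian_cos_integral(1) assms)
  qed simp
  also have "(\<integral>u. exp (- (r * u)\<^sup>2 / 2) * (cmod (\<phi>N N u))\<^sup>2 \<partial>lborel)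
      = sqrt (2 * pi) / r * ((\<Sum>w\<in>words N. \<Sum>w'\<in>words N. exp (- ((tv c w - tv c w') / r)\<^sup>2 / 2)) / 4 ^ N)"
    unfolding *
    by (simp only: integral_divide_zero Bochner_Integration.integral_sum Bochner_Integration.integrable_sum
        gaussian_cos_integral[OF assms]) (simp only: sum_distrib_left times_divide_eq_right)
  finally show ?thesis .
qed

text \<open>Against a Gaussian weight of width \<open>1 / r\<close>, the squared modulus for finite
  words integrates to a Gaussian energy at scale \<open>r\<close>, which
  \<open>gaussian_le_tri\<close> bounds by values of \<open>GN\<close>, uniformly in
  \<open>r\<close>. Fatou is used in \<open>N\<close> and again as \<open>r\<close> tends to
  0.\<close>

theorem char_square_integrable:
  defines "\<phi> \<equiv> \<lambda>u. \<integral>\<omega>. exp (\<i> * complex_of_real (u * T \<omega>)) \<partial>M"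
  shows "\<phi> \<in> borel_measurable borel" "integrable lborel (\<lambda>u. (cmod (\<phi> u))\<^sup>2)"
proof -
  show meas [measurable]: "\<phi> \<in> borel_measurable borel"
    unfolding \<phi>_def by (rule borel_measurable_LIMSEQ_metric[OF \<phi>N_measurable \<phi>N_tendsto])
  obtain K where K: "1 \<le> K" "\<forall>r>0. eventually (\<lambda>N. GN N r c \<le> K) sequentially"
    using GN_eventually_le[OF pb \<beta>_pos, of c] by (elim exE conjE)
  define q where "q = exp (- 1 / 2 :: real)"
  have q: "0 < q" "q < 1" by (auto simp: q_def)
  define S where "S = (\<Sum>m. (1 + real m) ^ 1 * q ^ m)"
  have summ: "summable (\<lambda>m. (1 + real m) ^ 1 * q ^ m)" using q by (intro summable_jet_bound) auto
  have bound: "(\<integral>\<^sup>+u. ennreal (exp (- (r * u)\<^sup>2 / 2) * (cmod (\<phi> u))\<^sup>2) \<partial>lborel) \<le> ennreal (sqrt (2 * pi) * (4 * K * S))"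
    if r: "0 < r" for r
  proof -
    \<comment> \<open>Differences of \<open>tv\<close> are at most \<open>2 * Yb C0\<close>, so
      finitely many triangles suffice, and \<open>GN\<close> is eventually at most \<open>K\<close>
      at all their scales simultaneously.\<close>
    obtain m0 :: nat where m0: "2 * Yb C0 / r \<le> real m0" using real_arch_simple by blast
    have "eventually (\<lambda>N. \<forall>m\<in>{..m0}. GN N (2 * (real m + 1) * r) c \<le> K) sequentially"
      using K(2) r by (intro eventually_ball_finite) auto
    then have ev: "eventually (\<lambda>N. (\<integral>\<^sup>+u. ennreal (exp (- (r * u)\<^sup>2 / 2) * (cmod (\<phi>N N u))\<^sup>2) \<partial>lborel)
        \<le> ennreal (sqrt (2 * pi) * (4 * K * S))) sequentially"
    proof eventually_elim
      case (elim N)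
      have "(\<Sum>w\<in>words N. \<Sum>w'\<in>words N. exp (- ((tv c w - tv c w') / r)\<^sup>2 / 2))
          \<le> (\<Sum>w\<in>words N. \<Sum>w'\<in>words N. \<Sum>m\<le>m0. q ^ m * (4 * (real m + 1) * r) * tri (2 * (real m + 1) * r) (tv c w - tv c w'))"
        unfolding q_def
      proof (intro sum_mono gaussian_le_tri r)
        fix w w'
        have "\<bar>tv c w - tv c w'\<bar> \<le> 2 * Yb C0" using abs_tv_le[OF C0(1,2), of w] abs_tv_le[OF C0(1,2), of w'] by linarith
        also have "\<dots> \<le> real m0 * r" using m0 r by (simp add: pos_divide_le_eq)
        also have "\<dots> \<le> (real m0 + 1) * r" using r by simp
        finally show "\<bar>tv c w - tv c w'\<bar> \<le> (real m0 + 1) * r" .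
      qed
      also have "\<dots> = (\<Sum>w\<in>words N. \<Sum>m\<le>m0. \<Sum>w'\<in>words N. q ^ m * (4 * (real m + 1) * r) * tri (2 * (real m + 1) * r) (tv c w - tv c w'))"
        by (rule sum.cong[OF refl], rule sum.swap)
      also have "\<dots> = (\<Sum>m\<le>m0. \<Sum>w\<in>words N. \<Sum>w'\<in>words N. q ^ m * (4 * (real m + 1) * r) * tri (2 * (real m + 1) * r) (tv c w - tv c w'))"
        by (rule sum.swap)
      also have "\<dots> = (\<Sum>m\<le>m0. q ^ m * (4 * (real m + 1) * r) * (4 ^ N * GN N (2 * (real m + 1) * r) c))"
      proof -
        have "4 ^ N * GN N R c = (\<Sum>w\<in>words N. \<Sum>w'\<in>words N. tri R (tv c w - tv c w'))" for R by (simp add: GN_def)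
        then show ?thesis by (simp only: sum_distrib_left)
      qed
      also have "\<dots> \<le> (\<Sum>m\<le>m0. q ^ m * (4 * (real m + 1) * r) * (4 ^ N * K))"
        using elim q r by (intro sum_mono mult_left_mono) auto
      also have "\<dots> = (\<Sum>m\<le>m0. (1 + real m) ^ 1 * q ^ m) * (4 * r * K * 4 ^ N)"
        unfolding sum_distrib_right by (intro sum.cong refl) (simp add: algebra_simps)
      also have "\<dots> \<le> S * (4 * r * K * 4 ^ N)"
        unfolding S_def using q r K(1) by (intro mult_right_mono sum_le_suminf summ) auto
      finally have "(\<Sum>w\<in>words N. \<Sum>w'\<in>words N. exp (- ((tv c w - tv c w') / r)\<^sup>2 / 2)) / 4 ^ N \<le> S * (4 * r * K)"
        by (simp add: pos_divide_le_eq mult.assoc)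
      then have "sqrt (2 * pi) / r * ((\<Sum>w\<in>words N. \<Sum>w'\<in>words N. exp (- ((tv c w - tv c w') / r)\<^sup>2 / 2)) / 4 ^ N)
          \<le> sqrt (2 * pi) / r * (S * (4 * r * K))"
        using r by (intro mult_left_mono) auto
      also have "\<dots> = sqrt (2 * pi) * (4 * K * S)" using r by simp
      finally show ?case unfolding gaussian_\<phi>N[OF r] by (rule ennreal_leI)
    qed
    have "(\<integral>\<^sup>+u. ennreal (exp (- (r * u)\<^sup>2 / 2) * (cmod (\<phi> u))\<^sup>2) \<partial>lborel)
        \<le> (\<integral>\<^sup>+u. liminf (\<lambda>N. ennreal (exp (- (r * u)\<^sup>2 / 2) * (cmod (\<phi>N N u))\<^sup>2)) \<partial>lborel)"
    proof (rule nn_integral_mono)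
      fix u
      have *: "(\<lambda>N. ennreal (exp (- (r * u)\<^sup>2 / 2) * (cmod (\<phi>N N u))\<^sup>2)) \<longlonglongrightarrow> ennreal (exp (- (r * u)\<^sup>2 / 2) * (cmod (\<phi> u))\<^sup>2)"
        unfolding \<phi>_def by (intro tendsto_ennrealI tendsto_mult tendsto_const tendsto_power tendsto_norm \<phi>N_tendsto)
      show "ennreal (exp (- (r * u)\<^sup>2 / 2) * (cmod (\<phi> u))\<^sup>2) \<le> liminf (\<lambda>N. ennreal (exp (- (r * u)\<^sup>2 / 2) * (cmod (\<phi>N N u))\<^sup>2))"
        using lim_imp_Liminf[OF _ *] by simp
    qed
    also have "\<dots> \<le> liminf (\<lambda>N. \<integral>\<^sup>+u. ennreal (exp (- (r * u)\<^sup>2 / 2) * (cmod (\<phi>N N u))\<^sup>2) \<partial>lborel)"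
      by (intro nn_integral_liminf) measurable
    also have "\<dots> \<le> liminf (\<lambda>N. ennreal (sqrt (2 * pi) * (4 * K * S)))" by (rule Liminf_mono[OF ev])
    also have "\<dots> = ennreal (sqrt (2 * pi) * (4 * K * S))" by (simp add: Liminf_const)
    finally show ?thesis .
  qed
  define r where "r j = inverse (real (Suc j))" for j
  have "(\<integral>\<^sup>+u. ennreal ((cmod (\<phi> u))\<^sup>2) \<partial>lborel)
      \<le> (\<integral>\<^sup>+u. liminf (\<lambda>j. ennreal (exp (- (r j * u)\<^sup>2 / 2) * (cmod (\<phi> u))\<^sup>2)) \<partial>lborel)"
  proof (rule nn_integral_mono)
    fix u
    have "(\<lambda>j. exp (- (r j * u)\<^sup>2 / 2) * (cmod (\<phi> u))\<^sup>2) \<longlonglongrightarrow> exp (- (0 * u)\<^sup>2 / 2) * (cmod (\<phi> u))\<^sup>2"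
      unfolding r_def by (intro tendsto_intros LIMSEQ_inverse_real_of_nat) simp
    then have *: "(\<lambda>j. ennreal (exp (- (r j * u)\<^sup>2 / 2) * (cmod (\<phi> u))\<^sup>2)) \<longlonglongrightarrow> ennreal ((cmod (\<phi> u))\<^sup>2)"
      by (intro tendsto_ennrealI) simp
    show "ennreal ((cmod (\<phi> u))\<^sup>2) \<le> liminf (\<lambda>j. ennreal (exp (- (r j * u)\<^sup>2 / 2) * (cmod (\<phi> u))\<^sup>2))"
      using lim_imp_Liminf[OF _ *] by simp
  qed
  also have "\<dots> \<le> liminf (\<lambda>j. \<integral>\<^sup>+u. ennreal (exp (- (r j * u)\<^sup>2 / 2) * (cmod (\<phi> u))\<^sup>2) \<partial>lborel)"
    by (intro nn_integral_liminf) measurable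
  also have "\<dots> \<le> ennreal (sqrt (2 * pi) * (4 * K * S))"
    by (intro Liminf_le always_eventually allI bound) (auto simp: r_def)
  finally have "(\<integral>\<^sup>+u. ennreal ((cmod (\<phi> u))\<^sup>2) \<partial>lborel) < \<infinity>" by (auto intro: le_less_trans)
  then show "integrable lborel (\<lambda>u. (cmod (\<phi> u))\<^sup>2)" by (intro integrableI_nonneg) auto
qed

end

section \<open>Binary digits and the baker map\<close>

text \<open>Binary expansion with digits \<plusminus>1: a point \<open>y\<close> of the unit
  interval is \<open>(1 + Usum (dgt y)) / 2\<close> by \<open>eq_Usum\<close>.\<close>

definition Usum :: "(nat \<Rightarrow> bool) \<Rightarrow> real" where
  "Usum s = (\<Sum>i. sg (s i) / 2 ^ Suc i)"

lemma summable_Usum: "summable (\<lambda>i. sg (s i) / 2 ^ Suc i)"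
proof (rule summable_comparison_test)
  show "summable (\<lambda>i. (1 / 2 :: real) ^ Suc i)" using summable_geometric[of "1 / 2 :: real"] by (simp add: summable_mult)
  show "\<exists>N. \<forall>n\<ge>N. norm (sg (s n) / 2 ^ Suc n) \<le> (1 / 2) ^ Suc n"
    by (auto simp: sg_def power_one_over)
qed

lemma Usum_rec: "Usum s = (sg (s 0) + Usum (\<lambda>i. s (Suc i))) / 2"
proof -
  have "Usum s = sg (s 0) / 2 + (\<Sum>i. sg (s (Suc i)) / 2 ^ Suc (Suc i))"
    unfolding Usum_def using suminf_split_head[OF summable_Usum, of s] by simp
  also have "(\<Sum>i. sg (s (Suc i)) / 2 ^ Suc (Suc i)) = (\<Sum>i. sg (s (Suc i)) / 2 ^ Suc i / 2)"
    by (simp add: mult.commute)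
  also have "\<dots> = Usum (\<lambda>i. s (Suc i)) / 2"
    unfolding Usum_def by (rule suminf_divide[OF summable_Usum])
  finally show ?thesis by simp
qed

lemma abs_Usum_le: "\<bar>Usum s\<bar> \<le> 1"
proof -
  have "norm (Usum s) \<le> (\<Sum>i. (1 / 2 :: real) ^ Suc i)"
    unfolding Usum_def
  proof (rule norm_suminf_le)
    show "norm (sg (s i) / 2 ^ Suc i) \<le> (1 / 2) ^ Suc i" for i by (simp add: sg_def power_one_over)
    show "summable (\<lambda>i. (1 / 2 :: real) ^ Suc i)" using summable_geometric[of "1 / 2 :: real"] by (simp add: summable_mult)
  qed
  also have "\<dots> = 1" using power_half_series by (simp add: sums_iff)
  finally show ?thesis by simp
qed

context walk
begin

lemma uv_tendsto: "(\<lambda>N. uv (map s [0..<N])) \<longlonglongrightarrow> Usum s"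
proof -
  have "uv (map s [0..<N]) = (\<Sum>i<N. sg (s i) / 2 ^ Suc i)" for N
    by (induction N) (simp_all add: uv_append)
  then show ?thesis using summable_LIMSEQ[OF summable_Usum, of s] by (simp add: Usum_def)
qed

lemma Tlim_eq: "Tlim c s = Tlim 0 s + c * Usum s"
proof (rule LIMSEQ_unique[OF Tlim_tendsto])
  have "tv c w = tv 0 w + c * uv w" for w using tv_diff[of c w 0] by simp
  then show "(\<lambda>N. tv c (map s [0..<N])) \<longlonglongrightarrow> Tlim 0 s + c * Usum s"
    by (simp only:) (intro tendsto_intros Tlim_tendsto uv_tendsto)
qed

lemma Tlim_rec: "Tlim c s = sg (s 0) * (g * a + c / 2) + g * Tlim (k * c + sg (s 0)) (\<lambda>i. s (Suc i))"
proof (rule LIMSEQ_unique[OF LIMSEQ_Suc[OF Tlim_tendsto]])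
  have "map s [0..<Suc N] = s 0 # map (\<lambda>i. s (Suc i)) [0..<N]" for N by (rule map_upt_Suc)
  then show "(\<lambda>N. tv c (map s [0..<Suc N])) \<longlonglongrightarrow> sg (s 0) * (g * a + c / 2) + g * Tlim (k * c + sg (s 0)) (\<lambda>i. s (Suc i))"
    by (simp only: tv.simps) (intro tendsto_intros Tlim_tendsto)
qed

text \<open>The right side \<open>R s\<close> equals the first term plus \<open>g\<close> times
  \<open>R\<close> of the shifted signs, because splitting off the first sign changes the slope from
  0 to \<open>sg (s 0)\<close> and \<open>Tlim\<close> is affine in the slope. Iteration leaves a
  remainder of order \<open>g ^ N\<close>. The terms are the values of \<Phi> on the backward orbit,
  see \<open>Phi_tail\<close>.\<close>

lemma sums_of_Tlim:
  assumes "a = 0"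
  shows "(\<lambda>n. g ^ n * (1 / 4 - sg (s n) * Usum (\<lambda>i. s (i + Suc n)) / 4)) sums (1 / (4 * (1 - g)) - Tlim 0 s / (4 * g))"
proof -
  define R where "R s = 1 / (4 * (1 - g)) - Tlim 0 s / (4 * g)" for s
  have rec: "R s = (1 / 4 - sg (s 0) * Usum (\<lambda>i. s (Suc i)) / 4) + g * R (\<lambda>i. s (Suc i))" for s
  proof -
    have "Tlim 0 s = g * (Tlim 0 (\<lambda>i. s (Suc i)) + sg (s 0) * Usum (\<lambda>i. s (Suc i)))"
      using Tlim_rec[of 0 s] Tlim_eq[of "sg (s 0)" "\<lambda>i. s (Suc i)"] assms by simp
    then have "Tlim 0 s / (4 * g) = Tlim 0 (\<lambda>i. s (Suc i)) / 4 + sg (s 0) * Usum (\<lambda>i. s (Suc i)) / 4"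
      using g_pos by simp
    moreover have "1 / (4 * (1 - g)) = 1 / 4 + g * (1 / (4 * (1 - g)))" using g_lt by (simp add: field_simps)
    moreover have "g * (Tlim 0 (\<lambda>i. s (Suc i)) / (4 * g)) = Tlim 0 (\<lambda>i. s (Suc i)) / 4" using g_pos by simp
    ultimately show ?thesis unfolding R_def right_diff_distrib by linarith
  qed
  have part: "(\<Sum>n<N. g ^ n * (1 / 4 - sg (s n) * Usum (\<lambda>i. s (i + Suc n)) / 4)) = R s - g ^ N * R (\<lambda>i. s (i + N))" for N
  proof (induction N)
    case (Suc N)
    have "R (\<lambda>i. s (i + N)) = (1 / 4 - sg (s N) * Usum (\<lambda>i. s (i + Suc N)) / 4) + g * R (\<lambda>i. s (i + Suc N))"
      using rec[of "\<lambda>i. s (i + N)"] by simp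
    then have "g ^ N * R (\<lambda>i. s (i + N)) = g ^ N * (1 / 4 - sg (s N) * Usum (\<lambda>i. s (i + Suc N)) / 4)
        + g ^ Suc N * R (\<lambda>i. s (i + Suc N))"
      by (simp only: distrib_left power_Suc2 mult.assoc)
    then show ?case using Suc unfolding sum.lessThan_Suc by linarith
  qed simp
  have "(\<lambda>N. g ^ N * R (\<lambda>i. s (i + N))) \<longlonglongrightarrow> 0"
  proof (rule Lim_null_comparison)
    have "\<bar>R s\<bar> \<le> 1 / (4 * (1 - g)) + Yb (1 / (1 - k)) / (4 * g)" for s
    proof -
      have "\<bar>Tlim 0 s\<bar> \<le> Yb (1 / (1 - k))" using k_lt by (intro abs_Tlim_le) auto
      then have "\<bar>Tlim 0 s / (4 * g)\<bar> \<le> Yb (1 / (1 - k)) / (4 * g)" using g_pos by (simp add: abs_divide divide_right_mono)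
      moreover have "0 \<le> 1 / (4 * (1 - g))" using g_lt by simp
      ultimately show ?thesis unfolding R_def by linarith
    qed
    then show "eventually (\<lambda>N. norm (g ^ N * R (\<lambda>i. s (i + N))) \<le> g ^ N * (1 / (4 * (1 - g)) + Yb (1 / (1 - k)) / (4 * g))) sequentially"
      using g_pos by (intro always_eventually allI) (simp add: abs_mult mult_left_mono)
    have "(\<lambda>N. g ^ N * (1 / (4 * (1 - g)) + Yb (1 / (1 - k)) / (4 * g))) \<longlonglongrightarrow> 0 * (1 / (4 * (1 - g)) + Yb (1 / (1 - k)) / (4 * g))"
      using g_pos g_lt by (intro tendsto_mult tendsto_const LIMSEQ_power_zero) auto
    then show "(\<lambda>N. g ^ N * (1 / (4 * (1 - g)) + Yb (1 / (1 - k)) / (4 * g))) \<longlonglongrightarrow> 0" by simp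
  qed
  then have "(\<lambda>N. R s - g ^ N * R (\<lambda>i. s (i + N))) \<longlonglongrightarrow> R s - 0" by (intro tendsto_diff tendsto_const)
  then show ?thesis unfolding sums_def part R_def by simp
qed

end

section \<open>The functions S and H in terms of binary digits\<close>

lemma Phi_eq: "0 \<le> t \<Longrightarrow> t \<le> 1 \<Longrightarrow> Phi t = min t (1 - t)"
proof -
  assume t: "0 \<le> t" "t \<le> 1"
  have "Phi t \<le> dist t 0" "Phi t \<le> dist t 1" unfolding Phi_def by (intro infdist_le Ints_0 Ints_1)+
  moreover have "min t (1 - t) \<le> Phi t"
    unfolding Phi_def
  proof (subst infdist_notempty)
    show "min t (1 - t) \<le> (INF a\<in>\<int>. dist t a)"
    proof (rule cINF_greatest)
      fix x :: real assume "x \<in> \<int>"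
      then obtain i where i: "x = of_int i" by (elim Ints_cases)
      consider "i \<le> 0" | "1 \<le> i" by linarith
      then show "min t (1 - t) \<le> dist t x"
        using t unfolding i dist_real_def by cases (auto simp: min_def abs_if)
    qed auto
  qed auto
  ultimately show ?thesis using t by (simp add: dist_real_def min_def abs_if split: if_splits)
qed

lemma Phi_low: "0 \<le> t \<Longrightarrow> t \<le> 1 / 2 \<Longrightarrow> Phi t = t"
  by (subst Phi_eq) (auto simp: min_def)

lemma Phi_high: "1 / 2 \<le> t \<Longrightarrow> t \<le> 1 \<Longrightarrow> Phi t = 1 - t"
  by (subst Phi_eq) (auto simp: min_def)

definition dgt :: "real \<Rightarrow> nat \<Rightarrow> bool" where
  "dgt y i \<longleftrightarrow> binary_digits y i = 1"

lemma digit_eq: "y \<in> {0..1} \<Longrightarrow> real (binary_digits y i) = (1 + sg (dgt y i)) / 2"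
  using is_chosen_expansion_binary_digits[of y]
  unfolding is_chosen_expansion_def is_binary_expansion_def by (auto simp: dgt_def sg_def)

lemma digits_sums: "y \<in> {0..1} \<Longrightarrow> (\<lambda>n. real (binary_digits y n) / 2 ^ (n + 1)) sums y"
  using is_chosen_expansion_binary_digits[of y]
  unfolding is_chosen_expansion_def is_binary_expansion_def by simp

lemma tail_sums:
  assumes "y \<in> {0..1}"
  shows "(\<lambda>i. real (binary_digits y (i + n)) / 2 ^ (i + 1)) sums ((1 + Usum (\<lambda>i. dgt y (i + n))) / 2)"
proof -
  have "(\<lambda>i. (1 / 2) ^ Suc i / 2 + sg (dgt y (i + n)) / 2 ^ Suc i / 2) sums (1 / 2 + Usum (\<lambda>i. dgt y (i + n)) / 2)"
    unfolding Usum_def by (intro sums_add sums_divide power_half_series summable_sums summable_Usum)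
  moreover have "(1 / 2) ^ Suc i / 2 + sg (dgt y (i + n)) / 2 ^ Suc i / 2 = real (binary_digits y (i + n)) / 2 ^ (i + 1)" for i
    unfolding digit_eq[OF assms] by (simp add: power_one_over add_divide_distrib)
  ultimately show ?thesis by (simp add: add_divide_distrib)
qed

lemma eq_Usum:
  assumes "y \<in> {0..1}"
  shows "y = (1 + Usum (dgt y)) / 2"
  using sums_unique2[OF digits_sums[OF assms] tail_sums[OF assms, of 0, unfolded add_0_right]] .

lemma baker_neg:
  assumes "y \<in> {0..1}"
  shows "baker_iter2 (- int n) \<xi> y = (1 + Usum (\<lambda>i. dgt y (i + n))) / 2"
proof (cases "n = 0")
  case True
  then show ?thesis using eq_Usum[OF assms] by (simp add: baker_iter2_def baker_iter_def)
next
  case False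
  then show ?thesis
    using tail_sums[OF assms, of n] by (simp add: baker_iter2_def baker_iter_def sums_iff)
qed

lemma baker_neg_0: "baker_iter2 (- int n) \<xi> 0 = 0"
proof -
  have "(\<lambda>n. real (binary_digits 0 n) / 2 ^ (n + 1)) sums 0" by (rule digits_sums) simp
  then have "real (binary_digits 0 n) / 2 ^ (n + 1) = 0" for n
    using suminf_eq_zero_iff[of "\<lambda>n. real (binary_digits 0 n) / 2 ^ (n + 1)"] by (auto simp: sums_iff)
  then have "binary_digits 0 n = 0" for n by simp
  then show ?thesis by (auto simp: baker_iter2_def baker_iter_def)
qed

text \<open>The leading digit decides on which branch of \<Phi> the point lies; in terms of signs
  both branches give the same formula.\<close>

lemma Phi_tail:
  assumes "y \<in> {0..1}"
  shows "Phi (baker_iter2 (- int n) \<xi> y) = 1 / 4 - sg (dgt y n) * Usum (\<lambda>i. dgt y (i + Suc n)) / 4"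
proof -
  let ?U = "Usum (\<lambda>i. dgt y (i + Suc n))"
  have U: "- 1 \<le> ?U" "?U \<le> 1" using abs_Usum_le[of "\<lambda>i. dgt y (i + Suc n)"] by auto
  have "Usum (\<lambda>i. dgt y (i + n)) = (sg (dgt y n) + ?U) / 2"
    using Usum_rec[of "\<lambda>i. dgt y (i + n)"] by simp
  then have b: "baker_iter2 (- int n) \<xi> y = (1 + (sg (dgt y n) + ?U) / 2) / 2"
    unfolding baker_neg[OF assms] by simp
  show ?thesis
  proof (cases "dgt y n")
    case True
    have "Phi ((3 + ?U) / 4) = 1 - (3 + ?U) / 4" using U by (intro Phi_high) auto
    moreover have "(1 + (sg (dgt y n) + ?U) / 2) / 2 = (3 + ?U) / 4" using True by (simp add: sg_def field_simps)
    ultimately show ?thesis unfolding b using True by (simp add: sg_def field_simps)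
  next
    case False
    have "Phi ((1 + ?U) / 4) = (1 + ?U) / 4" using U by (intro Phi_low) auto
    moreover have "(1 + (sg (dgt y n) + ?U) / 2) / 2 = (1 + ?U) / 4" using False by (simp add: sg_def field_simps)
    ultimately show ?thesis unfolding b using False by (simp add: sg_def field_simps)
  qed
qed

text \<open>The second component of the \<open>m\<close>-th baker iterate at \<open>x = 0\<close>;
  the digit of index \<open>m - 1\<close> is the leading one.\<close>

definition hd_part :: "real \<Rightarrow> nat \<Rightarrow> real" where
  "hd_part \<xi> m = (\<Sum>j<m. real (binary_digits \<xi> j) / 2 ^ (m - j))"

lemma hd_part_Suc: "hd_part \<xi> (Suc m) = (real (binary_digits \<xi> m) + hd_part \<xi> m) / 2"
proof -
  have "(\<Sum>j<m. real (binary_digits \<xi> j) / 2 ^ (Suc m - j)) = (\<Sum>j<m. real (binary_digits \<xi> j) / 2 ^ (m - j) / 2)"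
    by (intro sum.cong refl) (simp add: Suc_diff_le mult.commute)
  then show ?thesis by (simp add: hd_part_def add_divide_distrib sum_divide_distrib)
qed

lemma hd_part_bounds:
  assumes "\<xi> \<in> {0..1}"
  shows "0 \<le> hd_part \<xi> m \<and> hd_part \<xi> m \<le> 1 - 1 / 2 ^ m"
proof (induction m)
  case (Suc m)
  have "real (binary_digits \<xi> m) \<le> 1" unfolding digit_eq[OF assms] by (simp add: sg_def)
  then have "(real (binary_digits \<xi> m) + hd_part \<xi> m) / 2 \<le> (1 + (1 - 1 / 2 ^ m)) / 2"
    using Suc by (intro divide_right_mono add_mono) auto
  also have "\<dots> = 1 - 1 / 2 ^ Suc m" by (simp add: diff_divide_distrib mult.commute)
  finally show ?case using Suc by (simp add: hd_part_Suc)
qed (simp add: hd_part_def)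

lemma baker_pos: "baker_iter2 (int (Suc m)) \<xi> x = hd_part \<xi> (Suc m) + x / 2 ^ Suc m"
  by (simp add: baker_iter2_def baker_iter_def hd_part_def nat_add_distrib del: sum.lessThan_Suc)

text \<open>Adding \<open>y / 2 ^ (m + 1)\<close> with \<open>y \<le> 1\<close> does not cross 1/2,
  so the point stays in the half given by the leading digit, where \<Phi> is linear with slope
  \<open>- sg (dgt \<xi> m)\<close>.\<close>

lemma Phi_baker_pos:
  assumes "\<xi> \<in> {0..1}" "y \<in> {0..1}"
  shows "Phi (baker_iter2 (int (Suc m)) \<xi> y) - Phi (baker_iter2 (int (Suc m)) \<xi> 0) = - sg (dgt \<xi> m) * (y / 2 ^ Suc m)"
proof -
  define e where "e = y / 2 ^ Suc m"
  define q where "q = 1 / (2::real) ^ m"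
  have "2 * (y / 2 ^ Suc m) = y / 2 ^ m" by simp
  also have "\<dots> \<le> 1 / 2 ^ m" using assms(2) by (intro divide_right_mono) auto
  finally have e: "0 \<le> e" "2 * e \<le> q" using assms(2) by (simp_all add: e_def q_def)
  have h: "0 \<le> hd_part \<xi> m" "hd_part \<xi> m \<le> 1 - q" using hd_part_bounds[OF assms(1), of m] by (auto simp: q_def)
  have b: "baker_iter2 (int (Suc m)) \<xi> x = ((1 + sg (dgt \<xi> m)) / 2 + hd_part \<xi> m) / 2 + x / 2 ^ Suc m" for x
    unfolding baker_pos hd_part_Suc digit_eq[OF assms(1)] ..
  have p: "0 \<le> q" by (simp add: q_def)
  have "Phi (((1 + sg (dgt \<xi> m)) / 2 + hd_part \<xi> m) / 2 + e) - Phi (((1 + sg (dgt \<xi> m)) / 2 + hd_part \<xi> m) / 2)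
    = - sg (dgt \<xi> m) * e"
  proof (cases "dgt \<xi> m")
    case True
    have "Phi ((1 + hd_part \<xi> m) / 2 + e) = 1 - ((1 + hd_part \<xi> m) / 2 + e)"
      by (rule Phi_high; use e h p in \<open>simp add: field_simps\<close>)
    moreover have "Phi ((1 + hd_part \<xi> m) / 2) = 1 - (1 + hd_part \<xi> m) / 2"
      by (rule Phi_high; use e h p in \<open>simp add: field_simps\<close>)
    ultimately show ?thesis using True by (simp add: sg_def)
  next
    case False
    have "Phi (hd_part \<xi> m / 2 + e) = hd_part \<xi> m / 2 + e"
      by (rule Phi_low; use e h p in \<open>simp add: field_simps\<close>)
    moreover have "Phi (hd_part \<xi> m / 2) = hd_part \<xi> m / 2"
      by (rule Phi_low; use e h p in \<open>simp add: field_simps\<close>)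
    ultimately show ?thesis using False by (simp add: sg_def)
  qed
  then show ?thesis unfolding b e_def by simp
qed

text \<open>Since \<open>hd_part \<xi> n < 1\<close>, the breakpoint 1/2 is only reached with
  leading digit 1, and there the convention gives -1.\<close>

lemma Phi_deriv_baker:
  assumes "\<xi> \<in> {0..1}"
  shows "Phi_deriv (binary_digits \<xi> n) (baker_iter2 (int (n + 1)) \<xi> 0) = - sg (dgt \<xi> n)"
proof -
  have b: "baker_iter2 (int (n + 1)) \<xi> 0 = (real (binary_digits \<xi> n) + hd_part \<xi> n) / 2"
    using baker_pos[of n \<xi> 0] by (simp add: hd_part_Suc)
  have h: "0 \<le> hd_part \<xi> n" "hd_part \<xi> n < 1"
  proof -
    have "0 < 1 / (2::real) ^ n" by simp
    then show "0 \<le> hd_part \<xi> n" "hd_part \<xi> n < 1" using hd_part_bounds[OF assms, of n] by linarith+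
  qed
  have d: "real (binary_digits \<xi> n) = (1 + sg (dgt \<xi> n)) / 2" by (rule digit_eq[OF assms])
  show ?thesis
  proof (cases "dgt \<xi> n")
    case True
    then have "binary_digits \<xi> n = 1" by (simp add: dgt_def)
    then show ?thesis unfolding b using h True by (simp add: Phi_deriv_def sg_def)
  next
    case False
    then have "binary_digits \<xi> n = 0" using d by (simp add: sg_def)
    then show ?thesis unfolding b using h False by (simp add: Phi_deriv_def sg_def)
  qed
qed

text \<open>For negative indices the summands are linear in \<open>y\<close> and add up to
  \<open>S * y\<close>; the other indices form the series of \<open>sums_of_Tlim\<close>. After
  subtracting \<open>kappa \<gamma> * y * S\<close>, the remaining linear term is absorbed into the
  starting slope, because \<open>Tlim\<close> is affine in it with coefficient
  \<open>Usum (dgt y) = 2 * y - 1\<close>.\<close>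

lemma H_fun_eq:
  assumes "walk \<gamma> (kappa \<gamma>)" "\<xi> \<in> {0..1}" "y \<in> {0..1}"
  shows "H_fun \<gamma> \<xi> y - kappa \<gamma> * y * S_fun \<gamma> \<xi> 0
    = (1 / (4 * (1 - \<gamma>)) + (1 - kappa \<gamma>) * S_fun \<gamma> \<xi> 0 / 2)
      - walk.Tlim \<gamma> (kappa \<gamma>) 0 (- 2 * \<gamma> * (1 - kappa \<gamma>) * S_fun \<gamma> \<xi> 0) (dgt y) / (4 * \<gamma>)"
proof -
  interpret walk \<gamma> "kappa \<gamma>" 0 by fact
  define S where "S = S_fun \<gamma> \<xi> 0"
  define f where "f n = \<gamma> powi n * (Phi (baker_iter2 (- n) \<xi> y) - Phi (baker_iter2 (- n) \<xi> 0))" for n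
  have Phi0: "Phi 0 = 0" by (simp add: Phi_eq)
  have sumS: "summable (\<lambda>n. norm (kappa \<gamma> ^ (n + 1) * - sg (dgt \<xi> n)))"
  proof -
    have "norm (kappa \<gamma> ^ (n + 1) * - sg (dgt \<xi> n)) = kappa \<gamma> * kappa \<gamma> ^ n" for n
      using k_pos by (simp add: abs_mult)
    moreover have "summable (\<lambda>n. kappa \<gamma> * kappa \<gamma> ^ n)"
      using k_pos k_lt by (intro summable_mult summable_geometric) simp
    ultimately show ?thesis by (simp only:)
  qed
  have S_sums: "(\<lambda>n. kappa \<gamma> ^ (n + 1) * - sg (dgt \<xi> n)) sums S"
    unfolding S_def S_fun_def Phi_deriv_baker[OF assms(2)] using summable_sums[OF summable_norm_cancel[OF sumS]] .
  have pos: "(f has_sum (1 / (4 * (1 - \<gamma>)) - Tlim 0 (dgt y) / (4 * \<gamma>))) {0..}"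
  proof -
    have f_int: "f (int n) = \<gamma> ^ n * (1 / 4 - sg (dgt y n) * Usum (\<lambda>i. dgt y (i + Suc n)) / 4)" for n
      unfolding f_def Phi_tail[OF assms(3)] baker_neg_0 Phi0 by (simp add: power_int_of_nat)
    have "((f \<circ> int) has_sum (1 / (4 * (1 - \<gamma>)) - Tlim 0 (dgt y) / (4 * \<gamma>))) UNIV"
      unfolding o_def f_int
    proof (rule norm_summable_imp_has_sum)
      show "summable (\<lambda>n. norm (\<gamma> ^ n * (1 / 4 - sg (dgt y n) * Usum (\<lambda>i. dgt y (i + Suc n)) / 4)))"
      proof (rule summable_comparison_test)
        show "summable (\<lambda>n. \<gamma> ^ n)" using g_pos g_lt by (intro summable_geometric) auto
        have "\<bar>1 / 4 - sg (dgt y n) * Usum (\<lambda>i. dgt y (i + Suc n)) / 4\<bar> \<le> 1" for n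
        proof -
          have "\<bar>sg (dgt y n) * Usum (\<lambda>i. dgt y (i + Suc n))\<bar> \<le> 1" using abs_Usum_le by (simp add: abs_mult)
          then show ?thesis by linarith
        qed
        then show "\<exists>N. \<forall>n\<ge>N. norm (norm (\<gamma> ^ n * (1 / 4 - sg (dgt y n) * Usum (\<lambda>i. dgt y (i + Suc n)) / 4))) \<le> \<gamma> ^ n"
          using g_pos by (intro exI[of _ 0] allI impI) (simp add: abs_mult mult_left_le)
      qed
    qed (rule sums_of_Tlim, simp)
    moreover have "range int = {0..}" by (auto simp: image_iff intro: nonneg_int_cases)
    ultimately show ?thesis using has_sum_reindex[of int UNIV f] by simp
  qed
  have neg: "(f has_sum (S * y)) {..<0}"
  proof -
    define h where "h m = - int (Suc m)" for m
    have f_h: "f (h m) = kappa \<gamma> ^ (m + 1) * - sg (dgt \<xi> m) * y" for m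
    proof -
      have "f (h m) = \<gamma> powi (- int (Suc m)) * (- sg (dgt \<xi> m) * (y / 2 ^ Suc m))"
        unfolding f_def h_def minus_minus Phi_baker_pos[OF assms(2,3)] ..
      also have "\<gamma> powi (- int (Suc m)) = 1 / \<gamma> ^ Suc m"
        by (simp only: power_int_minus power_int_of_nat inverse_eq_divide)
      finally show ?thesis by (simp add: kappa_def power_divide power_mult_distrib)
    qed
    have "((f \<circ> h) has_sum (S * y)) UNIV"
      unfolding o_def f_h
    proof (rule norm_summable_imp_has_sum)
      show "summable (\<lambda>m. norm (kappa \<gamma> ^ (m + 1) * - sg (dgt \<xi> m) * y))"
        unfolding norm_mult[of _ y] using sumS by (rule summable_mult2)
      show "(\<lambda>m. kappa \<gamma> ^ (m + 1) * - sg (dgt \<xi> m) * y) sums (S * y)" by (rule sums_mult2[OF S_sums])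
    qed
    moreover have "inj h" by (auto simp: inj_on_def h_def)
    moreover have "range h = {..<0}"
    proof -
      have "n \<in> range h" if "n < 0" for n
        using that by (intro image_eqI[of _ _ "nat (- n - 1)"]) (auto simp: h_def)
      then show ?thesis by (auto simp: h_def)
    qed
    ultimately show ?thesis using has_sum_reindex[of h UNIV f] by simp
  qed
  have "(f has_sum (1 / (4 * (1 - \<gamma>)) - Tlim 0 (dgt y) / (4 * \<gamma>) + S * y)) ({0..} \<union> {..<0})"
    by (rule has_sum_Un_disjoint[OF pos neg]) auto
  moreover have "{0..} \<union> {..<0} = (UNIV :: int set)" by auto
  ultimately have "infsum f UNIV = 1 / (4 * (1 - \<gamma>)) - Tlim 0 (dgt y) / (4 * \<gamma>) + S * y"
    by (intro infsumI) (simp only:)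
  then have H: "H_fun \<gamma> \<xi> y = 1 / (4 * (1 - \<gamma>)) - Tlim 0 (dgt y) / (4 * \<gamma>) + S * y"
    unfolding H_fun_def f_def[abs_def] .
  have T: "Tlim (- 2 * \<gamma> * (1 - kappa \<gamma>) * S) (dgt y) / (4 * \<gamma>)
      = Tlim 0 (dgt y) / (4 * \<gamma>) - (1 - kappa \<gamma>) * S / 2 * Usum (dgt y)"
  proof -
    have "(- 2 * \<gamma> * (1 - kappa \<gamma>) * S) * Usum (dgt y) / (4 * \<gamma>) = - ((1 - kappa \<gamma>) * S / 2 * Usum (dgt y))"
      using g_pos by simp
    then show ?thesis unfolding Tlim_eq[of "- 2 * \<gamma> * (1 - kappa \<gamma>) * S"] add_divide_distrib by linarith
  qed
  have "H_fun \<gamma> \<xi> y - kappa \<gamma> * y * S = 1 / (4 * (1 - \<gamma>)) - Tlim 0 (dgt y) / (4 * \<gamma>) + (1 - kappa \<gamma>) * S * y"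
    unfolding H by (simp add: algebra_simps)
  also have "(1 - kappa \<gamma>) * S * y = (1 - kappa \<gamma>) * S / 2 + (1 - kappa \<gamma>) * S / 2 * Usum (dgt y)"
    by (subst eq_Usum[OF assms(3)]) (simp add: field_simps)
  finally show ?thesis unfolding S_def[symmetric] T by simp
qed

lemma distr_density_affine:
  fixes h :: "real \<Rightarrow> real"
  assumes [measurable]: "h \<in> borel_measurable borel" and b: "b \<noteq> 0"
  shows "distr (density lborel (\<lambda>x. ennreal (h x))) borel (\<lambda>x. t + b * x)
    = density lborel (\<lambda>x. ennreal (h ((x - t) / b) / \<bar>b\<bar>))"
proof -
  let ?A = "\<lambda>x. t + b * x"
  have "density lborel (\<lambda>x. ennreal (h ((x - t) / b) / \<bar>b\<bar>))
      = density (density (distr lborel borel ?A) (\<lambda>_. ennreal \<bar>b\<bar>)) (\<lambda>x. ennreal (h ((x - t) / b) / \<bar>b\<bar>))"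
    using lborel_real_affine[OF b, of t] by simp
  also have "\<dots> = density (distr lborel borel ?A) (\<lambda>x. ennreal \<bar>b\<bar> * ennreal (h ((x - t) / b) / \<bar>b\<bar>))"
    by (intro density_density_eq) measurable
  also have "\<dots> = distr (density lborel (\<lambda>x. ennreal \<bar>b\<bar> * ennreal (h ((?A x - t) / b) / \<bar>b\<bar>))) borel ?A"
    by (intro density_distr) measurable
  also have "(\<lambda>x. ennreal \<bar>b\<bar> * ennreal (h ((?A x - t) / b) / \<bar>b\<bar>)) = (\<lambda>x. ennreal (h x))"
    using b by (intro ext) (simp flip: ennreal_mult')
  finally show ?thesis ..
qed

section \<open>Lebesgue measure as the law of fair digits\<close>

context walk
begin

lemma Usum_split: "Usum s = uv (map s [0..<n]) + Usum (\<lambda>i. s (i + n)) / 2 ^ n"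
proof (induction n)
  case (Suc n)
  have "Usum (\<lambda>i. s (i + n)) = (sg (s n) + Usum (\<lambda>i. s (i + Suc n))) / 2"
    using Usum_rec[of "\<lambda>i. s (i + n)"] by simp
  moreover have "uv (map s [0..<Suc n]) = uv (map s [0..<n]) + sg (s n) / 2 / 2 ^ n"
    by (simp add: uv_append)
  ultimately show ?case using Suc by (simp add: add_divide_distrib mult.commute)
qed simp

definition cyl :: "bool list \<Rightarrow> real set" where
  "cyl w = {y \<in> {0..1}. map (dgt y) [0..<length w] = w}"

definition dyad :: "bool list \<Rightarrow> real set" where
  "dyad w = {(1 + uv w - 1 / 2 ^ length w) / 2<..(1 + uv w + 1 / 2 ^ length w) / 2}"

text \<open>The left endpoints of the intervals \<open>dyad w\<close>. The intervals are open on the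
  left, in line with the choice of expansions that do not end in zeros; only at these countably many
  points can digits and intervals disagree.\<close>

definition bad :: "real set" where
  "bad = range (\<lambda>w. (1 + uv w - 1 / 2 ^ length w) / 2)"

lemma negligible_bad: "negligible bad"
  unfolding bad_def negligible_iff_null_sets
  by (intro null_sets_completionI countable_imp_null_set_lborel countable_image) simp

lemma dyad_subset: "dyad w \<subseteq> {0..1}"
  using abs_uv_le[of w] unfolding dyad_def by (auto simp: abs_le_iff)

lemma prefix_dyad:
  assumes "y \<in> {0..1}" "y \<notin> bad"
  shows "y \<in> dyad (map (dgt y) [0..<n])"
proof -
  let ?w = "map (dgt y) [0..<n]"
  let ?U = "Usum (\<lambda>i. dgt y (i + n))"
  have y: "y = (1 + uv ?w + ?U / 2 ^ n) / 2"
    using eq_Usum[OF assms(1)] Usum_split[of "dgt y" n] by simp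
  have "?U \<noteq> - 1"
  proof
    assume "?U = - 1"
    then have "y = (1 + uv ?w - 1 / 2 ^ length ?w) / 2" using y by simp
    then show False using assms(2) unfolding bad_def by blast
  qed
  then have "- 1 < ?U" "?U \<le> 1" using abs_Usum_le[of "\<lambda>i. dgt y (i + n)"] by auto
  then have "- 1 / 2 ^ n < ?U / 2 ^ n" "?U / 2 ^ n \<le> 1 / 2 ^ n"
    using divide_strict_right_mono[of "- 1" ?U "2 ^ n"] divide_right_mono[of ?U 1 "2 ^ n"] by simp_all
  then have "(1 + uv ?w - 1 / 2 ^ n) / 2 < (1 + uv ?w + ?U / 2 ^ n) / 2"
    "(1 + uv ?w + ?U / 2 ^ n) / 2 \<le> (1 + uv ?w + 1 / 2 ^ n) / 2"
  proof -
    assume *: "- 1 / 2 ^ n < ?U / 2 ^ n" "?U / 2 ^ n \<le> 1 / 2 ^ n"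
    show "(1 + uv ?w - 1 / 2 ^ n) / 2 < (1 + uv ?w + ?U / 2 ^ n) / 2"
      by (rule divide_strict_right_mono) (use *(1) in auto)
    show "(1 + uv ?w + ?U / 2 ^ n) / 2 \<le> (1 + uv ?w + 1 / 2 ^ n) / 2"
      by (rule divide_right_mono) (use *(2) in auto)
  qed
  then have "(1 + uv ?w - 1 / 2 ^ n) / 2 < y" "y \<le> (1 + uv ?w + 1 / 2 ^ n) / 2"
    unfolding y[symmetric] .
  then show ?thesis unfolding dyad_def by simp
qed

lemma dyad_disjoint:
  assumes "y \<in> dyad w" "y \<in> dyad v" "length w = length v"
  shows "w = v"
proof (rule ccontr)
  assume "w \<noteq> v"
  then have "2 / 2 ^ length w \<le> \<bar>uv w - uv v\<bar>" using assms(3) by (intro uv_separated)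
  then have "1 / 2 ^ length w + 1 / 2 ^ length w \<le> \<bar>uv w - uv v\<bar>" by simp
  then show False using assms unfolding dyad_def by (simp add: abs_if split: if_splits)
qed

lemma cyl_diff: "negligible ((dyad w - cyl w) \<union> (cyl w - dyad w))"
proof (rule negligible_subset[OF negligible_bad], rule subsetI, rule ccontr)
  fix y assume y: "y \<in> (dyad w - cyl w) \<union> (cyl w - dyad w)" "y \<notin> bad"
  then have y01: "y \<in> {0..1}" using dyad_subset[of w] unfolding cyl_def by blast
  have *: "y \<in> dyad (map (dgt y) [0..<length w])" by (rule prefix_dyad[OF y01 y(2)])
  from y(1) show False
  proof
    assume "y \<in> dyad w - cyl w"
    then show False using dyad_disjoint[OF _ *, of w] y01 by (simp add: cyl_def)
  next
    assume "y \<in> cyl w - dyad w"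
    then show False using * by (simp add: cyl_def)
  qed
qed

lemma dyad_lmeasurable: "dyad w \<in> lmeasurable"
  unfolding dyad_def fmeasurable_def by simp

lemma cyl_lmeasurable: "cyl w \<in> lmeasurable"
  by (rule lmeasurable_negligible_symdiff[OF dyad_lmeasurable cyl_diff])

lemma measure_cyl: "measure lebesgue (cyl w) = 1 / 2 ^ length w"
proof -
  have "measure lebesgue (cyl w) = measure lebesgue (dyad w)"
    by (rule measure_negligible_symdiff[OF dyad_lmeasurable cyl_diff])
  also have "\<dots> = measure lborel (dyad w)" by (simp add: dyad_def)
  also have "\<dots> = 1 / 2 ^ length w"
    unfolding dyad_def measure_lborel_Ioc by (simp add: field_simps)
  finally show ?thesis .
qed

lemma fair_bits_digits: "fair_bits (lebesgue_on {0..1}) (\<lambda>i y. dgt y i)"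
proof -
  let ?M = "lebesgue_on {0..1::real}"
  have space: "space ?M = {0..1}" by (simp add: space_restrict_space)
  have "emeasure lebesgue {0..1::real} = 1" by simp
  then have P: "prob_space ?M" by (intro prob_spaceI) (simp add: emeasure_restrict_space)
  have cyl_sets: "cyl w \<in> sets ?M" for w
    using fmeasurableD[OF cyl_lmeasurable, of w] by (subst sets_restrict_space_iff) (auto simp: cyl_def)
  interpret prob_space ?M by (rule P)
  show ?thesis
  proof (unfold_locales)
    fix i
    have "{y \<in> space ?M. dgt y i} = (\<Union>w\<in>{w \<in> words (Suc i). w ! i}. cyl w)"
    proof (intro set_eqI iffI)
      fix y assume "y \<in> {y \<in> space ?M. dgt y i}"
      then have "y \<in> cyl (map (dgt y) [0..<Suc i])" "map (dgt y) [0..<Suc i] ! i" "map (dgt y) [0..<Suc i] \<in> words (Suc i)"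
        by (auto simp: cyl_def words_def space simp del: upt_Suc)
      then show "y \<in> (\<Union>w\<in>{w \<in> words (Suc i). w ! i}. cyl w)" by blast
    next
      fix y assume "y \<in> (\<Union>w\<in>{w \<in> words (Suc i). w ! i}. cyl w)"
      then obtain w where w: "length w = Suc i" "w ! i" "y \<in> cyl w" by (auto simp: words_def)
      then have "map (dgt y) [0..<Suc i] ! i" by (simp add: cyl_def del: upt_Suc)
      then have "dgt y i" by (simp del: upt_Suc)
      then show "y \<in> {y \<in> space ?M. dgt y i}" using w(3) by (simp add: cyl_def space)
    qed
    also have "\<dots> \<in> sets ?M" using cyl_sets by (intro sets.finite_UN) auto
    finally show "(\<lambda>y. dgt y i) \<in> measurable ?M (count_space UNIV)" by (simp add: pred_def)
  next
    fix w
    have "{\<omega> \<in> space ?M. map (\<lambda>i. dgt \<omega> i) [0..<length w] = w} = cyl w" by (simp add: cyl_def space)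
    moreover have "measure ?M (cyl w) = measure lebesgue (cyl w)"
      by (intro measure_restrict_space) (auto simp: cyl_def)
    ultimately show "prob {\<omega> \<in> space ?M. map (\<lambda>i. dgt \<omega> i) [0..<length w] = w} = 1 / 2 ^ length w"
      using measure_cyl by simp
  qed
qed

end

lemma walk_kappa: "1 / 2 < \<gamma> \<Longrightarrow> \<gamma> < 1 \<Longrightarrow> walk \<gamma> (kappa \<gamma>)"
  by unfold_locales (auto simp: kappa_def)

text \<open>For fixed \<xi> the function agrees on the unit interval with an affine image of
  \<open>Tlim c\<close> for a slope \<open>c\<close> determined by \<xi>. Regularity of
  \<open>kappa \<gamma>\<close> does not involve \<xi>, and the decay holds for every starting
  slope, so the same \<gamma> serves all \<xi>.\<close>

lemma occupation_density:
  assumes \<gamma>: "1 / 2 < \<gamma>" "\<gamma> < 1" and reg: "collision_regular (kappa \<gamma>) e D" "0 \<le> D" and \<xi>: "\<xi> \<in> {0..1}"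
  shows "has_square_integrable_occupation_density (\<lambda>y. H_fun \<gamma> \<xi> y - kappa \<gamma> * y * S_fun \<gamma> \<xi> 0)"
proof -
  let ?M = "lebesgue_on {0..1::real}"
  let ?F = "\<lambda>y. H_fun \<gamma> \<xi> y - kappa \<gamma> * y * S_fun \<gamma> \<xi> 0"
  interpret walk \<gamma> "kappa \<gamma>" 0 by (rule walk_kappa[OF \<gamma>])
  obtain \<beta> where \<beta>: "0 < \<beta>" "power_bound (- \<beta>)" using power_bound_decay[OF reg] by blast
  define c where "c = - 2 * \<gamma> * (1 - kappa \<gamma>) * S_fun \<gamma> \<xi> 0"
  define t where "t = 1 / (4 * (1 - \<gamma>)) + (1 - kappa \<gamma>) * S_fun \<gamma> \<xi> 0 / 2"
  define b where "b = - 1 / (4 * \<gamma>)"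
  have b: "b \<noteq> 0" using \<gamma> by (simp add: b_def)
  interpret fair_bits ?M "\<lambda>i y. dgt y i" by (rule fair_bits_digits)
  interpret walk_bits \<gamma> "kappa \<gamma>" 0 ?M "\<lambda>i y. dgt y i" c \<beta>
    by unfold_locales (use \<beta> in auto)
  obtain h where h: "h \<in> borel_measurable borel" "\<And>x. 0 \<le> h x" "integrable lborel (\<lambda>x. (h x)\<^sup>2)"
      "law = density lborel (\<lambda>x. ennreal (h x))"
    using law_density by blast
  note [measurable] = h(1)
  have F: "?F y = t + b * Tlim c (dgt y)" if "y \<in> space ?M" for y
    using H_fun_eq[OF walk_kappa[OF \<gamma>] \<xi>, of y] that
    by (simp add: space_restrict_space t_def b_def c_def)
  define h' where "h' x = h ((x - t) / b) / \<bar>b\<bar>" for x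
  have meas: "?F \<in> borel_measurable ?M"
  proof -
    have "(\<lambda>y. t + b * Tlim c (\<lambda>i. dgt y i)) \<in> borel_measurable ?M" by measurable
    then show ?thesis by (subst measurable_cong[OF F]) auto
  qed
  have "occupation_measure ?F = distr ?M borel (\<lambda>y. t + b * Tlim c (dgt y))"
    unfolding occupation_measure_def by (intro distr_cong F refl)
  also have "\<dots> = distr law borel (\<lambda>x. t + b * x)"
    unfolding law_def by (subst distr_distr) (auto simp: o_def)
  also have "\<dots> = density lborel (\<lambda>x. ennreal (h' x))"
    unfolding h(4) h'_def by (rule distr_density_affine[OF h(1) b])
  finally have occ: "occupation_measure ?F = density lborel (\<lambda>x. ennreal (h' x))" .
  have h'_meas [measurable]: "h' \<in> borel_measurable borel" unfolding h'_def by measurable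
  have "integrable lborel (\<lambda>x. (norm (h' x))\<^sup>2)"
  proof -
    have "integrable lborel (\<lambda>x. (h (- t / b + 1 / b * x))\<^sup>2)"
      using b by (intro lborel_integrable_real_affine[OF h(3)]) simp
    then have "integrable lborel (\<lambda>x. (h (- t / b + 1 / b * x))\<^sup>2 / b\<^sup>2)" by simp
    moreover have "(h (- t / b + 1 / b * x))\<^sup>2 / b\<^sup>2 = (norm (h' x))\<^sup>2" for x
      by (simp add: h'_def power_divide diff_divide_distrib)
    ultimately show ?thesis by simp
  qed
  moreover have "0 \<le> h' x" for x using h(2) by (simp add: h'_def)
  ultimately show ?thesis
    unfolding has_square_integrable_occupation_density_def square_integrable_def
    using meas occ absolutely_continuousI_density[of "\<lambda>x. ennreal (h' x)" lborel] by (intro conjI exI[of _ h']) auto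
qed

context walk
begin

section \<open>The Rademacher chaos\<close>

text \<open>Apart from the term with \<open>a\<close>, the sign \<open>s n\<close> enters with
  \<open>g ^ n / 2\<close> times the slope at time \<open>n\<close>. As
  \<open>g * k = 1 / 2\<close>, this product is a sum over the earlier signs \<open>s j\<close> with
  weights \<open>(1 / 2) ^ (n - j)\<close>.\<close>

lemma tv_map_eq:
  "tv 0 (map s [0..<N]) = a * (\<Sum>n<N. g ^ (n + 1) * sg (s n))
    + (\<Sum>n<N. \<Sum>j<n. g ^ (j + 1) * (1 / 2) ^ (n - j) * sg (s j) * sg (s n))"
proof (induction N)
  case (Suc N)
  have slope: "g ^ n * slope 0 (map s [0..<n]) / 2 = (\<Sum>j<n. g ^ (j + 1) * (1 / 2) ^ (n - j) * sg (s j))" for n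
  proof (induction n)
    case (Suc n)
    have "g ^ Suc n * slope 0 (map s [0..<Suc n]) / 2
        = (g * k) * (g ^ n * slope 0 (map s [0..<n]) / 2) + g ^ Suc n * sg (s n) / 2"
      by (simp add: slope_append algebra_simps add_divide_distrib)
    also have "g * k = 1 / 2" using gk by simp
    also have "1 / 2 * (g ^ n * slope 0 (map s [0..<n]) / 2) = (\<Sum>j<n. g ^ (j + 1) * (1 / 2) ^ (Suc n - j) * sg (s j))"
      unfolding Suc sum_distrib_left by (intro sum.cong refl) (simp add: Suc_diff_le)
    finally show ?case by simp
  qed simp
  have "tv 0 (map s [0..<Suc N]) = tv 0 (map s [0..<N])
      + (a * (g ^ (N + 1) * sg (s N)) + g ^ N * slope 0 (map s [0..<N]) / 2 * sg (s N))"
    by (simp add: tv_append algebra_simps)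
  then show ?case unfolding Suc slope by (simp add: sum_distrib_right sum_distrib_left algebra_simps)
qed simp

end

text \<open>As \<open>kappa \<gamma> / 2 = 1 / (4 * \<gamma>)\<close>, the half-integer powers of
  \<gamma> combine to \<open>\<gamma> ^ i\<close> and those of 1/4 to a power of 1/2.\<close>

lemma g_coeff_less:
  assumes "0 < \<gamma>" "i < j"
  shows "g_coeff \<gamma> i j = 1 / 2 * (\<gamma> ^ i * (1 / 2) ^ (j - i))"
proof -
  define x where "x = real (j - i) / 2"
  have x: "\<bar>real i - real j\<bar> / 2 = x" "real (i + j) / 2 = real i + x"
    using assms(2) by (simp_all add: x_def of_nat_diff field_simps)
  have "(kappa \<gamma> / 2) powr x = (1 / 2) ^ (j - i) / \<gamma> powr x"
  proof -
    have "kappa \<gamma> / 2 = ((1 / 2) powr 2) / \<gamma>" by (simp add: kappa_def power2_eq_square)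
    then have "(kappa \<gamma> / 2) powr x = ((1 / 2) powr 2) powr x / \<gamma> powr x"
      using assms(1) by (simp only: powr_divide)
    also have "((1 / 2) powr 2) powr x = (1 / 2 :: real) powr (real (j - i))"
      unfolding powr_powr by (simp add: x_def)
    also have "\<dots> = (1 / 2) ^ (j - i)" by (subst powr_realpow) auto
    finally show ?thesis .
  qed
  then show ?thesis
    using assms unfolding g_coeff_def x powr_add by (simp add: powr_realpow)
qed

lemma g_coeff_sym: "g_coeff \<gamma> i j = g_coeff \<gamma> j i"
  by (simp add: g_coeff_def add.commute abs_minus_commute)

lemma g_coeff_diag: "g_coeff \<gamma> i i = 0"
  by (simp add: g_coeff_def)

lemma abs_g_coeff_le:
  assumes "1 / 2 < \<gamma>"
  shows "\<bar>g_coeff \<gamma> i j\<bar> \<le> sqrt \<gamma> ^ i * sqrt \<gamma> ^ j"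
proof -
  have "\<gamma> powr (real (i + j) / 2) = sqrt \<gamma> ^ (i + j)"
    using assms by (simp add: powr_half_sqrt[symmetric] powr_realpow[symmetric] powr_powr)
  moreover have "(kappa \<gamma> / 2) powr (\<bar>real i - real j\<bar> / 2) \<le> 1"
    using assms by (intro powr_le1) (auto simp: kappa_def)
  ultimately show ?thesis
    unfolding g_coeff_def using assms by (auto simp: abs_mult power_add intro!: mult_le_one mult_left_le)
qed

lemma sum_square_symmetric:
  fixes H :: "nat \<Rightarrow> nat \<Rightarrow> real"
  assumes "\<And>i j. H i j = H j i" "\<And>i. H i i = 0"
  shows "(\<Sum>i<N. \<Sum>j<N. H i j) = 2 * (\<Sum>n<N. \<Sum>j<n. H j n)"
proof (induction N)
  case (Suc N)
  have "(\<Sum>j<N. H N j) = (\<Sum>j<N. H j N)" by (intro sum.cong refl assms(1))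
  then show ?case using Suc assms(2) by (simp add: sum.distrib)
qed simp

definition sq :: "nat \<Rightarrow> (nat \<times> nat) set" where
  "sq N = Suc ` {..<N} \<times> Suc ` {..<N}"

lemma sq_props: "finite (sq N)" "sq N \<subseteq> {1..} \<times> {1..}"
  by (auto simp: sq_def)

lemma finite_subset_sq:
  assumes "finite S" "S \<subseteq> {1..} \<times> {1..}"
  obtains n where "\<And>N. n \<le> N \<Longrightarrow> S \<subseteq> sq N"
proof -
  have "finite (fst ` S \<union> snd ` S)" using assms(1) by simp
  then obtain n where n: "\<And>x. x \<in> fst ` S \<union> snd ` S \<Longrightarrow> x \<le> n"
    unfolding finite_nat_set_iff_bounded_le by blast
  have "S \<subseteq> sq N" if "n \<le> N" for N
  proof
    fix p assume p: "p \<in> S"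
    then have "fst p \<le> N" "snd p \<le> N" using n[of "fst p"] n[of "snd p"] that by force+
    moreover have "1 \<le> fst p" "1 \<le> snd p" using assms(2) p by auto
    ultimately have "fst p \<in> Suc ` {..<N}" "snd p \<in> Suc ` {..<N}"
      unfolding image_Suc_lessThan by simp_all
    then show "p \<in> sq N" unfolding sq_def by (cases p) simp
  qed
  then show ?thesis using that by blast
qed

lemma sum_sq_tendsto:
  fixes f :: "nat \<times> nat \<Rightarrow> real"
  assumes "f summable_on {1..} \<times> {1..}"
  shows "(\<lambda>N. sum f (sq N)) \<longlonglongrightarrow> infsum f ({1..} \<times> {1..})"
proof (rule filterlim_compose[OF infsum_tendsto[OF assms]])
  show "filterlim sq (finite_subsets_at_top ({1..} \<times> {1..})) sequentially"
    unfolding filterlim_finite_subsets_at_top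
  proof (intro allI impI)
    fix S :: "(nat \<times> nat) set" assume "finite S \<and> S \<subseteq> {1..} \<times> {1..}"
    then obtain n where "\<And>N. n \<le> N \<Longrightarrow> S \<subseteq> sq N" using finite_subset_sq by metis
    then show "eventually (\<lambda>N. finite (sq N) \<and> S \<subseteq> sq N \<and> sq N \<subseteq> {1..} \<times> {1..}) sequentially"
      using sq_props unfolding eventually_sequentially by blast
  qed
qed

text \<open>Measurability of \<open>I2\<close> involves every outcome, including those where the
  family is not summable and \<open>infsum\<close> takes its default value 0. Real summability is
  absolute and can be tested on squares; bounds by natural numbers keep the test countable.\<close>

lemma infsum_eq_lim_sq:
  fixes f :: "nat \<times> nat \<Rightarrow> real"
  shows "infsum f ({1..} \<times> {1..})
    = (if \<exists>K :: nat. \<forall>N. (\<Sum>p\<in>sq N. \<bar>f p\<bar>) \<le> real K then lim (\<lambda>N. sum f (sq N)) else 0)"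
proof (cases "f summable_on {1..} \<times> {1..}")
  case True
  then have abs: "(\<lambda>p. \<bar>f p\<bar>) summable_on {1..} \<times> {1..}"
    using summable_on_iff_abs_summable_on_real[of f] by simp
  obtain K :: nat where K: "infsum (\<lambda>p. \<bar>f p\<bar>) ({1..} \<times> {1..}) \<le> real K" using real_arch_simple by blast
  have "(\<Sum>p\<in>sq N. \<bar>f p\<bar>) \<le> real K" for N
    using finite_sum_le_infsum[OF abs sq_props] K by (meson abs_ge_zero order_trans)
  moreover have "lim (\<lambda>N. sum f (sq N)) = infsum f ({1..} \<times> {1..})"
    by (rule limI[OF sum_sq_tendsto[OF True]])
  ultimately show ?thesis by auto
next
  case False
  have "\<not> (\<forall>N. (\<Sum>p\<in>sq N. \<bar>f p\<bar>) \<le> real K)" for K :: nat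
  proof
    assume K: "\<forall>N. (\<Sum>p\<in>sq N. \<bar>f p\<bar>) \<le> real K"
    have "(\<lambda>p. \<bar>f p\<bar>) summable_on {1..} \<times> {1..}"
    proof (rule nonneg_bdd_above_summable_on)
      show "bdd_above (sum (\<lambda>p. \<bar>f p\<bar>) ` {F. F \<subseteq> {1..} \<times> {1..} \<and> finite F})"
      proof (rule bdd_aboveI2[where M = "real K"])
        fix F :: "(nat \<times> nat) set" assume "F \<in> {F. F \<subseteq> {1..} \<times> {1..} \<and> finite F}"
        then obtain n where "F \<subseteq> sq n" using finite_subset_sq[of F] by (metis mem_Collect_eq order_refl)
        then have "(\<Sum>p\<in>F. \<bar>f p\<bar>) \<le> (\<Sum>p\<in>sq n. \<bar>f p\<bar>)" by (intro sum_mono2 sq_props) auto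
        then show "(\<Sum>p\<in>F. \<bar>f p\<bar>) \<le> real K" using K order_trans by blast
      qed
    qed simp
    then show False using False summable_on_iff_abs_summable_on_real[of f] by simp
  qed
  then have "\<not> (\<exists>K :: nat. \<forall>N. (\<Sum>p\<in>sq N. \<bar>f p\<bar>) \<le> real K)" by blast
  then show ?thesis by (simp only: if_False infsum_not_exists[OF False])
qed

lemma I2_measurable:
  assumes "\<And>n. X (Suc n) \<in> borel_measurable M"
  shows "I2 X g \<in> borel_measurable M"
proof -
  have m: "(\<lambda>\<omega>. (case p of (n, m) \<Rightarrow> g n m * X n \<omega> * X m \<omega>)) \<in> borel_measurable M" if "p \<in> sq N" for p N
    using that assms by (cases p) (auto simp: sq_def)
  have 1: "(\<lambda>\<omega>. \<Sum>p\<in>sq N. case p of (n, m) \<Rightarrow> g n m * X n \<omega> * X m \<omega>) \<in> borel_measurable M" for N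
    by (intro borel_measurable_sum m)
  have 2 [measurable]: "(\<lambda>\<omega>. \<Sum>p\<in>sq N. \<bar>case p of (n, m) \<Rightarrow> g n m * X n \<omega> * X m \<omega>\<bar>) \<in> borel_measurable M" for N
    by (intro borel_measurable_sum borel_measurable_abs m)
  have 3 [measurable]: "(\<lambda>\<omega>. lim (\<lambda>N. \<Sum>p\<in>sq N. case p of (n, m) \<Rightarrow> g n m * X n \<omega> * X m \<omega>)) \<in> borel_measurable M"
    by (rule borel_measurable_lim_metric[OF 1])
  show ?thesis
    unfolding I2_def infsum_eq_lim_sq by measurable
qed

lemma I1_measurable:
  assumes [measurable]: "\<And>n. X (Suc n) \<in> borel_measurable M"
  shows "I1 X f \<in> borel_measurable M"
  unfolding I1_def by simp

text \<open>The double series is dominated by a product of two geometric series of ratio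
  \<open>sqrt \<gamma>\<close>, so it may be summed over squares. Symmetry and the zero diagonal of
  \<open>g_coeff\<close> then give the partial sums of \<open>tv_map_eq\<close>.\<close>

lemma chaos_eq_Tlim:
  assumes "walk \<gamma> (kappa \<gamma>)" and X: "\<And>n. X (Suc n) \<omega> = sg (s n)"
  shows "a * I1 X (f_coeff \<gamma>) \<omega> + I2 X (g_coeff \<gamma>) \<omega> = walk.Tlim \<gamma> (kappa \<gamma>) a 0 s"
proof -
  interpret walk \<gamma> "kappa \<gamma>" a by fact
  define H where "H i j = g_coeff \<gamma> (Suc i) (Suc j) * X (Suc i) \<omega> * X (Suc j) \<omega>" for i j
  let ?f = "\<lambda>(n, m). g_coeff \<gamma> n m * X n \<omega> * X m \<omega>"
  have sumI1: "summable (\<lambda>n. \<gamma> ^ (n + 1) * sg (s n))"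
  proof (rule summable_comparison_test)
    show "summable (\<lambda>n. \<gamma> ^ Suc n)" using g_pos g_lt by (subst summable_Suc_iff) (simp add: summable_geometric)
    show "\<exists>N. \<forall>n\<ge>N. norm (\<gamma> ^ (n + 1) * sg (s n)) \<le> \<gamma> ^ Suc n"
      using g_pos by (intro exI[of _ 0] allI impI) (simp add: abs_mult)
  qed
  have I1: "(\<lambda>N. \<Sum>n<N. \<gamma> ^ (n + 1) * sg (s n)) \<longlonglongrightarrow> I1 X (f_coeff \<gamma>) \<omega>"
    using summable_LIMSEQ[OF sumI1] by (simp add: I1_def f_coeff_def X)
  have "(\<lambda>p. norm (?f p)) summable_on {1..} \<times> {1..}"
  proof (rule Infinite_Sum.abs_summable_on_comparison_test)
    have "summable (\<lambda>n. sqrt \<gamma> ^ n)" using g_pos g_lt by (intro summable_geometric) auto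
    then have "(\<lambda>n. sqrt \<gamma> ^ n) summable_on UNIV"
      using g_pos by (intro norm_summable_imp_summable_on) (simp add: power_abs)
    then have "(\<lambda>n. sqrt \<gamma> ^ n) summable_on {1..}" by (rule summable_on_subset_banach) simp
    then obtain S where S: "((\<lambda>n. sqrt \<gamma> ^ n) has_sum S) {1..}" unfolding summable_on_def by blast
    show "(\<lambda>p. norm (case p of (n, m) \<Rightarrow> sqrt \<gamma> ^ n * sqrt \<gamma> ^ m)) summable_on {1..} \<times> {1..}"
    proof (rule summable_on_SigmaI[where g = "\<lambda>n. sqrt \<gamma> ^ n * S"])
      have "((\<lambda>m. sqrt \<gamma> ^ n * sqrt \<gamma> ^ m) has_sum sqrt \<gamma> ^ n * S) {1..}" for n :: nat
        by (rule has_sum_cmult_right[OF S])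
      then show "((\<lambda>m. norm (case (n, m) of (n, m) \<Rightarrow> sqrt \<gamma> ^ n * sqrt \<gamma> ^ m)) has_sum sqrt \<gamma> ^ n * S) {1..}" for n :: nat
        using g_pos by (simp add: abs_mult power_abs)
      show "(\<lambda>n. sqrt \<gamma> ^ n * S) summable_on {1..}"
        using has_sum_cmult_left[OF S, of S] unfolding summable_on_def by blast
    qed simp
    fix p :: "nat \<times> nat" assume "p \<in> {1..} \<times> {1..}"
    then obtain i j where p: "p = (Suc i, Suc j)" by (cases p) (auto elim!: Suc_le_D[elim_format])
    have "\<bar>g_coeff \<gamma> (Suc i) (Suc j) * X (Suc i) \<omega> * X (Suc j) \<omega>\<bar> = \<bar>g_coeff \<gamma> (Suc i) (Suc j)\<bar>"
      by (simp add: X abs_mult)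
    also have "\<dots> \<le> sqrt \<gamma> ^ Suc i * sqrt \<gamma> ^ Suc j" by (rule abs_g_coeff_le[OF g_gt])
    finally show "norm (?f p) \<le> norm (case p of (n, m) \<Rightarrow> sqrt \<gamma> ^ n * sqrt \<gamma> ^ m)"
      unfolding p using g_pos by (simp add: abs_mult power_abs)
  qed
  then have "?f summable_on {1..} \<times> {1..}" by (rule Infinite_Sum.abs_summable_summable)
  then have "(\<lambda>N. sum ?f (sq N)) \<longlonglongrightarrow> I2 X (g_coeff \<gamma>) \<omega>"
    unfolding I2_def by (rule sum_sq_tendsto)
  moreover have "sum ?f (sq N) = (\<Sum>n<N. \<Sum>j<n. \<gamma> ^ (j + 1) * (1 / 2) ^ (n - j) * sg (s j) * sg (s n))" for N
  proof -
    have "sum ?f (sq N) = (\<Sum>i<N. \<Sum>j<N. H i j)"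
      unfolding sq_def sum.cartesian_product[symmetric] by (simp add: sum.reindex H_def)
    also have "\<dots> = 2 * (\<Sum>n<N. \<Sum>j<n. H j n)"
      by (rule sum_square_symmetric) (simp_all add: H_def g_coeff_diag g_coeff_sym[of \<gamma>])
    also have "\<dots> = (\<Sum>n<N. \<Sum>j<n. 2 * H j n)" by (simp only: sum_distrib_left)
    also have "\<dots> = (\<Sum>n<N. \<Sum>j<n. \<gamma> ^ (j + 1) * (1 / 2) ^ (n - j) * sg (s j) * sg (s n))"
      by (intro sum.cong refl) (simp add: H_def g_coeff_less[OF g_pos] X)
    finally show ?thesis .
  qed
  ultimately have I2: "(\<lambda>N. \<Sum>n<N. \<Sum>j<n. \<gamma> ^ (j + 1) * (1 / 2) ^ (n - j) * sg (s j) * sg (s n)) \<longlonglongrightarrow> I2 X (g_coeff \<gamma>) \<omega>"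
    by (simp only:)
  have "(\<lambda>N. tv 0 (map s [0..<N])) \<longlonglongrightarrow> a * I1 X (f_coeff \<gamma>) \<omega> + I2 X (g_coeff \<gamma>) \<omega>"
    unfolding tv_map_eq by (intro tendsto_intros I1 I2)
  then show ?thesis by (rule LIMSEQ_unique[OF _ Tlim_tendsto])
qed

text \<open>The probabilities of the values 1 and -1 add up to 1, so up to a null set the event
  \<open>X n = 1\<close> determines the sign, and its complement stands for -1.\<close>

lemma
  assumes "prob_space M" "rademacher_seq M X"
  shows fair_bits_rademacher: "fair_bits M (\<lambda>i \<omega>. X (Suc i) \<omega> = 1)"
    and AE_rademacher: "AE \<omega> in M. \<forall>n. X (Suc n) \<omega> = sg (X (Suc n) \<omega> = 1)"
proof -
  interpret prob_space M by fact
  have ind: "indep_vars (\<lambda>_. borel) X {1..}" and half: "\<And>n. n \<ge> 1 \<Longrightarrow> prob {\<omega> \<in> space M. X n \<omega> = 1} = 1 / 2"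
      "\<And>n. n \<ge> 1 \<Longrightarrow> prob {\<omega> \<in> space M. X n \<omega> = - 1} = 1 / 2"
    using assms(2) unfolding rademacher_seq_def by auto
  have X [measurable]: "X (Suc n) \<in> borel_measurable M" for n
    using ind unfolding indep_vars_def by auto
  show "fair_bits M (\<lambda>i \<omega>. X (Suc i) \<omega> = 1)"
  proof (unfold_locales)
    show "(\<lambda>\<omega>. X (Suc i) \<omega> = 1) \<in> measurable M (count_space UNIV)" for i by measurable
    fix w :: "bool list"
    define A where "A i = (if w ! (i - 1) then {1} else UNIV - {1 :: real})" for i :: nat
    define N where "N = length w"
    show "prob {\<omega> \<in> space M. map (\<lambda>i. X (Suc i) \<omega> = 1) [0..<length w] = w} = 1 / 2 ^ length w"
    proof (cases "N = 0")
      case True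
      then have "w = []" by (simp add: N_def)
      then show ?thesis by (simp add: prob_space)
    next
      case False
      have "{\<omega> \<in> space M. map (\<lambda>i. X (Suc i) \<omega> = 1) [0..<length w] = w}
          = {\<omega> \<in> space M. \<forall>i<N. X (Suc i) \<omega> \<in> A (Suc i)}"
      proof (intro Collect_cong conj_cong refl)
        fix \<omega>
        have "map (\<lambda>i. X (Suc i) \<omega> = 1) [0..<length w] = w \<longleftrightarrow> (\<forall>i<N. (X (Suc i) \<omega> = 1) = w ! i)"
          by (subst list_eq_iff_nth_eq) (simp add: N_def)
        also have "\<dots> \<longleftrightarrow> (\<forall>i<N. X (Suc i) \<omega> \<in> A (Suc i))"
          by (intro all_cong) (simp add: A_def)
        finally show "map (\<lambda>i. X (Suc i) \<omega> = 1) [0..<length w] = w \<longleftrightarrow> (\<forall>i<N. X (Suc i) \<omega> \<in> A (Suc i))" .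
      qed
      also have "\<dots> = (\<Inter>i\<in>Suc ` {..<N}. X i -` A i \<inter> space M)"
        using False by auto
      finally have eq: "{\<omega> \<in> space M. map (\<lambda>i. X (Suc i) \<omega> = 1) [0..<length w] = w}
          = (\<Inter>i\<in>Suc ` {..<N}. X i -` A i \<inter> space M)" .
      have "prob (X i -` A i \<inter> space M) = 1 / 2" if i: "i \<in> Suc ` {..<N}" for i
      proof -
        obtain n where n: "i = Suc n" using i by auto
        have E: "{\<omega> \<in> space M. X i \<omega> = 1} \<in> events" unfolding n by measurable
        show ?thesis
        proof (cases "w ! (i - 1)")
          case True
          then have "X i -` A i \<inter> space M = {\<omega> \<in> space M. X i \<omega> = 1}" by (auto simp: A_def)
          then show ?thesis using half(1)[of i] n by simp
        next
          case False
          then have "X i -` A i \<inter> space M = space M - {\<omega> \<in> space M. X i \<omega> = 1}" by (auto simp: A_def)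
          then show ?thesis using half(1)[of i] n prob_compl[OF E] by simp
        qed
      qed
      then have "(\<Prod>i\<in>Suc ` {..<N}. prob (X i -` A i \<inter> space M)) = (\<Prod>i\<in>Suc ` {..<N}. 1 / 2)"
        by (intro prod.cong refl)
      also have "\<dots> = (1 / 2) ^ N" by (simp add: card_image)
      finally have "(\<Prod>i\<in>Suc ` {..<N}. prob (X i -` A i \<inter> space M)) = (1 / 2) ^ N" .
      moreover have "prob (\<Inter>i\<in>Suc ` {..<N}. X i -` A i \<inter> space M) = (\<Prod>i\<in>Suc ` {..<N}. prob (X i -` A i \<inter> space M))"
        using False by (intro indep_varsD[OF ind]) (auto simp: A_def)
      ultimately show ?thesis unfolding eq by (simp add: N_def power_one_over)
    qed
  qed
  have "AE \<omega> in M. X (Suc n) \<omega> = sg (X (Suc n) \<omega> = 1)" for n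
  proof -
    have "prob ({\<omega> \<in> space M. X (Suc n) \<omega> = 1} \<union> {\<omega> \<in> space M. X (Suc n) \<omega> = - 1})
        = prob {\<omega> \<in> space M. X (Suc n) \<omega> = 1} + prob {\<omega> \<in> space M. X (Suc n) \<omega> = - 1}"
      by (rule finite_measure_Union) auto
    also have "\<dots> = 1" using half[of "Suc n"] by simp
    finally have "AE \<omega> in M. \<omega> \<in> {\<omega> \<in> space M. X (Suc n) \<omega> = 1} \<union> {\<omega> \<in> space M. X (Suc n) \<omega> = - 1}"
      by (intro AE_prob_1)
    then show ?thesis by eventually_elim (auto simp: sg_def)
  qed
  then show "AE \<omega> in M. \<forall>n. X (Suc n) \<omega> = sg (X (Suc n) \<omega> = 1)" by (simp add: AE_all_countable)
qed

lemma chaos_char_square_integrable: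
  fixes M :: "'w measure"
  assumes \<gamma>: "1 / 2 < \<gamma>" "\<gamma> < 1" and reg: "collision_regular (kappa \<gamma>) e D" "0 \<le> D"
    and X: "prob_space M" "rademacher_seq M X" and ab: "0 < (b :: real)"
  shows "square_integrable
    (\<lambda>u :: real. \<integral>\<omega>. exp (\<i> * complex_of_real (u * (a * I1 X (f_coeff \<gamma>) \<omega> + b * I2 X (g_coeff \<gamma>) \<omega>))) \<partial>M)"
proof -
  interpret walk \<gamma> "kappa \<gamma>" "a / b" by (rule walk_kappa[OF \<gamma>])
  obtain \<beta> where \<beta>: "0 < \<beta>" "power_bound (- \<beta>)" using power_bound_decay[OF reg] by blast
  interpret fair_bits M "\<lambda>i \<omega>. X (Suc i) \<omega> = 1" by (rule fair_bits_rademacher[OF X])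
  interpret walk_bits \<gamma> "kappa \<gamma>" "a / b" M "\<lambda>i \<omega>. X (Suc i) \<omega> = 1" 0 \<beta>
    by unfold_locales (use \<beta> in auto)
  define \<phi> where "\<phi> u = (\<integral>\<omega>. exp (\<i> * complex_of_real (u * T \<omega>)) \<partial>M)" for u
  have [measurable]: "X (Suc n) \<in> borel_measurable M" for n
    using X(2) unfolding rademacher_seq_def indep_vars_def by auto
  note [measurable] = I1_measurable[of X M] I2_measurable[of X M]
  have ae: "AE \<omega> in M. a * I1 X (f_coeff \<gamma>) \<omega> + b * I2 X (g_coeff \<gamma>) \<omega> = b * T \<omega>"
    using AE_rademacher[OF X]
  proof eventually_elim
    case (elim \<omega>)
    have "a / b * I1 X (f_coeff \<gamma>) \<omega> + I2 X (g_coeff \<gamma>) \<omega> = T \<omega>"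
      using elim by (intro chaos_eq_Tlim[OF walk_kappa[OF \<gamma>]]) auto
    then have "b * (a / b * I1 X (f_coeff \<gamma>) \<omega> + I2 X (g_coeff \<gamma>) \<omega>) = b * T \<omega>" by simp
    then show ?case using ab by (simp add: distrib_left)
  qed
  have eq: "(\<integral>\<omega>. exp (\<i> * complex_of_real (u * (a * I1 X (f_coeff \<gamma>) \<omega> + b * I2 X (g_coeff \<gamma>) \<omega>))) \<partial>M) = \<phi> (0 + b * u)" for u
  proof -
    have "(\<integral>\<omega>. exp (\<i> * complex_of_real (u * (a * I1 X (f_coeff \<gamma>) \<omega> + b * I2 X (g_coeff \<gamma>) \<omega>))) \<partial>M)
        = (\<integral>\<omega>. exp (\<i> * complex_of_real (u * (b * T \<omega>))) \<partial>M)"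
    proof (rule integral_cong_AE)
      show "AE \<omega> in M. exp (\<i> * complex_of_real (u * (a * I1 X (f_coeff \<gamma>) \<omega> + b * I2 X (g_coeff \<gamma>) \<omega>)))
          = exp (\<i> * complex_of_real (u * (b * T \<omega>)))"
        using ae by eventually_elim simp
    qed measurable
    then show ?thesis by (simp add: \<phi>_def mult_ac)
  qed
  show ?thesis
    unfolding square_integrable_def eq
  proof
    have "\<phi> \<in> borel_measurable borel" unfolding \<phi>_def by (rule char_square_integrable(1))
    then show "(\<lambda>u. \<phi> (0 + b * u)) \<in> borel_measurable lborel" by measurable
    have "integrable lborel (\<lambda>u. (cmod (\<phi> u))\<^sup>2)" unfolding \<phi>_def by (rule char_square_integrable(2))
    then show "integrable lborel (\<lambda>u. (cmod (\<phi> (0 + b * u)))\<^sup>2)"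
      using ab by (intro lborel_integrable_real_affine) auto
  qed
qed

text \<open>\<open>kappa\<close> is a differentiable involution of the interval (1/2, 1), so the
  exceptional \<gamma> lie in the image of a null set under \<open>kappa\<close>, which is again
  null.\<close>

lemma AE_collision_regular_kappa:
  "AE \<gamma> in lborel. \<gamma> \<in> {1 / 2<..<1} \<longrightarrow> (\<exists>e D. 0 \<le> D \<and> collision_regular (kappa \<gamma>) e D)"
proof -
  obtain N where N: "N \<in> null_sets lborel"
    "{x. \<not> (0 < x \<longrightarrow> x < 1 \<longrightarrow> (\<exists>e D. 0 \<le> D \<and> collision_regular x e D))} \<subseteq> N"
    using AE_collision_regular unfolding eventually_ae_filter by auto
  define N' where "N' = N \<inter> {1 / 2<..<1}"
  have "negligible N" unfolding negligible_iff_null_sets using N(1) by (rule null_sets_completionI)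
  then have "negligible N'" by (rule negligible_subset) (simp add: N'_def)
  moreover have "kappa differentiable_on N'"
    unfolding differentiable_on_def
  proof
    fix x assume "x \<in> N'"
    then have "2 * x \<noteq> 0" by (auto simp: N'_def)
    then show "kappa differentiable (at x within N')"
      unfolding kappa_def[abs_def] by (rule differentiable_divide[rotated 2]) simp_all
  qed
  ultimately have "negligible (kappa ` N')"
    by (rule negligible_differentiable_image_negligible[OF order_refl])
  then have "kappa ` N' \<in> null_sets lebesgue" unfolding negligible_iff_null_sets .
  then have "AE \<gamma> in lebesgue. \<gamma> \<notin> kappa ` N'" by (rule AE_not_in)
  then have "AE \<gamma> in lborel. \<gamma> \<notin> kappa ` N'" unfolding AE_completion_iff .
  then show ?thesis
  proof eventually_elim
    case (elim \<gamma>)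
    show ?case
    proof
      assume \<gamma>: "\<gamma> \<in> {1 / 2<..<1}"
      then have k: "kappa \<gamma> \<in> {1 / 2<..<1}" "kappa (kappa \<gamma>) = \<gamma>" by (auto simp: kappa_def field_simps)
      have "kappa \<gamma> \<notin> N"
      proof
        assume "kappa \<gamma> \<in> N"
        then have "kappa \<gamma> \<in> N'" using k(1) by (simp add: N'_def)
        then show False using elim k(2) by (metis imageI)
      qed
      then have "\<not> \<not> (0 < kappa \<gamma> \<longrightarrow> kappa \<gamma> < 1 \<longrightarrow> (\<exists>e D. 0 \<le> D \<and> collision_regular (kappa \<gamma>) e D))"
        using N(2) by blast
      then show "\<exists>e D. 0 \<le> D \<and> collision_regular (kappa \<gamma>) e D" using k(1) by simp
    qed
  qed
qed

theorem theorem4p18: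
  fixes M :: "'w measure" and X :: "nat \<Rightarrow> 'w \<Rightarrow> real"
  assumes "prob_space M" and "rademacher_seq M X"
  shows "AE \<gamma> in lborel. \<gamma> \<in> {1 / 2 <..< 1} \<longrightarrow>
    ((\<forall>a b :: real. a > 0 \<longrightarrow> b > 0 \<longrightarrow>
       square_integrable
         (\<lambda>u :: real. \<integral>\<omega>. exp (\<i> * complex_of_real (u * (a * I1 X (f_coeff \<gamma>) \<omega> + b * I2 X (g_coeff \<gamma>) \<omega>))) \<partial>M)) \<and>
    (\<forall>\<xi>\<in>{0..1}.
       has_square_integrable_occupation_density (\<lambda>y. H_fun \<gamma> \<xi> y - kappa \<gamma> * y * S_fun \<gamma> \<xi> 0)))"
  using AE_collision_regular_kappa
proof eventually_elim
  case (elim \<gamma>)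
  show ?case
  proof
    assume \<gamma>: "\<gamma> \<in> {1 / 2<..<1}"
    then obtain e D where reg: "0 \<le> D" "collision_regular (kappa \<gamma>) e D" using elim by blast
    show "(\<forall>a b :: real. a > 0 \<longrightarrow> b > 0 \<longrightarrow>
       square_integrable
         (\<lambda>u :: real. \<integral>\<omega>. exp (\<i> * complex_of_real (u * (a * I1 X (f_coeff \<gamma>) \<omega> + b * I2 X (g_coeff \<gamma>) \<omega>))) \<partial>M)) \<and>
    (\<forall>\<xi>\<in>{0..1}.
       has_square_integrable_occupation_density (\<lambda>y. H_fun \<gamma> \<xi> y - kappa \<gamma> * y * S_fun \<gamma> \<xi> 0))"
      using \<gamma> reg by (intro conjI allI impI ballI chaos_char_square_integrable[OF _ _ reg(2,1) assms]
          occupation_density[OF _ _ reg(2,1)]) auto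
  qed
qed

end
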